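(* Let $0<p\le\infty$, $r,s\in\mathbb{N}$, $0<\alpha\le r$, $p_1=\min(p,1)$, and let $f\in H_p^{r,\alpha}$. Let $\mathcal{K}$ be the set of all $k\in\mathbb{N}$ with $k>s+\frac1{p_1}-1$ such that, in the case $0<p<1$ and $\alpha=r$, in addition there is a constant $C>0$, independent of $\delta$, with $$\left(\int_0^\delta\left(\frac{\omega_{r+k}(f,t)_p}{t^\alpha}\right)^{p_1}\frac{dt}{t}\right)^{1/p_1}\le C\,\frac{\omega_{r+k}(f,\delta)_p}{\delta^\alpha},\qquad0<\delta<1$$ (in all other cases no additional condition is imposed on $k$). Suppose that $\mathcal{K}$ is nonempty. Then there exists a constant $L>0$ such that for any $n\in\mathbb{N}$ $$\psi_{s,r,\alpha}\left(f,\tfrac1n\right)_p\le L\,E_n(f)_{H_p^{r,\alpha}}$$ if and only if for some $k\in\mathcal{K}$ there exists a constant $M>0$ such that for any $h\in(0,1]$ $$\psi_{s,r,\alpha}(f,h)_p\le M\,\psi_{k,r,\alpha}(f,h)_p .$$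
   Context: $\mathbb{T}\cong[0,2\pi)$ is the torus; functions are complex-valued and $2\pi$-periodic. For $0<p<\infty$, $L_p=L_p(\mathbb{T})$ is the space of measurable functions with $\|f\|_p=\left(\frac1{2\pi}\int_{\mathbb{T}}|f(x)|^p\,dx\right)^{1/p}<\infty$; $L_\infty$ denotes the space of $2\pi$-periodic continuous functions with $\|f\|_\infty=\max|f|$. For $k\in\mathbb{N}=\{1,2,\dots\}$: $\Delta_\delta^k f(x)=\sum_{\nu=0}^k(-1)^\nu\binom k\nu f(x+\nu\delta)$ and $\omega_k(f,t)_p=\sup_{0<\delta<t}\|\Delta_\delta^kf\|_p$. For $0<p\le\infty$, $r\in\mathbb{N}$, $0<\alpha\le r$: $f\in H_p^{r,\alpha}$ if $f\in L_p$ and $\|f\|_{H_p^{r,\alpha}}=\|f\|_p+|f|_{H_p^{r,\alpha}}<\infty$, where $|f|_{H_p^{r,\alpha}}=\sup_{h>0}h^{-\alpha}\|\Delta_h^rf\|_p$. $\mathcal{T}_n$ is the set of trigonometric polynomials $\sum_{\nu=-n}^nc_\nu e^{i\nu x}$, $c_\nu\in\mathbb{C}$, and $E_n(f)_{H_p^{r,\alpha}}=\inf_{T\in\mathcal{T}_n}\|f-T\|_{H_p^{r,\alpha}}$. Further, $\psi_{k,r,\alpha}(f,\delta)_p=\sup_{0<h\le\delta}h^{-\alpha}\omega_k(\Delta_h^rf,\delta)_p$. The constants $L$ and $M$ may depend on $f$. *)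

theory Defs
  imports "HOL-Analysis.Analysis"
begin

text \<open>
  The exponent p ranges over the extended nonnegative reals, with p = \<open>\<infinity>\<close> allowed. All norms,
  moduli and integrals take values in \<^typ>\<open>ennreal\<close>, so that suprema and integrals that happen to
  be infinite really have the value \<open>\<infinity>\<close>. Functions on the torus are 2 pi-periodic functions on
  the real line.
\<close>

text \<open>Real powers of extended nonnegative reals; only used with exponent \<open>a > 0\<close>.\<close>

definition epowr :: "ennreal \<Rightarrow> real \<Rightarrow> ennreal" where
  "epowr x a = (if x = \<infinity> then \<infinity> else ennreal (enn2real x powr a))"

definition torus_fun :: "(real \<Rightarrow> complex) \<Rightarrow> bool" where
  "torus_fun f \<longleftrightarrow> (\<forall>x. f (x + 2 * pi) = f x)"

text \<open>For \<open>p = \<infinity>\<close> this is the maximum norm, the functions concerned being continuous and periodic.\<close>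

definition Lnorm :: "ennreal \<Rightarrow> (real \<Rightarrow> complex) \<Rightarrow> ennreal" where
  "Lnorm p f =
    (if p = \<infinity> then (SUP x. ennreal (cmod (f x)))
     else epowr (ennreal (1 / (2 * pi)) *
                   (\<integral>\<^sup>+x\<in>{0..<2 * pi}. ennreal (cmod (f x) powr enn2real p) \<partial>lebesgue))
                (1 / enn2real p))"

definition Lspace :: "ennreal \<Rightarrow> (real \<Rightarrow> complex) set" where
  "Lspace p =
    (if p = \<infinity> then {f. torus_fun f \<and> continuous_on UNIV f}
     else {f. torus_fun f \<and> f \<in> borel_measurable lebesgue \<and> Lnorm p f < \<infinity>})"

definition fdiff :: "nat \<Rightarrow> real \<Rightarrow> (real \<Rightarrow> complex) \<Rightarrow> real \<Rightarrow> complex" where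
  "fdiff k d f = (\<lambda>x. \<Sum>\<nu>=0..k. (-1) ^ \<nu> * of_nat (k choose \<nu>) * f (x + real \<nu> * d))"

definition modulus :: "nat \<Rightarrow> ennreal \<Rightarrow> (real \<Rightarrow> complex) \<Rightarrow> real \<Rightarrow> ennreal" where
  "modulus k p f t = (SUP d\<in>{0<..<t}. Lnorm p (fdiff k d f))"

definition Hseminorm :: "ennreal \<Rightarrow> nat \<Rightarrow> real \<Rightarrow> (real \<Rightarrow> complex) \<Rightarrow> ennreal" where
  "Hseminorm p r \<alpha> f = (SUP h\<in>{0<..}. ennreal (h powr (-\<alpha>)) * Lnorm p (fdiff r h f))"

definition Hnorm :: "ennreal \<Rightarrow> nat \<Rightarrow> real \<Rightarrow> (real \<Rightarrow> complex) \<Rightarrow> ennreal" where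
  "Hnorm p r \<alpha> f = Lnorm p f + Hseminorm p r \<alpha> f"

definition Hspace :: "ennreal \<Rightarrow> nat \<Rightarrow> real \<Rightarrow> (real \<Rightarrow> complex) set" where
  "Hspace p r \<alpha> = {f \<in> Lspace p. Hnorm p r \<alpha> f < \<infinity>}"

definition trig_polys :: "nat \<Rightarrow> (real \<Rightarrow> complex) set" where
  "trig_polys n =
    {T. \<exists>c :: int \<Rightarrow> complex.
          T = (\<lambda>x. \<Sum>\<nu>\<in>{- int n..int n}. c \<nu> * exp (\<i> * of_int \<nu> * of_real x))}"

definition best_approx :: "nat \<Rightarrow> ennreal \<Rightarrow> nat \<Rightarrow> real \<Rightarrow> (real \<Rightarrow> complex) \<Rightarrow> ennreal" where
  "best_approx n p r \<alpha> f = (INF T\<in>trig_polys n. Hnorm p r \<alpha> (\<lambda>x. f x - T x))"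

definition psi :: "nat \<Rightarrow> nat \<Rightarrow> real \<Rightarrow> (real \<Rightarrow> complex) \<Rightarrow> real \<Rightarrow> ennreal \<Rightarrow> ennreal" where
  "psi k r \<alpha> f d p = (SUP h\<in>{0<..d}. ennreal (h powr (-\<alpha>)) * modulus k p (fdiff r h f) d)"

definition p_one :: "ennreal \<Rightarrow> real" where
  "p_one p = enn2real (min p 1)"

definition modulus_int_cond ::
    "ennreal \<Rightarrow> nat \<Rightarrow> real \<Rightarrow> (real \<Rightarrow> complex) \<Rightarrow> nat \<Rightarrow> bool" where
  "modulus_int_cond p r \<alpha> f k \<longleftrightarrow>
    (\<exists>C::real. C > 0 \<and> (\<forall>\<delta>::real. 0 < \<delta> \<and> \<delta> < 1 \<longrightarrow>
       epowr (\<integral>\<^sup>+t\<in>{0<..<\<delta>}.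
                epowr (modulus (r + k) p f t / ennreal (t powr \<alpha>)) (p_one p) / ennreal t \<partial>lborel)
             (1 / p_one p)
       \<le> ennreal C * (modulus (r + k) p f \<delta> / ennreal (\<delta> powr \<alpha>))))"

definition admissible ::
    "ennreal \<Rightarrow> nat \<Rightarrow> nat \<Rightarrow> real \<Rightarrow> (real \<Rightarrow> complex) \<Rightarrow> nat set" where
  "admissible p r s \<alpha> f =
    {k. k \<ge> 1 \<and> real k > real s + 1 / p_one p - 1 \<and>
        (p < 1 \<and> \<alpha> = real r \<longrightarrow> modulus_int_cond p r \<alpha> f k)}"

end

theory Submission
  imports Defs "HOL-Computational_Algebra.Polynomial"
begin

text \<open>
  Put \<open>\<theta> = min p 1\<close> and \<open>Q g = \<parallel>g\<parallel>\<^sub>p\<^sup>\<theta>\<close>, which is subadditive. A Jackson theorem gives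
  \<open>E\<^sub>n(f) \<le> C \<psi>\<^sub>k(f, 1/n)\<close>, so an estimate of \<open>\<psi>\<^sub>s\<close> by \<open>E\<^sub>n\<close> yields one by \<open>\<psi>\<^sub>k\<close>. Conversely, Bernstein's
  inequality for a polynomial \<open>T\<close> of degree \<open>n\<close> close to \<open>f\<close> shows that
  \<open>\<psi>\<^sub>k(f, 1/m)\<^sup>\<theta> \<le> C (E\<^sub>n(f)\<^sup>\<theta> + (n/m)\<^sup>\<gamma> \<psi>\<^sub>k(f, 1/n)\<^sup>\<theta>)\<close> with \<open>\<gamma> = (k + r - \<alpha>) \<theta>\<close>, while
  \<open>\<psi>\<^sub>s(f, 1/n)\<^sup>\<theta> \<le> C (m/n)\<^sup>\<beta> \<psi>\<^sub>s(f, 1/m)\<^sup>\<theta>\<close> with some \<open>\<beta> < \<gamma>\<close>; this is where \<open>k > s + 1/\<theta> - 1\<close> enters. If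
  \<open>\<psi>\<^sub>s \<le> M \<psi>\<^sub>k\<close> and \<open>m/n\<close> is a large constant, the last term is absorbed and \<open>\<psi>\<^sub>s(f, 1/n) \<le> L E\<^sub>n(f)\<close> remains.

  All inequalities for polynomials come from sampling formulas with a kernel that reproduces
  polynomials of degree \<open>n\<close> and decays like \<open>(1 + n\<bar>t\<bar>)\<^bsup>-M\<^esup>\<close>; its coefficients are \<open>\<theta>\<close>-summable, so the
  arguments survive for \<open>p < 1\<close>. There the Jackson theorem is obtained by averaging over the position
  of the sampling lattice and iterating a contraction, since no convolution operators are available.
\<close>

section \<open>Trigonometric polynomials and reproducing kernels\<close>

text \<open>The exponent \<open>\<beta>\<close> comes from counting coefficients. A difference of
  order K with step l d is \<open>(1 + X + ... + X^(l-1))^K\<close> in the shift by d, applied to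
  the one with step d; this polynomial has at most K l coefficients, none above l^(K-1), which costs
  K l^((K-1)\<theta>+1) in \<open>Q\<close>. With K = s + r and the Hoelder weight this gives
  \<beta> = (s+r-1)\<theta> + 1 - \<alpha>\<theta>, and \<beta> < \<gamma> means exactly k > s +
  1/\<theta> - 1. The obstacle is that \<psi> has two independent steps: rescaling both would pay
  the excess 1 - \<theta> twice. For p < 1 the proof therefore passes to the ordinary modulus of
  order k + r by taking both steps equal, rescales there, and returns to
  \<open>\<psi>\<^sub>k\<close> through Jackson's theorem along dyadic degrees. The return needs a
  series that is geometric for \<alpha> < r; for \<alpha> = r it is controlled by the integral
  condition. The assumption \<open>\<psi>\<^sub>s \<le> M \<psi>\<^sub>k\<close> closes the loop.
  For p \<ge> 1 there is no excess, and density of polynomials replaces the series.\<close>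

definition tspan :: "int \<Rightarrow> int \<Rightarrow> (real \<Rightarrow> complex) set" where
  "tspan a b = {T. \<exists>c. T = (\<lambda>x. \<Sum>\<nu>\<in>{a..b}. c \<nu> * cis (of_int \<nu> * x))}"

lemma trig_polys_eq_tspan: "trig_polys n = tspan (- int n) (int n)"
proof -
  have "exp (\<i> * of_int \<nu> * of_real x) = cis (of_int \<nu> * x)" for \<nu> :: int and x :: real
    by (simp add: cis_conv_exp mult.assoc)
  then show ?thesis
    unfolding trig_polys_def tspan_def by simp
qed

lemma tspan_cis: assumes "a \<le> \<nu>" "\<nu> \<le> b" shows "(\<lambda>x. cis (of_int \<nu> * x)) \<in> tspan a b"
proof -
  have "(\<Sum>\<mu>\<in>{a..b}. (if \<mu> = \<nu> then 1 else 0) * cis (of_int \<mu> * x)) = cis (of_int \<nu> * x)" for x :: real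
    using assms by (subst sum.remove[of _ \<nu>]) (auto intro!: sum.neutral)
  then show ?thesis
    unfolding tspan_def by (intro CollectI exI[of _ "\<lambda>\<mu>. if \<mu> = \<nu> then 1 else 0"]) (simp add: fun_eq_iff)
qed

lemma tspan_add:
  assumes "T \<in> tspan a b" "S \<in> tspan a b" shows "(\<lambda>x. T x + S x) \<in> tspan a b"
proof -
  obtain c d where "T = (\<lambda>x. \<Sum>\<nu>\<in>{a..b}. c \<nu> * cis (of_int \<nu> * x))"
      "S = (\<lambda>x. \<Sum>\<nu>\<in>{a..b}. d \<nu> * cis (of_int \<nu> * x))"
    using assms unfolding tspan_def by auto
  then show ?thesis
    unfolding tspan_def
    by (intro CollectI exI[of _ "\<lambda>\<nu>. c \<nu> + d \<nu>"]) (simp add: fun_eq_iff sum.distrib algebra_simps)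
qed

lemma tspan_scale:
  assumes "T \<in> tspan a b" shows "(\<lambda>x. k * T x) \<in> tspan a b"
proof -
  obtain c where "T = (\<lambda>x. \<Sum>\<nu>\<in>{a..b}. c \<nu> * cis (of_int \<nu> * x))"
    using assms unfolding tspan_def by auto
  then show ?thesis
    unfolding tspan_def
    by (intro CollectI exI[of _ "\<lambda>\<nu>. k * c \<nu>"]) (simp add: fun_eq_iff sum_distrib_left mult.assoc)
qed

lemma tspan_zero: "(\<lambda>x. 0) \<in> tspan a b"
  unfolding tspan_def by (intro CollectI exI[of _ "\<lambda>\<nu>. 0"]) simp

lemma tspan_sum:
  assumes "\<And>i. i \<in> I \<Longrightarrow> T i \<in> tspan a b" shows "(\<lambda>x. \<Sum>i\<in>I. T i x) \<in> tspan a b"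
  using assms by (induction I rule: infinite_finite_induct) (auto intro: tspan_zero tspan_add)

lemma tspan_mono:
  assumes "T \<in> tspan a b" "a' \<le> a" "b \<le> b'" shows "T \<in> tspan a' b'"
proof -
  obtain c where T: "T = (\<lambda>x. \<Sum>\<nu>\<in>{a..b}. c \<nu> * cis (of_int \<nu> * x))"
    using assms unfolding tspan_def by auto
  show ?thesis
    unfolding T by (intro tspan_sum tspan_scale tspan_cis) (use assms in auto)
qed

lemma tspan_mult:
  assumes "T \<in> tspan a b" "S \<in> tspan a' b'" shows "(\<lambda>x. T x * S x) \<in> tspan (a + a') (b + b')"
proof -
  obtain c d where TS: "T = (\<lambda>x. \<Sum>\<nu>\<in>{a..b}. c \<nu> * cis (of_int \<nu> * x))"
      "S = (\<lambda>x. \<Sum>\<nu>\<in>{a'..b'}. d \<nu> * cis (of_int \<nu> * x))"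
    using assms unfolding tspan_def by auto
  have eq: "T x * S x = (\<Sum>\<nu>\<in>{a..b}. \<Sum>\<mu>\<in>{a'..b'}. (c \<nu> * d \<mu>) * cis (of_int (\<nu> + \<mu>) * x))" for x
    unfolding TS sum_product by (intro sum.cong refl) (simp add: cis_mult[symmetric] algebra_simps)
  show ?thesis
    unfolding eq by (intro tspan_sum tspan_scale tspan_cis) auto
qed

lemma tspan_power:
  assumes "T \<in> tspan 0 b" shows "(\<lambda>x. T x ^ M) \<in> tspan 0 (int M * b)"
proof (induction M)
  case 0
  show ?case using tspan_cis[of 0 0 0] by simp
next
  case (Suc M)
  show ?case using tspan_mult[OF assms Suc] by (simp add: algebra_simps)
qed

lemma tspan_shift:
  assumes "T \<in> tspan a b" shows "(\<lambda>x. T (x + t)) \<in> tspan a b"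
proof -
  obtain c where T: "T = (\<lambda>x. \<Sum>\<nu>\<in>{a..b}. c \<nu> * cis (of_int \<nu> * x))"
    using assms unfolding tspan_def by auto
  have eq: "T (x + t) = (\<Sum>\<nu>\<in>{a..b}. (c \<nu> * cis (of_int \<nu> * t)) * cis (of_int \<nu> * x))" for x
    unfolding T by (intro sum.cong refl) (simp add: cis_mult algebra_simps)
  show ?thesis
    unfolding eq by (intro tspan_sum tspan_scale tspan_cis) auto
qed

lemma tspan_reflect:
  assumes "T \<in> tspan a b" shows "(\<lambda>x. T (t - x)) \<in> tspan (-b) (-a)"
proof -
  obtain c where T: "T = (\<lambda>x. \<Sum>\<nu>\<in>{a..b}. c \<nu> * cis (of_int \<nu> * x))"
    using assms unfolding tspan_def by auto
  have eq: "T (t - x) = (\<Sum>\<nu>\<in>{a..b}. (c \<nu> * cis (of_int \<nu> * t)) * cis (of_int (-\<nu>) * x))" for x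
    unfolding T by (intro sum.cong refl) (simp add: cis_mult algebra_simps)
  show ?thesis
    unfolding eq by (intro tspan_sum tspan_scale tspan_cis) auto
qed

lemma torus_fun_tspan:
  assumes "T \<in> tspan a b" shows "torus_fun T"
proof -
  obtain c where T: "T = (\<lambda>x. \<Sum>\<nu>\<in>{a..b}. c \<nu> * cis (of_int \<nu> * x))"
    using assms unfolding tspan_def by auto
  have "cis (of_int \<nu> * (x + 2 * pi)) = cis (of_int \<nu> * x)" for \<nu> x
  proof -
    have "cis (of_int \<nu> * (x + 2 * pi)) = cis (of_int \<nu> * x) * cis (2 * pi * of_int \<nu>)"
      by (simp add: cis_mult algebra_simps)
    then show ?thesis by simp
  qed
  then show ?thesis
    unfolding torus_fun_def T by simp
qed

lemma torus_fun_int: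
  assumes "torus_fun f" shows "f (x + of_int k * (2 * pi)) = f x"
proof (induction k rule: int_induct[where k = 0])
  case (step1 i)
  have "f ((x + of_int i * (2 * pi)) + 2 * pi) = f (x + of_int i * (2 * pi))"
    using assms unfolding torus_fun_def by blast
  then show ?case using step1 by (simp add: algebra_simps)
next
  case (step2 i)
  have "f ((x + of_int (i - 1) * (2 * pi)) + 2 * pi) = f (x + of_int (i - 1) * (2 * pi))"
    using assms unfolding torus_fun_def by blast
  then show ?case using step2 by (simp add: algebra_simps)
qed simp

section \<open>Characters on a finite lattice and sampling formulas\<close>

lemma sum_periodic_int:
  fixes g :: "int \<Rightarrow> 'a::comm_monoid_add"
  assumes "\<And>l. g (l + int N) = g l" "N > 0"
  shows "sum g {a..<a + int N} = sum g {b..<b + int N}"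
proof -
  have step: "sum g {a..<a + int N} = sum g {a + 1..<(a + 1) + int N}" for a
  proof -
    have "{a..<a + int N} = insert a {a + 1..<a + int N}" "{a + 1..<(a + 1) + int N} = insert (a + int N) {a + 1..<a + int N}"
      using assms(2) by auto
    then show ?thesis using assms(1)[of a] by simp
  qed
  have "sum g {a..<a + int N} = sum g {0..<0 + int N}" for a
  proof (induction a rule: int_induct[where k = 0])
    case (step1 i)
    then show ?case using step[of i] by simp
  next
    case (step2 i)
    then show ?case using step[of "i - 1"] by simp
  qed simp
  from this[of a] this[of b] show ?thesis by simp
qed

text \<open>The summands are powers of an N-th root of unity, and their geometric series vanishes
  unless that root is 1. The window starts at an arbitrary \<open>a\<close>, so that sums over the
  lattice can be recentred at will.\<close>

lemma sum_cis_lattice: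
  assumes "N > 0"
  shows "(\<Sum>l\<in>{a..<a + int N}. cis (of_int q * (of_int l * (2 * pi / real N)))) =
         (if int N dvd q then of_nat N else 0)"
proof -
  define g where "g l = cis (of_int q * (of_int l * (2 * pi / real N)))" for l :: int
  have per: "g (l + int N) = g l" for l
  proof -
    have "of_int (l + int N) * (2 * pi / real N) = of_int l * (2 * pi / real N) + 2 * pi"
      using assms by (simp add: field_simps)
    then have "g (l + int N) = g l * cis (2 * pi * of_int q)"
      unfolding g_def by (simp add: cis_mult ring_distribs mult.commute add.commute)
    then show ?thesis by simp
  qed
  define z where "z = cis (of_int q * (2 * pi / real N))"
  have "sum g {a..<a + int N} = sum g {0..<0 + int N}"
    by (rule sum_periodic_int) (use per assms in auto)
  also have "\<dots> = (\<Sum>j<N. z ^ j)"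
  proof (rule sum.reindex_bij_witness[of _ int nat])
    fix l assume "l \<in> {0..<0 + int N}"
    then have l: "real (nat l) = of_int l" by simp
    have "z ^ nat l = cis (real (nat l) * (of_int q * (2 * pi / real N)))"
      unfolding z_def by (rule Complex.DeMoivre)
    then show "z ^ nat l = g l"
      unfolding l g_def by (simp only: mult.left_commute)
  qed auto
  also have "\<dots> = (if int N dvd q then of_nat N else 0)"
  proof (cases "int N dvd q")
    case True
    then obtain k where "q = int N * k" by blast
    then have "z = cis (2 * pi * of_int k)"
      using assms unfolding z_def by (simp add: field_simps)
    then show ?thesis using True by simp
  next
    case False
    have "z ^ N = cis (2 * pi * of_int q)"
      using assms unfolding z_def Complex.DeMoivre by (simp add: field_simps)
    then have zN: "z ^ N = 1" by simp
    have "z \<noteq> 1"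
    proof
      assume "z = 1"
      then have "exp (\<i> * of_real (of_int q * (2 * pi / real N))) = 1"
        unfolding z_def cis_conv_exp .
      then obtain k :: int where "of_int q * (2 * pi / real N) = of_int (2 * k) * pi"
        unfolding exp_eq_1 by auto
      then have "of_int q = (of_int (int N * k) :: real)"
        using assms by (simp add: field_simps)
      then have "q = int N * k" by linarith
      then show False using False by simp
    qed
    then have "(\<Sum>j<N. z ^ j) = (1 - z ^ N) / (1 - z)"
      by (simp add: sum_gp_strict)
    then show ?thesis using zN False by simp
  qed
  finally show ?thesis unfolding g_def .
qed

text \<open>
  The powers of \<open>fej\<close> have frequencies \<open>0, \<dots>, M n\<close> only; the asymmetric frequency range of \<open>dir\<close> makes
  the product \<open>ker\<close> reproduce polynomials of degree \<open>n\<close> under sampling.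
\<close>

definition fej :: "nat \<Rightarrow> real \<Rightarrow> complex" where
  "fej L t = (\<Sum>l<L. cis (real l * t)) / of_nat L"

definition dir :: "nat \<Rightarrow> nat \<Rightarrow> real \<Rightarrow> complex" where
  "dir M n t = (\<Sum>\<nu>\<in>{- int (n + M * n)..int n}. cis (of_int \<nu> * t))"

definition ker :: "nat \<Rightarrow> nat \<Rightarrow> real \<Rightarrow> complex" where
  "ker M n t = dir M n t * fej (n + 1) t ^ M"

lemma fej_tspan: "fej (n + 1) \<in> tspan 0 (int n)"
proof -
  have "fej (n + 1) = (\<lambda>t. \<Sum>l<n+1. (1 / of_nat (n + 1)) * cis (of_int (int l) * t))"
    unfolding fej_def by (simp add: fun_eq_iff sum_divide_distrib del: sum.lessThan_Suc)
  also have "\<dots> \<in> tspan 0 (int n)"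
    by (intro tspan_sum tspan_scale tspan_cis) auto
  finally show ?thesis .
qed

lemma fej_power_tspan: "(\<lambda>t. fej (n + 1) t ^ M) \<in> tspan 0 (int (M * n))"
  using tspan_power[OF fej_tspan] by simp

lemma ker_tspan: "ker M n \<in> tspan (- int (n + M * n)) (int (n + M * n))"
proof -
  have "dir M n \<in> tspan (- int (n + M * n)) (int n)"
    unfolding dir_def by (intro tspan_sum tspan_cis) auto
  from tspan_mult[OF this fej_power_tspan] show ?thesis
    unfolding ker_def by simp
qed

text \<open>A frequency of \<open>dir\<close> plus one of \<open>P\<close> has absolute value at
  most 2n + Mn < N, so on N nodes only the total frequency 0 survives: there is no aliasing. The
  range of \<open>dir\<close> is the reflection of that of \<open>P\<close>, hence every coefficient
  of \<open>P\<close> is picked up exactly once.\<close>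

lemma dir_reproduce:
  assumes "P \<in> tspan (- int n) (int (n + M * n))" "N > 2 * n + M * n"
  shows "(\<Sum>l\<in>{a..<a + int N}. dir M n (of_int l * (2 * pi / real N) + h) * P (of_int l * (2 * pi / real N) + h)) = of_nat N * P 0"
proof -
  have N0: "N > 0" using assms by simp
  define \<tau> where "\<tau> = 2 * pi / real N"
  obtain c where P: "P = (\<lambda>x. \<Sum>\<mu>\<in>{- int n..int (n + M * n)}. c \<mu> * cis (of_int \<mu> * x))"
    using assms(1) unfolding tspan_def by auto
  have *: "(\<Sum>l\<in>{a..<a + int N}. cis (of_int (\<nu> + \<mu>) * (of_int l * \<tau> + h))) = (if \<nu> = - \<mu> then of_nat N else 0)"
    if "\<nu> \<in> {- int (n + M * n)..int n}" "\<mu> \<in> {- int n..int (n + M * n)}" for \<nu> \<mu>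
  proof -
    have "(\<Sum>l\<in>{a..<a + int N}. cis (of_int (\<nu> + \<mu>) * (of_int l * \<tau> + h)))
       = cis (of_int (\<nu> + \<mu>) * h) * (\<Sum>l\<in>{a..<a + int N}. cis (of_int (\<nu> + \<mu>) * (of_int l * \<tau>)))"
      by (simp add: sum_distrib_left cis_mult algebra_simps)
    also have "\<dots> = cis (of_int (\<nu> + \<mu>) * h) * (if int N dvd \<nu> + \<mu> then of_nat N else 0)"
      using sum_cis_lattice[OF N0, of "\<nu> + \<mu>" a] unfolding \<tau>_def by simp
    also have "(int N dvd \<nu> + \<mu>) \<longleftrightarrow> \<nu> = - \<mu>"
    proof
      assume d: "int N dvd \<nu> + \<mu>"
      have "int N > 2 * int n + int (M * n)" using assms(2) by linarith
      then have "abs (\<nu> + \<mu>) < int N" using that by (simp add: abs_less_iff del: of_nat_mult)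
      then have "\<nu> + \<mu> = 0" using d dvd_imp_le_int[of "\<nu> + \<mu>" "int N"] by (cases "\<nu> + \<mu> = 0") simp_all
      then show "\<nu> = - \<mu>" by simp
    qed simp
    finally show ?thesis by simp
  qed
  have "(\<Sum>l\<in>{a..<a + int N}. dir M n (of_int l * \<tau> + h) * P (of_int l * \<tau> + h))
     = (\<Sum>l\<in>{a..<a + int N}. \<Sum>\<nu>\<in>{- int (n + M * n)..int n}. \<Sum>\<mu>\<in>{- int n..int (n + M * n)}. c \<mu> * cis (of_int (\<nu> + \<mu>) * (of_int l * \<tau> + h)))"
    unfolding dir_def P sum_product
    by (intro sum.cong refl) (simp add: cis_mult algebra_simps)
  also have "\<dots> = (\<Sum>\<nu>\<in>{- int (n + M * n)..int n}. \<Sum>l\<in>{a..<a + int N}. \<Sum>\<mu>\<in>{- int n..int (n + M * n)}. c \<mu> * cis (of_int (\<nu> + \<mu>) * (of_int l * \<tau> + h)))"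
    by (rule sum.swap)
  also have "\<dots> = (\<Sum>\<nu>\<in>{- int (n + M * n)..int n}. \<Sum>\<mu>\<in>{- int n..int (n + M * n)}. \<Sum>l\<in>{a..<a + int N}. c \<mu> * cis (of_int (\<nu> + \<mu>) * (of_int l * \<tau> + h)))"
    by (intro sum.cong refl sum.swap)
  also have "\<dots> = (\<Sum>\<nu>\<in>{- int (n + M * n)..int n}. \<Sum>\<mu>\<in>{- int n..int (n + M * n)}. c \<mu> * (if \<nu> = - \<mu> then of_nat N else 0))"
    by (intro sum.cong refl, subst sum_distrib_left[symmetric]) (simp add: * del: of_int_add)
  also have "\<dots> = (\<Sum>\<mu>\<in>{- int n..int (n + M * n)}. \<Sum>\<nu>\<in>{- int (n + M * n)..int n}. c \<mu> * (if \<nu> = - \<mu> then of_nat N else 0))"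
    by (rule sum.swap)
  also have "\<dots> = (\<Sum>\<mu>\<in>{- int n..int (n + M * n)}. c \<mu> * of_nat N)"
  proof (intro sum.cong refl)
    fix \<mu> assume "\<mu> \<in> {- int n..int (n + M * n)}"
    then have "- \<mu> \<in> {- int (n + M * n)..int n}" by auto
    then show "(\<Sum>\<nu>\<in>{- int (n + M * n)..int n}. c \<mu> * (if \<nu> = - \<mu> then of_nat N else 0)) = c \<mu> * of_nat N"
      by (subst sum.remove[of _ "- \<mu>"]) (auto intro!: sum.neutral)
  qed
  also have "\<dots> = of_nat N * P 0"
    unfolding P by (simp add: sum_distrib_left mult.commute)
  finally show ?thesis unfolding \<tau>_def .
qed

text \<open>\<open>dir_reproduce\<close> is applied to the function
  \<open>fej (n + 1) t ^ M * T (x + h - t)\<close> of t, whose value at 0 is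
  \<open>T (x + h)\<close> because \<open>fej\<close> is 1 there. The samples of \<open>T\<close>
  sit at x - l\<tau> whatever h is; h enters only through the kernel. An increment of
  \<open>T\<close> is therefore a combination of the same samples with increments of the kernel as
  coefficients.\<close>

lemma ker_reproduce:
  fixes a :: int and x h :: real
  assumes "T \<in> trig_polys n" "N > 2 * n + M * n"
  shows "T (x + h) = (\<Sum>l\<in>{a..<a + int N}. ker M n (of_int l * (2 * pi / real N) + h) / of_nat N * T (x - of_int l * (2 * pi / real N)))"
proof -
  define P where "P t = fej (n + 1) t ^ M * T (x + h - t)" for t
  have "(\<lambda>t. T (x + h - t)) \<in> tspan (- int n) (int n)"
    using tspan_reflect[of T "- int n" "int n" "x + h"] assms(1) unfolding trig_polys_eq_tspan by simp
  then have "P \<in> tspan (0 + - int n) (int (M * n) + int n)"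
    unfolding P_def by (rule tspan_mult[OF fej_power_tspan])
  moreover have "0 + - int n = - int n" "int (M * n) + int n = int (n + M * n)" by simp_all
  ultimately have P: "P \<in> tspan (- int n) (int (n + M * n))"
    by (simp only:)
  have "fej (n + 1) 0 = of_nat (n + 1) / of_nat (n + 1)"
    unfolding fej_def by simp
  then have "fej (n + 1) 0 = 1"
    using of_nat_neq_0[of n] by (metis Suc_eq_plus1 divide_self)
  then have P0: "P 0 = T (x + h)"
    unfolding P_def by simp
  have "of_nat N * T (x + h) = (\<Sum>l\<in>{a..<a + int N}. dir M n (of_int l * (2 * pi / real N) + h) * P (of_int l * (2 * pi / real N) + h))"
    using dir_reproduce[OF P assms(2), where a = a and h = h] P0 by simp
  also have "\<dots> = (\<Sum>l\<in>{a..<a + int N}. ker M n (of_int l * (2 * pi / real N) + h) * T (x - of_int l * (2 * pi / real N)))"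
    unfolding P_def ker_def by (intro sum.cong refl) (simp add: mult.assoc)
  finally have "T (x + h) = (\<Sum>l\<in>{a..<a + int N}. ker M n (of_int l * (2 * pi / real N) + h) * T (x - of_int l * (2 * pi / real N))) / of_nat N"
    using assms(2) by (simp add: eq_divide_eq mult.commute)
  then show ?thesis by (simp only: sum_divide_distrib times_divide_eq_left)
qed

lemma ker_sum_one:
  assumes "N > 2 * n + M * n"
  shows "(\<Sum>l\<in>{a..<a + int N}. ker M n (of_int l * (2 * pi / real N) + h) / of_nat N) = 1"
proof -
  have "(\<lambda>x. 1) \<in> trig_polys n"
    using tspan_cis[of "- int n" 0 "int n"] by (simp add: trig_polys_eq_tspan)
  from ker_reproduce[OF this assms] show ?thesis by simp
qed

text \<open>A frequency outside the spectrum of \<open>S\<close>, but too small to alias into it, is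
  annihilated. This removes the high frequencies in \<open>smoothing_operator\<close>.\<close>

lemma lattice_filter:
  assumes "S \<in> tspan (- int b) (int b)" "\<bar>q\<bar> > int b" "N > b + nat \<bar>q\<bar>"
  shows "(\<Sum>l\<in>{a..<a + int N}. S (- (of_int l * (2 * pi / real N))) * cis (of_int q * (of_int l * (2 * pi / real N)))) = 0"
proof -
  have N0: "N > 0" using assms by simp
  obtain c where S: "S = (\<lambda>x. \<Sum>\<mu>\<in>{- int b..int b}. c \<mu> * cis (of_int \<mu> * x))"
    using assms(1) unfolding tspan_def by auto
  have z: "(\<Sum>l\<in>{a..<a + int N}. cis (of_int (q - \<mu>) * (of_int l * (2 * pi / real N)))) = 0"
    if "\<mu> \<in> {- int b..int b}" for \<mu>
  proof -
    have "\<not> int N dvd q - \<mu>"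
    proof
      assume d: "int N dvd q - \<mu>"
      have b: "abs (q - \<mu>) < int N" "q - \<mu> \<noteq> 0" using that assms by auto
      from dvd_imp_le_int[OF b(2) d] b(1) show False by simp
    qed
    then show ?thesis using sum_cis_lattice[OF N0, of "q - \<mu>" a] by simp
  qed
  have "(\<Sum>l\<in>{a..<a + int N}. S (- (of_int l * (2 * pi / real N))) * cis (of_int q * (of_int l * (2 * pi / real N))))
     = (\<Sum>l\<in>{a..<a + int N}. \<Sum>\<mu>\<in>{- int b..int b}. c \<mu> * cis (of_int (q - \<mu>) * (of_int l * (2 * pi / real N))))"
    unfolding S sum_distrib_right
  proof (intro sum.cong refl)
    fix l \<mu>
    have "d * cis (of_int \<mu> * (- t)) * cis (of_int q * t) = d * cis (of_int (q - \<mu>) * t)" for d t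
      by (simp add: cis_mult algebra_simps)
    then show "c \<mu> * cis (of_int \<mu> * - (of_int l * (2 * pi / real N))) * cis (of_int q * (of_int l * (2 * pi / real N)))
      = c \<mu> * cis (of_int (q - \<mu>) * (of_int l * (2 * pi / real N)))"
      by (simp only:)
  qed
  also have "\<dots> = (\<Sum>\<mu>\<in>{- int b..int b}. \<Sum>l\<in>{a..<a + int N}. c \<mu> * cis (of_int (q - \<mu>) * (of_int l * (2 * pi / real N))))"
    by (rule sum.swap)
  also have "\<dots> = 0"
    by (rule sum.neutral, rule ballI) (simp only: sum_distrib_left[symmetric] z mult_zero_right)
  finally show ?thesis .
qed

section \<open>Size and summability of the kernel\<close>

lemma cmod_one_minus_cis: "cmod (1 - cis t) = 2 * \<bar>sin (t / 2)\<bar>"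
proof -
  have c: "cos t = 1 - 2 * (sin (t / 2))\<^sup>2" using cos_double_sin[of "t / 2"] by simp
  have "(cmod (1 - cis t))\<^sup>2 = (1 - cos t)\<^sup>2 + (sin t)\<^sup>2"
    by (simp add: cmod_power2)
  also have "\<dots> = 2 - 2 * cos t" using sin_cos_squared_add[of t] by (simp add: power2_eq_square algebra_simps)
  also have "\<dots> = (2 * \<bar>sin (t / 2)\<bar>)\<^sup>2" unfolding c by (simp add: power2_eq_square)
  finally show ?thesis by (rule power2_eq_imp_eq) auto
qed

lemma cis_lipschitz: "cmod (cis s - cis t) \<le> \<bar>s - t\<bar>"
proof -
  have "cis s - cis t = cis s * (1 - cis (t - s))" by (simp add: algebra_simps cis_mult)
  then have "cmod (cis s - cis t) = cmod (1 - cis (t - s))" by (simp add: norm_mult)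
  also have "\<dots> \<le> \<bar>s - t\<bar>"
    unfolding cmod_one_minus_cis using abs_sin_x_le_abs_x[of "(t - s) / 2"] by simp
  finally show ?thesis .
qed

lemma jordan_inequality: fixes x :: real assumes "0 \<le> x" "x \<le> pi / 2" shows "2 * x / pi \<le> sin x"
proof -
  have "concave_on {0..pi/2} sin"
  proof (rule f''_le0_imp_concave)
    show "(sin has_real_derivative cos x) (at x)" for x :: real by (rule DERIV_sin)
    show "(cos has_real_derivative - sin x) (at x)" for x :: real by (rule DERIV_cos)
    show "- sin x \<le> 0" if "x \<in> {0..pi/2}" for x :: real using that sin_ge_zero[of x] by auto
  qed simp_all
  from concave_onD[OF this, of "2 * x / pi" 0 "pi/2"] show ?thesis
    using assms by (simp add: field_simps)
qed

lemma cmod_one_minus_cis_ge: assumes "\<bar>t\<bar> \<le> pi" shows "2 * \<bar>t\<bar> / pi \<le> cmod (1 - cis t)"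
proof -
  have "2 * (\<bar>t\<bar> / 2) / pi \<le> sin (\<bar>t\<bar> / 2)" using assms by (intro jordan_inequality) auto
  also have "\<dots> \<le> \<bar>sin (t / 2)\<bar>" by (cases "t \<ge> 0") auto
  finally show ?thesis unfolding cmod_one_minus_cis by simp
qed

lemma fej_le_one: "cmod (fej L t) \<le> 1"
proof -
  have "cmod (\<Sum>l<L. cis (real l * t)) \<le> (\<Sum>l<L. 1)"
    by (rule order_trans[OF norm_sum]) simp
  then show ?thesis unfolding fej_def by (cases "L = 0") (simp_all add: norm_divide divide_simps)
qed

text \<open>Multiplication by 1 - z with z = \<open>cis t\<close> closes the geometric sum to 1 -
  z^L, of modulus at most 2.\<close>

lemma fej_decay: "cmod (fej L t) * (real L * cmod (1 - cis t)) \<le> 2"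
proof (cases "L = 0")
  case False
  have "(1 - cis t) * (\<Sum>l<L. cis (real l * t)) = 1 - cis t ^ L"
    using one_diff_power_eq[of "cis t" L] by (simp add: Complex.DeMoivre)
  then have "cmod (1 - cis t) * cmod (\<Sum>l<L. cis (real l * t)) = cmod (1 - cis t ^ L)"
    by (metis norm_mult)
  also have "\<dots> \<le> 2" using norm_triangle_ineq4[of 1 "cis t ^ L"] by (simp add: norm_power)
  finally show ?thesis using False unfolding fej_def by (simp add: norm_divide mult.commute)
qed simp

lemma fej_decay_pi: assumes "\<bar>t\<bar> \<le> pi" shows "cmod (fej L t) * (real L * \<bar>t\<bar>) \<le> pi"
proof -
  have "cmod (fej L t) * (real L * (2 * \<bar>t\<bar> / pi)) \<le> cmod (fej L t) * (real L * cmod (1 - cis t))"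
    using cmod_one_minus_cis_ge[OF assms] by (intro mult_left_mono) auto
  also have "\<dots> \<le> 2" by (rule fej_decay)
  finally show ?thesis by (simp add: field_simps)
qed

lemma dir_le: "cmod (dir M n t) \<le> real (2 * n + M * n + 1)"
proof -
  have "cmod (dir M n t) \<le> (\<Sum>\<nu>\<in>{- int (n + M * n)..int n}. 1)"
    unfolding dir_def by (rule order_trans[OF norm_sum]) simp
  also have "\<dots> = real (2 * n + M * n + 1)" by simp
  finally show ?thesis .
qed

lemma ker_le: "cmod (ker M n t) \<le> real (2 * n + M * n + 1) * cmod (fej (n + 1) t) ^ M"
  unfolding ker_def norm_mult norm_power by (intro mult_right_mono dir_le) auto

lemma ker_lipschitz:
  "cmod (ker M n s - ker M n t) \<le> real (2 * n + M * n + 1) * (real n + 2 * real (M * n)) * \<bar>s - t\<bar>"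
proof -
  have d: "cmod (dir M n s - dir M n t) \<le> real (2 * n + M * n + 1) * (real (n + M * n) * \<bar>s - t\<bar>)"
  proof -
    have "cmod (dir M n s - dir M n t) \<le> (\<Sum>\<nu>\<in>{- int (n + M * n)..int n}. real (n + M * n) * \<bar>s - t\<bar>)"
      unfolding dir_def sum_subtractf[symmetric]
    proof (rule order_trans[OF norm_sum], rule sum_mono)
      fix \<nu> assume "\<nu> \<in> {- int (n + M * n)..int n}"
      then have "- int (n + M * n) \<le> \<nu>" "\<nu> \<le> int (n + M * n)" by (simp_all add: add_increasing2)
      then have "\<bar>\<nu>\<bar> \<le> int (n + M * n)" by linarith
      then have nu: "\<bar>real_of_int \<nu>\<bar> \<le> real (n + M * n)" by linarith
      have "cmod (cis (of_int \<nu> * s) - cis (of_int \<nu> * t)) \<le> \<bar>of_int \<nu> * s - of_int \<nu> * t\<bar>"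
        by (rule cis_lipschitz)
      also have "\<dots> = \<bar>real_of_int \<nu>\<bar> * \<bar>s - t\<bar>" by (simp add: abs_mult right_diff_distrib[symmetric])
      also have "\<dots> \<le> real (n + M * n) * \<bar>s - t\<bar>" using nu by (intro mult_right_mono) auto
      finally show "cmod (cis (of_int \<nu> * s) - cis (of_int \<nu> * t)) \<le> real (n + M * n) * \<bar>s - t\<bar>" .
    qed
    also have "\<dots> = real (2 * n + M * n + 1) * (real (n + M * n) * \<bar>s - t\<bar>)" by simp
    finally show ?thesis .
  qed
  have f: "cmod (fej (n + 1) s - fej (n + 1) t) \<le> real n * \<bar>s - t\<bar>"
  proof -
    have "cmod ((\<Sum>l<n+1. cis (real l * s)) - (\<Sum>l<n+1. cis (real l * t))) \<le> (\<Sum>l<n+1. real n * \<bar>s - t\<bar>)"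
      unfolding sum_subtractf[symmetric]
    proof (rule order_trans[OF norm_sum], rule sum_mono)
      fix l assume "l \<in> {..<n+1}"
      have "cmod (cis (real l * s) - cis (real l * t)) \<le> \<bar>real l * s - real l * t\<bar>"
        by (rule cis_lipschitz)
      also have "\<dots> = real l * \<bar>s - t\<bar>" by (simp add: abs_mult right_diff_distrib[symmetric])
      also have "\<dots> \<le> real n * \<bar>s - t\<bar>" using \<open>l \<in> {..<n+1}\<close> by (intro mult_right_mono) auto
      finally show "cmod (cis (real l * s) - cis (real l * t)) \<le> real n * \<bar>s - t\<bar>" .
    qed
    also have "\<dots> = real (n + 1) * (real n * \<bar>s - t\<bar>)" by simp
    finally have "cmod ((\<Sum>l<n+1. cis (real l * s)) - (\<Sum>l<n+1. cis (real l * t))) / real (n + 1) \<le> real n * \<bar>s - t\<bar>"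
      by (subst pos_divide_le_eq) (simp_all add: mult.commute)
    then show ?thesis
      unfolding fej_def diff_divide_distrib[symmetric] norm_divide norm_of_nat .
  qed
  have p: "cmod (fej (n + 1) s ^ M - fej (n + 1) t ^ M) \<le> real M * (real n * \<bar>s - t\<bar>)"
    using norm_power_diff[of "fej (n + 1) s" "fej (n + 1) t" M] fej_le_one f
    by (meson mult_left_mono of_nat_0_le_iff order_trans)
  have "ker M n s - ker M n t = (dir M n s - dir M n t) * fej (n + 1) s ^ M + dir M n t * (fej (n + 1) s ^ M - fej (n + 1) t ^ M)"
    unfolding ker_def by (simp add: algebra_simps)
  then have "cmod (ker M n s - ker M n t) \<le> cmod (dir M n s - dir M n t) * cmod (fej (n + 1) s) ^ M + cmod (dir M n t) * cmod (fej (n + 1) s ^ M - fej (n + 1) t ^ M)"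
    by (metis norm_mult norm_power norm_triangle_ineq)
  also have "\<dots> \<le> real (2 * n + M * n + 1) * (real (n + M * n) * \<bar>s - t\<bar>) * 1 + real (2 * n + M * n + 1) * (real M * (real n * \<bar>s - t\<bar>))"
    by (intro add_mono mult_mono d p dir_le power_le_one fej_le_one) auto
  also have "\<dots> = real (2 * n + M * n + 1) * (real n + 2 * real (M * n)) * \<bar>s - t\<bar>"
    by (simp add: algebra_simps)
  finally show ?thesis .
qed

text \<open>Odd, so that the symmetric window from \<open>- half\<close> to \<open>half\<close> is
  exactly one period; larger than 2n + Mn, the threshold of \<open>dir_reproduce\<close>; and
  comparable with n + 1, so that one node spacing matches the scale on which the kernel
  decays.\<close>

definition nodes :: "nat \<Rightarrow> nat \<Rightarrow> nat" where
  "nodes M n = 2 * ((M + 2) * (n + 1)) + 1"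

definition half :: "nat \<Rightarrow> nat \<Rightarrow> int" where
  "half M n = int ((M + 2) * (n + 1))"

lemma half_interval: "{- half M n..half M n} = {- half M n..< - half M n + int (nodes M n)}"
  unfolding half_def nodes_def by auto

lemma nodes_pos: "real (nodes M n) > 0"
  unfolding nodes_def of_nat_0_less_iff by simp

lemma dir_size_nodes: "real (2 * n + M * n + 1) \<le> real (nodes M n)"
  unfolding nodes_def of_nat_le_iff by (simp add: algebra_simps)

lemma nodes_gt: "nodes M n > 2 * n + M * n"
  unfolding nodes_def by (simp add: algebra_simps)

lemma nodes_le: "real (nodes M n) \<le> real (2 * M + 5) * real (n + 1)"
proof -
  have "nodes M n \<le> (2 * M + 5) * (n + 1)" unfolding nodes_def by (simp add: algebra_simps)
  then show ?thesis unfolding of_nat_mult[symmetric] of_nat_le_iff .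
qed

text \<open>Uniform in offsets h up to one node spacing: with N nodes and J = |j|, Jordan's
  inequality gives at least 4J/N for |1 - cis s| at the node itself, the offset changes this by at
  most 2\<pi>/N, and J \<ge> 4 > \<pi> leaves 2J/N. For |j| \<le> 3 the bound
  \<open>fej_le_one\<close> is enough.\<close>

lemma fej_node:
  assumes "\<bar>h\<bar> \<le> 2 * pi / real (nodes M n)" "\<bar>j\<bar> \<le> half M n"
  shows "cmod (fej (n + 1) (of_int j * (2 * pi / real (nodes M n)) + h)) \<le> real (4 * (2 * M + 5)) / (1 + \<bar>of_int j\<bar>)"
proof (cases "\<bar>j\<bar> \<le> 3")
  case True
  then have "1 + \<bar>real_of_int j\<bar> \<le> 4" by linarith
  then have "1 \<le> real (4 * (2 * M + 5)) / (1 + \<bar>of_int j\<bar>)"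
    by (subst pos_le_divide_eq) auto
  then show ?thesis using fej_le_one order_trans by blast
next
  case False
  define N where "N = real (nodes M n)"
  define J where "J = \<bar>real_of_int j\<bar>"
  have J: "J \<ge> 4" using False unfolding J_def by linarith
  have N: "N > 0" unfolding N_def by (rule nodes_pos)
  define s where "s = of_int j * (2 * pi / N)"
  have abs_s: "\<bar>s\<bar> = J * (2 * pi / N)" unfolding s_def J_def using N by (simp add: abs_mult)
  have "2 * J \<le> N" using assms(2) unfolding J_def N_def half_def nodes_def by linarith
  then have "\<bar>s\<bar> \<le> pi" unfolding abs_s using N by (simp add: field_simps)
  then have 1: "2 * \<bar>s\<bar> / pi \<le> cmod (1 - cis s)" by (rule cmod_one_minus_cis_ge)
  have e: "2 * \<bar>s\<bar> / pi = 4 * J / N" unfolding abs_s by simp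
  have "cmod (cis s - cis (s + h)) \<le> 2 * pi / N"
    using cis_lipschitz[of s "s + h"] assms(1) unfolding N_def by simp
  moreover have "cmod (1 - cis s) \<le> cmod (1 - cis (s + h)) + cmod (cis s - cis (s + h))"
    using norm_triangle_ineq[of "1 - cis (s + h)" "- (cis s - cis (s + h))"] by (simp add: norm_minus_commute)
  ultimately have "4 * J / N \<le> cmod (1 - cis (s + h)) + 2 * pi / N" using 1 e by linarith
  moreover have "2 * J / N \<le> 4 * J / N - 2 * pi / N"
    unfolding diff_divide_distrib[symmetric] using J N pi_less_4 by (intro divide_right_mono) auto
  ultimately have ge: "2 * J / N \<le> cmod (1 - cis (s + h))" by linarith
  have "cmod (fej (n + 1) (s + h)) * (real (n + 1) * (2 * J / N)) \<le> cmod (fej (n + 1) (s + h)) * (real (n + 1) * cmod (1 - cis (s + h)))"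
    using ge by (intro mult_left_mono) auto
  also have "\<dots> \<le> 2" by (rule fej_decay)
  finally have "cmod (fej (n + 1) (s + h)) * (real (n + 1) * J) \<le> N" using N by (simp add: field_simps)
  also have "\<dots> \<le> real (2 * M + 5) * real (n + 1)" unfolding N_def by (rule nodes_le)
  finally have "real (n + 1) * (cmod (fej (n + 1) (s + h)) * J) \<le> real (n + 1) * real (2 * M + 5)"
    by (simp only: mult.left_commute mult.commute)
  then have *: "cmod (fej (n + 1) (s + h)) * J \<le> real (2 * M + 5)" by (rule mult_left_le_imp_le) simp
  have "cmod (fej (n + 1) (s + h)) * (1 + J) \<le> 1 + cmod (fej (n + 1) (s + h)) * J"
    using fej_le_one[of "n + 1" "s + h"] by (simp add: algebra_simps)
  also have "\<dots> \<le> real (4 * (2 * M + 5))" using * by simp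
  finally show ?thesis
    unfolding s_def[symmetric] N_def[symmetric] J_def[symmetric] s_def[unfolded N_def, symmetric]
    using J by (simp add: pos_le_divide_eq s_def N_def)
qed

lemma ker_node:
  assumes "\<bar>h\<bar> \<le> 2 * pi / real (nodes M n)" "\<bar>j\<bar> \<le> half M n"
  shows "cmod (ker M n (of_int j * (2 * pi / real (nodes M n)) + h)) / real (nodes M n)
    \<le> (real (4 * (2 * M + 5)) / (1 + \<bar>of_int j\<bar>)) ^ M"
proof -
  have "cmod (ker M n (of_int j * (2 * pi / real (nodes M n)) + h)) \<le> real (nodes M n) * (real (4 * (2 * M + 5)) / (1 + \<bar>of_int j\<bar>)) ^ M"
    by (rule order_trans[OF ker_le], intro mult_mono power_mono fej_node assms) (use dir_size_nodes[of n M] in auto)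
  then show ?thesis
    by (subst pos_divide_le_eq[OF nodes_pos]) (simp only: mult.commute)
qed

lemma sum_abs_int_le:
  fixes g :: "nat \<Rightarrow> real" assumes "\<And>j. g j \<ge> 0"
  shows "(\<Sum>j\<in>{- int R..int R}. g (nat \<bar>j\<bar>)) \<le> 2 * (\<Sum>j\<le>R. g j)"
proof (induction R)
  case 0 then show ?case using assms[of 0] by simp
next
  case (Suc R)
  have "{- int (Suc R)..int (Suc R)} = insert (- int (Suc R)) (insert (int (Suc R)) {- int R..int R})" by auto
  then have "(\<Sum>j\<in>{- int (Suc R)..int (Suc R)}. g (nat \<bar>j\<bar>)) = g (Suc R) + (g (Suc R) + (\<Sum>j\<in>{- int R..int R}. g (nat \<bar>j\<bar>)))"
    by (simp add: nat_add_distrib)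
  then show ?case using Suc by simp
qed

text \<open>The term with index j \<ge> 1 is at most 1/(1 + z(j - 1)) - 1/(1 + zj), which
  telescopes. The mesh z is kept as a parameter because \<open>moment_coeffs\<close> uses lattices
  much finer than the kernel scale; the sum behaves like an integral and stays below 4 for all z
  \<le> 1.\<close>

lemma sum_inverse_square_le:
  fixes z :: real assumes "z > 0"
  shows "(\<Sum>j\<in>{- int R..int R}. z / (1 + z * \<bar>of_int j\<bar>)\<^sup>2) \<le> 2 * (z + 1)"
proof -
  have "(\<Sum>j\<le>R. z / (1 + z * real j)\<^sup>2) \<le> z + 1 - 1 / (1 + z * real R)"
  proof (induction R)
    case (Suc R)
    have p: "1 + z * real R > 0" "1 + z * real (Suc R) > 0" using assms by (auto intro!: add_pos_nonneg)
    have "z / (1 + z * real (Suc R))\<^sup>2 \<le> z / ((1 + z * real R) * (1 + z * real (Suc R)))"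
      unfolding power2_eq_square using p assms by (intro divide_left_mono mult_right_mono mult_pos_pos) (auto simp: algebra_simps)
    also have "\<dots> = 1 / (1 + z * real R) - 1 / (1 + z * real (Suc R))"
      using p by (simp add: field_simps)
    finally show ?case using Suc by simp
  qed simp
  also have "\<dots> \<le> z + 1" using assms by simp
  finally have "2 * (\<Sum>j\<le>R. z / (1 + z * real j)\<^sup>2) \<le> 2 * (z + 1)" by simp
  moreover have "(\<Sum>j\<in>{- int R..int R}. z / (1 + z * real (nat \<bar>j\<bar>))\<^sup>2) \<le> 2 * (\<Sum>j\<le>R. z / (1 + z * real j)\<^sup>2)"
    using assms by (intro sum_abs_int_le) auto
  ultimately show ?thesis by simp
qed

text \<open>Two bounds for one coefficient are interpolated by splitting the exponent \<theta> into
  two halves: the Lipschitz bound supplies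
  \<open>(real n * \<bar>h\<bar>) powr (\<theta> / 2)\<close>, the decay of the kernel supplies (1 +
  |j|)^(-M\<theta>/2), and M\<theta> \<ge> 4 makes the latter at least inverse-square.\<close>

lemma weak_bernstein_coeffs:
  assumes "0 < \<theta>" "\<theta> \<le> 1" "real M * \<theta> \<ge> 4"
  shows "\<exists>C>0. \<forall>n h. \<bar>h\<bar> \<le> 2 * pi / real (nodes M n) \<longrightarrow>
    (\<Sum>j\<in>{- half M n..half M n}. cmod ((ker M n (of_int j * (2 * pi / real (nodes M n)) + h) - ker M n (of_int j * (2 * pi / real (nodes M n)))) / of_nat (nodes M n)) powr \<theta>)
      \<le> C * (real n * \<bar>h\<bar>) powr (\<theta> / 2)"
proof -
  define K where "K = real (4 * (2 * M + 5))"
  define e where "e = \<theta> / 2"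
  have e: "e > 0" "real M * e \<ge> 2" using assms unfolding e_def by auto
  define B where "B = (1 + 2 * real M) powr e * 2 powr e * K powr (real M * e)"
  have B: "B > 0" unfolding B_def K_def by simp
  have "(\<Sum>j\<in>{- half M n..half M n}. cmod ((ker M n (of_int j * (2 * pi / real (nodes M n)) + h) - ker M n (of_int j * (2 * pi / real (nodes M n)))) / of_nat (nodes M n)) powr \<theta>)
      \<le> (B * 4) * (real n * \<bar>h\<bar>) powr e"
    if h: "\<bar>h\<bar> \<le> 2 * pi / real (nodes M n)" for n h
  proof -
    define t where "t j = of_int j * (2 * pi / real (nodes M n))" for j :: int
    define b where "b j = cmod ((ker M n (t j + h) - ker M n (t j)) / of_nat (nodes M n))" for j
    have N0: "real (nodes M n) > 0" by (rule nodes_pos)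
    have summand: "b j powr \<theta> \<le> (B * (real n * \<bar>h\<bar>) powr e) * (1 / (1 + 1 * \<bar>of_int j\<bar>)\<^sup>2)" if "j \<in> {- half M n..half M n}" for j
    proof -
      have jh: "\<bar>j\<bar> \<le> half M n" using that by auto
      have "b j = cmod (ker M n (t j + h) - ker M n (t j)) / real (nodes M n)"
        unfolding b_def by (simp add: norm_divide)
      also have "\<dots> \<le> real (2 * n + M * n + 1) * (real n + 2 * real (M * n)) * \<bar>h\<bar> / real (nodes M n)"
        using ker_lipschitz[of M n "t j + h" "t j"] N0 by (intro divide_right_mono) auto
      also have "\<dots> \<le> real (nodes M n) * (real n + 2 * real (M * n)) * \<bar>h\<bar> / real (nodes M n)"
        using dir_size_nodes[of n M] N0 by (intro divide_right_mono mult_right_mono) auto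
      also have "\<dots> = (1 + 2 * real M) * (real n * \<bar>h\<bar>)" using N0 by (simp add: field_simps)
      finally have b1: "b j \<le> (1 + 2 * real M) * (real n * \<bar>h\<bar>)" .
      have "b j = cmod (ker M n (t j + h) - ker M n (t j)) / real (nodes M n)"
        unfolding b_def by (simp add: norm_divide)
      also have "\<dots> \<le> (cmod (ker M n (t j + h)) + cmod (ker M n (t j + 0))) / real (nodes M n)"
        using N0 norm_triangle_ineq4 by (intro divide_right_mono) auto
      also have "\<dots> \<le> (K / (1 + \<bar>of_int j\<bar>)) ^ M + (K / (1 + \<bar>of_int j\<bar>)) ^ M"
        unfolding add_divide_distrib K_def t_def using h jh
        by (intro add_mono ker_node) auto
      finally have b2: "b j \<le> 2 * (K / (1 + \<bar>of_int j\<bar>)) ^ M" by simp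
      have b0: "b j \<ge> 0" unfolding b_def by simp
      have "b j powr \<theta> = b j powr e * b j powr e" unfolding e_def by (simp add: powr_add[symmetric])
      also have "\<dots> \<le> ((1 + 2 * real M) * (real n * \<bar>h\<bar>)) powr e * (2 * (K / (1 + \<bar>of_int j\<bar>)) ^ M) powr e"
        using e b0 b1 b2 by (intro mult_mono powr_mono2) auto
      also have "(2 * (K / (1 + \<bar>of_int j\<bar>)) ^ M) powr e = 2 powr e * (K / (1 + \<bar>of_int j\<bar>)) powr (real M * e)"
        by (simp add: powr_mult powr_powr[symmetric] powr_realpow[symmetric] K_def)
      also have "(K / (1 + \<bar>of_int j\<bar>)) powr (real M * e) = K powr (real M * e) / (1 + \<bar>of_int j\<bar>) powr (real M * e)"
        by (simp add: powr_divide K_def)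
      also have "((1 + 2 * real M) * (real n * \<bar>h\<bar>)) powr e * (2 powr e * (K powr (real M * e) / (1 + \<bar>of_int j\<bar>) powr (real M * e)))
         = (B * (real n * \<bar>h\<bar>) powr e) * (1 / (1 + \<bar>of_int j\<bar>) powr (real M * e))"
        unfolding B_def by (simp add: powr_mult)
      also have "\<dots> \<le> (B * (real n * \<bar>h\<bar>) powr e) * (1 / (1 + 1 * \<bar>of_int j\<bar>)\<^sup>2)"
      proof (intro mult_left_mono divide_left_mono)
        have "(1 + \<bar>real_of_int j\<bar>) powr 2 \<le> (1 + \<bar>of_int j\<bar>) powr (real M * e)"
          using e by (intro powr_mono) auto
        then show "(1 + 1 * \<bar>real_of_int j\<bar>)\<^sup>2 \<le> (1 + \<bar>of_int j\<bar>) powr (real M * e)" by simp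
      qed (use B in auto)
      finally show ?thesis .
    qed
    have "(\<Sum>j\<in>{- half M n..half M n}. b j powr \<theta>) \<le> (\<Sum>j\<in>{- half M n..half M n}. (B * (real n * \<bar>h\<bar>) powr e) * (1 / (1 + 1 * \<bar>of_int j\<bar>)\<^sup>2))"
      by (rule sum_mono[OF summand])
    also have "\<dots> = (B * (real n * \<bar>h\<bar>) powr e) * (\<Sum>j\<in>{- half M n..half M n}. 1 / (1 + 1 * \<bar>of_int j\<bar>)\<^sup>2)"
      by (simp add: sum_distrib_left)
    also have "\<dots> \<le> (B * (real n * \<bar>h\<bar>) powr e) * 4"
      using sum_inverse_square_le[of 1 "(M + 2) * (n + 1)"] B unfolding half_def by (intro mult_left_mono) auto
    finally show ?thesis unfolding b_def t_def by simp
  qed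
  then show ?thesis using B unfolding e_def by (intro exI[of _ "B * 4"]) auto
qed

lemma div_degree_bound: "real (n + 1) \<le> real (M + 1) * real (n div (M + 1) + 1)"
proof -
  have "n = (M + 1) * (n div (M + 1)) + n mod (M + 1)" by (rule mult_div_mod_eq[symmetric])
  moreover have "n mod (M + 1) < M + 1" by (rule mod_less_divisor) simp
  moreover have "(M + 1) * (n div (M + 1) + 1) = (M + 1) * (n div (M + 1)) + (M + 1)" by (simp add: distrib_left)
  ultimately have "n + 1 \<le> (M + 1) * (n div (M + 1) + 1)" by linarith
  then show ?thesis unfolding of_nat_mult[symmetric] of_nat_le_iff .
qed

lemma ker_div_trig: "ker M (n div (M + 1)) \<in> trig_polys n"
proof -
  have "n div (M + 1) + M * (n div (M + 1)) = (M + 1) * (n div (M + 1))" by simp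
  also have "\<dots> \<le> n" by (rule times_div_less_eq_dividend)
  finally show ?thesis
    unfolding trig_polys_eq_tspan by (intro tspan_mono[OF ker_tspan]) (simp_all only: neg_le_iff_le of_nat_le_iff)
qed

lemma dir_size: "real (2 * n + M * n + 1) \<le> real (M + 2) * real (n + 1)"
proof -
  have "2 * n + M * n + 1 \<le> (M + 2) * (n + 1)" by (simp add: algebra_simps)
  then show ?thesis unfolding of_nat_mult[symmetric] of_nat_le_iff .
qed

lemma div_le_nodes: "(M + 2) * (n div (M + 1) + 1) \<le> nodes M n"
proof -
  have "n div (M + 1) \<le> n" by (rule div_le_dividend)
  then have "(M + 2) * (n div (M + 1) + 1) \<le> (M + 2) * (n + 1)" by (intro mult_le_mono2) simp
  then show ?thesis unfolding nodes_def by simp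
qed

text \<open>The weight |l| is the cost of bounding a first difference with step l\<tau> by one with
  step \<tau>, see \<open>Q_rest_op\<close>. The parameter \<open>n div (M + 1)\<close> puts the
  kernel into \<open>trig_polys n\<close>. Three powers of its decay are used, one of them against
  the weight. The constant depends on m, the refinement factor of the lattice.\<close>

lemma averaging_coeffs:
  assumes "0 < \<theta>" "\<theta> \<le> 1" "real M * \<theta> \<ge> 4" "m \<ge> 1"
  shows "\<exists>C>0. \<forall>n R. nodes M n \<le> 2 * R + 1 \<longrightarrow> 2 * R + 1 \<le> m * nodes M n \<longrightarrow>
     (\<Sum>l\<in>{- int R..int R}. (cmod (ker M (n div (M + 1)) (- (of_int l * (2 * pi / real (2 * R + 1))))) / real (2 * R + 1)) powr \<theta> * \<bar>of_int l\<bar>) \<le> C"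
proof -
  define D where "D = real m * real (2 * M + 5) * real (M + 1)"
  have D: "D \<ge> 1"
    using mult_mono[of 1 "real m * real (2 * M + 5)" 1 "real (M + 1)"] mult_mono[of 1 "real m" 1 "real (2 * M + 5)"] assms(4)
    unfolding D_def by simp
  have "(\<Sum>l\<in>{- int R..int R}. (cmod (ker M (n div (M + 1)) (- (of_int l * (2 * pi / real (2 * R + 1))))) / real (2 * R + 1)) powr \<theta> * \<bar>of_int l\<bar>)
      \<le> D powr (real M * \<theta>) * 4"
    if R: "nodes M n \<le> 2 * R + 1" "2 * R + 1 \<le> m * nodes M n" for n R
  proof -
    define N where "N = real (2 * R + 1)"
    have N: "N > 0" unfolding N_def by simp
    define n0 where "n0 = n div (M + 1)"
    have big: "real (2 * n0 + M * n0 + 1) \<le> N"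
      using dir_size[of n0 M] div_le_nodes[of M n] R(1) unfolding N_def n0_def of_nat_mult[symmetric] by linarith
    have N2: "N \<le> D * real (n0 + 1)"
    proof -
      have "N \<le> real m * real (nodes M n)" using R(2) unfolding N_def of_nat_mult[symmetric] of_nat_le_iff .
      also have "\<dots> \<le> real m * (real (2 * M + 5) * (real (M + 1) * real (n0 + 1)))"
        using nodes_le[of M n] div_degree_bound[of n M] unfolding n0_def
        by (intro mult_left_mono order_trans[OF nodes_le] div_degree_bound) auto
      finally show ?thesis unfolding D_def by (simp only: mult.assoc)
    qed
    have summand: "(cmod (ker M n0 (- (of_int l * (2 * pi / N)))) / N) powr \<theta> * \<bar>of_int l\<bar> \<le> D powr (real M * \<theta>) * (1 / (1 + 1 * \<bar>of_int l\<bar>)\<^sup>2)"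
      if l: "l \<in> {- int R..int R}" for l
    proof -
      define x where "x = \<bar>real_of_int l\<bar>"
      define \<phi> where "\<phi> = cmod (fej (n0 + 1) (- (of_int l * (2 * pi / N))))"
      have x0: "x \<ge> 0" unfolding x_def by simp
      have phi0: "\<phi> \<ge> 0" "\<phi> \<le> 1" unfolding \<phi>_def using fej_le_one by auto
      have "2 * x \<le> N" using l unfolding x_def N_def by auto
      then have "\<bar>- (of_int l * (2 * pi / N))\<bar> \<le> pi"
        using N unfolding x_def by (simp add: abs_mult field_simps)
      from fej_decay_pi[OF this, of "n0 + 1"] have "\<phi> * (real (n0 + 1) * (x * (2 * pi / N))) \<le> pi"
        unfolding \<phi>_def x_def using N by (simp add: abs_mult)
      also have "\<phi> * (real (n0 + 1) * (x * (2 * pi / N))) = pi * (2 * (\<phi> * x * real (n0 + 1)) / N)" by simp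
      finally have "pi * (2 * (\<phi> * x * real (n0 + 1)) / N) \<le> pi * 1" by simp
      then have "2 * (\<phi> * x * real (n0 + 1)) / N \<le> 1" by (rule mult_left_le_imp_le) simp
      then have "2 * (\<phi> * x * real (n0 + 1)) \<le> N" using N by (simp add: divide_le_eq_1)
      also have "N \<le> D * real (n0 + 1)" by (rule N2)
      finally have "(2 * (\<phi> * x)) * real (n0 + 1) \<le> D * real (n0 + 1)" by (simp only: mult.assoc)
      then have h: "2 * (\<phi> * x) \<le> D" by (rule mult_right_le_imp_le) simp
      have "\<phi> * (1 + x) \<le> D"
      proof (cases "l = 0")
        case True then show ?thesis using phi0 D unfolding x_def by simp
      next
        case False
        then have "x \<ge> 1" unfolding x_def by linarith
        then have "\<phi> * (1 + x) \<le> \<phi> * (2 * x)" using phi0 by (intro mult_left_mono) auto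
        then show ?thesis using h by simp
      qed
      then have phi: "\<phi> \<le> D / (1 + x)" using x0 by (simp add: pos_le_divide_eq)
      have "cmod (ker M n0 (- (of_int l * (2 * pi / N)))) \<le> N * (D / (1 + x)) ^ M"
      proof (rule order_trans[OF ker_le])
        show "real (2 * n0 + M * n0 + 1) * cmod (fej (n0 + 1) (- (of_int l * (2 * pi / N)))) ^ M \<le> N * (D / (1 + x)) ^ M"
          unfolding \<phi>_def[symmetric] by (rule mult_mono[OF big power_mono[OF phi phi0(1)]]) (use N phi0 in simp_all)
      qed
      then have "cmod (ker M n0 (- (of_int l * (2 * pi / N)))) / N \<le> (D / (1 + x)) ^ M"
        using N by (simp add: pos_divide_le_eq mult.commute)
      then have "(cmod (ker M n0 (- (of_int l * (2 * pi / N)))) / N) powr \<theta> \<le> ((D / (1 + x)) ^ M) powr \<theta>"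
        using assms N by (intro powr_mono2) auto
      also have "\<dots> = D powr (real M * \<theta>) / (1 + x) powr (real M * \<theta>)"
        using D x0 by (simp add: powr_realpow[symmetric] powr_powr powr_divide)
      also have "\<dots> \<le> D powr (real M * \<theta>) / (1 + x) ^ 3"
      proof (intro divide_left_mono)
        have "(1 + x) powr real 3 \<le> (1 + x) powr (real M * \<theta>)"
          using assms x0 by (intro powr_mono) auto
        moreover have "(1 + x) powr real 3 = (1 + x) ^ 3" using x0 by (intro powr_realpow) simp
        ultimately show "(1 + x) ^ 3 \<le> (1 + x) powr (real M * \<theta>)" by simp
      qed (use x0 in auto)
      finally have "(cmod (ker M n0 (- (of_int l * (2 * pi / N)))) / N) powr \<theta> * x \<le> D powr (real M * \<theta>) / (1 + x) ^ 3 * (1 + x)"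
        using x0 by (intro mult_mono) auto
      also have "\<dots> = D powr (real M * \<theta>) * (1 / (1 + 1 * x)\<^sup>2)"
        using x0 by (simp add: power3_eq_cube power2_eq_square)
      finally show ?thesis unfolding x_def .
    qed
    have "(\<Sum>l\<in>{- int R..int R}. (cmod (ker M n0 (- (of_int l * (2 * pi / N)))) / N) powr \<theta> * \<bar>of_int l\<bar>)
       \<le> (\<Sum>l\<in>{- int R..int R}. D powr (real M * \<theta>) * (1 / (1 + 1 * \<bar>of_int l\<bar>)\<^sup>2))"
      by (rule sum_mono[OF summand])
    also have "\<dots> = D powr (real M * \<theta>) * (\<Sum>l\<in>{- int R..int R}. 1 / (1 + 1 * \<bar>of_int l\<bar>)\<^sup>2)"
      by (simp add: sum_distrib_left)
    also have "\<dots> \<le> D powr (real M * \<theta>) * 4"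
      using sum_inverse_square_le[of 1 R] by (intro mult_left_mono) auto
    finally show ?thesis unfolding N_def n0_def .
  qed
  moreover have "D powr (real M * \<theta>) * 4 > 0" using D by simp
  ultimately show ?thesis by blast
qed

text \<open>With M = K + 2, K powers of the decay cancel the moment (1 + n|t|)^K and the other two
  give summability. In contrast to \<open>averaging_coeffs\<close> the constant is uniform in R,
  because \<open>smoothing_operator\<close> chooses R according to the degree of an auxiliary
  polynomial.\<close>

lemma moment_coeffs:
  "\<exists>C>0. \<forall>n R. nodes (K + 2) n \<le> 2 * R + 1 \<longrightarrow>
     (\<Sum>l\<in>{- int R..int R}. (cmod (ker (K + 2) (n div (K + 2 + 1)) (- (of_int l * (2 * pi / real (2 * R + 1))))) / real (2 * R + 1)) * (1 + real n * \<bar>of_int l * (2 * pi / real (2 * R + 1))\<bar>) ^ K) \<le> C"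
proof -
  define M where "M = K + 2"
  define D where "D = real (M + 2) * (1 + pi) ^ M * real (M + 1) ^ K"
  have D: "D > 0" unfolding D_def by (simp add: add_pos_nonneg)
  have "(\<Sum>l\<in>{- int R..int R}. (cmod (ker M (n div (M + 1)) (- (of_int l * (2 * pi / real (2 * R + 1))))) / real (2 * R + 1)) * (1 + real n * \<bar>of_int l * (2 * pi / real (2 * R + 1))\<bar>) ^ K) \<le> D * 4"
    if R: "nodes M n \<le> 2 * R + 1" for n R
  proof -
    define N where "N = real (2 * R + 1)"
    have N: "N > 0" unfolding N_def by simp
    define n0 where "n0 = n div (M + 1)"
    \<comment> \<open>Up to a constant factor this is the lattice spacing in units of the width of
      the kernel; the sum below is a Riemann sum with this mesh.\<close>
    define z where "z = real (n0 + 1) / N"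
    have z: "z > 0" "z \<le> 1"
    proof -
      have "n0 + 1 \<le> (M + 2) * (n0 + 1)" by simp
      then have "n0 + 1 \<le> 2 * R + 1" using div_le_nodes[of M n] R unfolding n0_def by linarith
      then show "z > 0" "z \<le> 1" unfolding z_def N_def by (auto simp: divide_le_eq_1)
    qed
    have summand: "(cmod (ker M n0 (- (of_int l * (2 * pi / N)))) / N) * (1 + real n * \<bar>of_int l * (2 * pi / N)\<bar>) ^ K \<le> D * (z / (1 + z * \<bar>of_int l\<bar>)\<^sup>2)"
      if l: "l \<in> {- int R..int R}" for l
    proof -
      define t where "t = \<bar>of_int l * (2 * pi / N)\<bar>"
      define x where "x = real (n0 + 1) * t"
      define \<phi> where "\<phi> = cmod (fej (n0 + 1) (- (of_int l * (2 * pi / N))))"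
      have t0: "t \<ge> 0" "x \<ge> 0" unfolding t_def x_def by auto
      have phi0: "\<phi> \<ge> 0" "\<phi> \<le> 1" unfolding \<phi>_def using fej_le_one by auto
      have t_eq: "t = \<bar>real_of_int l\<bar> * (2 * pi / N)" unfolding t_def using N by (simp add: abs_mult)
      have "2 * \<bar>real_of_int l\<bar> \<le> N" using l unfolding N_def by auto
      then have "\<bar>- (of_int l * (2 * pi / N))\<bar> \<le> pi"
        using N by (simp add: abs_mult field_simps)
      from fej_decay_pi[OF this, of "n0 + 1"] have "\<phi> * x \<le> pi"
        unfolding \<phi>_def x_def t_def by simp
      then have "\<phi> * (1 + x) \<le> 1 + pi" using phi0 by (simp add: distrib_left)
      then have phi: "\<phi> \<le> (1 + pi) / (1 + x)" using t0 by (simp add: pos_le_divide_eq)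
      have "cmod (ker M n0 (- (of_int l * (2 * pi / N)))) \<le> (real (M + 2) * real (n0 + 1)) * ((1 + pi) / (1 + x)) ^ M"
      proof (rule order_trans[OF ker_le])
        show "real (2 * n0 + M * n0 + 1) * cmod (fej (n0 + 1) (- (of_int l * (2 * pi / N)))) ^ M \<le> (real (M + 2) * real (n0 + 1)) * ((1 + pi) / (1 + x)) ^ M"
          unfolding \<phi>_def[symmetric] by (rule mult_mono[OF dir_size power_mono[OF phi phi0(1)]]) (use phi0 in simp_all)
      qed
      then have "cmod (ker M n0 (- (of_int l * (2 * pi / N)))) / N \<le> (real (M + 2) * real (n0 + 1)) * ((1 + pi) / (1 + x)) ^ M / N"
        using N by (intro divide_right_mono) auto
      also have "\<dots> = real (M + 2) * z * ((1 + pi) / (1 + x)) ^ M" unfolding z_def by simp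
      finally have k: "cmod (ker M n0 (- (of_int l * (2 * pi / N)))) / N \<le> real (M + 2) * z * ((1 + pi) / (1 + x)) ^ M" .
      have nt: "1 + real n * t \<le> real (M + 1) * (1 + x)"
      proof -
        have "real n * t \<le> real (n + 1) * t" using t0 by (intro mult_right_mono) auto
        also have "\<dots> \<le> (real (M + 1) * real (n0 + 1)) * t"
          using div_degree_bound[of n M] t0 unfolding n0_def by (intro mult_right_mono) auto
        also have "\<dots> = real (M + 1) * x" unfolding x_def by simp
        finally have "1 + real n * t \<le> 1 + real (M + 1) * x" by simp
        also have "\<dots> \<le> real (M + 1) * (1 + x)" by (simp add: algebra_simps)
        finally show ?thesis .
      qed
      have "(cmod (ker M n0 (- (of_int l * (2 * pi / N)))) / N) * (1 + real n * t) ^ K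
         \<le> (real (M + 2) * z * ((1 + pi) / (1 + x)) ^ M) * (real (M + 1) * (1 + x)) ^ K"
        using k nt t0 z N by (intro mult_mono power_mono) auto
      also have "\<dots> = D * (z / (1 + x)\<^sup>2)"
      proof -
        have M: "(1 + x) ^ M = (1 + x) ^ K * (1 + x)\<^sup>2" unfolding M_def by (rule power_add)
        have nz: "(1 + x) ^ K \<noteq> 0" using t0 by simp
        have gen: "a * z * (b / (A * B)) * (c * A) = a * b * c * (z / B)" if "A \<noteq> 0" for a b c A B :: real
          using that by simp
        show ?thesis
          unfolding D_def power_divide power_mult_distrib M using nz by (rule gen)
      qed
      also have "\<dots> \<le> D * (z / (1 + z * \<bar>of_int l\<bar>)\<^sup>2)"
      proof (intro mult_left_mono divide_left_mono power_mono)
        have "x = (2 * pi) * (z * \<bar>of_int l\<bar>)" unfolding x_def t_eq z_def by simp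
        moreover have "1 * (z * \<bar>real_of_int l\<bar>) \<le> (2 * pi) * (z * \<bar>of_int l\<bar>)"
          using pi_gt3 z by (intro mult_right_mono) auto
        ultimately show "1 + z * \<bar>real_of_int l\<bar> \<le> 1 + x" by simp
        have "0 < 1 + z * \<bar>real_of_int l\<bar>" using z by (intro add_pos_nonneg) auto
        then show "0 < (1 + x)\<^sup>2 * (1 + z * \<bar>real_of_int l\<bar>)\<^sup>2" "0 \<le> 1 + z * \<bar>real_of_int l\<bar>"
          using t0 by simp_all
      qed (use z D in auto)
      finally show ?thesis unfolding t_def .
    qed
    have "(\<Sum>l\<in>{- int R..int R}. (cmod (ker M n0 (- (of_int l * (2 * pi / N)))) / N) * (1 + real n * \<bar>of_int l * (2 * pi / N)\<bar>) ^ K)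
       \<le> (\<Sum>l\<in>{- int R..int R}. D * (z / (1 + z * \<bar>of_int l\<bar>)\<^sup>2))"
      by (rule sum_mono[OF summand])
    also have "\<dots> = D * (\<Sum>l\<in>{- int R..int R}. z / (1 + z * \<bar>of_int l\<bar>)\<^sup>2)"
      by (simp add: sum_distrib_left)
    also have "\<dots> \<le> D * (2 * (z + 1))"
      using sum_inverse_square_le[of z R] z D by (intro mult_left_mono) auto
    also have "\<dots> \<le> D * 4" using z D by (intro mult_left_mono) auto
    finally show ?thesis unfolding N_def n0_def .
  qed
  moreover have "D * 4 > 0" using D by simp
  ultimately show ?thesis unfolding M_def by blast
qed

section \<open>Differences as polynomials in the shift\<close>

text \<open>The polynomial \<open>P\<close> evaluated at the shift by d. Identities between
  difference operators with commensurable steps become identities in a commutative polynomial ring,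
  where one can factor and divide.\<close>

definition opr :: "real poly \<Rightarrow> real \<Rightarrow> (real \<Rightarrow> complex) \<Rightarrow> real \<Rightarrow> complex" where
  "opr P d f = (\<lambda>x. \<Sum>i\<le>degree P. of_real (coeff P i) * f (x + real i * d))"

lemma opr_eq:
  assumes "degree P \<le> n"
  shows "opr P d f x = (\<Sum>i\<le>n. of_real (coeff P i) * f (x + real i * d))"
  unfolding opr_def using assms
  by (intro sum.mono_neutral_left) (auto simp: coeff_eq_0)

lemma opr_0: "opr 0 d f = (\<lambda>x. 0)"
  by (simp add: opr_def)

lemma opr_pCons: "opr (pCons a P) d f x = of_real a * f x + opr P d f (x + d)"
proof -
  have "opr (pCons a P) d f x = (\<Sum>i\<le>Suc (degree P). of_real (coeff (pCons a P) i) * f (x + real i * d))"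
    by (rule opr_eq) (rule degree_pCons_le)
  also have "\<dots> = of_real a * f x + (\<Sum>i\<le>degree P. of_real (coeff P i) * f (x + real (Suc i) * d))"
    by (subst sum.atMost_Suc_shift) simp
  also have "(\<Sum>i\<le>degree P. of_real (coeff P i) * f (x + real (Suc i) * d)) = opr P d f (x + d)"
    unfolding opr_def by (intro sum.cong refl) (simp add: algebra_simps)
  finally show ?thesis .
qed

lemma opr_add: "opr (P + Q) d f x = opr P d f x + opr Q d f x"
proof -
  define n where "n = max (degree P) (degree Q)"
  have "degree (P + Q) \<le> n" "degree P \<le> n" "degree Q \<le> n"
    unfolding n_def by (auto intro: degree_add_le)
  then show ?thesis by (simp add: opr_eq[where n = n] sum.distrib algebra_simps)
qed

lemma opr_smult: "opr (smult c P) d f x = of_real c * opr P d f x"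
proof -
  have "degree (smult c P) \<le> degree P" by (rule degree_smult_le)
  then show ?thesis by (simp add: opr_eq[where n = "degree P"] sum_distrib_left mult.assoc)
qed

lemma opr_mult: "opr (P * Q) d f x = opr P d (opr Q d f) x"
proof (induction P arbitrary: x)
  case 0
  show ?case by (simp add: opr_0)
next
  case (pCons a P)
  have "opr (pCons a P * Q) d f x = opr (smult a Q + pCons 0 (P * Q)) d f x" by simp
  also have "\<dots> = of_real a * opr Q d f x + opr (P * Q) d f (x + d)"
    unfolding opr_add opr_smult opr_pCons by simp
  finally show ?case unfolding opr_pCons pCons.IH .
qed

lemma fdiff_opr: "fdiff k d f = opr ([:1, -1:] ^ k) d f"
proof
  fix x
  have deg: "degree ([:1, -1:] ^ k :: real poly) \<le> k"
    using degree_power_le[of "[:1, -1:] :: real poly" k] by simp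
  have c: "coeff ([:1, -1:] ^ k :: real poly) i = (-1) ^ i * real (k choose i)" for i
  proof (cases "i \<le> k")
    case True
    then show ?thesis using coeff_linear_poly_power[of i k 1 "-1 :: real"] by simp
  next
    case False
    then have "degree ([:1, -1:] ^ k :: real poly) < i" using deg by simp
    then show ?thesis using False by (simp add: coeff_eq_0 binomial_eq_0)
  qed
  show "fdiff k d f x = opr ([:1, -1:] ^ k) d f x"
    unfolding opr_eq[OF deg] fdiff_def c by (simp add: atLeast0AtMost)
qed

lemma fdiff_0: "fdiff 0 d f = f"
  by (simp add: fdiff_def)

lemma fdiff_1: "fdiff 1 d f x = f x - f (x + d)"
  by (simp add: fdiff_def)

lemma fdiff_add: "fdiff (k + l) d f = fdiff k d (fdiff l d f)"
  unfolding fdiff_opr power_add by (rule ext) (rule opr_mult)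

lemma fdiff_Suc: "fdiff (Suc k) d f = fdiff 1 d (fdiff k d f)"
  using fdiff_add[of 1 k d f] by simp

lemma fdiff_Suc': "fdiff (Suc k) d f = fdiff k d (fdiff 1 d f)"
  using fdiff_add[of k 1 d f] by simp

lemma opr_commute: "opr P d (opr Q e f) = opr Q e (opr P d f)"
proof
  fix x
  have "opr P d (opr Q e f) x = (\<Sum>i\<le>degree P. \<Sum>j\<le>degree Q. of_real (coeff P i) * (of_real (coeff Q j) * f (x + real i * d + real j * e)))"
    unfolding opr_def by (simp add: sum_distrib_left)
  also have "\<dots> = (\<Sum>j\<le>degree Q. \<Sum>i\<le>degree P. of_real (coeff P i) * (of_real (coeff Q j) * f (x + real i * d + real j * e)))"
    by (rule sum.swap)
  also have "\<dots> = opr Q e (opr P d f) x"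
    unfolding opr_def by (simp add: sum_distrib_left algebra_simps)
  finally show "opr P d (opr Q e f) x = opr Q e (opr P d f) x" .
qed

lemma fdiff_commute: "fdiff k d (fdiff l e f) = fdiff l e (fdiff k d f)"
  unfolding fdiff_opr by (rule opr_commute)

lemma fdiff_lincomb:
  "fdiff k d (\<lambda>x. \<Sum>i\<in>I. c i * f i x) = (\<lambda>x. \<Sum>i\<in>I. c i * fdiff k d (f i) x)"
proof
  fix x
  have "fdiff k d (\<lambda>x. \<Sum>i\<in>I. c i * f i x) x = (\<Sum>\<nu>=0..k. \<Sum>i\<in>I. c i * ((- 1) ^ \<nu> * of_nat (k choose \<nu>) * f i (x + real \<nu> * d)))"
    unfolding fdiff_def by (simp add: sum_distrib_left mult.left_commute)
  also have "\<dots> = (\<Sum>i\<in>I. \<Sum>\<nu>=0..k. c i * ((- 1) ^ \<nu> * of_nat (k choose \<nu>) * f i (x + real \<nu> * d)))"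
    by (rule sum.swap)
  finally show "fdiff k d (\<lambda>x. \<Sum>i\<in>I. c i * f i x) x = (\<Sum>i\<in>I. c i * fdiff k d (f i) x)"
    unfolding fdiff_def by (simp add: sum_distrib_left)
qed

lemma fdiff_diff: "fdiff k d (\<lambda>x. f x - g x) = (\<lambda>x. fdiff k d f x - fdiff k d g x)"
  unfolding fdiff_def by (rule ext) (simp only: right_diff_distrib sum_subtractf)

lemma fdiff_shift: "fdiff k d (\<lambda>x. f (x + t)) = (\<lambda>x. fdiff k d f (x + t))"
  unfolding fdiff_def by (rule ext, rule sum.cong[OF refl]) (simp only: add.assoc add.commute add.left_commute)

lemma fdiff_neg: "fdiff k (- d) f = (\<lambda>x. (-1) ^ k * fdiff k d f (x + (- (real k * d))))"
proof (induction k)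
  case 0
  show ?case by (simp add: fdiff_0)
next
  case (Suc k)
  show ?case
  proof
    fix x
    have "fdiff (Suc k) (- d) f x = (-1) ^ k * fdiff k d f (x + - (real k * d)) - (-1) ^ k * fdiff k d f (x + - d + - (real k * d))"
      by (subst fdiff_Suc) (simp only: fdiff_1 Suc)
    also have "\<dots> = (-1) ^ Suc k * (fdiff k d f (x + - (real (Suc k) * d)) - fdiff k d f (x + - (real (Suc k) * d) + d))"
      by (simp add: algebra_simps)
    also have "\<dots> = (-1) ^ Suc k * fdiff (Suc k) d f (x + - (real (Suc k) * d))"
      by (subst fdiff_Suc) (simp only: fdiff_1)
    finally show "fdiff (Suc k) (- d) f x = (-1) ^ Suc k * fdiff (Suc k) d f (x + - (real (Suc k) * d))" .
  qed
qed

lemma fdiff_zero_step: assumes "k \<ge> 1" shows "fdiff k 0 f = (\<lambda>x. 0)"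
proof -
  obtain l where "k = Suc l" using assms by (cases k) auto
  then have "fdiff k 0 f = fdiff 1 0 (fdiff l 0 f)" by (simp only: fdiff_Suc)
  then show ?thesis by (simp only: fun_eq_iff fdiff_1) simp
qed

lemma fdiff_trig: assumes "T \<in> trig_polys n" shows "fdiff k d T \<in> trig_polys n"
  unfolding trig_polys_eq_tspan fdiff_def
  by (rule tspan_sum, rule tspan_scale, rule tspan_shift) (use assms in \<open>simp add: trig_polys_eq_tspan\<close>)

lemma trig_polys_mono: assumes "T \<in> trig_polys n" "n \<le> m" shows "T \<in> trig_polys m"
  unfolding trig_polys_eq_tspan by (rule tspan_mono) (use assms in \<open>auto simp: trig_polys_eq_tspan\<close>)

lemma trig_polys_diff: assumes "T \<in> trig_polys n" "S \<in> trig_polys n" shows "(\<lambda>x. T x - S x) \<in> trig_polys n"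
  using tspan_add[of T "- int n" "int n" "\<lambda>x. (-1) * S x"] tspan_scale[of S "- int n" "int n" "-1"] assms
  unfolding trig_polys_eq_tspan by simp

section \<open>The polynomial (1 - X^l)/(1 - X) and its powers\<close>

definition geo_poly :: "nat \<Rightarrow> real poly" where
  "geo_poly l = (\<Sum>j<l. monom 1 j)"

lemma geo_poly_mult: "[:1, -1:] * geo_poly l = 1 - monom 1 l"
proof (induction l)
  case (Suc l)
  have "[:1, -1:] * geo_poly (Suc l) = [:1, -1:] * geo_poly l + [:1, -1:] * monom 1 l"
    unfolding geo_poly_def by (simp add: distrib_left)
  also have "\<dots> = 1 - monom 1 l + (monom 1 l - monom 1 (Suc l))"
    unfolding Suc by (simp add: monom_Suc)
  finally show ?case by simp
qed (simp add: geo_poly_def)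

lemma opr_monom: "opr (monom 1 l) d f x = f (x + real l * d)"
proof -
  have "opr (monom 1 l) d f x = (\<Sum>i\<le>l. of_real (coeff (monom 1 l) i) * f (x + real i * d))"
    by (rule opr_eq) (simp add: degree_monom_le)
  also have "\<dots> = f (x + real l * d)"
    by (subst sum.remove[of _ l]) (auto intro!: sum.neutral)
  finally show ?thesis .
qed

lemma fdiff_multiple: "fdiff k (real l * d) f = opr ((1 - monom 1 l) ^ k) d f"
proof (induction k)
  case 0
  show ?case by (simp add: fdiff_0 opr_def)
next
  case (Suc k)
  have o1: "opr (1 - monom 1 l) d g = fdiff 1 (real l * d) g" for g
  proof
    fix x
    have "opr (1 - monom 1 l) d g x = opr ([:1:] + smult (-1) (monom 1 l)) d g x"
      by (simp add: one_pCons)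
    also have "\<dots> = fdiff 1 (real l * d) g x"
      unfolding opr_add opr_smult opr_monom fdiff_1 by (simp add: opr_def)
    finally show "opr (1 - monom 1 l) d g x = fdiff 1 (real l * d) g x" .
  qed
  show ?case
    unfolding fdiff_Suc[of k] Suc power_Suc o1[symmetric] by (rule ext) (rule opr_mult[symmetric])
qed

lemma poly_geo_poly: "poly (geo_poly l) 1 = real l"
  unfolding geo_poly_def by (simp add: poly_sum poly_monom)

lemma coeff_geo_poly: "0 \<le> coeff (geo_poly l) i" "coeff (geo_poly l) i \<le> 1"
proof -
  have "coeff (geo_poly l) i = (if i < l then 1 else 0)"
    unfolding geo_poly_def coeff_sum by (auto intro: sum.neutral simp: sum.delta')
  then show "0 \<le> coeff (geo_poly l) i" "coeff (geo_poly l) i \<le> 1" by auto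
qed

lemma coeff_geo_power_nonneg: "0 \<le> coeff (geo_poly l ^ K) i"
proof (induction K arbitrary: i)
  case (Suc K)
  show ?case
    unfolding power_Suc coeff_mult by (intro sum_nonneg mult_nonneg_nonneg coeff_geo_poly Suc)
qed simp

text \<open>One factor has coefficients 0 and 1, and the coefficients of the other K factors add up
  to l^K. The bound is smaller by a factor l than the sum of all coefficients, which the
  \<theta>-sum in \<open>weight_geo_power\<close> exploits.\<close>

lemma coeff_geo_power_le: "coeff (geo_poly l ^ Suc K) i \<le> real l ^ K"
proof -
  define P where "P = geo_poly l ^ K"
  have nn: "0 \<le> coeff P j" for j unfolding P_def by (rule coeff_geo_power_nonneg)
  have "coeff (geo_poly l ^ Suc K) i = (\<Sum>j\<le>i. coeff (geo_poly l) j * coeff P (i - j))"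
    by (simp add: coeff_mult P_def)
  also have "\<dots> \<le> (\<Sum>j\<le>i. coeff P (i - j))"
    using coeff_geo_poly nn by (intro sum_mono mult_left_le_one_le) auto
  also have "\<dots> = (\<Sum>j\<le>i. coeff P j)" by (rule sum.reindex_bij_witness[of _ "\<lambda>j. i - j" "\<lambda>j. i - j"]) auto
  also have "\<dots> \<le> (\<Sum>j\<le>max i (degree P). coeff P j)"
    using nn by (intro sum_mono2) auto
  also have "\<dots> = (\<Sum>j\<le>degree P. coeff P j)"
    by (intro sum.mono_neutral_right) (auto simp: coeff_eq_0)
  also have "\<dots> = poly P 1" by (simp add: poly_altdef)
  also have "\<dots> = real l ^ K" unfolding P_def by (simp add: poly_power poly_geo_poly)
  finally show ?thesis .
qed

lemma degree_geo_power: "degree (geo_poly l ^ K) \<le> K * (l - 1)"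
proof -
  have "degree (geo_poly l) \<le> l - 1"
    unfolding geo_poly_def by (intro degree_sum_le) (auto intro: order_trans[OF degree_monom_le])
  then show ?thesis using degree_power_le[of "geo_poly l" K] by (metis le_trans mult.commute mult_le_mono2)
qed

lemma dyadic_interval:
  fixes x :: real assumes "0 < x" "x \<le> 1"
  shows "\<exists>i. 1 / 2 ^ Suc i < x \<and> x \<le> 1 / 2 ^ i"
proof -
  obtain j where j: "(1/2) ^ j < x" using real_arch_pow_inv[of x "1/2"] assms by auto
  define m where "m = (LEAST j. (1/2) ^ j < x)"
  have m: "(1/2) ^ m < x" unfolding m_def using j by (rule LeastI)
  have "m \<noteq> 0" using m assms by (intro notI) simp
  then obtain i where i: "m = Suc i" by (cases m) auto
  have "\<not> (1/2) ^ i < x" using not_less_Least[of i "\<lambda>j. (1/2) ^ j < x"] i unfolding m_def by simp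
  then show ?thesis using m i by (intro exI[of _ i]) (auto simp: power_one_over)
qed

section \<open>Inequalities in abstract translation-invariant spaces\<close>

text \<open>\<open>Q\<close> stands for \<open>\<parallel>\<cdot>\<parallel>\<^sub>p\<^sup>\<theta>\<close> with \<open>\<theta> = min p 1\<close>.\<close>

locale gauge =
  fixes X :: "(real \<Rightarrow> complex) set" and Q :: "(real \<Rightarrow> complex) \<Rightarrow> real" and \<theta> :: real
  assumes theta_pos: "0 < \<theta>" and theta_le: "\<theta> \<le> 1"
    and X_add: "\<And>f g. f \<in> X \<Longrightarrow> g \<in> X \<Longrightarrow> (\<lambda>x. f x + g x) \<in> X"
    and X_scale: "\<And>f c. f \<in> X \<Longrightarrow> (\<lambda>x. c * f x) \<in> X"
    and X_shift: "\<And>f t. f \<in> X \<Longrightarrow> (\<lambda>x. f (x + t)) \<in> X"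
    and X_trig: "\<And>T n. T \<in> trig_polys n \<Longrightarrow> T \<in> X"
    and Q_nonneg: "\<And>f. 0 \<le> Q f"
    and Q_add: "\<And>f g. f \<in> X \<Longrightarrow> g \<in> X \<Longrightarrow> Q (\<lambda>x. f x + g x) \<le> Q f + Q g"
    and Q_scale: "\<And>f c. f \<in> X \<Longrightarrow> Q (\<lambda>x. c * f x) = cmod c powr \<theta> * Q f"
    and Q_shift: "\<And>f t. f \<in> X \<Longrightarrow> Q (\<lambda>x. f (x + t)) = Q f"
begin

section \<open>Linear combinations, shifts and differences under the gauge\<close>

lemma X_zero: "(\<lambda>x. 0) \<in> X"
  by (rule X_trig[of _ 0]) (simp add: trig_polys_eq_tspan tspan_zero)

lemma Q_zero: "Q (\<lambda>x. 0) = 0"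
  using Q_scale[OF X_zero, of 0] by simp

lemma X_lincomb:
  assumes "\<And>i. i \<in> I \<Longrightarrow> f i \<in> X" shows "(\<lambda>x. \<Sum>i\<in>I. c i * f i x) \<in> X"
  using assms
proof (induction I rule: infinite_finite_induct)
  case (insert i I)
  then have "(\<lambda>x. c i * f i x + (\<Sum>i\<in>I. c i * f i x)) \<in> X"
    by (intro X_add X_scale) auto
  then show ?case using insert.hyps by simp
qed (simp_all add: X_zero)

lemma Q_lincomb:
  assumes "\<And>i. i \<in> I \<Longrightarrow> f i \<in> X"
  shows "Q (\<lambda>x. \<Sum>i\<in>I. c i * f i x) \<le> (\<Sum>i\<in>I. cmod (c i) powr \<theta> * Q (f i))"
  using assms
proof (induction I rule: infinite_finite_induct)
  case (insert i I)
  have "Q (\<lambda>x. c i * f i x + (\<Sum>i\<in>I. c i * f i x)) \<le> Q (\<lambda>x. c i * f i x) + Q (\<lambda>x. \<Sum>i\<in>I. c i * f i x)"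
    using insert.prems by (intro Q_add X_scale X_lincomb) auto
  also have "\<dots> \<le> cmod (c i) powr \<theta> * Q (f i) + (\<Sum>i\<in>I. cmod (c i) powr \<theta> * Q (f i))"
    using insert.prems by (intro add_mono insert.IH) (auto simp: Q_scale)
  finally show ?case using insert.hyps by simp
qed (simp_all add: Q_zero)

lemma Q_shift_comb:
  assumes "f \<in> X"
  shows "Q (\<lambda>x. \<Sum>i\<in>I. c i * f (x + t i)) \<le> (\<Sum>i\<in>I. cmod (c i) powr \<theta>) * Q f"
proof -
  have "Q (\<lambda>x. \<Sum>i\<in>I. c i * (\<lambda>x. f (x + t i)) x) \<le> (\<Sum>i\<in>I. cmod (c i) powr \<theta> * Q (\<lambda>x. f (x + t i)))"
    by (rule Q_lincomb) (rule X_shift[OF assms])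
  then show ?thesis by (simp add: Q_shift[OF assms] sum_distrib_right)
qed

lemma X_shift_comb: "f \<in> X \<Longrightarrow> (\<lambda>x. \<Sum>i\<in>I. c i * f (x + t i)) \<in> X"
  using X_lincomb[of I "\<lambda>i x. f (x + t i)" c] X_shift by simp

lemma X_diff: assumes "f \<in> X" "g \<in> X" shows "(\<lambda>x. f x - g x) \<in> X"
  using X_add[OF assms(1) X_scale[OF assms(2), of "-1"]] by simp

lemma Q_diff: assumes "f \<in> X" "g \<in> X" shows "Q (\<lambda>x. f x - g x) \<le> Q f + Q g"
  using Q_add[OF assms(1) X_scale[OF assms(2), of "-1"]] Q_scale[OF assms(2), of "-1"] by simp

lemma Q_minus_commute: assumes "f \<in> X" "g \<in> X" shows "Q (\<lambda>x. f x - g x) = Q (\<lambda>x. g x - f x)"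
  using Q_scale[OF X_diff[OF assms], of "-1"] by simp

lemma Q_triangle: assumes "f \<in> X" "g \<in> X" "h \<in> X"
  shows "Q (\<lambda>x. f x - h x) \<le> Q (\<lambda>x. f x - g x) + Q (\<lambda>x. g x - h x)"
  using Q_add[OF X_diff[OF assms(1,2)] X_diff[OF assms(2,3)]] by simp

text \<open>An operator bound for \<open>opr P d\<close> with respect to \<open>Q\<close> that is
  uniform in the step d, see \<open>Q_opr\<close>.\<close>

definition weight :: "real poly \<Rightarrow> real" where
  "weight P = (\<Sum>i\<le>degree P. \<bar>coeff P i\<bar> powr \<theta>)"

lemma weight_nonneg: "0 \<le> weight P"
  unfolding weight_def by (intro sum_nonneg) auto

lemma X_opr: "f \<in> X \<Longrightarrow> opr P d f \<in> X"
  unfolding opr_def by (rule X_shift_comb)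

lemma Q_opr: "f \<in> X \<Longrightarrow> Q (opr P d f) \<le> weight P * Q f"
  unfolding opr_def weight_def
  using Q_shift_comb[where f = f and I = "{..degree P}" and c = "\<lambda>i. of_real (coeff P i)" and t = "\<lambda>i. real i * d"] by simp

lemma X_fdiff: "f \<in> X \<Longrightarrow> fdiff k d f \<in> X"
  unfolding fdiff_opr by (rule X_opr)

lemma Q_fdiff_1: assumes "f \<in> X" shows "Q (fdiff 1 d f) \<le> 2 * Q f"
proof -
  have "fdiff 1 d f = (\<lambda>x. f x - f (x + d))" by (rule ext) (rule fdiff_1)
  then show ?thesis using Q_diff[OF assms X_shift[OF assms, of d]] Q_shift[OF assms, of d] by simp
qed

lemma Q_fdiff: assumes "f \<in> X" shows "Q (fdiff k d f) \<le> 2 ^ k * Q f"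
proof (induction k)
  case 0
  show ?case by (simp add: fdiff_0)
next
  case (Suc k)
  have "Q (fdiff (Suc k) d f) \<le> 2 * Q (fdiff k d f)"
    unfolding fdiff_Suc by (rule Q_fdiff_1[OF X_fdiff[OF assms]])
  then show ?case using Suc by simp
qed

lemma Q_fdiff_mono: assumes "f \<in> X" "k \<le> l" shows "Q (fdiff l d f) \<le> 2 ^ (l - k) * Q (fdiff k d f)"
  using Q_fdiff[OF X_fdiff[OF assms(1), of k d], of "l - k" d] fdiff_add[of "l - k" k d f] assms(2) by simp

lemma Q_fdiff_neg: assumes "f \<in> X" shows "Q (fdiff k (- d) f) = Q (fdiff k d f)"
proof -
  have "Q (fdiff k (- d) f) = cmod ((-1) ^ k) powr \<theta> * Q (\<lambda>x. fdiff k d f (x + (- (real k * d))))"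
    unfolding fdiff_neg by (rule Q_scale) (rule X_shift[OF X_fdiff[OF assms]])
  also have "\<dots> = Q (fdiff k d f)"
    by (simp add: Q_shift[OF X_fdiff[OF assms]] norm_power del: add_uminus_conv_diff)
  finally show ?thesis .
qed

lemma Q_fdiff_abs: assumes "f \<in> X" shows "Q (fdiff k \<bar>d\<bar> f) = Q (fdiff k d f)"
  using Q_fdiff_neg[OF assms, of k d] by (cases "d \<ge> 0") auto

lemma Q_fdiff_triangle:
  assumes "f \<in> X" "g \<in> X"
  shows "Q (fdiff k d f) \<le> Q (fdiff k d g) + 2 ^ k * Q (\<lambda>x. f x - g x)"
proof -
  have "fdiff k d f = (\<lambda>x. fdiff k d g x + fdiff k d (\<lambda>x. f x - g x) x)"
    unfolding fdiff_diff by simp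
  then have "Q (fdiff k d f) \<le> Q (fdiff k d g) + Q (fdiff k d (\<lambda>x. f x - g x))"
    using Q_add[OF X_fdiff[OF assms(2), of k d] X_fdiff[OF X_diff[OF assms], of k d]] by simp
  also have "\<dots> \<le> Q (fdiff k d g) + 2 ^ k * Q (\<lambda>x. f x - g x)"
    using Q_fdiff[OF X_diff[OF assms]] by simp
  finally show ?thesis .
qed

section \<open>Dilating the step of a difference, and Marchaud inequalities\<close>

lemma Q_fdiff_multiple_1: assumes "f \<in> X" shows "Q (fdiff 1 (real l * d) f) \<le> real l * Q (fdiff 1 d f)"
proof (induction l)
  case 0
  have "fdiff 1 (real 0 * d) f = (\<lambda>x. 0)" using fdiff_zero_step[of 1 f] by simp
  then show ?case by (simp only: Q_zero)
next
  case (Suc l)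
  have eq: "fdiff 1 (real (Suc l) * d) f = (\<lambda>x. fdiff 1 (real l * d) f x + (fdiff 1 d f) (x + real l * d))"
    by (rule ext) (simp only: fdiff_1, simp add: algebra_simps)
  have "Q (fdiff 1 (real (Suc l) * d) f) \<le> Q (fdiff 1 (real l * d) f) + Q (\<lambda>x. fdiff 1 d f (x + real l * d))"
    unfolding eq by (rule Q_add[OF X_fdiff[OF assms] X_shift[OF X_fdiff[OF assms]]])
  also have "\<dots> = Q (fdiff 1 (real l * d) f) + Q (fdiff 1 d f)"
    using Q_shift[OF X_fdiff[OF assms]] by simp
  finally show ?case using Suc by (simp add: distrib_right)
qed

lemma Q_fdiff_multiple: assumes "f \<in> X" shows "Q (fdiff k (real l * d) f) \<le> real l ^ k * Q (fdiff k d f)"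
  using assms
proof (induction k arbitrary: f)
  case 0
  show ?case by (simp add: fdiff_0)
next
  case (Suc k)
  have "Q (fdiff (Suc k) (real l * d) f) \<le> real l * Q (fdiff 1 d (fdiff k (real l * d) f))"
    unfolding fdiff_Suc by (rule Q_fdiff_multiple_1[OF X_fdiff[OF Suc.prems]])
  also have "\<dots> = real l * Q (fdiff k (real l * d) (fdiff 1 d f))"
    by (simp only: fdiff_commute[of 1])
  also have "\<dots> \<le> real l * (real l ^ k * Q (fdiff k d (fdiff 1 d f)))"
    by (intro mult_left_mono Suc.IH X_fdiff Suc.prems) auto
  finally show ?case by (simp only: fdiff_Suc' power_Suc mult.assoc)
qed

text \<open>There are at most K l coefficients, each at most l^(K-1). For \<theta> < 1 and K > 1 the
  resulting exponent (K - 1)\<theta> + 1 is below the exponent K of \<open>Q_fdiff_multiple\<close>,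
  and it is the origin of the lower bound on k in the theorem.\<close>

lemma weight_geo_power: assumes "K \<ge> 1" "l \<ge> 1"
  shows "weight (geo_poly l ^ K) \<le> real K * real l powr (real (K - 1) * \<theta> + 1)"
proof -
  obtain K' where K: "K = Suc K'" using assms(1) by (cases K) auto
  have "weight (geo_poly l ^ K) \<le> (\<Sum>i\<le>degree (geo_poly l ^ K). (real l ^ K') powr \<theta>)"
    unfolding weight_def K
  proof (rule sum_mono)
    fix i
    have "\<bar>coeff (geo_poly l ^ Suc K') i\<bar> \<le> real l ^ K'"
      using coeff_geo_power_nonneg[of l "Suc K'" i] coeff_geo_power_le[of l K' i] by linarith
    then show "\<bar>coeff (geo_poly l ^ Suc K') i\<bar> powr \<theta> \<le> (real l ^ K') powr \<theta>"
      using theta_pos by (intro powr_mono2) auto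
  qed
  also have "\<dots> = real (degree (geo_poly l ^ K) + 1) * (real l powr (real K' * \<theta>))"
    using assms by (simp add: powr_realpow[symmetric] powr_powr)
  also have "\<dots> \<le> (real K * real l) * (real l powr (real K' * \<theta>))"
  proof (intro mult_right_mono)
    have "degree (geo_poly l ^ K) + 1 \<le> K * (l - 1) + K" using degree_geo_power[of l K] assms by linarith
    also have "\<dots> = K * l" using assms(2) by (simp add: mult_eq_if[of l] algebra_simps)
    finally show "real (degree (geo_poly l ^ K) + 1) \<le> real K * real l"
      unfolding of_nat_mult[symmetric] of_nat_le_iff .
  qed simp
  also have "\<dots> = real K * real l powr (real (K - 1) * \<theta> + 1)"
    using assms unfolding K by (simp add: powr_add)
  finally show ?thesis .
qed

lemma Q_fdiff_scaling: assumes "f \<in> X" "K \<ge> 1" "l \<ge> 1"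
  shows "Q (fdiff K (real l * d) f) \<le> real K * real l powr (real (K - 1) * \<theta> + 1) * Q (fdiff K d f)"
proof -
  have "fdiff K (real l * d) f = opr (geo_poly l ^ K * [:1, -1:] ^ K) d f"
    unfolding fdiff_multiple geo_poly_mult[symmetric] power_mult_distrib by (simp only: mult.commute)
  also have "\<dots> = opr (geo_poly l ^ K) d (fdiff K d f)"
    unfolding fdiff_opr by (rule ext) (rule opr_mult)
  finally have "Q (fdiff K (real l * d) f) \<le> weight (geo_poly l ^ K) * Q (fdiff K d f)"
    using Q_opr[OF X_fdiff[OF assms(1)]] by simp
  also have "\<dots> \<le> real K * real l powr (real (K - 1) * \<theta> + 1) * Q (fdiff K d f)"
    using weight_geo_power[OF assms(2,3)] Q_nonneg by (intro mult_right_mono) auto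
  finally show ?thesis .
qed

text \<open>The polynomial \<open>1 - (geo_poly l / l) ^ i\<close> vanishes at 1 and so contains a
  factor 1 - X. Multiplication by (1 - X)^i then expresses (1 - X)^i as l^(-i) (1 - X^l)^i, whose
  operator bound is small for large l, plus a multiple of (1 - X)^(i+1).\<close>

lemma marchaud_step:
  assumes "i \<ge> 1" "l \<ge> 1"
  shows "\<exists>C\<ge>0. \<forall>v\<in>X. \<forall>h. Q (fdiff i h v) \<le> real l powr (- \<theta>) * 2 ^ i * Q v + C * Q (fdiff (Suc i) h v)"
proof -
  define c where "c = 1 / real l ^ i"
  have l0: "real l > 0" using assms by simp
  have c0: "c \<ge> 0" unfolding c_def by simp
  have "poly (1 - smult c (geo_poly l ^ i)) 1 = 0"
    unfolding c_def using l0 by (simp add: poly_power poly_geo_poly)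
  then have "[:-1, 1:] dvd 1 - smult c (geo_poly l ^ i)" by (rule poly_eq_0_iff_dvd[THEN iffD1])
  then obtain R' where R': "1 - smult c (geo_poly l ^ i) = [:-1, 1:] * R'" by (rule dvdE)
  define R where "R = - R'"
  have R: "1 - smult c (geo_poly l ^ i) = [:1, -1:] * R" unfolding R_def R' by simp
  have eq: "[:1, -1:] ^ i = smult c ((1 - monom 1 l) ^ i) + R * [:1, -1:] ^ Suc i"
  proof -
    have "[:1, -1:] ^ i = smult c (geo_poly l ^ i) * [:1, -1:] ^ i + (1 - smult c (geo_poly l ^ i)) * [:1, -1:] ^ i"
      by (simp add: algebra_simps)
    also have "(1 - smult c (geo_poly l ^ i)) * [:1, -1:] ^ i = R * [:1, -1:] ^ Suc i"
      unfolding R power_Suc by (simp only: mult.commute mult.left_commute)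
    also have "smult c (geo_poly l ^ i) * [:1, -1:] ^ i = smult c ((1 - monom 1 l) ^ i)"
      unfolding geo_poly_mult[symmetric] power_mult_distrib mult_smult_left by (simp only: mult.commute)
    finally show ?thesis .
  qed
  have "Q (fdiff i h v) \<le> real l powr (- \<theta>) * 2 ^ i * Q v + weight R * Q (fdiff (Suc i) h v)" if v: "v \<in> X" for v h
  proof -
    have "fdiff i h v = (\<lambda>x. of_real c * fdiff i (real l * h) v x + opr R h (fdiff (Suc i) h v) x)"
    proof
      fix x
      show "fdiff i h v x = of_real c * fdiff i (real l * h) v x + opr R h (fdiff (Suc i) h v) x"
        by (simp only: fdiff_multiple) (simp only: fdiff_opr eq[of] opr_add opr_smult opr_mult[symmetric])
    qed
    then have "Q (fdiff i h v) \<le> Q (\<lambda>x. of_real c * fdiff i (real l * h) v x) + Q (opr R h (fdiff (Suc i) h v))"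
      using Q_add[OF X_scale[OF X_fdiff[OF v]] X_opr[OF X_fdiff[OF v]]] by simp
    also have "\<dots> \<le> c powr \<theta> * (2 ^ i * Q v) + weight R * Q (fdiff (Suc i) h v)"
      using l0 unfolding Q_scale[OF X_fdiff[OF v]]
      by (intro add_mono mult_mono Q_fdiff Q_opr X_fdiff v) (auto simp: c0 Q_nonneg)
    also have "\<dots> \<le> real l powr (- \<theta>) * (2 ^ i * Q v) + weight R * Q (fdiff (Suc i) h v)"
    proof (intro add_right_mono mult_right_mono)
      have "real l ^ 1 \<le> real l ^ i" using assms by (intro power_increasing) auto
      then have "c \<le> 1 / real l" unfolding c_def using l0 by (intro divide_left_mono) auto
      then have "c powr \<theta> \<le> (1 / real l) powr \<theta>" using theta_pos l0 by (intro powr_mono2) (auto simp: c_def)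
      also have "\<dots> = real l powr (- \<theta>)" using l0 by (simp add: powr_divide powr_minus_divide)
      finally show "c powr \<theta> \<le> real l powr (- \<theta>)" .
    qed (simp add: Q_nonneg)
    finally show ?thesis by (simp add: mult.assoc)
  qed
  then show ?thesis using weight_nonneg by blast
qed

text \<open>A Marchaud inequality without integrals: instead of a sum over scales, an arbitrarily
  small multiple of \<open>Q v\<close> is tolerated, which later is either absorbed or sent to zero.
  In the induction l is so large that the coefficient of \<open>Q v\<close> in
  \<open>marchaud_step\<close>, multiplied by the constant already present, is at most
  \<epsilon>/2.\<close>

lemma marchaud:
  assumes "i \<ge> 1" "\<epsilon> > 0"
  shows "\<exists>C\<ge>0. \<forall>v\<in>X. \<forall>h. Q (fdiff 1 h v) \<le> \<epsilon> * Q v + C * Q (fdiff i h v)"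
  using assms
proof (induction i arbitrary: \<epsilon> rule: nat_induct_at_least)
  case base
  then show ?case using Q_nonneg by (intro exI[of _ 1]) auto
next
  case (Suc i)
  obtain C where C: "C \<ge> 0" "\<And>v h. v \<in> X \<Longrightarrow> Q (fdiff 1 h v) \<le> \<epsilon> / 2 * Q v + C * Q (fdiff i h v)"
    using Suc.IH[of "\<epsilon> / 2"] Suc.prems by auto
  have "((\<lambda>l. C * 2 ^ i * real l powr (- \<theta>)) \<longlongrightarrow> C * 2 ^ i * 0) sequentially"
    using theta_pos by (intro tendsto_intros tendsto_neg_powr filterlim_real_sequentially) auto
  then have "\<forall>\<^sub>F l in sequentially. C * 2 ^ i * real l powr (- \<theta>) < \<epsilon> / 2"
    using Suc.prems by (intro order_tendstoD) auto
  then obtain l0 where "\<And>l. l \<ge> l0 \<Longrightarrow> C * 2 ^ i * real l powr (- \<theta>) < \<epsilon> / 2"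
    unfolding eventually_sequentially by blast
  then obtain l where l: "l \<ge> 1" "C * 2 ^ i * real l powr (- \<theta>) \<le> \<epsilon> / 2"
    using less_imp_le by (meson max.cobounded1 max.cobounded2)
  obtain B where B: "B \<ge> 0" "\<And>v h. v \<in> X \<Longrightarrow> Q (fdiff i h v) \<le> real l powr (- \<theta>) * 2 ^ i * Q v + B * Q (fdiff (Suc i) h v)"
    using marchaud_step[OF Suc.hyps l(1)] by blast
  have "Q (fdiff 1 h v) \<le> \<epsilon> * Q v + C * B * Q (fdiff (Suc i) h v)" if v: "v \<in> X" for v h
  proof -
    have "Q (fdiff 1 h v) \<le> \<epsilon> / 2 * Q v + C * (real l powr (- \<theta>) * 2 ^ i * Q v + B * Q (fdiff (Suc i) h v))"
      using C(2)[OF v, of h] mult_left_mono[OF B(2)[OF v, of h] C(1)] by linarith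
    also have "\<dots> = \<epsilon> / 2 * Q v + (C * 2 ^ i * real l powr (- \<theta>)) * Q v + C * B * Q (fdiff (Suc i) h v)"
      by (simp add: algebra_simps)
    also have "\<dots> \<le> \<epsilon> / 2 * Q v + (\<epsilon> / 2) * Q v + C * B * Q (fdiff (Suc i) h v)"
      using mult_right_mono[OF l(2) Q_nonneg[of v]] by simp
    finally show ?thesis by simp
  qed
  then show ?case using C(1) B(1) by (intro exI[of _ "C * B"]) auto
qed

text \<open>\<open>ker_reproduce\<close> with offsets 0 and h uses the same samples of T, so the
  difference is a combination of shifts of T. The exponent \<theta>/2 in place of the sharp \<theta>
  is the price of \<open>weak_bernstein_coeffs\<close>; what counts is that it is positive and makes
  differences small for h much below 1/n.\<close>

lemma weak_bernstein:
  assumes "real M * \<theta> \<ge> 4"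
  shows "\<exists>C>0. \<forall>n h. \<bar>h\<bar> \<le> 2 * pi / real (nodes M n) \<longrightarrow>
    (\<forall>T\<in>trig_polys n. Q (fdiff 1 h T) \<le> C * (real n * \<bar>h\<bar>) powr (\<theta> / 2) * Q T)"
proof -
  obtain C where C: "C > 0" "\<And>n h. \<bar>h\<bar> \<le> 2 * pi / real (nodes M n) \<Longrightarrow>
    (\<Sum>j\<in>{- half M n..half M n}. cmod ((ker M n (of_int j * (2 * pi / real (nodes M n)) + h) - ker M n (of_int j * (2 * pi / real (nodes M n)))) / of_nat (nodes M n)) powr \<theta>)
      \<le> C * (real n * \<bar>h\<bar>) powr (\<theta> / 2)"
    using weak_bernstein_coeffs[OF theta_pos theta_le assms] by blast
  have "Q (fdiff 1 h T) \<le> C * (real n * \<bar>h\<bar>) powr (\<theta> / 2) * Q T"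
    if h: "\<bar>h\<bar> \<le> 2 * pi / real (nodes M n)" and T: "T \<in> trig_polys n" for n h T
  proof -
    define \<tau> where "\<tau> = 2 * pi / real (nodes M n)"
    define b where "b j = (ker M n (of_int j * \<tau> + h) - ker M n (of_int j * \<tau>)) / of_nat (nodes M n)" for j
    have "fdiff 1 h T = (\<lambda>x. \<Sum>j\<in>{- half M n..half M n}. (- b j) * T (x + (- (of_int j * \<tau>))))"
    proof
      fix x
      have "T (x + h') = (\<Sum>j\<in>{- half M n..half M n}. ker M n (of_int j * \<tau> + h') / of_nat (nodes M n) * T (x - of_int j * \<tau>))" for h'
        unfolding \<tau>_def half_interval by (rule ker_reproduce[OF T nodes_gt])
      from this[of 0] this[of h]
      show "fdiff 1 h T x = (\<Sum>j\<in>{- half M n..half M n}. (- b j) * T (x + (- (of_int j * \<tau>))))"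
        unfolding fdiff_1 b_def by (simp add: sum_subtractf[symmetric] algebra_simps diff_divide_distrib)
    qed
    then have "Q (fdiff 1 h T) \<le> (\<Sum>j\<in>{- half M n..half M n}. cmod (- b j) powr \<theta>) * Q T"
      using Q_shift_comb[OF X_trig[OF T], where I = "{- half M n..half M n}" and c = "\<lambda>j. - b j" and t = "\<lambda>j. - (of_int j * \<tau>)"] by simp
    also have "\<dots> \<le> (C * (real n * \<bar>h\<bar>) powr (\<theta> / 2)) * Q T"
      using C(2)[OF h] Q_nonneg unfolding b_def \<tau>_def norm_minus_cancel by (intro mult_right_mono)
    finally show ?thesis .
  qed
  then show ?thesis using C(1) by blast
qed

lemma geometric_partial_le: assumes "0 \<le> (q::real)" "q < 1" shows "(\<Sum>l<n. q ^ l) \<le> 1 / (1 - q)"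
  using assms by (simp add: sum_gp_strict divide_right_mono)

text \<open>
  The weak inequality makes \<open>\<Delta>\<^sub>h\<close> small on differences of polynomials, so \<open>2 \<Delta>\<^sub>h = \<Delta>\<^sub>2\<^sub>h + \<Delta>\<^sub>h\<^sup>2\<close> gives
  \<open>Q(\<Delta>\<^sub>h T) \<le> 2\<^bsup>-\<theta>\<^esup> (1 + o(1)) Q(\<Delta>\<^sub>2\<^sub>h T)\<close>, which is iterated along dyadic steps.
\<close>

lemma bernstein:
  "\<exists>c C. 0 < c \<and> c < 1 \<and> 0 < C \<and> (\<forall>n T h. n \<ge> 1 \<longrightarrow> T \<in> trig_polys n \<longrightarrow> 0 < h \<longrightarrow> h \<le> 1 / real n \<longrightarrow>
     Q (fdiff 1 h T) \<le> C * (real n * h) powr \<theta> * Q (fdiff 1 (c / real n) T))"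
proof -
  obtain M :: nat where M: "real M * \<theta> \<ge> 4"
  proof -
    obtain M :: nat where "real M \<ge> 4 / \<theta>" using real_arch_simple by blast
    then show ?thesis using that[of M] theta_pos by (simp add: pos_divide_le_eq)
  qed
  obtain A where A: "A > 0" and wb: "\<And>n h T. \<bar>h\<bar> \<le> 2 * pi / real (nodes M n) \<Longrightarrow> T \<in> trig_polys n \<Longrightarrow>
       Q (fdiff 1 h T) \<le> A * (real n * \<bar>h\<bar>) powr (\<theta> / 2) * Q T"
    using weak_bernstein[OF M] by blast
  \<comment> \<open>The first entry keeps c/n below the node spacing required by \<open>wb\<close>,
    the second makes \<open>A * c powr (\<theta> / 2)\<close> at most 1/2.\<close>
  define c where "c = min (1 / real (2 * M + 5)) ((1 / (2 * A)) powr (2 / \<theta>))"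
  have c0: "c > 0" unfolding c_def using A by simp
  have "1 / real (2 * M + 5) < 1" by simp
  then have c1: "c < 1" unfolding c_def by linarith
  have cA: "A * c powr (\<theta> / 2) \<le> 1 / 2"
  proof -
    have "c powr (\<theta> / 2) \<le> ((1 / (2 * A)) powr (2 / \<theta>)) powr (\<theta> / 2)"
      using theta_pos c0 by (intro powr_mono2) (auto simp: c_def)
    also have "\<dots> = 1 / (2 * A)" using theta_pos A by (simp add: powr_powr)
    finally have "A * c powr (\<theta> / 2) \<le> A * (1 / (2 * A))" using A by (intro mult_left_mono) auto
    then show ?thesis using A by simp
  qed
  define q where "q = (2::real) powr (- \<theta>)"
  define \<rho> where "\<rho> = (2::real) powr (- \<theta> / 2)"
  have q: "0 < q" "q < 1" unfolding q_def using theta_pos by (auto simp: powr_less_one)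
  have rho: "0 < \<rho>" "\<rho> < 1" unfolding \<rho>_def using theta_pos by (auto simp: powr_less_one)
  define E where "E = exp (1 / (1 - \<rho>))"
  have E: "E \<ge> 1" unfolding E_def using rho by simp
  define J where "J = nat \<lceil>1 / c\<rceil>"
  have J: "real J \<ge> 1 / c" unfolding J_def by linarith
  then have J0: "real J > 0" using c0 by (smt (verit) divide_pos_pos)
  define C where "C = real J * (E / (1 - q)) * (1 / c) powr \<theta>"
  have C0: "C > 0" unfolding C_def using J0 E q c0 by simp
  have main: "Q (fdiff 1 h T) \<le> C * (real n * h) powr \<theta> * Q (fdiff 1 (c / real n) T)"
    if n: "n \<ge> 1" and T: "T \<in> trig_polys n" and h: "0 < h" "h \<le> 1 / real n" for n T h
  proof -
    have n0: "real n > 0" using n by simp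
    define \<eta> where "\<eta> = c / real n"
    have eta0: "\<eta> > 0" unfolding \<eta>_def using c0 n0 by simp
    define D where "D h = Q (fdiff 1 h T)" for h
    have D0: "D h \<ge> 0" for h unfolding D_def by (rule Q_nonneg)
    have TX: "T \<in> X" by (rule X_trig[OF T])
    have eta_nodes: "\<eta> \<le> 2 * pi / real (nodes M n)"
    proof -
      have "real (nodes M n) \<le> real (2 * M + 5) * real (n + 1)" by (rule nodes_le)
      also have "\<dots> \<le> real (2 * M + 5) * (2 * real n)" using n by (intro mult_left_mono) auto
      finally have a: "real (nodes M n) \<le> real (2 * M + 5) * (2 * real n)" .
      have "\<eta> \<le> 1 / (real (2 * M + 5) * real n)"
        unfolding \<eta>_def using n0 by (simp add: c_def divide_right_mono divide_divide_eq_left[symmetric] del: divide_divide_eq_left)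
      also have "\<dots> = 2 / (real (2 * M + 5) * (2 * real n))" by simp
      also have "\<dots> \<le> 2 / real (nodes M n)" using a nodes_pos n0 by (intro divide_left_mono mult_pos_pos) auto
      also have "\<dots> \<le> 2 * pi / real (nodes M n)" using pi_gt3 by (intro divide_right_mono) auto
      finally show ?thesis .
    qed
    have wb': "Q (fdiff 1 h U) \<le> (\<rho> ^ i / 2) * Q U" if "0 \<le> h" "h \<le> \<eta> / 2 ^ i" "U \<in> trig_polys n" for h i U
    proof -
      have le: "h \<le> \<eta>" using that(2) eta0 by (smt (verit, best) divide_le_eq_1 one_le_power divide_less_eq mult_le_cancel_left1)
      have "Q (fdiff 1 h U) \<le> A * (real n * \<bar>h\<bar>) powr (\<theta> / 2) * Q U"
        using that le eta_nodes by (intro wb) auto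
      also have "\<dots> \<le> (\<rho> ^ i / 2) * Q U"
      proof (intro mult_right_mono Q_nonneg)
        have "real n * \<bar>h\<bar> \<le> real n * (\<eta> / 2 ^ i)" using that n0 by (intro mult_left_mono) auto
        also have "\<dots> = c / 2 ^ i" unfolding \<eta>_def using n0 by simp
        finally have "(real n * \<bar>h\<bar>) powr (\<theta> / 2) \<le> (c / 2 ^ i) powr (\<theta> / 2)"
          using theta_pos n0 by (intro powr_mono2) auto
        also have "\<dots> = c powr (\<theta> / 2) * \<rho> ^ i"
          unfolding \<rho>_def using c0 by (simp add: powr_divide powr_powr powr_realpow[symmetric] powr_minus_divide mult.commute)
        finally have "A * (real n * \<bar>h\<bar>) powr (\<theta> / 2) \<le> A * (c powr (\<theta> / 2) * \<rho> ^ i)"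
          using A by (intro mult_left_mono) auto
        also have "\<dots> = (A * c powr (\<theta> / 2)) * \<rho> ^ i" by simp
        also have "\<dots> \<le> 1 / 2 * \<rho> ^ i" using cA rho by (intro mult_right_mono) auto
        finally show "A * (real n * \<bar>h\<bar>) powr (\<theta> / 2) \<le> \<rho> ^ i / 2" by simp
      qed
      finally show ?thesis .
    qed
    have dbl: "2 powr \<theta> * D h \<le> D (2 * h) + Q (fdiff 1 h (fdiff 1 h T))" for h
    proof -
      have eq: "(\<lambda>x. 2 * fdiff 1 h T x) = (\<lambda>x. fdiff 1 (2 * h) T x + fdiff 1 h (fdiff 1 h T) x)"
        by (rule ext) (simp only: fdiff_1, simp add: algebra_simps)
      have "2 powr \<theta> * D h = Q (\<lambda>x. 2 * fdiff 1 h T x)"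
        unfolding D_def by (subst Q_scale[OF X_fdiff[OF TX]]) simp
      also have "\<dots> \<le> D (2 * h) + Q (fdiff 1 h (fdiff 1 h T))"
        unfolding eq D_def by (rule Q_add[OF X_fdiff[OF TX] X_fdiff[OF X_fdiff[OF TX]]])
      finally show ?thesis .
    qed
    have step: "D (\<eta> / 2 ^ Suc i) \<le> q * exp (\<rho> ^ Suc i) * D (\<eta> / 2 ^ i)" for i
    proof -
      define x where "x = \<rho> ^ Suc i / 2"
      have x: "0 \<le> x" "x \<le> 1 / 2" unfolding x_def using rho power_le_one[of \<rho> "Suc i"] by auto
      define B where "B = D (\<eta> / 2 ^ Suc i)"
      have B0: "B \<ge> 0" unfolding B_def by (rule D0)
      have "Q (fdiff 1 (\<eta> / 2 ^ Suc i) (fdiff 1 (\<eta> / 2 ^ Suc i) T)) \<le> x * B"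
        unfolding x_def B_def D_def using eta0 by (intro wb' fdiff_trig T) auto
      then have "2 powr \<theta> * B \<le> D (\<eta> / 2 ^ i) + x * B"
        using dbl[of "\<eta> / 2 ^ Suc i"] unfolding B_def by simp
      moreover have "1 * (x * B) \<le> 2 powr \<theta> * (x * B)"
        using x B0 theta_pos by (intro mult_right_mono ge_one_powr_ge_zero) auto
      ultimately have a: "2 powr \<theta> * ((1 - x) * B) \<le> D (\<eta> / 2 ^ i)" by (simp add: algebra_simps)
      \<comment> \<open>For 0 \<le> x \<le> 1/2 this bounds 1/(1 - x) by exp(2x). Since 2x =
        \<rho>^(i+1), the product of these factors over all levels stays below
        \<open>E\<close>.\<close>
      have "1 \<le> (1 - x) * (1 + 2 * x)" using x mult_left_mono[of "2 * x" 1 x] by (simp add: algebra_simps)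
      also have "\<dots> \<le> (1 - x) * exp (2 * x)" using x exp_ge_add_one_self[of "2 * x"] by (intro mult_left_mono) auto
      finally have "1 * (2 powr \<theta> * B) \<le> ((1 - x) * exp (2 * x)) * (2 powr \<theta> * B)"
        using B0 by (intro mult_right_mono) auto
      also have "\<dots> = exp (2 * x) * (2 powr \<theta> * ((1 - x) * B))" by simp
      also have "\<dots> \<le> exp (2 * x) * D (\<eta> / 2 ^ i)" using a by (intro mult_left_mono) auto
      finally have "q * (2 powr \<theta> * B) \<le> q * (exp (2 * x) * D (\<eta> / 2 ^ i))" using q by (intro mult_left_mono) auto
      moreover have "q * (2 powr \<theta> * B) = B" unfolding q_def by (simp add: powr_minus)
      ultimately have "B \<le> q * (exp (2 * x) * D (\<eta> / 2 ^ i))" by (simp only:)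
      moreover have "2 * x = \<rho> ^ Suc i" unfolding x_def by simp
      ultimately show ?thesis unfolding B_def by (simp only: mult.assoc)
    qed
    have geo: "D (\<eta> / 2 ^ i) \<le> q ^ i * exp (\<Sum>l<i. \<rho> ^ Suc l) * D \<eta>" for i
    proof (induction i)
      case (Suc i)
      have "D (\<eta> / 2 ^ Suc i) \<le> q * exp (\<rho> ^ Suc i) * (q ^ i * exp (\<Sum>l<i. \<rho> ^ Suc l) * D \<eta>)"
        by (rule order_trans[OF step], rule mult_left_mono[OF Suc]) (use q in auto)
      then show ?case by (simp add: exp_add mult.left_commute mult.commute mult.assoc)
    qed simp
    have sumrho: "(\<Sum>l<i. \<rho> ^ Suc l) \<le> 1 / (1 - \<rho>)" for i
    proof -
      have "(\<Sum>l<i. \<rho> ^ Suc l) \<le> (\<Sum>l<i. \<rho> ^ l)" using rho by (intro sum_mono power_decreasing) auto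
      then show ?thesis using geometric_partial_le[of \<rho> i] rho by linarith
    qed
    have geoE: "D (\<eta> / 2 ^ i) \<le> E * q ^ i * D \<eta>" for i
    proof -
      have "q ^ i * exp (\<Sum>l<i. \<rho> ^ Suc l) * D \<eta> \<le> q ^ i * E * D \<eta>"
        unfolding E_def using q sumrho[of i] D0 by (intro mult_right_mono mult_left_mono) auto
      with geo[of i] show ?thesis by (simp add: mult.commute)
    qed
    \<comment> \<open>Binary expansion of h relative to \<eta>: at each level the dyadic step is
      either skipped or split off and charged by \<open>geoE\<close>. The remainder after I digits
      is handled by the weak inequality \<open>wb'\<close> with a factor \<rho>^(i+I), which
      vanishes as I grows; so the weak exponent disappears in the limit taken in
      \<open>fine\<close>.\<close>
    have bin: "D h \<le> E * D \<eta> * (\<Sum>l<I. q ^ (Suc i + l)) + \<rho> ^ (i + I) / 2 * Q T"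
      if "0 \<le> h" "h \<le> \<eta> / 2 ^ i" for I i h
      using that
    proof (induction I arbitrary: i h)
      case 0
      then show ?case using wb'[OF 0(1,2) T] unfolding D_def by simp
    next
      case (Suc I)
      have shift: "(\<Sum>l<Suc I. q ^ (Suc i + l)) = q ^ Suc i + (\<Sum>l<I. q ^ (Suc (Suc i) + l))"
        by (subst sum.lessThan_Suc_shift) simp
      have nn: "0 \<le> E * D \<eta> * q ^ Suc i" using E q D0 by simp
      show ?case
      proof (cases "h \<le> \<eta> / 2 ^ Suc i")
        case True
        from Suc.IH[OF Suc.prems(1) this] show ?thesis unfolding shift using nn by (simp add: distrib_left)
      next
        case False
        define h' where "h' = h - \<eta> / 2 ^ Suc i"
        have h': "0 \<le> h'" "h' \<le> \<eta> / 2 ^ Suc i" using False Suc.prems unfolding h'_def by (auto simp: field_simps)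
        have eq: "fdiff 1 h T = (\<lambda>x. fdiff 1 (\<eta> / 2 ^ Suc i) T x + fdiff 1 h' T (x + \<eta> / 2 ^ Suc i))"
          unfolding h'_def by (rule ext) (simp only: fdiff_1, simp add: algebra_simps)
        have "D h \<le> D (\<eta> / 2 ^ Suc i) + Q (\<lambda>x. fdiff 1 h' T (x + \<eta> / 2 ^ Suc i))"
          unfolding D_def eq by (rule Q_add[OF X_fdiff[OF TX] X_shift[OF X_fdiff[OF TX]]])
        also have "Q (\<lambda>x. fdiff 1 h' T (x + \<eta> / 2 ^ Suc i)) = D h'"
          unfolding D_def by (rule Q_shift[OF X_fdiff[OF TX]])
        also have "D (\<eta> / 2 ^ Suc i) + D h' \<le> E * q ^ Suc i * D \<eta> + (E * D \<eta> * (\<Sum>l<I. q ^ (Suc (Suc i) + l)) + \<rho> ^ (Suc i + I) / 2 * Q T)"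
          by (intro add_mono geoE Suc.IH h')
        finally show ?thesis unfolding shift by (simp add: distrib_left mult_ac)
      qed
    qed
    have fine: "D h \<le> E / (1 - q) * (h / \<eta>) powr \<theta> * D \<eta>" if h: "0 < h" "h \<le> \<eta>" for h
    proof -
      obtain i where i: "1 / 2 ^ Suc i < h / \<eta>" "h / \<eta> \<le> 1 / 2 ^ i"
        using dyadic_interval[of "h / \<eta>"] h eta0 by auto
      have hi: "h \<le> \<eta> / 2 ^ i" using i(2) eta0 by (simp add: field_simps)
      have le: "D h \<le> E * D \<eta> * (q ^ Suc i / (1 - q)) + \<rho> ^ i / 2 * Q T * \<rho> ^ I" for I
      proof -
        have "(\<Sum>l<I. q ^ (Suc i + l)) = q ^ Suc i * (\<Sum>l<I. q ^ l)" unfolding power_add by (rule sum_distrib_left[symmetric])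
        also have "\<dots> \<le> q ^ Suc i * (1 / (1 - q))" using q geometric_partial_le[of q I] by (intro mult_left_mono) auto
        finally have "E * D \<eta> * (\<Sum>l<I. q ^ (Suc i + l)) \<le> E * D \<eta> * (q ^ Suc i / (1 - q))"
          using E D0 by (intro mult_left_mono) auto
        moreover have "\<rho> ^ (i + I) / 2 * Q T = \<rho> ^ i / 2 * Q T * \<rho> ^ I" by (simp add: power_add)
        ultimately show ?thesis using bin[of h i I] h hi by linarith
      qed
      have "(\<lambda>I. E * D \<eta> * (q ^ Suc i / (1 - q)) + \<rho> ^ i / 2 * Q T * \<rho> ^ I) \<longlonglongrightarrow> E * D \<eta> * (q ^ Suc i / (1 - q)) + \<rho> ^ i / 2 * Q T * 0"
        using rho by (intro tendsto_intros LIMSEQ_realpow_zero) auto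
      from LIMSEQ_le_const[OF this] have "D h \<le> E * D \<eta> * (q ^ Suc i / (1 - q))" using le by simp
      also have "\<dots> = E / (1 - q) * q ^ Suc i * D \<eta>" by simp
      also have "\<dots> \<le> E / (1 - q) * (h / \<eta>) powr \<theta> * D \<eta>"
      proof (intro mult_right_mono mult_left_mono D0)
        have "q ^ Suc i = (1 / 2 ^ Suc i) powr \<theta>"
        proof -
          have "(1 / 2 ^ Suc i) powr \<theta> = (((1 / 2) :: real) powr real (Suc i)) powr \<theta>"
            by (subst powr_realpow) (simp_all add: power_one_over)
          also have "\<dots> = ((1 / 2) powr \<theta>) powr real (Suc i)" by (simp only: powr_powr mult.commute)
          also have "\<dots> = q powr real (Suc i)" unfolding q_def by (simp add: powr_divide powr_minus_divide)
          also have "\<dots> = q ^ Suc i" using q by (intro powr_realpow)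
          finally show ?thesis by simp
        qed
        also have "\<dots> \<le> (h / \<eta>) powr \<theta>" using i(1) theta_pos by (intro powr_mono2) auto
        finally show "q ^ Suc i \<le> (h / \<eta>) powr \<theta>" .
      qed (use E q in auto)
      finally show ?thesis .
    qed
    \<comment> \<open>Division by \<open>J\<close>, which is at least 1/c, moves h from the range up
      to 1/n into the range up to \<eta> = c/n covered by \<open>fine\<close>.\<close>
    define h' where "h' = h / real J"
    have h'0: "h' > 0" unfolding h'_def using h J0 by simp
    have "1 \<le> c * real J" using J c0 by (simp add: pos_divide_le_eq mult.commute)
    then have "1 / real n \<le> c * real J / real n" using n0 by (intro divide_right_mono) auto
    then have h'1: "h' \<le> \<eta>" unfolding h'_def \<eta>_def using h(2) J0 by (simp add: pos_divide_le_eq)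
    have "D h = D (real J * h')" unfolding h'_def using J0 by simp
    also have "\<dots> \<le> real J * D h'" unfolding D_def by (rule Q_fdiff_multiple_1[OF TX])
    also have "\<dots> \<le> real J * (E / (1 - q) * (h' / \<eta>) powr \<theta> * D \<eta>)"
      using fine[OF h'0 h'1] by (intro mult_left_mono) auto
    also have "\<dots> \<le> real J * (E / (1 - q) * ((1 / c) * (real n * h)) powr \<theta> * D \<eta>)"
    proof (intro mult_left_mono mult_right_mono D0 powr_mono2)
      have "real J \<ge> 1" using J0 by simp
      then have "h' \<le> h" unfolding h'_def using h J0 by (simp add: divide_le_eq mult_le_cancel_left1)
      then have "h' / \<eta> \<le> h / \<eta>" using eta0 by (intro divide_right_mono) auto
      also have "\<dots> = (1 / c) * (real n * h)" unfolding \<eta>_def using n0 c0 by (simp add: field_simps)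
      finally show "h' / \<eta> \<le> (1 / c) * (real n * h)" .
    qed (use theta_pos h'0 eta0 E q in auto)
    also have "\<dots> = C * (real n * h) powr \<theta> * D \<eta>"
      unfolding C_def powr_mult[of "1 / c" "real n * h"] by (simp only: mult.assoc)
    finally show ?thesis unfolding D_def \<eta>_def .
  qed
  then show ?thesis using c0 c1 C0 by blast
qed

text \<open>The right-hand side keeps a difference of T with the fixed step c/n instead of
  \<open>Q T\<close>. Such a difference can be traded for one of f, and c < 1 puts its step strictly
  below 1/n, inside the open range over which moduli are taken. The factors are collected one
  difference at a time, since differences commute.\<close>

lemma bernstein_mixed:
  "\<exists>c C. 0 < c \<and> c < 1 \<and> 0 < C \<and> (\<forall>k r n T h d. n \<ge> 1 \<longrightarrow> T \<in> trig_polys n \<longrightarrow> 0 < h \<longrightarrow> h \<le> 1 / real n \<longrightarrow> 0 < d \<longrightarrow> d \<le> 1 / real n \<longrightarrow>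
     Q (fdiff k d (fdiff r h T)) \<le> (C * (real n * d) powr \<theta>) ^ k * (C * (real n * h) powr \<theta>) ^ r * Q (fdiff (k + r) (c / real n) T))"
proof -
  obtain c C where c: "0 < c" "c < 1" and C: "0 < C" and b: "\<And>n T h. n \<ge> 1 \<Longrightarrow> T \<in> trig_polys n \<Longrightarrow> 0 < h \<Longrightarrow> h \<le> 1 / real n \<Longrightarrow>
     Q (fdiff 1 h T) \<le> C * (real n * h) powr \<theta> * Q (fdiff 1 (c / real n) T)"
    using bernstein by blast
  have pow: "Q (fdiff k d T) \<le> (C * (real n * d) powr \<theta>) ^ k * Q (fdiff k (c / real n) T)"
    if n: "n \<ge> 1" and T: "T \<in> trig_polys n" and d: "0 < d" "d \<le> 1 / real n" for k n T d
    using T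
  proof (induction k arbitrary: T)
    case 0
    show ?case by (simp add: fdiff_0)
  next
    case (Suc k)
    have nn: "0 \<le> C * (real n * d) powr \<theta>" using C by simp
    have "Q (fdiff (Suc k) d T) \<le> C * (real n * d) powr \<theta> * Q (fdiff 1 (c / real n) (fdiff k d T))"
      unfolding fdiff_Suc by (rule b[OF n fdiff_trig[OF Suc.prems] d])
    also have "Q (fdiff 1 (c / real n) (fdiff k d T)) = Q (fdiff k d (fdiff 1 (c / real n) T))"
      by (simp only: fdiff_commute[of 1])
    also have "C * (real n * d) powr \<theta> * \<dots> \<le> C * (real n * d) powr \<theta> * ((C * (real n * d) powr \<theta>) ^ k * Q (fdiff k (c / real n) (fdiff 1 (c / real n) T)))"
      by (rule mult_left_mono[OF Suc.IH[OF fdiff_trig[OF Suc.prems]] nn])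
    finally show ?case by (simp only: fdiff_Suc' power_Suc mult.assoc)
  qed
  have "Q (fdiff k d (fdiff r h T)) \<le> (C * (real n * d) powr \<theta>) ^ k * (C * (real n * h) powr \<theta>) ^ r * Q (fdiff (k + r) (c / real n) T)"
    if n: "n \<ge> 1" and T: "T \<in> trig_polys n" and h: "0 < h" "h \<le> 1 / real n" and d: "0 < d" "d \<le> 1 / real n" for k r n T h d
  proof -
    have "Q (fdiff k d (fdiff r h T)) \<le> (C * (real n * d) powr \<theta>) ^ k * Q (fdiff k (c / real n) (fdiff r h T))"
      by (rule pow[OF n fdiff_trig[OF T] d])
    also have "Q (fdiff k (c / real n) (fdiff r h T)) = Q (fdiff r h (fdiff k (c / real n) T))"
      by (simp only: fdiff_commute[of k])
    also have "(C * (real n * d) powr \<theta>) ^ k * \<dots> \<le> (C * (real n * d) powr \<theta>) ^ k * ((C * (real n * h) powr \<theta>) ^ r * Q (fdiff r (c / real n) (fdiff k (c / real n) T)))"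
      using C by (intro mult_left_mono pow[OF n fdiff_trig[OF T] h]) auto
    finally show ?thesis by (simp only: fdiff_add add.commute[of k r] mult.assoc)
  qed
  then show ?thesis using c C by blast
qed

text \<open>For h beyond 1/n the factor (n h)^(k\<theta>) is at least 1 and the bound 2^k of
  \<open>Q_fdiff\<close> takes over, so every positive h is covered.\<close>

lemma bernstein_norm:
  "\<exists>C>0. \<forall>n T h. n \<ge> 1 \<longrightarrow> T \<in> trig_polys n \<longrightarrow> 0 < h \<longrightarrow> Q (fdiff k h T) \<le> C * (real n * h) powr (real k * \<theta>) * Q T"
proof -
  obtain c C where C: "0 < C" and b: "\<And>k r n T h d. n \<ge> 1 \<Longrightarrow> T \<in> trig_polys n \<Longrightarrow> 0 < h \<Longrightarrow> h \<le> 1 / real n \<Longrightarrow> 0 < d \<Longrightarrow> d \<le> 1 / real n \<Longrightarrow>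
     Q (fdiff k d (fdiff r h T)) \<le> (C * (real n * d) powr \<theta>) ^ k * (C * (real n * h) powr \<theta>) ^ r * Q (fdiff (k + r) (c / real n) T)"
    using bernstein_mixed by blast
  define D where "D = (C ^ k + 1) * 2 ^ k"
  have D: "D > 0" unfolding D_def using C by (intro mult_pos_pos add_pos_pos) auto
  have "Q (fdiff k h T) \<le> D * (real n * h) powr (real k * \<theta>) * Q T"
    if n: "n \<ge> 1" and T: "T \<in> trig_polys n" and h: "0 < h" for n T h
  proof (cases "h \<le> 1 / real n")
    case True
    have "Q (fdiff k h T) \<le> (C * (real n * h) powr \<theta>) ^ k * Q (fdiff k (c / real n) T)"
      using b[OF n T h True h True, of k 0] by (simp add: fdiff_0)
    also have "\<dots> \<le> (C * (real n * h) powr \<theta>) ^ k * (2 ^ k * Q T)"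
      using C by (intro mult_left_mono Q_fdiff X_trig[OF T]) auto
    also have "(C * (real n * h) powr \<theta>) ^ k = C ^ k * (real n * h) powr (real k * \<theta>)"
      using n h unfolding power_mult_distrib by (simp add: powr_powr[symmetric] powr_realpow[symmetric] mult.commute)
    also have "C ^ k * (real n * h) powr (real k * \<theta>) * (2 ^ k * Q T) \<le> D * (real n * h) powr (real k * \<theta>) * Q T"
      unfolding D_def using Q_nonneg[of T] by (simp add: algebra_simps)
    finally show ?thesis .
  next
    case False
    then have "1 \<le> real n * h" using n by (simp add: field_simps)
    then have "1 \<le> (real n * h) powr (real k * \<theta>)" using theta_pos by (intro ge_one_powr_ge_zero) auto
    moreover have "1 * 2 ^ k \<le> D" unfolding D_def using C by (intro mult_right_mono) auto
    ultimately have "2 ^ k * 1 \<le> D * (real n * h) powr (real k * \<theta>)" using D by (intro mult_mono) auto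
    then have "2 ^ k * Q T \<le> D * (real n * h) powr (real k * \<theta>) * Q T" using Q_nonneg by (intro mult_right_mono) auto
    then show ?thesis using Q_fdiff[OF X_trig[OF T], of k h] by linarith
  qed
  then show ?thesis using D by blast
qed

text \<open>
  \<open>psib k r \<alpha> f \<delta> B\<close> says \<open>\<psi>\<^bsub>k,r,\<alpha>\<^esub>(f, \<delta>)\<^sup>\<theta> \<le> B\<close>, and \<open>hb r \<alpha> g B\<close> says that the \<open>\<theta>\<close>-th power of the
  Hoelder seminorm of \<open>g\<close> is at most \<open>B\<close>.
\<close>

definition psib :: "nat \<Rightarrow> nat \<Rightarrow> real \<Rightarrow> (real \<Rightarrow> complex) \<Rightarrow> real \<Rightarrow> real \<Rightarrow> bool" where
  "psib k r \<alpha> f \<delta> B \<longleftrightarrow> (\<forall>h d. 0 < h \<and> h \<le> \<delta> \<and> 0 < d \<and> d < \<delta> \<longrightarrow> Q (fdiff k d (fdiff r h f)) \<le> h powr (\<alpha> * \<theta>) * B)"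

definition hb :: "nat \<Rightarrow> real \<Rightarrow> (real \<Rightarrow> complex) \<Rightarrow> real \<Rightarrow> bool" where
  "hb r \<alpha> g B \<longleftrightarrow> (\<forall>h>0. Q (fdiff r h g) \<le> h powr (\<alpha> * \<theta>) * B)"

lemma hb_nonneg: assumes "hb r \<alpha> g B" shows "B \<ge> 0"
proof -
  have "0 \<le> Q (fdiff r 1 g)" by (rule Q_nonneg)
  also have "\<dots> \<le> 1 powr (\<alpha> * \<theta>) * B" using assms unfolding hb_def by (meson zero_less_one)
  finally show ?thesis by simp
qed

lemma psib_nonneg: assumes "psib k r \<alpha> f \<delta> B" "\<delta> > 0" shows "B \<ge> 0"
proof -
  have "0 \<le> Q (fdiff k (\<delta>/2) (fdiff r (\<delta>/2) f))" by (rule Q_nonneg)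
  also have "\<dots> \<le> (\<delta>/2) powr (\<alpha> * \<theta>) * B" using assms unfolding psib_def by auto
  finally show ?thesis using assms(2) by (simp add: zero_le_mult_iff)
qed

text \<open>The factor (n h)^(r\<theta>) from Bernstein's inequality is split as (n
  h)^(\<alpha>\<theta>) (n h)^((r-\<alpha>)\<theta>). The first part is the Hoelder weight. The
  second, monotone in h because \<alpha> \<le> r, combines with the k differences in d to the gain
  (n/m)^((k+r-\<alpha>)\<theta>) on steps up to 1/m.\<close>

lemma poly_part_bound:
  assumes "\<alpha> \<le> real r"
  shows "\<exists>c C. 0 < c \<and> c < 1 \<and> 0 < C \<and> (\<forall>n m T h d. 1 \<le> n \<longrightarrow> n \<le> m \<longrightarrow> T \<in> trig_polys n \<longrightarrow> 0 < h \<longrightarrow> h \<le> 1 / real m \<longrightarrow> 0 < d \<longrightarrow> d \<le> 1 / real m \<longrightarrow>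
     Q (fdiff k d (fdiff r h T)) \<le> h powr (\<alpha> * \<theta>) * (C * (real n / real m) powr ((real k + real r - \<alpha>) * \<theta>) * (real n powr (\<alpha> * \<theta>) * Q (fdiff (k + r) (c / real n) T))))"
proof -
  obtain c C where c: "0 < c" "c < 1" and C: "0 < C" and b: "\<And>k r n T h d. n \<ge> 1 \<Longrightarrow> T \<in> trig_polys n \<Longrightarrow> 0 < h \<Longrightarrow> h \<le> 1 / real n \<Longrightarrow> 0 < d \<Longrightarrow> d \<le> 1 / real n \<Longrightarrow>
     Q (fdiff k d (fdiff r h T)) \<le> (C * (real n * d) powr \<theta>) ^ k * (C * (real n * h) powr \<theta>) ^ r * Q (fdiff (k + r) (c / real n) T)"
    using bernstein_mixed by blast
  have "Q (fdiff k d (fdiff r h T)) \<le> h powr (\<alpha> * \<theta>) * (C ^ (k + r) * (real n / real m) powr ((real k + real r - \<alpha>) * \<theta>) * (real n powr (\<alpha> * \<theta>) * Q (fdiff (k + r) (c / real n) T)))"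
    if n: "1 \<le> n" "n \<le> m" and T: "T \<in> trig_polys n" and h: "0 < h" "h \<le> 1 / real m" and d: "0 < d" "d \<le> 1 / real m" for n m T h d
  proof -
    have n0: "real n > 0" "real m > 0" using n by auto
    have mn: "1 / real m \<le> 1 / real n" using n n0 by (intro divide_left_mono) auto
    define x where "x = real n / real m"
    have nd: "real n * d \<le> x" "real n * h \<le> x"
      using mult_left_mono[OF d(2), of "real n"] mult_left_mono[OF h(2), of "real n"] unfolding x_def by auto
    have pw: "(C * y powr \<theta>) ^ j = C ^ j * y powr (real j * \<theta>)" if "y > 0" for y j
      using that unfolding power_mult_distrib by (simp add: powr_powr[symmetric] powr_realpow[symmetric] mult.commute)
    have kd: "(real n * d) powr (real k * \<theta>) \<le> x powr (real k * \<theta>)"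
      using nd d n0 theta_pos by (intro powr_mono2) auto
    have rh: "(real n * h) powr (real r * \<theta>) \<le> h powr (\<alpha> * \<theta>) * (real n powr (\<alpha> * \<theta>) * x powr ((real r - \<alpha>) * \<theta>))"
    proof -
      have "(real n * h) powr (real r * \<theta>) = (real n * h) powr (\<alpha> * \<theta>) * (real n * h) powr ((real r - \<alpha>) * \<theta>)"
        by (simp add: powr_add[symmetric] algebra_simps)
      also have "\<dots> \<le> (real n * h) powr (\<alpha> * \<theta>) * x powr ((real r - \<alpha>) * \<theta>)"
        using nd h n0 theta_pos assms by (intro mult_left_mono powr_mono2) auto
      finally show ?thesis by (simp add: powr_mult mult_ac)
    qed
    have "Q (fdiff k d (fdiff r h T)) \<le> (C * (real n * d) powr \<theta>) ^ k * (C * (real n * h) powr \<theta>) ^ r * Q (fdiff (k + r) (c / real n) T)"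
      using n T h d mn by (intro b) auto
    also have "\<dots> = C ^ (k + r) * ((real n * d) powr (real k * \<theta>) * (real n * h) powr (real r * \<theta>)) * Q (fdiff (k + r) (c / real n) T)"
      using n0 d h by (simp add: pw power_add)
    also have "\<dots> \<le> C ^ (k + r) * (x powr (real k * \<theta>) * (h powr (\<alpha> * \<theta>) * (real n powr (\<alpha> * \<theta>) * x powr ((real r - \<alpha>) * \<theta>)))) * Q (fdiff (k + r) (c / real n) T)"
      using C kd rh Q_nonneg by (intro mult_right_mono mult_left_mono mult_mono) auto
    also have "x powr (real k * \<theta>) * (h powr (\<alpha> * \<theta>) * (real n powr (\<alpha> * \<theta>) * x powr ((real r - \<alpha>) * \<theta>)))
       = h powr (\<alpha> * \<theta>) * real n powr (\<alpha> * \<theta>) * (x powr (real k * \<theta>) * x powr ((real r - \<alpha>) * \<theta>))" by (simp add: mult_ac)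
    also have "x powr (real k * \<theta>) * x powr ((real r - \<alpha>) * \<theta>) = x powr ((real k + real r - \<alpha>) * \<theta>)"
      by (simp add: powr_add[symmetric] algebra_simps)
    finally show ?thesis unfolding x_def by (simp add: mult_ac)
  qed
  then show ?thesis using c C by (intro exI[of _ c] exI[of _ "C ^ (k + r)"]) auto
qed

text \<open>f is split into T and f - T, and the second part costs 2^k E. For T the polynomial bound
  gives the gain in n/m times a difference of T with step c/n; this is traded back for f, which is
  bounded by B at scale 1/n, at the cost of another 2^k E.\<close>

lemma psib_upper:
  assumes "\<alpha> > 0" "\<alpha> \<le> real r"
  shows "\<exists>C>0. \<forall>f n m T E B. f \<in> X \<longrightarrow> 1 \<le> n \<longrightarrow> n \<le> m \<longrightarrow> T \<in> trig_polys n \<longrightarrow> hb r \<alpha> (\<lambda>x. f x - T x) E \<longrightarrow> psib k r \<alpha> f (1 / real n) B \<longrightarrow>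
     psib k r \<alpha> f (1 / real m) (2 ^ k * E + C * (real n / real m) powr ((real k + real r - \<alpha>) * \<theta>) * (B + 2 ^ k * E))"
proof -
  obtain c C where c: "0 < c" "c < 1" and C: "0 < C" and b: "\<And>n m T h d. 1 \<le> n \<Longrightarrow> n \<le> m \<Longrightarrow> T \<in> trig_polys n \<Longrightarrow> 0 < h \<Longrightarrow> h \<le> 1 / real m \<Longrightarrow> 0 < d \<Longrightarrow> d \<le> 1 / real m \<Longrightarrow>
     Q (fdiff k d (fdiff r h T)) \<le> h powr (\<alpha> * \<theta>) * (C * (real n / real m) powr ((real k + real r - \<alpha>) * \<theta>) * (real n powr (\<alpha> * \<theta>) * Q (fdiff (k + r) (c / real n) T)))"
    using poly_part_bound[OF assms(2), of k] by blast
  have "psib k r \<alpha> f (1 / real m) (2 ^ k * E + C * (real n / real m) powr ((real k + real r - \<alpha>) * \<theta>) * (B + 2 ^ k * E))"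
    if f: "f \<in> X" and n: "1 \<le> n" "n \<le> m" and T: "T \<in> trig_polys n" and E: "hb r \<alpha> (\<lambda>x. f x - T x) E" and B: "psib k r \<alpha> f (1 / real n) B" for f n m T E B
    unfolding psib_def
  proof (intro allI impI)
    fix h d assume hd: "0 < h \<and> h \<le> 1 / real m \<and> 0 < d \<and> d < 1 / real m"
    define x where "x = C * (real n / real m) powr ((real k + real r - \<alpha>) * \<theta>)"
    have x0: "x \<ge> 0" unfolding x_def using C by simp
    have n0: "real n > 0" using n by simp
    have TX: "T \<in> X" by (rule X_trig[OF T])
    have fT: "(\<lambda>x. f x - T x) \<in> X" by (rule X_diff[OF f TX])
    define \<eta> where "\<eta> = c / real n"
    have eta: "0 < \<eta>" "\<eta> < 1 / real n" unfolding \<eta>_def using c n0 by (auto simp: divide_strict_right_mono)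
    have tri: "Q (fdiff k d' (fdiff r h' g)) \<le> Q (fdiff k d' (fdiff r h' g')) + 2 ^ k * Q (fdiff r h' (\<lambda>x. g x - g' x))"
      if "g \<in> X" "g' \<in> X" for d' h' g g'
      using Q_fdiff_triangle[OF X_fdiff[OF that(1), of r h'] X_fdiff[OF that(2), of r h'], of k d'] by (simp add: fdiff_diff)
    have "Q (fdiff (k + r) \<eta> T) \<le> Q (fdiff k \<eta> (fdiff r \<eta> f)) + 2 ^ k * Q (fdiff r \<eta> (\<lambda>x. T x - f x))"
      unfolding fdiff_add by (rule tri[OF TX f])
    also have "Q (fdiff r \<eta> (\<lambda>x. T x - f x)) = Q (fdiff r \<eta> (\<lambda>x. f x - T x))"
      unfolding fdiff_diff by (rule Q_minus_commute[OF X_fdiff[OF TX] X_fdiff[OF f]])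
    also have "Q (fdiff k \<eta> (fdiff r \<eta> f)) + 2 ^ k * Q (fdiff r \<eta> (\<lambda>x. f x - T x)) \<le> \<eta> powr (\<alpha> * \<theta>) * B + 2 ^ k * (\<eta> powr (\<alpha> * \<theta>) * E)"
      using B E eta unfolding psib_def hb_def by (intro add_mono mult_left_mono) auto
    also have "\<dots> = \<eta> powr (\<alpha> * \<theta>) * (B + 2 ^ k * E)" by (simp add: algebra_simps)
    finally have "real n powr (\<alpha> * \<theta>) * Q (fdiff (k + r) \<eta> T) \<le> real n powr (\<alpha> * \<theta>) * (\<eta> powr (\<alpha> * \<theta>) * (B + 2 ^ k * E))"
      by (intro mult_left_mono) auto
    also have "\<dots> = (real n * \<eta>) powr (\<alpha> * \<theta>) * (B + 2 ^ k * E)" by (simp add: powr_mult mult.assoc)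
    also have "\<dots> \<le> 1 * (B + 2 ^ k * E)"
    proof (intro mult_right_mono)
      show "(real n * \<eta>) powr (\<alpha> * \<theta>) \<le> 1" using c n0 assms theta_pos unfolding \<eta>_def by (intro powr_le1) auto
      show "0 \<le> B + 2 ^ k * E" using psib_nonneg[OF B] hb_nonneg[OF E] n0 by simp
    qed
    finally have poly: "real n powr (\<alpha> * \<theta>) * Q (fdiff (k + r) \<eta> T) \<le> B + 2 ^ k * E" by simp
    have "Q (fdiff k d (fdiff r h f)) \<le> Q (fdiff k d (fdiff r h T)) + 2 ^ k * Q (fdiff r h (\<lambda>x. f x - T x))"
      by (rule tri[OF f TX])
    also have "\<dots> \<le> h powr (\<alpha> * \<theta>) * (x * (B + 2 ^ k * E)) + 2 ^ k * (h powr (\<alpha> * \<theta>) * E)"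
    proof (intro add_mono mult_left_mono)
      have "Q (fdiff k d (fdiff r h T)) \<le> h powr (\<alpha> * \<theta>) * (x * (real n powr (\<alpha> * \<theta>) * Q (fdiff (k + r) \<eta> T)))"
        unfolding x_def \<eta>_def using hd n T by (intro b) auto
      also have "\<dots> \<le> h powr (\<alpha> * \<theta>) * (x * (B + 2 ^ k * E))" using poly x0 by (intro mult_left_mono) auto
      finally show "Q (fdiff k d (fdiff r h T)) \<le> h powr (\<alpha> * \<theta>) * (x * (B + 2 ^ k * E))" .
      show "Q (fdiff r h (\<lambda>x. f x - T x)) \<le> h powr (\<alpha> * \<theta>) * E" using E hd unfolding hb_def by auto
    qed simp
    also have "\<dots> = h powr (\<alpha> * \<theta>) * (2 ^ k * E + x * (B + 2 ^ k * E))" by (simp add: algebra_simps)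
    finally show "Q (fdiff k d (fdiff r h f)) \<le> h powr (\<alpha> * \<theta>) * (2 ^ k * E + C * (real n / real m) powr ((real k + real r - \<alpha>) * \<theta>) * (B + 2 ^ k * E))"
      unfolding x_def .
  qed
  then show ?thesis using C by blast
qed

lemma Q_fdiff_multiple_mixed:
  assumes "f \<in> X"
  shows "Q (fdiff k (real l * d) (fdiff r (real l * h) f)) \<le> real l ^ (k + r) * Q (fdiff k d (fdiff r h f))"
proof -
  have "Q (fdiff k (real l * d) (fdiff r (real l * h) f)) \<le> real l ^ k * Q (fdiff k d (fdiff r (real l * h) f))"
    by (rule Q_fdiff_multiple[OF X_fdiff[OF assms]])
  also have "Q (fdiff k d (fdiff r (real l * h) f)) = Q (fdiff r (real l * h) (fdiff k d f))"
    by (simp only: fdiff_commute[of k])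
  also have "real l ^ k * \<dots> \<le> real l ^ k * (real l ^ r * Q (fdiff r h (fdiff k d f)))"
    by (intro mult_left_mono Q_fdiff_multiple X_fdiff assms) auto
  finally show ?thesis by (simp only: fdiff_commute[of r] power_add mult.assoc)
qed

text \<open>Rescales both steps by subadditivity alone. The exponent is good enough for comparing
  neighbouring scales and, when \<theta> = 1, also for \<open>absorption\<close> with s in place of
  k; for smaller \<theta> \<open>modulus_scaling\<close> takes its place there.\<close>

lemma psib_scale:
  assumes "f \<in> X" "psib k r \<alpha> f \<delta> B" "l \<ge> 1"
  shows "psib k r \<alpha> f (real l * \<delta>) (real l powr (real k + real r - \<alpha> * \<theta>) * B)"
  unfolding psib_def
proof (intro allI impI)
  fix h d assume hd: "0 < h \<and> h \<le> real l * \<delta> \<and> 0 < d \<and> d < real l * \<delta>"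
  have l0: "real l > 0" using assms by simp
  have "Q (fdiff k d (fdiff r h f)) = Q (fdiff k (real l * (d / real l)) (fdiff r (real l * (h / real l)) f))"
    using l0 by simp
  also have "\<dots> \<le> real l ^ (k + r) * Q (fdiff k (d / real l) (fdiff r (h / real l) f))"
    by (rule Q_fdiff_multiple_mixed[OF assms(1)])
  also have "\<dots> \<le> real l ^ (k + r) * ((h / real l) powr (\<alpha> * \<theta>) * B)"
  proof (intro mult_left_mono)
    have "0 < h / real l" "h / real l \<le> \<delta>" "0 < d / real l" "d / real l < \<delta>"
      using hd l0 by (auto simp: pos_divide_le_eq pos_divide_less_eq mult.commute)
    then show "Q (fdiff k (d / real l) (fdiff r (h / real l) f)) \<le> (h / real l) powr (\<alpha> * \<theta>) * B"
      using assms(2) unfolding psib_def by blast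
  qed simp
  also have "\<dots> = h powr (\<alpha> * \<theta>) * ((real l powr (real (k + r)) * real l powr (- (\<alpha> * \<theta>))) * B)"
    using l0 by (subst powr_realpow[OF l0]) (simp add: powr_divide powr_minus_divide)
  also have "real l powr (real (k + r)) * real l powr (- (\<alpha> * \<theta>)) = real l powr (real k + real r - \<alpha> * \<theta>)"
    by (simp add: powr_add[symmetric])
  finally show "Q (fdiff k d (fdiff r h f)) \<le> h powr (\<alpha> * \<theta>) * (real l powr (real k + real r - \<alpha> * \<theta>) * B)" .
qed

section \<open>Jackson theorems in the Hoelder seminorm\<close>

text \<open>A discrete Jackson operator: P minus a kernel average of K-th differences. Since the
  weights add up to 1, the term \<nu> = 0 of the differences cancels P, and the lattice average
  filters the frequencies above n out of the others. The operator commutes with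
  \<open>fdiff r h\<close>, so a single T serves all r, h and W. The lattice may be arbitrarily fine
  because for \<theta> = 1 the weights have a bounded sum of moduli on every lattice.\<close>

lemma smoothing_operator:
  assumes "\<theta> = 1" "K \<ge> 1"
  shows "\<exists>C>0. \<forall>n m P. n \<ge> 1 \<longrightarrow> P \<in> trig_polys m \<longrightarrow> (\<exists>T\<in>trig_polys n. \<forall>r h W.
     (\<forall>d. 0 < d \<and> d < 1 / real n \<longrightarrow> Q (fdiff K d (fdiff r h P)) \<le> W) \<longrightarrow> Q (fdiff r h (\<lambda>x. P x - T x)) \<le> C * W)"
proof -
  define M where "M = K + 2"
  obtain C where C: "C > 0" and mom: "\<And>n R. nodes M n \<le> 2 * R + 1 \<Longrightarrow>
     (\<Sum>l\<in>{- int R..int R}. (cmod (ker M (n div (M + 1)) (- (of_int l * (2 * pi / real (2 * R + 1))))) / real (2 * R + 1)) * (1 + real n * \<bar>of_int l * (2 * pi / real (2 * R + 1))\<bar>) ^ K) \<le> C"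
    using moment_coeffs[of K] unfolding M_def by blast
  have "\<exists>T\<in>trig_polys n. \<forall>r h W.
     (\<forall>d. 0 < d \<and> d < 1 / real n \<longrightarrow> Q (fdiff K d (fdiff r h P)) \<le> W) \<longrightarrow> Q (fdiff r h (\<lambda>x. P x - T x)) \<le> C * W"
    if n: "n \<ge> 1" and P: "P \<in> trig_polys m" for n m P
  proof -
    have PX: "P \<in> X" by (rule X_trig[OF P])
    \<comment> \<open>So many nodes that the dilated frequencies \<mu>\<nu>, of size up to K m,
      cannot alias into the spectrum of the kernel, which lies within n.\<close>
    define R where "R = nodes M n + K * m + n"
    define N where "N = 2 * R + 1"
    define \<tau> where "\<tau> = 2 * pi / real N"
    define \<kappa> where "\<kappa> l = ker M (n div (M + 1)) (- (of_int l * \<tau>)) / of_nat N" for l :: int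
    let ?I = "{- int R..int R}"
    have I: "?I = {- int R..< - int R + int N}" unfolding N_def by auto
    have one: "(\<Sum>l\<in>?I. \<kappa> l) = 1"
    proof -
      have "2 * (n div (M + 1)) + M * (n div (M + 1)) \<le> (M + 2) * (n div (M + 1) + 1)" by simp
      also have "\<dots> \<le> nodes M n" by (rule div_le_nodes)
      also have "\<dots> < N" unfolding N_def R_def by simp
      finally have big: "N > 2 * (n div (M + 1)) + M * (n div (M + 1))" .
      have "(\<Sum>l\<in>?I. \<kappa> l) = (\<Sum>l\<in>?I. ker M (n div (M + 1)) (of_int l * \<tau>) / of_nat N)"
        by (rule sum.reindex_bij_witness[of _ uminus uminus]) (auto simp: \<kappa>_def)
      also have "\<dots> = 1"
        using ker_sum_one[OF big, where a = "- int R" and h = 0] unfolding I \<tau>_def by simp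
      finally show ?thesis .
    qed
    define T where "T x = P x - (\<Sum>l\<in>?I. \<kappa> l * fdiff K (of_int l * \<tau>) P x)" for x
    have inner: "(\<lambda>x. \<Sum>l\<in>?I. \<kappa> l * P (x + real \<nu> * (of_int l * \<tau>))) \<in> trig_polys n" if nu: "\<nu> \<in> {1..K}" for \<nu> :: nat
    proof -
      obtain c where c: "P = (\<lambda>x. \<Sum>\<mu>\<in>{- int m..int m}. c \<mu> * cis (of_int \<mu> * x))"
        using P unfolding trig_polys_eq_tspan tspan_def by auto
      have eq: "(\<Sum>l\<in>?I. \<kappa> l * P (x + real \<nu> * (of_int l * \<tau>)))
         = (\<Sum>\<mu>\<in>{- int m..int m}. (c \<mu> * (\<Sum>l\<in>?I. \<kappa> l * cis (of_int (\<mu> * int \<nu>) * (of_int l * \<tau>)))) * cis (of_int \<mu> * x))" for x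
      proof -
        have "(\<Sum>l\<in>?I. \<kappa> l * P (x + real \<nu> * (of_int l * \<tau>)))
          = (\<Sum>l\<in>?I. \<Sum>\<mu>\<in>{- int m..int m}. c \<mu> * (\<kappa> l * cis (of_int (\<mu> * int \<nu>) * (of_int l * \<tau>))) * cis (of_int \<mu> * x))"
        proof (rule sum.cong[OF refl])
          fix l assume "l \<in> ?I"
          have "cis (of_int \<mu> * (x + real \<nu> * (of_int l * \<tau>))) = cis (of_int (\<mu> * int \<nu>) * (of_int l * \<tau>)) * cis (of_int \<mu> * x)" for \<mu> :: int
            unfolding cis_mult by (simp add: algebra_simps)
          then show "\<kappa> l * P (x + real \<nu> * (of_int l * \<tau>)) = (\<Sum>\<mu>\<in>{- int m..int m}. c \<mu> * (\<kappa> l * cis (of_int (\<mu> * int \<nu>) * (of_int l * \<tau>))) * cis (of_int \<mu> * x))"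
            unfolding c by (simp add: sum_distrib_left mult_ac)
        qed
        also have "\<dots> = (\<Sum>\<mu>\<in>{- int m..int m}. \<Sum>l\<in>?I. c \<mu> * (\<kappa> l * cis (of_int (\<mu> * int \<nu>) * (of_int l * \<tau>))) * cis (of_int \<mu> * x))"
          by (rule sum.swap)
        finally show ?thesis by (simp only: sum_distrib_left sum_distrib_right)
      qed
      \<comment> \<open>If |\<mu>\<nu>| \<le> n then also |\<mu>| \<le> n, as \<nu> \<ge> 1;
        otherwise the coefficient vanishes by \<open>lattice_filter\<close>.\<close>
      have each: "(\<lambda>x. (c \<mu> * (\<Sum>l\<in>?I. \<kappa> l * cis (of_int (\<mu> * int \<nu>) * (of_int l * \<tau>)))) * cis (of_int \<mu> * x)) \<in> tspan (- int n) (int n)"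
        if mu: "\<mu> \<in> {- int m..int m}" for \<mu>
      proof (cases "\<bar>\<mu> * int \<nu>\<bar> \<le> int n")
        case True
        have "\<bar>\<mu>\<bar> * 1 \<le> \<bar>\<mu>\<bar> * int \<nu>" using nu by (intro mult_left_mono) auto
        then have "\<bar>\<mu>\<bar> \<le> int n" using True by (simp add: abs_mult)
        then have "- int n \<le> \<mu>" "\<mu> \<le> int n" by auto
        then show ?thesis by (intro tspan_scale tspan_cis)
      next
        case False
        have "\<bar>\<mu> * int \<nu>\<bar> \<le> int m * int K" unfolding abs_mult using mu nu by (intro mult_mono) auto
        then have "nat \<bar>\<mu> * int \<nu>\<bar> \<le> K * m" by (simp add: nat_le_iff mult.commute)
        then have "n + nat \<bar>\<mu> * int \<nu>\<bar> \<le> n + K * m" by (rule add_left_mono)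
        also have "\<dots> < N" unfolding N_def R_def by simp
        finally have big: "N > n + nat \<bar>\<mu> * int \<nu>\<bar>" .
        have "ker M (n div (M + 1)) \<in> tspan (- int n) (int n)" using ker_div_trig by (simp only: trig_polys_eq_tspan)
        from lattice_filter[OF this _ big, where a = "- int R"] False
        have "(\<Sum>l\<in>?I. ker M (n div (M + 1)) (- (of_int l * \<tau>)) * cis (of_int (\<mu> * int \<nu>) * (of_int l * \<tau>))) = 0"
          unfolding I \<tau>_def by simp
        then have "(\<Sum>l\<in>?I. \<kappa> l * cis (of_int (\<mu> * int \<nu>) * (of_int l * \<tau>))) = 0"
          unfolding \<kappa>_def by (simp only: times_divide_eq_left sum_divide_distrib[symmetric]) simp
        then show ?thesis by (simp only: mult_zero_right mult_zero_left tspan_zero)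
      qed
      show ?thesis unfolding trig_polys_eq_tspan eq by (rule tspan_sum) (rule each)
    qed
    have Teq: "T = (\<lambda>x. \<Sum>\<nu>\<in>{1..K}. (- ((-1) ^ \<nu> * of_nat (K choose \<nu>))) * (\<Sum>l\<in>?I. \<kappa> l * P (x + real \<nu> * (of_int l * \<tau>))))"
    proof
      fix x
      have "T x = (\<Sum>l\<in>?I. \<kappa> l * (P x - fdiff K (of_int l * \<tau>) P x))"
        unfolding T_def right_diff_distrib sum_subtractf sum_distrib_right[symmetric] one by simp
      also have "\<dots> = (\<Sum>l\<in>?I. \<Sum>\<nu>\<in>{1..K}. (- ((-1) ^ \<nu> * of_nat (K choose \<nu>))) * (\<kappa> l * P (x + real \<nu> * (of_int l * \<tau>))))"
      proof (rule sum.cong[OF refl])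
        fix l assume "l \<in> ?I"
        have "fdiff K (of_int l * \<tau>) P x = P x + (\<Sum>\<nu>\<in>{1..K}. (-1) ^ \<nu> * of_nat (K choose \<nu>) * P (x + real \<nu> * (of_int l * \<tau>)))"
          unfolding fdiff_def by (subst sum.atLeast_Suc_atMost) simp_all
        then show "\<kappa> l * (P x - fdiff K (of_int l * \<tau>) P x) = (\<Sum>\<nu>\<in>{1..K}. (- ((-1) ^ \<nu> * of_nat (K choose \<nu>))) * (\<kappa> l * P (x + real \<nu> * (of_int l * \<tau>))))"
          by (simp add: sum_distrib_left sum_negf mult_ac)
      qed
      also have "\<dots> = (\<Sum>\<nu>\<in>{1..K}. \<Sum>l\<in>?I. (- ((-1) ^ \<nu> * of_nat (K choose \<nu>))) * (\<kappa> l * P (x + real \<nu> * (of_int l * \<tau>))))"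
        by (rule sum.swap)
      finally show "T x = (\<Sum>\<nu>\<in>{1..K}. (- ((-1) ^ \<nu> * of_nat (K choose \<nu>))) * (\<Sum>l\<in>?I. \<kappa> l * P (x + real \<nu> * (of_int l * \<tau>))))"
        by (simp only: sum_distrib_left)
    qed
    have T: "T \<in> trig_polys n"
      unfolding Teq trig_polys_eq_tspan
    proof (rule tspan_sum, rule tspan_scale)
      fix \<nu> assume "\<nu> \<in> {1..K}"
      from inner[OF this] show "(\<lambda>x. \<Sum>l\<in>?I. \<kappa> l * P (x + real \<nu> * (of_int l * \<tau>))) \<in> tspan (- int n) (int n)"
        by (simp only: trig_polys_eq_tspan)
    qed
    have "Q (fdiff r h (\<lambda>x. P x - T x)) \<le> C * W"
      if W: "\<And>d. 0 < d \<Longrightarrow> d < 1 / real n \<Longrightarrow> Q (fdiff K d (fdiff r h P)) \<le> W" for r h W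
    proof -
      define g where "g = fdiff r h P"
      have gX: "g \<in> X" unfolding g_def by (rule X_fdiff[OF PX])
      have n0: "real n > 0" using n by simp
      have W0: "W \<ge> 0" using W[of "1 / (2 * real n)"] Q_nonneg[of "fdiff K (1 / (2 * real n)) (fdiff r h P)"] n0
        by (simp add: field_simps)
      have bound: "Q (fdiff K t g) \<le> (1 + real n * \<bar>t\<bar>) ^ K * W" for t
      proof (cases "t = 0")
        case True
        then show ?thesis using fdiff_zero_step[OF assms(2), of g] Q_zero W0 by simp
      next
        case False
        \<comment> \<open>The number of pieces makes |t|/j strictly smaller than 1/n, also when n|t|
          is an integer, because W bounds only steps below 1/n.\<close>
        define j where "j = nat \<lfloor>real n * \<bar>t\<bar>\<rfloor> + 1"
        have j: "real j \<le> 1 + real n * \<bar>t\<bar>" "real n * \<bar>t\<bar> < real j" unfolding j_def using n0 by (auto, linarith)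
        have "j > 0" unfolding j_def by simp
        then have j0: "real j > 0" by simp
        define d where "d = \<bar>t\<bar> / real j"
        have d: "0 < d" "d < 1 / real n" unfolding d_def using False j j0 n0 by (auto simp: field_simps)
        have "Q (fdiff K t g) = Q (fdiff K \<bar>t\<bar> g)" by (rule Q_fdiff_abs[OF gX, symmetric])
        also have "\<dots> = Q (fdiff K (real j * d) g)" unfolding d_def using j0 by simp
        also have "\<dots> \<le> real j ^ K * Q (fdiff K d g)" by (rule Q_fdiff_multiple[OF gX])
        also have "\<dots> \<le> (1 + real n * \<bar>t\<bar>) ^ K * W"
          using W[OF d] j j0 Q_nonneg unfolding g_def by (intro mult_mono power_mono) auto
        finally show ?thesis .
      qed
      have "fdiff r h (\<lambda>x. P x - T x) = (\<lambda>x. \<Sum>l\<in>?I. \<kappa> l * fdiff r h (fdiff K (of_int l * \<tau>) P) x)"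
        unfolding T_def by (simp add: fdiff_lincomb)
      also have "\<dots> = (\<lambda>x. \<Sum>l\<in>?I. \<kappa> l * fdiff K (of_int l * \<tau>) g x)"
        unfolding g_def by (simp only: fdiff_commute[of r])
      finally have "Q (fdiff r h (\<lambda>x. P x - T x)) \<le> (\<Sum>l\<in>?I. cmod (\<kappa> l) powr \<theta> * Q (fdiff K (of_int l * \<tau>) g))"
        using Q_lincomb[of ?I "\<lambda>l. fdiff K (of_int l * \<tau>) g" \<kappa>] X_fdiff[OF gX] by simp
      also have "\<dots> \<le> (\<Sum>l\<in>?I. cmod (\<kappa> l) * ((1 + real n * \<bar>of_int l * \<tau>\<bar>) ^ K * W))"
        using assms(1) bound by (intro sum_mono mult_mono) (auto simp: Q_nonneg)
      also have "\<dots> = (\<Sum>l\<in>?I. cmod (\<kappa> l) * (1 + real n * \<bar>of_int l * \<tau>\<bar>) ^ K) * W"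
        by (simp add: sum_distrib_right mult.assoc)
      also have "\<dots> \<le> C * W"
      proof (intro mult_right_mono W0)
        show "(\<Sum>l\<in>?I. cmod (\<kappa> l) * (1 + real n * \<bar>of_int l * \<tau>\<bar>) ^ K) \<le> C"
          using mom[of n R] unfolding \<kappa>_def \<tau>_def N_def norm_divide norm_of_nat R_def by simp
      qed
      finally show ?thesis .
    qed
    then show ?thesis using T by blast
  qed
  then show ?thesis using C by blast
qed

text \<open>A polynomial P close to f is smoothed. Its error is absolute, whereas the Hoelder
  seminorm asks for an error proportional to h^\<alpha> for every h, which no single P provides. So
  for each small h the polynomial T is compared with a second S of the same degree, built from a
  better P; Bernstein's inequality for S - T returns the missing power of h.\<close>

lemma jackson_dense:
  assumes "\<theta> = 1" "k \<ge> 1" "\<alpha> > 0" "\<alpha> \<le> real r" "f \<in> X"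
    and dense: "\<And>\<epsilon>. \<epsilon> > 0 \<Longrightarrow> \<exists>m. \<exists>P\<in>trig_polys m. Q (\<lambda>x. f x - P x) < \<epsilon>"
  shows "\<exists>C>0. \<forall>n B \<epsilon>. n \<ge> 1 \<longrightarrow> psib k r \<alpha> f (1 / real n) B \<longrightarrow> \<epsilon> > 0 \<longrightarrow>
     (\<exists>T\<in>trig_polys n. Q (\<lambda>x. f x - T x) \<le> C * (B + \<epsilon>) \<and> hb r \<alpha> (\<lambda>x. f x - T x) (C * (B + \<epsilon>)))"
proof -
  obtain C1 where C1: "C1 > 0" and op: "\<And>n m P. n \<ge> 1 \<Longrightarrow> P \<in> trig_polys m \<Longrightarrow> \<exists>T\<in>trig_polys n. \<forall>r' h W.
     (\<forall>d. 0 < d \<and> d < 1 / real n \<longrightarrow> Q (fdiff (k + r) d (fdiff r' h P)) \<le> W) \<longrightarrow> Q (fdiff r' h (\<lambda>x. P x - T x)) \<le> C1 * W"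
    using smoothing_operator[OF assms(1), of "k + r"] assms(2) by auto
  obtain C4 where C4: "C4 > 0" and bn: "\<And>n T h. n \<ge> 1 \<Longrightarrow> T \<in> trig_polys n \<Longrightarrow> 0 < h \<Longrightarrow> Q (fdiff r h T) \<le> C4 * (real n * h) powr (real r * \<theta>) * Q T"
    using bernstein_norm[of r] by blast
  define A where "A = 2 ^ (k + r) * C1 * 2 ^ r + 2 ^ r"
  have A: "A \<ge> 1" "A \<ge> C1" "A \<ge> 2 ^ (k + r) * C1" "A \<ge> C1 * 2 ^ r" "A \<ge> 2 ^ r"
  proof -
    have p: "(1::real) \<le> 2 ^ r" "(1::real) \<le> 2 ^ (k + r)" by simp_all
    define Y where "Y = 2 ^ (k + r) * C1 * 2 ^ r"
    have y: "2 ^ (k + r) * C1 * 1 \<le> Y" "1 * C1 \<le> 2 ^ (k + r) * C1" "1 * (C1 * 2 ^ r) \<le> 2 ^ (k + r) * (C1 * 2 ^ r)"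
      unfolding Y_def using C1 p by (auto intro!: mult_left_mono mult_right_mono simp del: mult_1 mult_1_right)
    have "2 ^ (k + r) * (C1 * 2 ^ r) = Y" unfolding Y_def by simp
    moreover have "A = Y + 2 ^ r" unfolding A_def Y_def ..
    ultimately show "A \<ge> 1" "A \<ge> C1" "A \<ge> 2 ^ (k + r) * C1" "A \<ge> C1 * 2 ^ r" "A \<ge> 2 ^ r"
      using p C1 y by linarith+
  qed
  define C where "C = 2 ^ r * A + 2 * A + 4 * C4 * A"
  have C0: "C > 0" unfolding C_def using A C4 by (simp add: add_pos_pos)
  have key: "\<exists>T\<in>trig_polys n. Q (\<lambda>x. f x - T x) \<le> A * (real n powr (- \<alpha>) * B + e) \<and>
        (\<forall>h. 0 < h \<and> h \<le> 1 / real n \<longrightarrow> Q (fdiff r h (\<lambda>x. f x - T x)) \<le> A * (h powr \<alpha> * B + e))"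
    if n: "n \<ge> 1" and B: "psib k r \<alpha> f (1 / real n) B" and e: "e > 0" for n B e
  proof -
    have n0: "real n > 0" using n by simp
    have B0: "B \<ge> 0" using psib_nonneg[OF B] n0 by simp
    \<comment> \<open>Normalised so that the two ways in which the error of P enters add up to e,
      see \<open>ee\<close>.\<close>
    define e' where "e' = e / (2 ^ r + C1 * 2 ^ r * 2 ^ (k + r))"
    have den: "2 ^ r + C1 * 2 ^ r * 2 ^ (k + r) > 0" using C1 by (simp add: add_pos_pos)
    have e': "e' > 0" unfolding e'_def using e den by simp
    have ee: "2 ^ r * e' + C1 * 2 ^ r * (2 ^ (k + r) * e') = e" 
    proof -
      have "2 ^ r * e' + C1 * 2 ^ r * (2 ^ (k + r) * e') = (2 ^ r + C1 * 2 ^ r * 2 ^ (k + r)) * e'" by (simp add: algebra_simps)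
      then show ?thesis unfolding e'_def using den by simp
    qed
    obtain m P where P: "P \<in> trig_polys m" and fP: "Q (\<lambda>x. f x - P x) < e'" using dense[OF e'] by blast
    have PX: "P \<in> X" by (rule X_trig[OF P])
    obtain T where T: "T \<in> trig_polys n" and TW: "\<And>r' h W. (\<And>d. 0 < d \<Longrightarrow> d < 1 / real n \<Longrightarrow> Q (fdiff (k + r) d (fdiff r' h P)) \<le> W) \<Longrightarrow> Q (fdiff r' h (\<lambda>x. P x - T x)) \<le> C1 * W"
      using op[OF n P] by blast
    have TX: "T \<in> X" by (rule X_trig[OF T])
    have Pf: "Q (\<lambda>x. P x - f x) < e'" using fP Q_minus_commute[OF PX assms(5)] by simp
    have mixed: "Q (fdiff k d (fdiff r h P)) \<le> h powr \<alpha> * B + 2 ^ (k + r) * e'" if "0 < h" "h \<le> 1 / real n" "0 < d" "d < 1 / real n" for h d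
    proof -
      have "Q (fdiff k d (fdiff r h P)) \<le> Q (fdiff k d (fdiff r h f)) + 2 ^ k * Q (\<lambda>x. fdiff r h P x - fdiff r h f x)"
        by (rule Q_fdiff_triangle[OF X_fdiff[OF PX] X_fdiff[OF assms(5)]])
      also have "Q (fdiff k d (fdiff r h f)) \<le> h powr \<alpha> * B" using B that assms(1) unfolding psib_def by auto
      also have "Q (\<lambda>x. fdiff r h P x - fdiff r h f x) \<le> 2 ^ r * e'"
        unfolding fdiff_diff[symmetric] using Q_fdiff[OF X_diff[OF PX assms(5)], of r h] Pf
        by (meson less_imp_le mult_left_mono order_trans zero_le_numeral zero_le_power)
      finally show ?thesis by (simp add: power_add mult.assoc)
    qed
    have p1: "Q (\<lambda>x. f x - T x) \<le> A * (real n powr (- \<alpha>) * B + e)"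
    proof -
      have "Q (fdiff 0 0 (\<lambda>x. P x - T x)) \<le> C1 * (real n powr (- \<alpha>) * B + 2 ^ (k + r) * e')"
      proof (rule TW)
        fix d assume d: "0 < d" "d < 1 / real n"
        have "Q (fdiff (k + r) d (fdiff 0 0 P)) = Q (fdiff k d (fdiff r d P))" by (simp only: fdiff_0 fdiff_add)
        also have "\<dots> \<le> d powr \<alpha> * B + 2 ^ (k + r) * e'" using d by (intro mixed) auto
        also have "d powr \<alpha> \<le> (1 / real n) powr \<alpha>" using d assms by (intro powr_mono2) auto
        also have "(1 / real n) powr \<alpha> = real n powr (- \<alpha>)" using n0 by (simp add: powr_divide powr_minus_divide)
        finally show "Q (fdiff (k + r) d (fdiff 0 0 P)) \<le> real n powr (- \<alpha>) * B + 2 ^ (k + r) * e'" using B0 by (simp add: mult_right_mono)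
      qed
      then have PT: "Q (\<lambda>x. P x - T x) \<le> C1 * (real n powr (- \<alpha>) * B + 2 ^ (k + r) * e')" by (simp add: fdiff_0)
      have "Q (\<lambda>x. f x - T x) \<le> e' + C1 * (real n powr (- \<alpha>) * B + 2 ^ (k + r) * e')"
        using Q_triangle[OF assms(5) PX TX] fP PT by linarith
      also have "\<dots> = C1 * (real n powr (- \<alpha>) * B) + (1 * e' + C1 * 1 * (2 ^ (k + r) * e'))" by (simp add: algebra_simps)
      also have "\<dots> \<le> A * (real n powr (- \<alpha>) * B) + (2 ^ r * e' + C1 * 2 ^ r * (2 ^ (k + r) * e'))"
        using A B0 e' C1 by (intro add_mono mult_right_mono mult_left_mono) auto
      also have "\<dots> \<le> A * (real n powr (- \<alpha>) * B) + A * e" unfolding ee using A e by (simp add: mult_le_cancel_right1)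
      finally show ?thesis by (simp add: algebra_simps)
    qed
    have p2: "Q (fdiff r h (\<lambda>x. f x - T x)) \<le> A * (h powr \<alpha> * B + e)" if h: "0 < h" "h \<le> 1 / real n" for h
    proof -
      have "Q (fdiff r h (\<lambda>x. P x - T x)) \<le> C1 * (2 ^ r * (h powr \<alpha> * B + 2 ^ (k + r) * e'))"
      proof (rule TW)
        fix d assume d: "0 < d" "d < 1 / real n"
        have "Q (fdiff (k + r) d (fdiff r h P)) \<le> 2 ^ (k + r - k) * Q (fdiff k d (fdiff r h P))"
          by (rule Q_fdiff_mono[OF X_fdiff[OF PX]]) simp
        also have "\<dots> \<le> 2 ^ (k + r - k) * (h powr \<alpha> * B + 2 ^ (k + r) * e')"
          by (rule mult_left_mono[OF mixed[OF h d]]) simp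
        finally show "Q (fdiff (k + r) d (fdiff r h P)) \<le> 2 ^ r * (h powr \<alpha> * B + 2 ^ (k + r) * e')" by simp
      qed
      moreover have "Q (fdiff r h (\<lambda>x. f x - T x)) \<le> Q (fdiff r h (\<lambda>x. P x - T x)) + 2 ^ r * Q (\<lambda>x. f x - P x)"
        using Q_fdiff_triangle[OF X_diff[OF assms(5) TX] X_diff[OF PX TX], of r h] by simp
      moreover have "2 ^ r * Q (\<lambda>x. f x - P x) \<le> 2 ^ r * e'" using fP by (intro mult_left_mono) auto
      moreover have "C1 * (2 ^ r * (h powr \<alpha> * B + 2 ^ (k + r) * e')) = C1 * 2 ^ r * (h powr \<alpha> * B) + C1 * 2 ^ r * (2 ^ (k + r) * e')"
        by (simp add: algebra_simps)
      ultimately have "Q (fdiff r h (\<lambda>x. f x - T x)) \<le> C1 * 2 ^ r * (h powr \<alpha> * B) + (2 ^ r * e' + C1 * 2 ^ r * (2 ^ (k + r) * e'))"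
        by linarith
      also have "\<dots> \<le> A * (h powr \<alpha> * B) + A * e" unfolding ee using A B0 e by (intro add_mono mult_right_mono) (auto simp: mult_le_cancel_right1)
      finally show ?thesis by (simp add: algebra_simps)
    qed
    show ?thesis using T p1 p2 by blast
  qed
  have "\<exists>T\<in>trig_polys n. Q (\<lambda>x. f x - T x) \<le> C * (B + \<epsilon>) \<and> hb r \<alpha> (\<lambda>x. f x - T x) (C * (B + \<epsilon>))"
    if n: "n \<ge> 1" and B: "psib k r \<alpha> f (1 / real n) B" and eps: "\<epsilon> > 0" for n B \<epsilon>
  proof -
    have n0: "real n > 0" using n by simp
    have B0: "B \<ge> 0" using psib_nonneg[OF B] n0 by simp
    define na where "na = real n powr (- \<alpha>)"
    have na: "0 < na" "na \<le> 1"
      unfolding na_def using n assms(3) by (auto simp: powr_minus_divide ge_one_powr_ge_zero)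
    have "na * \<epsilon> > 0" using na eps by simp
    from key[OF n B this] obtain T where T: "T \<in> trig_polys n" and T1: "Q (\<lambda>x. f x - T x) \<le> A * (na * B + na * \<epsilon>)"
      and T2: "\<And>h. 0 < h \<Longrightarrow> h \<le> 1 / real n \<Longrightarrow> Q (fdiff r h (\<lambda>x. f x - T x)) \<le> A * (h powr \<alpha> * B + na * \<epsilon>)"
      unfolding na_def by blast
    have TX: "T \<in> X" by (rule X_trig[OF T])
    have T1': "Q (\<lambda>x. f x - T x) \<le> na * (A * (B + \<epsilon>))" using T1 by (simp add: algebra_simps)
    have "hb r \<alpha> (\<lambda>x. f x - T x) (C * (B + \<epsilon>))"
      unfolding hb_def
    proof (intro allI impI)
      fix h :: real assume h: "h > 0"
      show "Q (fdiff r h (\<lambda>x. f x - T x)) \<le> h powr (\<alpha> * \<theta>) * (C * (B + \<epsilon>))"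
      proof (cases "h \<le> 1 / real n")
        case False
        then have "1 / real n \<le> h" by simp
        then have "(1 / real n) powr \<alpha> \<le> h powr \<alpha>" using n0 assms by (intro powr_mono2) auto
        then have nah: "na \<le> h powr \<alpha>" unfolding na_def using n0 by (simp add: powr_divide powr_minus_divide)
        have "Q (fdiff r h (\<lambda>x. f x - T x)) \<le> 2 ^ r * Q (\<lambda>x. f x - T x)" by (rule Q_fdiff[OF X_diff[OF assms(5) TX]])
        also have "\<dots> \<le> 2 ^ r * (h powr \<alpha> * (A * (B + \<epsilon>)))"
          using T1' nah A B0 eps by (intro mult_left_mono order_trans[OF T1'] mult_right_mono) auto
        also have "\<dots> = h powr \<alpha> * ((2 ^ r * A) * (B + \<epsilon>))" by simp
        also have "\<dots> \<le> h powr \<alpha> * (C * (B + \<epsilon>))"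
          unfolding C_def using A C4 B0 eps by (intro mult_left_mono mult_right_mono) auto
        finally show ?thesis using assms(1) by simp
      next
        case True
        \<comment> \<open>Serves two purposes: it is below \<open>na * \<epsilon>\<close>, which
          controls the distance from S to f, and below \<open>h powr \<alpha> * \<epsilon>\<close>,
          which controls the difference with this particular h.\<close>
        define e2 where "e2 = na * (h powr \<alpha> * \<epsilon>)"
        have ha: "0 < h powr \<alpha>" "h powr \<alpha> \<le> 1"
        proof -
          have "1 / real n \<le> 1" using n by simp
          then have "h \<le> 1" using True by linarith
          then show "0 < h powr \<alpha>" "h powr \<alpha> \<le> 1" using h assms by (auto intro!: powr_le1)
        qed
        have e2: "e2 > 0" "e2 \<le> na * \<epsilon>" "e2 \<le> h powr \<alpha> * \<epsilon>"
          unfolding e2_def using na ha eps by (auto simp: mult_le_cancel_left1 mult_le_cancel_right1)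
        from key[OF n B e2(1)] obtain S where S: "S \<in> trig_polys n" and S1: "Q (\<lambda>x. f x - S x) \<le> A * (na * B + e2)"
          and S2: "\<And>h. 0 < h \<Longrightarrow> h \<le> 1 / real n \<Longrightarrow> Q (fdiff r h (\<lambda>x. f x - S x)) \<le> A * (h powr \<alpha> * B + e2)"
          unfolding na_def by blast
        have SX: "S \<in> X" by (rule X_trig[OF S])
        have "A * (na * B + e2) \<le> A * (na * B + na * \<epsilon>)" using A e2 by (intro mult_left_mono) auto
        then have S1': "Q (\<lambda>x. f x - S x) \<le> na * (A * (B + \<epsilon>))" using S1 by (simp add: algebra_simps)
        have "Q (\<lambda>x. S x - T x) \<le> Q (\<lambda>x. S x - f x) + Q (\<lambda>x. f x - T x)" by (rule Q_triangle[OF SX assms(5) TX])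
        also have "Q (\<lambda>x. S x - f x) = Q (\<lambda>x. f x - S x)" by (rule Q_minus_commute[OF SX assms(5)])
        finally have ST: "Q (\<lambda>x. S x - T x) \<le> na * (2 * A * (B + \<epsilon>))" using S1' T1' by (simp add: algebra_simps)
        have nh: "(real n * h) powr (real r * \<theta>) \<le> (real n * h) powr \<alpha>"
        proof -
          have "real n * h \<le> 1" using True n0 by (simp add: field_simps)
          then show ?thesis using h n0 assms by (intro powr_mono') auto
        qed
        have "Q (fdiff r h (\<lambda>x. S x - T x)) \<le> C4 * (real n * h) powr (real r * \<theta>) * Q (\<lambda>x. S x - T x)"
          by (rule bn[OF n trig_polys_diff[OF S T] h])
        also have "\<dots> \<le> C4 * (real n * h) powr \<alpha> * (na * (2 * A * (B + \<epsilon>)))"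
          using C4 nh ST by (intro mult_mono) (auto simp: Q_nonneg)
        also have "\<dots> = h powr \<alpha> * (2 * C4 * A * (B + \<epsilon>)) * (real n powr \<alpha> * na)"
          by (simp add: powr_mult)
        also have "real n powr \<alpha> * na = 1" unfolding na_def using n0 by (simp add: powr_minus)
        finally have q1: "Q (fdiff r h (\<lambda>x. S x - T x)) \<le> h powr \<alpha> * (2 * C4 * A * (B + \<epsilon>))" by simp
        have "A * (h powr \<alpha> * B + e2) \<le> A * (h powr \<alpha> * B + h powr \<alpha> * \<epsilon>)" using A e2 by (intro mult_left_mono) auto
        then have q2: "Q (fdiff r h (\<lambda>x. f x - S x)) \<le> h powr \<alpha> * (A * (B + \<epsilon>))" using S2[OF h True] by (simp add: algebra_simps)
        have "fdiff r h (\<lambda>x. f x - T x) = (\<lambda>x. fdiff r h (\<lambda>x. f x - S x) x + fdiff r h (\<lambda>x. S x - T x) x)"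
          by (simp add: fdiff_diff)
        then have "Q (fdiff r h (\<lambda>x. f x - T x)) \<le> Q (fdiff r h (\<lambda>x. f x - S x)) + Q (fdiff r h (\<lambda>x. S x - T x))"
          using Q_add[OF X_fdiff[OF X_diff[OF assms(5) SX], of r h] X_fdiff[OF X_diff[OF SX TX], of r h]] by simp
        also have "\<dots> \<le> h powr \<alpha> * ((A + 2 * C4 * A) * (B + \<epsilon>))" using q1 q2 by (simp add: algebra_simps)
        also have "\<dots> \<le> h powr \<alpha> * (C * (B + \<epsilon>))"
          unfolding C_def using A C4 B0 eps by (intro mult_left_mono mult_right_mono) auto
        finally show ?thesis using assms(1) by simp
      qed
    qed
    moreover have "Q (\<lambda>x. f x - T x) \<le> C * (B + \<epsilon>)"
    proof -
      have "na * (A * (B + \<epsilon>)) \<le> 1 * (A * (B + \<epsilon>))" using na A B0 eps by (intro mult_right_mono) auto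
      also have "\<dots> \<le> C * (B + \<epsilon>)" unfolding C_def using A C4 B0 eps by (simp add: mult_right_mono)
      finally show ?thesis using T1' by linarith
    qed
    ultimately show ?thesis using T by blast
  qed
  then show ?thesis using C0 by blast
qed

text \<open>The demands on errors at the degrees 2^i n under which \<open>telescoping\<close> works.
  The last clause concerns only \<alpha> = r: for \<alpha> < r the corresponding sum is geometric
  and is controlled by the second clause.\<close>

definition decay :: "nat \<Rightarrow> real \<Rightarrow> nat \<Rightarrow> (nat \<Rightarrow> real) \<Rightarrow> real \<Rightarrow> bool" where
  "decay r \<alpha> n w B \<longleftrightarrow> (\<forall>i. w (Suc i) \<le> w i) \<and> (\<forall>i. w i \<le> real (2 ^ i * n) powr (- (\<alpha> * \<theta>)) * B) \<and>
     (\<alpha> = real r \<longrightarrow> (\<forall>I. (\<Sum>i<I. real (2 ^ i * n) powr (real r * \<theta>) * w i) \<le> B))"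

definition approx_seq :: "nat \<Rightarrow> (real \<Rightarrow> complex) \<Rightarrow> (nat \<Rightarrow> real \<Rightarrow> complex) \<Rightarrow> (nat \<Rightarrow> real) \<Rightarrow> bool" where
  "approx_seq n f T w \<longleftrightarrow> (\<forall>i. T i \<in> trig_polys (2 ^ i * n) \<and> Q (\<lambda>x. f x - T i x) \<le> w i)"

definition diff_seq :: "nat \<Rightarrow> nat \<Rightarrow> (real \<Rightarrow> complex) \<Rightarrow> (nat \<Rightarrow> real) \<Rightarrow> bool" where
  "diff_seq K n f om \<longleftrightarrow> (\<forall>i d. 0 < d \<and> d < 1 / real (2 ^ i * n) \<longrightarrow> Q (fdiff K d f) \<le> om i)"

text \<open>f - T_0 is f - T_I plus the increments T_(i+1) - T_i with i < I, where 2^I n is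
  comparable with 1/h. The first part is small by itself. Bernstein's inequality bounds the
  increments by h^(r\<theta>) times the sum of N_i^(r\<theta>) w_i, which for \<alpha> < r is
  dominated by its last terms and for \<alpha> = r is bounded by \<open>decay\<close>.\<close>

lemma telescoping:
  assumes "\<alpha> > 0" "\<alpha> \<le> real r"
  shows "\<exists>C>0. \<forall>n f T w B. n \<ge> 1 \<longrightarrow> f \<in> X \<longrightarrow> approx_seq n f T w \<longrightarrow> decay r \<alpha> n w B \<longrightarrow> hb r \<alpha> (\<lambda>x. f x - T 0 x) (C * B)"
proof -
  obtain C1 where C1: "C1 > 0" and bn: "\<And>n T h. n \<ge> 1 \<Longrightarrow> T \<in> trig_polys n \<Longrightarrow> 0 < h \<Longrightarrow> Q (fdiff r h T) \<le> C1 * (real n * h) powr (real r * \<theta>) * Q T"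
    using bernstein_norm[of r] by blast
  define \<gamma> where "\<gamma> = (real r - \<alpha>) * \<theta>"
  have gam: "\<gamma> \<ge> 0" unfolding \<gamma>_def using assms theta_pos by simp
  define D where "D = (if \<alpha> = real r then 1 else 1 / (2 powr \<gamma> - 1))"
  have D: "D > 0"
  proof (cases "\<alpha> = real r")
    case False
    then have "\<gamma> > 0" unfolding \<gamma>_def using assms theta_pos by simp
    then have "2 powr \<gamma> > 1" by (rule gr_one_powr[rotated]) simp
    then show ?thesis unfolding D_def by simp
  qed (simp add: D_def)
  define C where "C = 2 ^ r * 2 ^ r + 2 * 2 ^ r * C1 * D"
  have C0: "C > 0" unfolding C_def using C1 D by (intro add_pos_pos mult_pos_pos) auto
  show ?thesis
  proof (intro exI[of _ C] conjI C0 allI impI)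
    fix n f T w B
    assume n: "n \<ge> 1" and f: "f \<in> X" and seq: "approx_seq n f T w" and w: "decay r \<alpha> n w B"
    have T: "\<And>i. T i \<in> trig_polys (2 ^ i * n)" and fT: "\<And>i. Q (\<lambda>x. f x - T i x) \<le> w i"
      using seq unfolding approx_seq_def by auto
    have dec: "\<And>i. w (Suc i) \<le> w i" and wB: "\<And>i. w i \<le> real (2 ^ i * n) powr (- (\<alpha> * \<theta>)) * B"
      and wsum: "\<And>I. \<alpha> = real r \<Longrightarrow> (\<Sum>i<I. real (2 ^ i * n) powr (real r * \<theta>) * w i) \<le> B"
      using w unfolding decay_def by blast+
    show "hb r \<alpha> (\<lambda>x. f x - T 0 x) (C * B)"
    unfolding hb_def
  proof (intro allI impI)
    fix h :: real assume h: "h > 0"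
    define N where "N i = real (2 ^ i * n)" for i
    have N0: "N i > 0" for i unfolding N_def using n by simp
    have NS: "N (Suc i) = 2 * N i" for i unfolding N_def by simp
    have w0: "w i \<ge> 0" for i using fT[of i] Q_nonneg order_trans by blast
    have B0: "B \<ge> 0" using wB[of 0] w0[of 0] N0[of 0] unfolding N_def by (smt (verit) mult_le_0_iff powr_gt_zero zero_le_mult_iff)
    have TX: "T i \<in> X" for i by (rule X_trig[OF T])
    have fTX: "(\<lambda>x. f x - T i x) \<in> X" for i by (rule X_diff[OF f TX])
    have ha: "h powr (\<alpha> * \<theta>) > 0" using h by simp
    have "2 powr (\<alpha> * \<theta>) \<le> 2 powr (real r)"
    proof (intro powr_mono)
      have "\<alpha> * \<theta> \<le> \<alpha> * 1" using assms theta_le by (intro mult_left_mono) auto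
      then show "\<alpha> * \<theta> \<le> real r" using assms by linarith
    qed simp
    then have two: "2 powr (\<alpha> * \<theta>) \<le> 2 ^ r" by (simp add: powr_realpow)
    show "Q (fdiff r h (\<lambda>x. f x - T 0 x)) \<le> h powr (\<alpha> * \<theta>) * (C * B)"
    proof (cases "real n * h \<le> 1")
      case False
      then have le: "inverse (real n) \<le> h" using n by (simp add: field_simps)
      have "Q (fdiff r h (\<lambda>x. f x - T 0 x)) \<le> 2 ^ r * Q (\<lambda>x. f x - T 0 x)" by (rule Q_fdiff[OF fTX])
      also have "\<dots> \<le> 2 ^ r * (real n powr (- (\<alpha> * \<theta>)) * B)"
        using fT[of 0] wB[of 0] by (intro mult_left_mono) auto
      also have "real n powr (- (\<alpha> * \<theta>)) = inverse (real n) powr (\<alpha> * \<theta>)" by (simp add: powr_minus_divide powr_divide inverse_eq_divide)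
      also have "2 ^ r * (inverse (real n) powr (\<alpha> * \<theta>) * B) \<le> 2 ^ r * (h powr (\<alpha> * \<theta>) * B)"
        using le assms theta_pos B0 by (intro mult_left_mono mult_right_mono powr_mono2) auto
      also have "\<dots> = h powr (\<alpha> * \<theta>) * (2 ^ r * 1 * B)" by simp
      also have "\<dots> \<le> h powr (\<alpha> * \<theta>) * (C * B)"
      proof (intro mult_left_mono mult_right_mono)
        have "2 ^ r * (1::real) \<le> 2 ^ r * 2 ^ r" by (intro mult_left_mono) auto
        moreover have "0 \<le> 2 * 2 ^ r * C1 * D" using C1 D by simp
        ultimately show "2 ^ r * 1 \<le> C" unfolding C_def by linarith
      qed (use B0 in auto)
      finally show ?thesis .
    next
      case True
      obtain I where I: "1 / 2 ^ Suc I < real n * h" "real n * h \<le> 1 / 2 ^ I"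
        using dyadic_interval[of "real n * h"] True h n by auto
      have NI: "N I * h \<le> 1" "1 / N I \<le> 2 * h"
        using I N0[of I] n unfolding N_def by (auto simp: field_simps)
      have tel: "Q (fdiff r h (\<lambda>x. T I x - T 0 x)) \<le> (\<Sum>i<I. Q (fdiff r h (\<lambda>x. T (Suc i) x - T i x)))" for I
      proof (induction I)
        case 0
        have "fdiff r h (\<lambda>x. T 0 x - T 0 x) = (\<lambda>x. 0)" unfolding fdiff_diff by simp
        then show ?case by (simp add: Q_zero)
      next
        case (Suc I)
        have "fdiff r h (\<lambda>x. T (Suc I) x - T 0 x) = (\<lambda>x. fdiff r h (\<lambda>x. T I x - T 0 x) x + fdiff r h (\<lambda>x. T (Suc I) x - T I x) x)"
          unfolding fdiff_diff by simp
        then have "Q (fdiff r h (\<lambda>x. T (Suc I) x - T 0 x)) \<le> Q (fdiff r h (\<lambda>x. T I x - T 0 x)) + Q (fdiff r h (\<lambda>x. T (Suc I) x - T I x))"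
          using Q_add[OF X_fdiff[OF X_diff[OF TX TX]] X_fdiff[OF X_diff[OF TX TX]]] by simp
        then show ?case using Suc by simp
      qed
      have piece: "Q (fdiff r h (\<lambda>x. T (Suc i) x - T i x)) \<le> (2 * 2 ^ r * C1 * h powr (real r * \<theta>)) * (N i powr (real r * \<theta>) * w i)" for i
      proof -
        have Tm: "T i \<in> trig_polys (2 ^ Suc i * n)" using T[of i] by (rule trig_polys_mono) simp
        have "1 \<le> 2 ^ Suc i * n" using n by (simp add: Suc_le_eq)
        then have "Q (fdiff r h (\<lambda>x. T (Suc i) x - T i x)) \<le> C1 * (N (Suc i) * h) powr (real r * \<theta>) * Q (\<lambda>x. T (Suc i) x - T i x)"
          unfolding N_def by (intro bn trig_polys_diff T Tm h)
        also have "\<dots> \<le> C1 * (2 ^ r * (h powr (real r * \<theta>) * N i powr (real r * \<theta>))) * (2 * w i)"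
        proof (intro mult_mono mult_left_mono)
          have "(N (Suc i) * h) powr (real r * \<theta>) = 2 powr (real r * \<theta>) * (h powr (real r * \<theta>) * N i powr (real r * \<theta>))"
            unfolding NS by (simp add: powr_mult mult_ac)
          also have "2 powr (real r * \<theta>) \<le> 2 powr (real r * 1)"
            using theta_le by (intro powr_mono mult_left_mono) auto
          then have "2 powr (real r * \<theta>) * (h powr (real r * \<theta>) * N i powr (real r * \<theta>)) \<le> 2 ^ r * (h powr (real r * \<theta>) * N i powr (real r * \<theta>))"
            by (intro mult_right_mono) (simp_all add: powr_realpow)
          finally show "(N (Suc i) * h) powr (real r * \<theta>) \<le> 2 ^ r * (h powr (real r * \<theta>) * N i powr (real r * \<theta>))" .
          have "Q (\<lambda>x. T (Suc i) x - T i x) \<le> Q (\<lambda>x. T (Suc i) x - f x) + Q (\<lambda>x. f x - T i x)"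
            by (rule Q_triangle[OF TX f TX])
          also have "Q (\<lambda>x. T (Suc i) x - f x) = Q (\<lambda>x. f x - T (Suc i) x)" by (rule Q_minus_commute[OF TX f])
          finally show "Q (\<lambda>x. T (Suc i) x - T i x) \<le> 2 * w i" using fT[of i] fT[of "Suc i"] dec[of i] by linarith
        qed (use C1 in \<open>auto simp: Q_nonneg\<close>)
        finally show ?thesis by (simp add: mult_ac)
      qed
      have S: "h powr (real r * \<theta>) * (\<Sum>i<I. N i powr (real r * \<theta>) * w i) \<le> h powr (\<alpha> * \<theta>) * (D * B)"
      proof (cases "\<alpha> = real r")
        case True
        then have "h powr (\<alpha> * \<theta>) * (\<Sum>i<I. N i powr (real r * \<theta>) * w i) \<le> h powr (\<alpha> * \<theta>) * B"
          using wsum[OF True] unfolding N_def by (intro mult_left_mono) auto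
        then show ?thesis using True unfolding D_def by simp
      next
        case False
        then have "\<gamma> > 0" unfolding \<gamma>_def using assms theta_pos by simp
        then have tg: "2 powr \<gamma> > 1" by (rule gr_one_powr[rotated]) simp
        have geo: "(\<Sum>i<I. N i powr \<gamma>) \<le> N I powr \<gamma> / (2 powr \<gamma> - 1)" for I
        proof (induction I)
          case 0
          show ?case using tg by simp
        next
          case (Suc I)
          have "(\<Sum>i<Suc I. N i powr \<gamma>) \<le> N I powr \<gamma> / (2 powr \<gamma> - 1) + N I powr \<gamma>" using Suc by simp
          also have "\<dots> = N I powr \<gamma> * 2 powr \<gamma> / (2 powr \<gamma> - 1)"
          proof -
            have "a / (b - 1) + a = a * b / (b - 1)" if "b > 1" for a b :: real
              using that by (simp add: field_simps)
            then show ?thesis using tg by blast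
          qed
          also have "\<dots> = N (Suc I) powr \<gamma> / (2 powr \<gamma> - 1)" unfolding NS by (simp add: powr_mult mult.commute)
          finally show ?case .
        qed
        have "(\<Sum>i<I. N i powr (real r * \<theta>) * w i) \<le> (\<Sum>i<I. N i powr \<gamma> * B)"
        proof (rule sum_mono)
          fix i
          have "N i powr (real r * \<theta>) * w i \<le> N i powr (real r * \<theta>) * (N i powr (- (\<alpha> * \<theta>)) * B)"
            using wB[of i] unfolding N_def by (intro mult_left_mono) auto
          also have "\<dots> = N i powr (real r * \<theta> + - (\<alpha> * \<theta>)) * B" unfolding powr_add by simp
          also have "real r * \<theta> + - (\<alpha> * \<theta>) = \<gamma>" unfolding \<gamma>_def by (simp add: algebra_simps)
          finally show "N i powr (real r * \<theta>) * w i \<le> N i powr \<gamma> * B" .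
        qed
        also have "\<dots> = (\<Sum>i<I. N i powr \<gamma>) * B" by (simp add: sum_distrib_right)
        also have "\<dots> \<le> N I powr \<gamma> / (2 powr \<gamma> - 1) * B" using geo B0 by (intro mult_right_mono) auto
        finally have "h powr (real r * \<theta>) * (\<Sum>i<I. N i powr (real r * \<theta>) * w i) \<le> h powr (real r * \<theta>) * (N I powr \<gamma> / (2 powr \<gamma> - 1) * B)"
          by (intro mult_left_mono) auto
        also have "\<dots> = h powr (\<alpha> * \<theta>) * ((N I * h) powr \<gamma> * (D * B))"
        proof -
          have "h powr (real r * \<theta>) = h powr (\<alpha> * \<theta>) * h powr \<gamma>"
            unfolding \<gamma>_def powr_add[symmetric] by (simp add: algebra_simps)
          then show ?thesis using False unfolding D_def by (simp add: powr_mult mult_ac)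
        qed
        also have "\<dots> \<le> h powr (\<alpha> * \<theta>) * (1 * (D * B))"
          using NI N0[of I] h gam D B0 by (intro mult_left_mono mult_right_mono powr_le1) auto
        finally show ?thesis by simp
      qed
      have "fdiff r h (\<lambda>x. f x - T 0 x) = (\<lambda>x. fdiff r h (\<lambda>x. f x - T I x) x + fdiff r h (\<lambda>x. T I x - T 0 x) x)"
        unfolding fdiff_diff by simp
      then have "Q (fdiff r h (\<lambda>x. f x - T 0 x)) \<le> Q (fdiff r h (\<lambda>x. f x - T I x)) + Q (fdiff r h (\<lambda>x. T I x - T 0 x))"
        using Q_add[OF X_fdiff[OF fTX] X_fdiff[OF X_diff[OF TX TX]]] by simp
      also have "Q (fdiff r h (\<lambda>x. f x - T I x)) \<le> 2 ^ r * (2 ^ r * h powr (\<alpha> * \<theta>) * B)"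
      proof -
        have "N I powr (- (\<alpha> * \<theta>)) = (1 / N I) powr (\<alpha> * \<theta>)" using N0[of I] by (simp add: powr_divide powr_minus_divide)
        also have "\<dots> \<le> (2 * h) powr (\<alpha> * \<theta>)" using NI N0[of I] assms theta_pos by (intro powr_mono2) auto
        also have "\<dots> \<le> 2 ^ r * h powr (\<alpha> * \<theta>)" using two by (simp add: powr_mult mult_right_mono)
        finally have "N I powr (- (\<alpha> * \<theta>)) * B \<le> 2 ^ r * h powr (\<alpha> * \<theta>) * B" using B0 by (intro mult_right_mono) auto
        then have "Q (\<lambda>x. f x - T I x) \<le> 2 ^ r * h powr (\<alpha> * \<theta>) * B" using fT[of I] wB[of I] unfolding N_def by linarith
        then have "2 ^ r * Q (\<lambda>x. f x - T I x) \<le> 2 ^ r * (2 ^ r * h powr (\<alpha> * \<theta>) * B)" by (intro mult_left_mono) auto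
        then show ?thesis using Q_fdiff[OF fTX, of r h I] by linarith
      qed
      also have "Q (fdiff r h (\<lambda>x. T I x - T 0 x)) \<le> 2 * 2 ^ r * C1 * (h powr (\<alpha> * \<theta>) * (D * B))"
      proof -
        have "Q (fdiff r h (\<lambda>x. T I x - T 0 x)) \<le> (\<Sum>i<I. (2 * 2 ^ r * C1 * h powr (real r * \<theta>)) * (N i powr (real r * \<theta>) * w i))"
          by (rule order_trans[OF tel], rule sum_mono[OF piece])
        also have "\<dots> = 2 * 2 ^ r * C1 * (h powr (real r * \<theta>) * (\<Sum>i<I. N i powr (real r * \<theta>) * w i))"
          unfolding sum_distrib_left[symmetric] by (simp add: mult.assoc)
        also have "\<dots> \<le> 2 * 2 ^ r * C1 * (h powr (\<alpha> * \<theta>) * (D * B))" using S C1 by (intro mult_left_mono) auto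
        finally show ?thesis .
      qed
      also have "2 ^ r * (2 ^ r * h powr (\<alpha> * \<theta>) * B) + 2 * 2 ^ r * C1 * (h powr (\<alpha> * \<theta>) * (D * B)) = h powr (\<alpha> * \<theta>) * (C * B)"
        unfolding C_def by (simp add: algebra_simps)
      finally show ?thesis by simp
    qed
  qed
  qed
qed

text \<open>Jackson's inequality of order K with a constant uniform in g and n; the \<epsilon>
  stands in for attaining the infimum. Within the locale it is a hypothesis, discharged by
  \<open>jackson_small\<close> for \<open>Lq q\<close> with q \<le> 1.\<close>

definition jackson :: "nat \<Rightarrow> bool" where
  "jackson K \<longleftrightarrow> (\<exists>C>0. \<forall>g\<in>X. \<forall>n\<ge>1. \<forall>w. (\<forall>d. 0 < d \<and> d < 1 / real n \<longrightarrow> Q (fdiff K d g) \<le> w) \<longrightarrow>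
     (\<forall>\<epsilon>>0. \<exists>T\<in>trig_polys n. Q (\<lambda>x. g x - T x) \<le> C * w + \<epsilon>))"

text \<open>Jackson's inequality at each degree 2^i n provides polynomials whose errors inherit
  \<open>decay\<close> from the moduli, and \<open>telescoping\<close> applies to them.\<close>

lemma jackson_sum:
  assumes "\<alpha> > 0" "\<alpha> \<le> real r" "jackson (k + r)"
  shows "\<exists>C>0. \<forall>n f om B \<epsilon>. n \<ge> 1 \<longrightarrow> f \<in> X \<longrightarrow> diff_seq (k + r) n f om \<longrightarrow> decay r \<alpha> n om B \<longrightarrow> \<epsilon> > 0 \<longrightarrow>
     (\<exists>T\<in>trig_polys n. Q (\<lambda>x. f x - T x) \<le> real n powr (- (\<alpha> * \<theta>)) * (C * (B + \<epsilon>)) \<and> hb r \<alpha> (\<lambda>x. f x - T x) (C * (B + \<epsilon>)))"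
proof -
  obtain CJ where CJ: "CJ > 0" and J': "\<forall>g\<in>X. \<forall>n\<ge>1. \<forall>w. (\<forall>d. 0 < d \<and> d < 1 / real n \<longrightarrow> Q (fdiff (k + r) d g) \<le> w) \<longrightarrow>
     (\<forall>\<epsilon>>0. \<exists>T\<in>trig_polys n. Q (\<lambda>x. g x - T x) \<le> CJ * w + \<epsilon>)"
    using assms(3) unfolding jackson_def by (elim exE conjE)
  have J: "\<exists>T\<in>trig_polys n. Q (\<lambda>x. g x - T x) \<le> CJ * w + \<epsilon>"
    if "g \<in> X" "n \<ge> 1" "\<And>d. 0 < d \<Longrightarrow> d < 1 / real n \<Longrightarrow> Q (fdiff (k + r) d g) \<le> w" "\<epsilon> > 0" for g n w \<epsilon>
  proof -
    have "\<forall>d. 0 < d \<and> d < 1 / real n \<longrightarrow> Q (fdiff (k + r) d g) \<le> w" using that(3) by simp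
    from J'[THEN bspec, OF that(1), THEN spec, THEN mp, OF that(2), THEN spec, THEN mp, OF this, THEN spec, THEN mp, OF that(4)]
    show ?thesis .
  qed
  obtain C1 where C1: "C1 > 0" and tel: "\<And>n f T w B. n \<ge> 1 \<Longrightarrow> f \<in> X \<Longrightarrow> approx_seq n f T w \<Longrightarrow> decay r \<alpha> n w B \<Longrightarrow> hb r \<alpha> (\<lambda>x. f x - T 0 x) (C1 * B)"
    using telescoping[OF assms(1,2)] by blast
  define C where "C = (C1 + 1) * (CJ + 2)"
  have C0: "C > 0" unfolding C_def using C1 CJ by simp
  show ?thesis
  proof (intro exI[of _ C] conjI C0 allI impI)
    fix n f om B and \<epsilon> :: real
    assume n: "n \<ge> 1" and f: "f \<in> X" and seq: "diff_seq (k + r) n f om" and w: "decay r \<alpha> n om B" and eps: "\<epsilon> > 0"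
    have om: "\<And>i d. 0 < d \<Longrightarrow> d < 1 / real (2 ^ i * n) \<Longrightarrow> Q (fdiff (k + r) d f) \<le> om i"
      using seq unfolding diff_seq_def by auto
    have dec: "\<And>i. om (Suc i) \<le> om i" and omB: "\<And>i. om i \<le> real (2 ^ i * n) powr (- (\<alpha> * \<theta>)) * B"
      and omsum: "\<And>I. \<alpha> = real r \<Longrightarrow> (\<Sum>i<I. real (2 ^ i * n) powr (real r * \<theta>) * om i) \<le> B"
      using w unfolding decay_def by blast+
    define N where "N i = real (2 ^ i * n)" for i
    have N1: "N i \<ge> 1" for i unfolding N_def using n mult_mono[of 1 "2 ^ i" 1 "real n"] by simp
    have N0: "N i > 0" for i using N1[of i] by linarith
    have nn: "2 ^ i * n \<ge> 1" for i using n by (simp add: Suc_le_eq)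
    have om0: "om i \<ge> 0" for i
      using om[of "1 / (2 * N i)" i] N0[of i] Q_nonneg[of "fdiff (k + r) (1 / (2 * N i)) f"] unfolding N_def[symmetric] by (simp add: field_simps)
    have B0: "B \<ge> 0" using omB[of 0] om0[of 0] n by (smt (verit) mult_le_0_iff powr_gt_zero zero_le_mult_iff N0 N_def)
    \<comment> \<open>Error allowances that decrease in i, stay below \<epsilon>
      N_i^(-\<alpha>\<theta>), and remain summable after multiplication by N_i^(r\<theta>), as
      \<open>decay\<close> demands.\<close>
    define e where "e i = \<epsilon> * N i powr (- (real r * \<theta>)) / 2 ^ i" for i
    have e0: "e i > 0" for i unfolding e_def using eps N0[of i] by simp
    have edec: "e (Suc i) \<le> e i" for i
    proof -
      have "N (Suc i) powr (- (real r * \<theta>)) \<le> N i powr (- (real r * \<theta>))"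
        using N0[of i] theta_pos unfolding N_def by (intro powr_mono2') auto
      then show ?thesis unfolding e_def using eps by (intro frac_le mult_left_mono) auto
    qed
    define w where "w i = CJ * om i + e i" for i
    have "\<exists>T\<in>trig_polys (2 ^ i * n). Q (\<lambda>x. f x - T x) \<le> w i" for i
      unfolding w_def by (rule J[OF f nn om e0])
    then obtain T where T: "\<And>i. T i \<in> trig_polys (2 ^ i * n)" "\<And>i. Q (\<lambda>x. f x - T i x) \<le> w i"
      by metis
    define B' where "B' = CJ * B + 2 * \<epsilon>"
    have wB: "w i \<le> N i powr (- (\<alpha> * \<theta>)) * B'" for i
    proof -
      have "e i \<le> \<epsilon> * N i powr (- (\<alpha> * \<theta>)) / 1"
        unfolding e_def using eps N1[of i] assms theta_pos by (intro frac_le mult_left_mono powr_mono) auto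
      moreover have "CJ * om i \<le> CJ * (N i powr (- (\<alpha> * \<theta>)) * B)"
        using omB[of i] CJ unfolding N_def by (intro mult_left_mono) auto
      moreover have "N i powr (- (\<alpha> * \<theta>)) * B' = CJ * (N i powr (- (\<alpha> * \<theta>)) * B) + 2 * (\<epsilon> * N i powr (- (\<alpha> * \<theta>)))"
        unfolding B'_def by (simp add: algebra_simps)
      moreover have "0 \<le> \<epsilon> * N i powr (- (\<alpha> * \<theta>))" using eps by simp
      ultimately show ?thesis unfolding w_def by simp
    qed
    have wsum: "(\<Sum>i<I. N i powr (real r * \<theta>) * w i) \<le> B'" if "\<alpha> = real r" for I
    proof -
      have "(\<Sum>i<I. N i powr (real r * \<theta>) * w i) = CJ * (\<Sum>i<I. N i powr (real r * \<theta>) * om i) + (\<Sum>i<I. \<epsilon> * (1 / 2) ^ i)"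
      proof -
        have "N i powr (real r * \<theta>) * w i = CJ * (N i powr (real r * \<theta>) * om i) + \<epsilon> * (1 / 2) ^ i" for i
          unfolding w_def e_def using N0[of i] by (simp add: algebra_simps powr_minus power_one_over)
        then show ?thesis by (simp add: sum.distrib sum_distrib_left)
      qed
      also have "(\<Sum>i<I. \<epsilon> * (1 / 2) ^ i) = \<epsilon> * (\<Sum>i<I. (1 / 2) ^ i)" by (simp add: sum_distrib_left)
      also have "\<dots> \<le> \<epsilon> * (1 / (1 - 1 / 2))" using eps by (intro mult_left_mono geometric_partial_le) auto
      also have "CJ * (\<Sum>i<I. N i powr (real r * \<theta>) * om i) \<le> CJ * B"
        using omsum[OF that] CJ unfolding N_def by (intro mult_left_mono) auto
      finally show ?thesis unfolding B'_def by simp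
    qed
    have "approx_seq n f T w" unfolding approx_seq_def using T by blast
    moreover have "decay r \<alpha> n w B'"
      unfolding decay_def
    proof (intro conjI allI impI)
      show "w (Suc i) \<le> w i" for i unfolding w_def using dec edec CJ by (auto intro!: add_mono mult_left_mono)
      show "w i \<le> real (2 ^ i * n) powr (- (\<alpha> * \<theta>)) * B'" for i using wB unfolding N_def by blast
      show "(\<Sum>i<I. real (2 ^ i * n) powr (real r * \<theta>) * w i) \<le> B'" if "\<alpha> = real r" for I using wsum[OF that] unfolding N_def by blast
    qed
    ultimately have "hb r \<alpha> (\<lambda>x. f x - T 0 x) (C1 * B')" by (rule tel[OF n f])
    moreover have B'0: "0 \<le> B'" "B' \<le> (CJ + 2) * (B + \<epsilon>)" unfolding B'_def using CJ B0 eps by (auto simp: algebra_simps)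
    have "C1 * B' \<le> C * (B + \<epsilon>)" "B' \<le> C * (B + \<epsilon>)"
    proof -
      have "C1 * B' \<le> (C1 + 1) * ((CJ + 2) * (B + \<epsilon>))" "1 * B' \<le> (C1 + 1) * ((CJ + 2) * (B + \<epsilon>))"
        by (rule mult_mono; use B'0 C1 in simp)+
      then show "C1 * B' \<le> C * (B + \<epsilon>)" "B' \<le> C * (B + \<epsilon>)" unfolding C_def by (simp_all add: mult.assoc)
    qed
    ultimately have "hb r \<alpha> (\<lambda>x. f x - T 0 x) (C * (B + \<epsilon>))"
      unfolding hb_def by (meson mult_left_mono order_trans powr_ge_zero)
    moreover have "Q (\<lambda>x. f x - T 0 x) \<le> real n powr (- (\<alpha> * \<theta>)) * (C * (B + \<epsilon>))"
    proof -
      have "Q (\<lambda>x. f x - T 0 x) \<le> real n powr (- (\<alpha> * \<theta>)) * B'"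
        using T(2)[of 0] wB[of 0] unfolding N_def by simp
      also have "\<dots> \<le> real n powr (- (\<alpha> * \<theta>)) * (C * (B + \<epsilon>))" using \<open>B' \<le> C * (B + \<epsilon>)\<close> by (intro mult_left_mono) auto
      finally show ?thesis .
    qed
    moreover have "T 0 \<in> trig_polys n" using T(1)[of 0] by simp
    ultimately show "\<exists>T\<in>trig_polys n. Q (\<lambda>x. f x - T x) \<le> real n powr (- (\<alpha> * \<theta>)) * (C * (B + \<epsilon>)) \<and> hb r \<alpha> (\<lambda>x. f x - T x) (C * (B + \<epsilon>))"
      by blast
  qed
qed

text \<open>Mixed differences with two independent steps are recovered from the one-step modulus of
  order k + r: f is replaced by a near-best T, for which Bernstein's inequality reduces both steps
  to the common step c/n, while f - T is small in the Hoelder seminorm.\<close>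

lemma psib_of_modulus_sum:
  assumes "\<alpha> > 0" "\<alpha> \<le> real r" "jackson (k + r)"
  shows "\<exists>C>0. \<forall>n f om B. n \<ge> 1 \<longrightarrow> f \<in> X \<longrightarrow> diff_seq (k + r) n f om \<longrightarrow> decay r \<alpha> n om B \<longrightarrow> psib k r \<alpha> f (1 / real n) (C * B)"
proof -
  obtain C1 where C1: "C1 > 0" and js: "\<And>n f om B \<epsilon>. n \<ge> 1 \<Longrightarrow> f \<in> X \<Longrightarrow> diff_seq (k + r) n f om \<Longrightarrow> decay r \<alpha> n om B \<Longrightarrow> \<epsilon> > 0 \<Longrightarrow>
     \<exists>T\<in>trig_polys n. Q (\<lambda>x. f x - T x) \<le> real n powr (- (\<alpha> * \<theta>)) * (C1 * (B + \<epsilon>)) \<and> hb r \<alpha> (\<lambda>x. f x - T x) (C1 * (B + \<epsilon>))"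
    using jackson_sum[OF assms] by blast
  obtain c C2 where c: "0 < c" "c < 1" and C2: "0 < C2" and pp: "\<And>n m T h d. 1 \<le> n \<Longrightarrow> n \<le> m \<Longrightarrow> T \<in> trig_polys n \<Longrightarrow> 0 < h \<Longrightarrow> h \<le> 1 / real m \<Longrightarrow> 0 < d \<Longrightarrow> d \<le> 1 / real m \<Longrightarrow>
     Q (fdiff k d (fdiff r h T)) \<le> h powr (\<alpha> * \<theta>) * (C2 * (real n / real m) powr ((real k + real r - \<alpha>) * \<theta>) * (real n powr (\<alpha> * \<theta>) * Q (fdiff (k + r) (c / real n) T)))"
    using poly_part_bound[OF assms(2), of k] by blast
  define C where "C = C2 * (1 + 2 ^ (k + r) * C1) + 2 ^ k * C1"
  have C0: "C > 0" unfolding C_def using C1 C2 by (intro add_pos_pos mult_pos_pos) auto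
  have "psib k r \<alpha> f (1 / real n) (C * B)"
    if n: "n \<ge> 1" and f: "f \<in> X" and om: "diff_seq (k + r) n f om" and omB: "decay r \<alpha> n om B" for n f om B
    unfolding psib_def
  proof (intro allI impI)
    fix h d assume hd: "0 < h \<and> h \<le> 1 / real n \<and> 0 < d \<and> d < 1 / real n"
    have n0: "real n > 0" using n by simp
    have "Q (fdiff k d (fdiff r h f)) \<le> h powr (\<alpha> * \<theta>) * (C * (B + \<epsilon>))" if eps: "\<epsilon> > 0" for \<epsilon>
    proof -
      obtain T where T: "T \<in> trig_polys n" and T1: "Q (\<lambda>x. f x - T x) \<le> real n powr (- (\<alpha> * \<theta>)) * (C1 * (B + \<epsilon>))"
        and T2: "hb r \<alpha> (\<lambda>x. f x - T x) (C1 * (B + \<epsilon>))"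
        using js[OF n f om omB eps] by blast
      have TX: "T \<in> X" by (rule X_trig[OF T])
      have fT: "(\<lambda>x. f x - T x) \<in> X" by (rule X_diff[OF f TX])
      define \<eta> where "\<eta> = c / real n"
      have eta: "0 < \<eta>" "\<eta> < 1 / real n" unfolding \<eta>_def using c n0 by (auto simp: divide_strict_right_mono)
      define na where "na = real n powr (- (\<alpha> * \<theta>))"
      have na: "real n powr (\<alpha> * \<theta>) * na = 1" unfolding na_def using n0 by (simp add: powr_minus)
      have "Q (fdiff (k + r) \<eta> T) \<le> Q (fdiff (k + r) \<eta> f) + 2 ^ (k + r) * Q (\<lambda>x. T x - f x)"
        by (rule Q_fdiff_triangle[OF TX f])
      also have "Q (fdiff (k + r) \<eta> f) \<le> om 0" using om[unfolded diff_seq_def, rule_format, of \<eta> 0] eta by simp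
      also have "om 0 \<le> na * B" using omB unfolding na_def decay_def by (metis mult_1 power_0)
      also have "Q (\<lambda>x. T x - f x) = Q (\<lambda>x. f x - T x)" by (rule Q_minus_commute[OF TX f])
      also have "\<dots> \<le> na * (C1 * (B + \<epsilon>))" using T1 unfolding na_def .
      finally have "Q (fdiff (k + r) \<eta> T) \<le> na * B + 2 ^ (k + r) * (na * (C1 * (B + \<epsilon>)))" by simp
      also have "\<dots> \<le> na * (B + \<epsilon>) + 2 ^ (k + r) * (na * (C1 * (B + \<epsilon>)))" using eps unfolding na_def by (simp add: mult_left_mono)
      also have "\<dots> = na * ((1 + 2 ^ (k + r) * C1) * (B + \<epsilon>))" by (simp add: algebra_simps)
      finally have "real n powr (\<alpha> * \<theta>) * Q (fdiff (k + r) \<eta> T) \<le> real n powr (\<alpha> * \<theta>) * (na * ((1 + 2 ^ (k + r) * C1) * (B + \<epsilon>)))"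
        by (intro mult_left_mono) auto
      then have poly: "real n powr (\<alpha> * \<theta>) * Q (fdiff (k + r) \<eta> T) \<le> (1 + 2 ^ (k + r) * C1) * (B + \<epsilon>)"
        unfolding mult.assoc[of "real n powr (\<alpha> * \<theta>)" na, symmetric] na by simp
      have "Q (fdiff k d (fdiff r h f)) \<le> Q (fdiff k d (fdiff r h T)) + 2 ^ k * Q (\<lambda>x. fdiff r h f x - fdiff r h T x)"
        by (rule Q_fdiff_triangle[OF X_fdiff[OF f] X_fdiff[OF TX]])
      also have "Q (fdiff k d (fdiff r h T)) \<le> h powr (\<alpha> * \<theta>) * (C2 * ((1 + 2 ^ (k + r) * C1) * (B + \<epsilon>)))"
      proof -
        have "Q (fdiff k d (fdiff r h T)) \<le> h powr (\<alpha> * \<theta>) * (C2 * (real n / real n) powr ((real k + real r - \<alpha>) * \<theta>) * (real n powr (\<alpha> * \<theta>) * Q (fdiff (k + r) (c / real n) T)))"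
          using hd n T by (intro pp) auto
        also have "(real n / real n) powr ((real k + real r - \<alpha>) * \<theta>) = 1" using n0 by simp
        also have "h powr (\<alpha> * \<theta>) * (C2 * 1 * (real n powr (\<alpha> * \<theta>) * Q (fdiff (k + r) (c / real n) T))) \<le> h powr (\<alpha> * \<theta>) * (C2 * 1 * ((1 + 2 ^ (k + r) * C1) * (B + \<epsilon>)))"
          using poly C2 unfolding \<eta>_def by (intro mult_left_mono) auto
        finally show ?thesis by simp
      qed
      also have "Q (\<lambda>x. fdiff r h f x - fdiff r h T x) \<le> h powr (\<alpha> * \<theta>) * (C1 * (B + \<epsilon>))"
        using T2 hd unfolding hb_def fdiff_diff by auto
      also have "h powr (\<alpha> * \<theta>) * (C2 * ((1 + 2 ^ (k + r) * C1) * (B + \<epsilon>))) + 2 ^ k * (h powr (\<alpha> * \<theta>) * (C1 * (B + \<epsilon>))) = h powr (\<alpha> * \<theta>) * (C * (B + \<epsilon>))"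
        unfolding C_def by (simp add: algebra_simps)
      finally show ?thesis by simp
    qed
    note * = this
    show "Q (fdiff k d (fdiff r h f)) \<le> h powr (\<alpha> * \<theta>) * (C * B)"
    proof (rule field_le_epsilon)
      fix e :: real assume e: "e > 0"
      have y: "h powr (\<alpha> * \<theta>) * C > 0" using hd C0 by simp
      have "Q (fdiff k d (fdiff r h f)) \<le> h powr (\<alpha> * \<theta>) * (C * (B + e / (h powr (\<alpha> * \<theta>) * C)))"
        using e y by (intro *) (rule divide_pos_pos)
      also have "\<dots> = h powr (\<alpha> * \<theta>) * (C * B) + (h powr (\<alpha> * \<theta>) * C) * (e / (h powr (\<alpha> * \<theta>) * C))"
        by (simp only: distrib_left mult.assoc)
      also have "(h powr (\<alpha> * \<theta>) * C) * (e / (h powr (\<alpha> * \<theta>) * C)) = e"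
        using nonzero_mult_div_cancel_left[of "h powr (\<alpha> * \<theta>) * C" e] y by (simp only: times_divide_eq_right)
      finally show "Q (fdiff k d (fdiff r h f)) \<le> h powr (\<alpha> * \<theta>) * (C * B) + e" .
    qed
  qed
  then show ?thesis using C0 by blast
qed

text \<open>A least upper bound stated by its two defining properties, so that the abstract argument
  stays within the real numbers.\<close>

definition is_modulus :: "nat \<Rightarrow> (real \<Rightarrow> complex) \<Rightarrow> (real \<Rightarrow> real) \<Rightarrow> bool" where
  "is_modulus K f om \<longleftrightarrow> (\<forall>\<delta>>0. (\<forall>d. 0 < d \<and> d < \<delta> \<longrightarrow> Q (fdiff K d f) \<le> om \<delta>) \<and>
     (\<forall>W. (\<forall>d. 0 < d \<and> d < \<delta> \<longrightarrow> Q (fdiff K d f) \<le> W) \<longrightarrow> om \<delta> \<le> W))"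

text \<open>The condition \<open>modulus_int_cond\<close> for \<alpha> = r, raised to the power
  \<theta> and discretised at the points 1/(2^i n); see
  \<open>modulus_int_cond_imp_dini\<close>.\<close>

definition dini :: "nat \<Rightarrow> (real \<Rightarrow> real) \<Rightarrow> bool" where
  "dini r om \<longleftrightarrow> (\<exists>C>0. \<forall>n\<ge>1. \<forall>I. (\<Sum>i<I. real (2 ^ i * n) powr (real r * \<theta>) * om (1 / real (2 ^ i * n))) \<le> C * (real n powr (real r * \<theta>) * om (1 / real n)))"

lemma is_modulus_mono:
  assumes "is_modulus K f om" "0 < \<delta>" "\<delta> \<le> \<delta>'" shows "om \<delta> \<le> om \<delta>'"
  using assms unfolding is_modulus_def by (meson less_le_trans order_trans)

lemma psib_imp_modulus:
  assumes "is_modulus (k + r) f om" "psib k r \<alpha> f \<delta> B" "0 < \<delta>'" "\<delta>' \<le> \<delta>" "\<alpha> > 0"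
  shows "om \<delta>' \<le> \<delta>' powr (\<alpha> * \<theta>) * B"
proof -
  have B0: "B \<ge> 0" using psib_nonneg[OF assms(2)] assms by simp
  have "Q (fdiff (k + r) d f) \<le> \<delta>' powr (\<alpha> * \<theta>) * B" if "0 < d" "d < \<delta>'" for d
  proof -
    have "Q (fdiff (k + r) d f) \<le> d powr (\<alpha> * \<theta>) * B"
      unfolding fdiff_add using assms that unfolding psib_def by auto
    also have "\<dots> \<le> \<delta>' powr (\<alpha> * \<theta>) * B"
      using that assms theta_pos B0 by (intro mult_right_mono powr_mono2) auto
    finally show ?thesis .
  qed
  then show ?thesis using assms(1,3) unfolding is_modulus_def by blast
qed

lemma inverse_powr: assumes "x > (0::real)" shows "(1 / x) powr a = x powr (- a)"
  using assms by (simp add: powr_divide powr_minus_divide)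

text \<open>Taking both steps equal in \<open>psib\<close> bounds the modulus of order k + r at all
  finer scales, which yields \<open>decay\<close> for its dyadic values; for \<alpha> = r the
  summation clause comes from \<open>dini\<close>. The second part goes the opposite way, from the
  modulus to \<open>psib\<close>; it is combined with \<open>modulus_scaling\<close> in
  \<open>equivalence_small\<close>.\<close>

lemma jackson_holder:
  assumes "\<alpha> > 0" "\<alpha> \<le> real r" "jackson (k + r)" "f \<in> X" "is_modulus (k + r) f om" "\<alpha> = real r \<longrightarrow> dini r om"
  shows "\<exists>C>0. \<forall>n B \<epsilon>. n \<ge> 1 \<longrightarrow> psib k r \<alpha> f (1 / real n) B \<longrightarrow> \<epsilon> > 0 \<longrightarrow>
     (\<exists>T\<in>trig_polys n. Q (\<lambda>x. f x - T x) \<le> C * (B + \<epsilon>) \<and> hb r \<alpha> (\<lambda>x. f x - T x) (C * (B + \<epsilon>)))"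
    and "\<exists>C>0. \<forall>n B. n \<ge> 1 \<longrightarrow> (\<forall>i. om (1 / real (2 ^ i * n)) \<le> real (2 ^ i * n) powr (- (\<alpha> * \<theta>)) * B) \<longrightarrow> psib k r \<alpha> f (1 / real n) (C * B)"
proof -
  obtain CD where CD: "CD > 0" and dn: "\<And>n I. \<alpha> = real r \<Longrightarrow> n \<ge> 1 \<Longrightarrow> (\<Sum>i<I. real (2 ^ i * n) powr (real r * \<theta>) * om (1 / real (2 ^ i * n))) \<le> CD * (real n powr (real r * \<theta>) * om (1 / real n))"
  proof (cases "\<alpha> = real r")
    case True
    then obtain C where "C > 0" "\<forall>n\<ge>1. \<forall>I. (\<Sum>i<I. real (2 ^ i * n) powr (real r * \<theta>) * om (1 / real (2 ^ i * n))) \<le> C * (real n powr (real r * \<theta>) * om (1 / real n))"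
      using assms(6) unfolding dini_def by blast
    then show ?thesis using that[of C] by blast
  next
    case False
    then show ?thesis using that[of 1] by simp
  qed
  have Npos: "real (2 ^ i * n) > 0" if "n \<ge> 1" for i n :: nat using that by simp
  have pre1: "diff_seq (k + r) n f (\<lambda>i. om (1 / real (2 ^ i * n)))" if "n \<ge> 1" for n
    using assms(5) unfolding diff_seq_def using Npos[OF that] unfolding is_modulus_def by (meson zero_less_divide_1_iff)
  have pre2: "\<forall>i. om (1 / real (2 ^ Suc i * n)) \<le> om (1 / real (2 ^ i * n))" if "n \<ge> 1" for n
  proof
    fix i
    have "1 / real (2 ^ Suc i * n) \<le> 1 / real (2 ^ i * n)" using Npos[OF that, of i] by (intro frac_le) auto
    then show "om (1 / real (2 ^ Suc i * n)) \<le> om (1 / real (2 ^ i * n))"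
      using Npos[OF that, of "Suc i"] by (intro is_modulus_mono[OF assms(5)]) auto
  qed
  have B0: "B \<ge> 0" if n: "n \<ge> 1" and om: "\<forall>i. om (1 / real (2 ^ i * n)) \<le> real (2 ^ i * n) powr (- (\<alpha> * \<theta>)) * B" for n B
  proof -
    have "0 \<le> Q (fdiff (k + r) (1 / (2 * real n)) f)" by (rule Q_nonneg)
    also have "\<dots> \<le> om (1 / real (2 ^ 0 * n))" using pre1[OF n, unfolded diff_seq_def, rule_format, of "1 / (2 * real n)" 0] n by (simp add: field_simps)
    also have "\<dots> \<le> real n powr (- (\<alpha> * \<theta>)) * B" using om[rule_format, of 0] by simp
    finally show ?thesis using n by (simp add: zero_le_mult_iff)
  qed
  have pre3: "\<forall>i. om (1 / real (2 ^ i * n)) \<le> real (2 ^ i * n) powr (- (\<alpha> * \<theta>)) * ((CD + 1) * B)"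
    if n: "n \<ge> 1" and om: "\<forall>i. om (1 / real (2 ^ i * n)) \<le> real (2 ^ i * n) powr (- (\<alpha> * \<theta>)) * B" for n B
  proof
    fix i
    have "1 * B \<le> (CD + 1) * B" using B0[OF n om] CD by (intro mult_right_mono) auto
    then have "real (2 ^ i * n) powr (- (\<alpha> * \<theta>)) * B \<le> real (2 ^ i * n) powr (- (\<alpha> * \<theta>)) * ((CD + 1) * B)"
      by (intro mult_left_mono) auto
    then show "om (1 / real (2 ^ i * n)) \<le> real (2 ^ i * n) powr (- (\<alpha> * \<theta>)) * ((CD + 1) * B)"
      using om[rule_format, of i] by linarith
  qed
  have pre4: "\<alpha> = real r \<longrightarrow> (\<forall>I. (\<Sum>i<I. real (2 ^ i * n) powr (real r * \<theta>) * om (1 / real (2 ^ i * n))) \<le> (CD + 1) * B)"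
    if n: "n \<ge> 1" and om: "\<forall>i. om (1 / real (2 ^ i * n)) \<le> real (2 ^ i * n) powr (- (\<alpha> * \<theta>)) * B" for n B
  proof (intro impI allI)
    fix I assume a: "\<alpha> = real r"
    have "(\<Sum>i<I. real (2 ^ i * n) powr (real r * \<theta>) * om (1 / real (2 ^ i * n))) \<le> CD * (real n powr (real r * \<theta>) * om (1 / real n))"
      by (rule dn[OF a n])
    also have "\<dots> \<le> CD * (real n powr (real r * \<theta>) * (real n powr (- (real r * \<theta>)) * B))"
      using om[rule_format, of 0] a CD by (intro mult_left_mono) auto
    also have "real n powr (real r * \<theta>) * (real n powr (- (real r * \<theta>)) * B) = B" using n by (simp add: powr_minus)
    also have "CD * B \<le> (CD + 1) * B" using B0[OF n om] by (intro mult_right_mono) auto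
    finally show "(\<Sum>i<I. real (2 ^ i * n) powr (real r * \<theta>) * om (1 / real (2 ^ i * n))) \<le> (CD + 1) * B" .
  qed
  have pre: "decay r \<alpha> n (\<lambda>i. om (1 / real (2 ^ i * n))) ((CD + 1) * B)"
    if n: "n \<ge> 1" and om: "\<forall>i. om (1 / real (2 ^ i * n)) \<le> real (2 ^ i * n) powr (- (\<alpha> * \<theta>)) * B" for n B
    unfolding decay_def using pre2[OF n] pre3[OF n om] pre4[OF n om] by blast
  obtain C1 where C1: "C1 > 0" and js: "\<And>n om B \<epsilon>. n \<ge> 1 \<Longrightarrow> diff_seq (k + r) n f om \<Longrightarrow> decay r \<alpha> n om B \<Longrightarrow> \<epsilon> > 0 \<Longrightarrow>
     \<exists>T\<in>trig_polys n. Q (\<lambda>x. f x - T x) \<le> real n powr (- (\<alpha> * \<theta>)) * (C1 * (B + \<epsilon>)) \<and> hb r \<alpha> (\<lambda>x. f x - T x) (C1 * (B + \<epsilon>))"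
    using jackson_sum[OF assms(1-3)] assms(4) by blast
  obtain C2 where C2: "C2 > 0" and ps: "\<And>n om B. n \<ge> 1 \<Longrightarrow> diff_seq (k + r) n f om \<Longrightarrow> decay r \<alpha> n om B \<Longrightarrow> psib k r \<alpha> f (1 / real n) (C2 * B)"
    using psib_of_modulus_sum[OF assms(1-3)] assms(4) by blast
  have "\<exists>T\<in>trig_polys n. Q (\<lambda>x. f x - T x) \<le> (C1 * (CD + 1)) * (B + \<epsilon>) \<and> hb r \<alpha> (\<lambda>x. f x - T x) ((C1 * (CD + 1)) * (B + \<epsilon>))"
    if n: "n \<ge> 1" and B: "psib k r \<alpha> f (1 / real n) B" and eps: "\<epsilon> > 0" for n B \<epsilon>
  proof -
    have om: "\<forall>i. om (1 / real (2 ^ i * n)) \<le> real (2 ^ i * n) powr (- (\<alpha> * \<theta>)) * B"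
    proof
      fix i
      have "1 / real (2 ^ i * n) \<le> 1 / real n" using n by (intro divide_left_mono) auto
      then show "om (1 / real (2 ^ i * n)) \<le> real (2 ^ i * n) powr (- (\<alpha> * \<theta>)) * B"
        using psib_imp_modulus[OF assms(5) B, of "1 / real (2 ^ i * n)"] assms(1) Npos[OF n, of i]
        by (simp only: inverse_powr) simp
    qed
    have "(CD + 1) * \<epsilon> > 0" using CD eps by simp
    from js[OF n pre1[OF n] pre[OF n om] this]
    obtain T where T: "T \<in> trig_polys n" and T1: "Q (\<lambda>x. f x - T x) \<le> real n powr (- (\<alpha> * \<theta>)) * (C1 * ((CD + 1) * B + (CD + 1) * \<epsilon>))"
      and T2: "hb r \<alpha> (\<lambda>x. f x - T x) (C1 * ((CD + 1) * B + (CD + 1) * \<epsilon>))" by blast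
    have eq: "C1 * ((CD + 1) * B + (CD + 1) * \<epsilon>) = (C1 * (CD + 1)) * (B + \<epsilon>)" by (simp add: algebra_simps)
    have "real n powr (- (\<alpha> * \<theta>)) \<le> 1" using n assms(1) theta_pos by (simp add: powr_minus_divide ge_one_powr_ge_zero)
    then have "real n powr (- (\<alpha> * \<theta>)) * ((C1 * (CD + 1)) * (B + \<epsilon>)) \<le> 1 * ((C1 * (CD + 1)) * (B + \<epsilon>))"
      using hb_nonneg[OF T2] unfolding eq by (intro mult_right_mono)
    then show ?thesis using T T1 T2 unfolding eq by (intro bexI[of _ T]) auto
  qed
  moreover have "C1 * (CD + 1) > 0" using C1 CD by simp
  ultimately show "\<exists>C>0. \<forall>n B \<epsilon>. n \<ge> 1 \<longrightarrow> psib k r \<alpha> f (1 / real n) B \<longrightarrow> \<epsilon> > 0 \<longrightarrow>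
     (\<exists>T\<in>trig_polys n. Q (\<lambda>x. f x - T x) \<le> C * (B + \<epsilon>) \<and> hb r \<alpha> (\<lambda>x. f x - T x) (C * (B + \<epsilon>)))" by blast
  have "psib k r \<alpha> f (1 / real n) ((C2 * (CD + 1)) * B)"
    if n: "n \<ge> 1" and om: "\<forall>i. om (1 / real (2 ^ i * n)) \<le> real (2 ^ i * n) powr (- (\<alpha> * \<theta>)) * B" for n B
    using ps[OF n pre1[OF n] pre[OF n om]] by (simp only: mult.assoc)
  moreover have "C2 * (CD + 1) > 0" using C2 CD by simp
  ultimately show "\<exists>C>0. \<forall>n B. n \<ge> 1 \<longrightarrow> (\<forall>i. om (1 / real (2 ^ i * n)) \<le> real (2 ^ i * n) powr (- (\<alpha> * \<theta>)) * B) \<longrightarrow> psib k r \<alpha> f (1 / real n) (C * B)"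
    by blast
qed

text \<open>For i \<ge> j the bound at scale 1/(2^j n) applies directly. For i < j the step is
  2^(j-i) times one below that scale, and \<open>Q_fdiff_scaling\<close> of order s + r gives the
  stated exponent. All i are covered with the same constant, in the form that
  \<open>jackson_holder\<close> expects.\<close>

lemma modulus_scaling:
  assumes "f \<in> X" "s \<ge> 1" "s \<le> k" "\<alpha> > 0" "is_modulus (k + r) f om" "\<alpha> \<le> real r"
    and "n \<ge> 1" "psib s r \<alpha> f (1 / real (2 ^ j * n)) B"
  shows "om (1 / real (2 ^ i * n)) \<le> real (2 ^ i * n) powr (- (\<alpha> * \<theta>)) *
    ((2 ^ (k - s) * real (s + r)) * (2 ^ j) powr (real (s + r - 1) * \<theta> + 1 - \<alpha> * \<theta>) * B)"
proof -
  define \<beta> where "\<beta> = real (s + r - 1) * \<theta> + 1 - \<alpha> * \<theta>"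
  define A where "A = 2 ^ (k - s) * real (s + r)"
  have A: "A \<ge> 1" unfolding A_def using assms(2) mult_mono[of 1 "2 ^ (k - s)" 1 "real (s + r)"] by simp
  have beta: "\<beta> \<ge> 0"
  proof -
    have "\<alpha> * \<theta> \<le> real r * \<theta>" using assms theta_pos by (intro mult_right_mono) auto
    also have "\<dots> \<le> real (s + r - 1) * \<theta>" using assms(2) theta_pos by (intro mult_right_mono) auto
    finally show ?thesis unfolding \<beta>_def by simp
  qed
  have N0: "real (2 ^ i * n) > 0" for i using assms(7) by simp
  have B0: "B \<ge> 0" using psib_nonneg[OF assms(8)] N0 by simp
  have two: "(2 ^ j) powr \<beta> \<ge> (1::real)" using beta by (intro ge_one_powr_ge_zero) auto
  have base: "Q (fdiff (s + r) d f) \<le> d powr (\<alpha> * \<theta>) * B" if "0 < d" "d < 1 / real (2 ^ j * n)" for d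
    unfolding fdiff_add using assms(8) that unfolding psib_def by auto
  have "Q (fdiff (k + r) d f) \<le> real (2 ^ i * n) powr (- (\<alpha> * \<theta>)) * (A * (2 ^ j) powr \<beta> * B)"
    if d: "0 < d" "d < 1 / real (2 ^ i * n)" for d
  proof -
    have dN: "d powr (\<alpha> * \<theta>) \<le> real (2 ^ i * n) powr (- (\<alpha> * \<theta>))"
      unfolding inverse_powr[OF N0, symmetric] using d assms theta_pos by (intro powr_mono2) auto
    have up: "Q (fdiff (k + r) d f) \<le> 2 ^ (k - s) * Q (fdiff (s + r) d f)"
      using Q_fdiff_mono[OF assms(1), of "s + r" "k + r" d] assms(3) by simp
    have low: "Q (fdiff (s + r) d f) \<le> real (2 ^ i * n) powr (- (\<alpha> * \<theta>)) * (real (s + r) * (2 ^ j) powr \<beta> * B)"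
    proof (cases "i \<ge> j")
      case True
      have "1 / real (2 ^ i * n) \<le> 1 / real (2 ^ j * n)"
        using True assms(7) by (intro divide_left_mono) (auto intro!: mult_right_mono power_increasing)
      then have "Q (fdiff (s + r) d f) \<le> d powr (\<alpha> * \<theta>) * B" using d by (intro base) auto
      also have "\<dots> \<le> real (2 ^ i * n) powr (- (\<alpha> * \<theta>)) * ((1 * 1) * B)" using dN B0 by (simp add: mult_right_mono)
      also have "\<dots> \<le> real (2 ^ i * n) powr (- (\<alpha> * \<theta>)) * ((real (s + r) * (2 ^ j) powr \<beta>) * B)"
        using two assms(2) B0 by (intro mult_left_mono mult_right_mono mult_mono) auto
      finally show ?thesis .
    next
      case False
      define l where "l = (2::nat) ^ (j - i)"
      have l: "l \<ge> 1" "2 ^ j = l * 2 ^ i" unfolding l_def using False by (auto simp: power_add[symmetric])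
      have l0: "real l > 0" using l by simp
      define d' where "d' = d / real l"
      have d': "0 < d'" unfolding d'_def using d l0 by simp
      have "d' < (1 / real (2 ^ i * n)) / real l" unfolding d'_def using d l0 by (intro divide_strict_right_mono)
      also have "\<dots> = 1 / real (2 ^ j * n)" unfolding l(2) by (simp add: mult_ac)
      finally have d'2: "d' < 1 / real (2 ^ j * n)" .
      have "Q (fdiff (s + r) d f) = Q (fdiff (s + r) (real l * d') f)" unfolding d'_def using l0 by simp
      also have "\<dots> \<le> real (s + r) * real l powr (real (s + r - 1) * \<theta> + 1) * Q (fdiff (s + r) d' f)"
        using assms(2) l by (intro Q_fdiff_scaling assms(1)) auto
      also have "\<dots> \<le> real (s + r) * real l powr (real (s + r - 1) * \<theta> + 1) * (d' powr (\<alpha> * \<theta>) * B)"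
        using base[OF d' d'2] by (intro mult_left_mono) auto
      also have "d' powr (\<alpha> * \<theta>) = d powr (\<alpha> * \<theta>) * real l powr (- (\<alpha> * \<theta>))"
        unfolding d'_def using l0 d by (simp add: powr_divide powr_minus_divide)
      also have "real (s + r) * real l powr (real (s + r - 1) * \<theta> + 1) * (d powr (\<alpha> * \<theta>) * real l powr (- (\<alpha> * \<theta>)) * B)
         = d powr (\<alpha> * \<theta>) * (real (s + r) * (real l powr (real (s + r - 1) * \<theta> + 1) * real l powr (- (\<alpha> * \<theta>))) * B)" by (simp only: mult_ac)
      also have "real l powr (real (s + r - 1) * \<theta> + 1) * real l powr (- (\<alpha> * \<theta>)) = real l powr \<beta>"
        unfolding \<beta>_def powr_add[symmetric] by simp
      also have "d powr (\<alpha> * \<theta>) * (real (s + r) * real l powr \<beta> * B) \<le> real (2 ^ i * n) powr (- (\<alpha> * \<theta>)) * (real (s + r) * (2 ^ j) powr \<beta> * B)"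
      proof (intro mult_mono dN mult_left_mono powr_mono2 beta)
        have "real l \<le> real (2 ^ j)" unfolding l_def by (intro of_nat_mono power_increasing) auto
        then show "real l \<le> 2 ^ j" by simp
      qed (use B0 l0 in auto)
      finally show ?thesis .
    qed
    have "Q (fdiff (k + r) d f) \<le> 2 ^ (k - s) * (real (2 ^ i * n) powr (- (\<alpha> * \<theta>)) * (real (s + r) * (2 ^ j) powr \<beta> * B))"
      by (rule order_trans[OF up mult_left_mono[OF low]]) simp
    then show ?thesis unfolding A_def by (simp only: mult_ac)
  qed
  then show ?thesis
    using assms(5) N0[of i] unfolding is_modulus_def A_def \<beta>_def by (meson zero_less_divide_1_iff)
qed

end

section \<open>The concrete spaces\<close>

text \<open>After division by a + b both terms lie in [0, 1], where x \<le> x^q.\<close>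

lemma powr_add_le:
  fixes a b q :: real assumes "0 \<le> a" "0 \<le> b" "0 < q" "q \<le> 1"
  shows "(a + b) powr q \<le> a powr q + b powr q"
proof (cases "a + b = 0")
  case True
  then show ?thesis using assms by simp
next
  case False
  define s where "s = a + b"
  have s: "s > 0" unfolding s_def using assms False by simp
  have le: "x \<le> x powr q" if "0 \<le> x" "x \<le> 1" for x :: real
    using powr_mono'[of q 1 x] that assms by simp
  have "a / s \<le> (a / s) powr q" "b / s \<le> (b / s) powr q"
    using assms s unfolding s_def by (auto intro!: le simp: divide_le_eq_1)
  then have "1 \<le> (a / s) powr q + (b / s) powr q"
    using s unfolding s_def by (smt (verit) add_divide_distrib divide_self)
  then have "s powr q * 1 \<le> s powr q * ((a / s) powr q + (b / s) powr q)"
    by (intro mult_left_mono) auto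
  also have "\<dots> = a powr q + b powr q"
    using s assms by (simp add: distrib_left powr_divide)
  finally show ?thesis unfolding s_def by simp
qed

lemma powr_convex2:
  fixes a b l q :: real assumes "0 \<le> a" "0 \<le> b" "0 < l" "l < 1" "q \<ge> 1"
  shows "(l * a + (1 - l) * b) powr q \<le> l * a powr q + (1 - l) * b powr q"
proof -
  have le: "x powr q \<le> x" if "0 \<le> x" "x \<le> 1" for x :: real
    using powr_mono'[of 1 q x] that assms by simp
  consider "a = 0" | "b = 0" | "a > 0" "b > 0" using assms by linarith
  then show ?thesis
  proof cases
    case 1
    then show ?thesis using assms le[of "1 - l"] by (simp add: powr_mult mult_right_mono)
  next
    case 2
    then show ?thesis using assms le[of l] by (simp add: powr_mult mult_right_mono)
  next
    case 3
    have "((1 - l) *\<^sub>R b + l *\<^sub>R a) powr q \<le> (1 - l) * b powr q + l * a powr q"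
      by (rule convex_onD[OF powr_convex[OF assms(5)]]) (use 3 assms in auto)
    then show ?thesis by (simp add: add.commute)
  qed
qed

lemma measurable_times_interval:
  fixes g :: "real \<Rightarrow> ennreal" assumes [measurable]: "g \<in> borel_measurable lebesgue"
  shows "(\<lambda>x. g x * indicator {a..<b} x) \<in> borel_measurable lebesgue"
proof -
  have [measurable]: "{a..<b} \<in> sets lebesgue" by simp
  show ?thesis by measurable
qed

lemma nn_integral_shift_lebesgue:
  fixes g :: "real \<Rightarrow> ennreal" assumes "g \<in> borel_measurable lebesgue"
  shows "(\<integral>\<^sup>+x\<in>{a..<b}. g (x + t) \<partial>lebesgue) = (\<integral>\<^sup>+x\<in>{a + t..<b + t}. g x \<partial>lebesgue)"
proof -
  have ind: "indicator {a + t..<b + t} (x + t) = (indicator {a..<b} x :: ennreal)" for x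
    by (auto simp: indicator_def)
  have "(\<integral>\<^sup>+x. g x * indicator {a + t..<b + t} x \<partial>lebesgue) = (\<integral>\<^sup>+x. g (t + 1 * x) * indicator {a + t..<b + t} (t + 1 * x) \<partial>lebesgue)"
    using measurable_times_interval[OF assms] by (subst nn_integral_real_affine_lebesgue[where c = 1 and t = t]) auto
  then show ?thesis by (simp only: mult_1 add.commute[of t] ind)
qed

lemma nn_integral_periodic_shift:
  fixes g :: "real \<Rightarrow> ennreal"
  assumes g: "g \<in> borel_measurable lebesgue" and per: "\<And>x. g (x + 2 * pi) = g x"
  shows "(\<integral>\<^sup>+x\<in>{0..<2 * pi}. g (x + t) \<partial>lebesgue) = (\<integral>\<^sup>+x\<in>{0..<2 * pi}. g x \<partial>lebesgue)"
proof -
  define H where "H a b = (\<integral>\<^sup>+x\<in>{a..<b}. g x \<partial>lebesgue)" for a b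
  have perk: "g (x + of_int k * (2 * pi)) = g x" for x k
  proof (induction k rule: int_induct[where k = 0])
    case (step1 i)
    then show ?case using per[of "x + of_int i * (2 * pi)"] by (simp add: algebra_simps)
  next
    case (step2 i)
    then show ?case using per[of "x + of_int (i - 1) * (2 * pi)"] by (simp add: algebra_simps)
  qed simp
  have shift: "H (a + of_int k * (2 * pi)) (b + of_int k * (2 * pi)) = H a b" for a b k
    using nn_integral_shift_lebesgue[OF g, where a = a and b = b and t = "of_int k * (2 * pi)"] unfolding H_def perk by simp
  have split: "H a c = H a b + H b c" if "a \<le> b" "b \<le> c" for a b c
  proof -
    have "H a c = (\<integral>\<^sup>+x. g x * indicator {a..<b} x + g x * indicator {b..<c} x \<partial>lebesgue)"
      unfolding H_def using that by (intro nn_integral_cong) (auto simp: indicator_def)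
    also have "\<dots> = H a b + H b c" unfolding H_def using measurable_times_interval[OF g] by (intro nn_integral_add)
    finally show ?thesis .
  qed
  define k where "k = \<lfloor>t / (2 * pi)\<rfloor>"
  define s where "s = t - of_int k * (2 * pi)"
  have s: "0 \<le> s" "s \<le> 2 * pi"
  proof -
    have "of_int k \<le> t / (2 * pi)" "t / (2 * pi) \<le> of_int k + 1" unfolding k_def by linarith+
    then show "0 \<le> s" "s \<le> 2 * pi" unfolding s_def by (auto simp: field_simps)
  qed
  have "(\<integral>\<^sup>+x\<in>{0..<2 * pi}. g (x + t) \<partial>lebesgue) = H t (t + 2 * pi)"
    using nn_integral_shift_lebesgue[OF g, where a = 0 and b = "2 * pi" and t = t] unfolding H_def by (simp add: add.commute)
  also have "\<dots> = H (s + of_int k * (2 * pi)) (s + 2 * pi + of_int k * (2 * pi))" unfolding s_def by (simp add: algebra_simps)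
  also have "\<dots> = H s (s + 2 * pi)" by (rule shift)
  also have "\<dots> = H s (2 * pi) + H (2 * pi) (s + 2 * pi)" using s by (intro split) auto
  also have "H (2 * pi) (s + 2 * pi) = H 0 s" using shift[of 0 1 s] by simp
  also have "H s (2 * pi) + H 0 s = H 0 s + H s (2 * pi)" by (rule add.commute)
  also have "\<dots> = H 0 (2 * pi)" using s by (intro split[symmetric]) auto
  finally show ?thesis unfolding H_def .
qed

section \<open>Lebesgue spaces with finite exponent\<close>

definition Iq :: "real \<Rightarrow> (real \<Rightarrow> complex) \<Rightarrow> ennreal" where
  "Iq q f = (\<integral>\<^sup>+x\<in>{0..<2 * pi}. ennreal (cmod (f x) powr q) \<partial>lebesgue)"

definition Lq :: "real \<Rightarrow> (real \<Rightarrow> complex) set" where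
  "Lq q = {f. torus_fun f \<and> f \<in> borel_measurable lebesgue \<and> Iq q f < \<infinity>}"

text \<open>The q-th power of the normalised L_q norm. For q \<le> 1 it is itself the gauge, for q
  \<ge> 1 the gauge is its q-th root.\<close>

definition mean_power :: "real \<Rightarrow> (real \<Rightarrow> complex) \<Rightarrow> real" where
  "mean_power q f = enn2real (Iq q f) / (2 * pi)"

lemma Iq_eq: assumes "f \<in> Lq q" shows "Iq q f = ennreal (2 * pi * mean_power q f)"
  using assms unfolding Lq_def mean_power_def by (auto simp: less_top)

lemma mean_power_nonneg: "0 \<le> mean_power q f"
  unfolding mean_power_def by simp

lemma mean_power_le:
  assumes "Iq q f \<le> ennreal (2 * pi * B)" "B \<ge> 0" shows "mean_power q f \<le> B"
proof -
  have "enn2real (Iq q f) \<le> 2 * pi * B" using assms by (intro enn2real_leI) auto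
  then show ?thesis unfolding mean_power_def by (simp add: field_simps)
qed

lemma Lq_measurable_power: assumes "f \<in> Lq q" shows "(\<lambda>x. ennreal (cmod (f x) powr q)) \<in> borel_measurable lebesgue"
proof -
  have [measurable]: "f \<in> borel_measurable lebesgue" using assms unfolding Lq_def by blast
  show ?thesis by measurable
qed

lemma Iq_mono_sum:
  assumes "f \<in> Lq q" "g \<in> Lq q" "a \<ge> 0" "b \<ge> 0" and le: "\<And>x. cmod (h x) powr q \<le> a * cmod (f x) powr q + b * cmod (g x) powr q"
  shows "Iq q h \<le> ennreal (2 * pi * (a * mean_power q f + b * mean_power q g))"
proof -
  have "Iq q h \<le> (\<integral>\<^sup>+x. ennreal a * (ennreal (cmod (f x) powr q) * indicator {0..<2 * pi} x) + ennreal b * (ennreal (cmod (g x) powr q) * indicator {0..<2 * pi} x) \<partial>lebesgue)"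
    unfolding Iq_def
  proof (rule nn_integral_mono)
    fix x
    have "ennreal (cmod (h x) powr q) \<le> ennreal a * ennreal (cmod (f x) powr q) + ennreal b * ennreal (cmod (g x) powr q)"
      using le[of x] assms(3,4) by (simp add: ennreal_mult'[symmetric] ennreal_plus[symmetric] del: ennreal_plus)
    then show "ennreal (cmod (h x) powr q) * indicator {0..<2 * pi} x \<le> ennreal a * (ennreal (cmod (f x) powr q) * indicator {0..<2 * pi} x) + ennreal b * (ennreal (cmod (g x) powr q) * indicator {0..<2 * pi} x)"
      by (auto simp: indicator_def)
  qed
  also have "\<dots> = ennreal a * Iq q f + ennreal b * Iq q g"
    unfolding Iq_def
    using measurable_times_interval[OF Lq_measurable_power[OF assms(1)]] measurable_times_interval[OF Lq_measurable_power[OF assms(2)]]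
    by (subst nn_integral_add) (auto simp: nn_integral_cmult intro!: borel_measurable_times_ennreal)
  also have "\<dots> = ennreal (2 * pi * (a * mean_power q f + b * mean_power q g))"
    unfolding Iq_eq[OF assms(1)] Iq_eq[OF assms(2)] using assms(3,4)
    by (simp add: ennreal_mult'[symmetric] ennreal_plus[symmetric] mean_power_nonneg algebra_simps del: ennreal_plus)
  finally show ?thesis .
qed

lemma Lq_add: assumes "f \<in> Lq q" "g \<in> Lq q" "q > 0" shows "(\<lambda>x. f x + g x) \<in> Lq q"
proof -
  have "cmod (f x + g x) powr q \<le> 2 powr q * cmod (f x) powr q + 2 powr q * cmod (g x) powr q" for x
  proof -
    have "cmod (f x + g x) \<le> 2 * max (cmod (f x)) (cmod (g x))" using norm_triangle_ineq[of "f x" "g x"] by linarith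
    then have "cmod (f x + g x) powr q \<le> (2 * max (cmod (f x)) (cmod (g x))) powr q" using assms(3) by (intro powr_mono2) auto
    also have "\<dots> \<le> 2 powr q * cmod (f x) powr q + 2 powr q * cmod (g x) powr q"
      by (auto simp: powr_mult max_def)
    finally show ?thesis .
  qed
  from Iq_mono_sum[OF assms(1,2) _ _ this] have "Iq q (\<lambda>x. f x + g x) < \<infinity>"
    by (rule le_less_trans) auto
  then show ?thesis using assms unfolding Lq_def torus_fun_def by auto
qed

lemma Lq_scale: assumes "f \<in> Lq q" shows "(\<lambda>x. c * f x) \<in> Lq q" "mean_power q (\<lambda>x. c * f x) = cmod c powr q * mean_power q f"
proof -
  have "Iq q (\<lambda>x. c * f x) = (\<integral>\<^sup>+x. ennreal (cmod c powr q) * (ennreal (cmod (f x) powr q) * indicator {0..<2 * pi} x) \<partial>lebesgue)"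
    unfolding Iq_def by (intro nn_integral_cong) (auto simp: norm_mult powr_mult ennreal_mult' indicator_def)
  also have "\<dots> = ennreal (cmod c powr q) * Iq q f"
    unfolding Iq_def by (intro nn_integral_cmult measurable_times_interval Lq_measurable_power[OF assms])
  finally have eq: "Iq q (\<lambda>x. c * f x) = ennreal (cmod c powr q) * Iq q f" .
  show "(\<lambda>x. c * f x) \<in> Lq q"
    using assms eq unfolding Lq_def torus_fun_def by (auto simp: ennreal_mult_less_top)
  show "mean_power q (\<lambda>x. c * f x) = cmod c powr q * mean_power q f"
    unfolding mean_power_def eq by (simp add: enn2real_mult)
qed

lemma Lq_shift: assumes "f \<in> Lq q" shows "(\<lambda>x. f (x + t)) \<in> Lq q" "mean_power q (\<lambda>x. f (x + t)) = mean_power q f"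
proof -
  have eq: "Iq q (\<lambda>x. f (x + t)) = Iq q f"
    unfolding Iq_def
  proof (rule nn_integral_periodic_shift[OF Lq_measurable_power[OF assms]])
    show "ennreal (cmod (f (x + 2 * pi)) powr q) = ennreal (cmod (f x) powr q)" for x
      using assms unfolding Lq_def torus_fun_def by simp
  qed
  have m: "(\<lambda>x. f (x + t)) \<in> borel_measurable lebesgue"
  proof -
    have "(\<lambda>x. t + (\<Sum>j\<in>Basis. (1 * (x \<bullet> j)) *\<^sub>R j)) \<in> lebesgue \<rightarrow>\<^sub>M (lebesgue :: real measure)"
      by (rule lebesgue_affine_measurable) auto
    then have "(\<lambda>x. x + t) \<in> lebesgue \<rightarrow>\<^sub>M (lebesgue :: real measure)" by (simp add: add.commute)
    from measurable_compose[OF this] show ?thesis using assms unfolding Lq_def by auto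
  qed
  have "torus_fun (\<lambda>x. f (x + t))"
    unfolding torus_fun_def
  proof
    fix x
    have "f ((x + t) + 2 * pi) = f (x + t)" using assms unfolding Lq_def torus_fun_def by blast
    then show "f (x + 2 * pi + t) = f (x + t)" by (simp add: algebra_simps)
  qed
  then show "(\<lambda>x. f (x + t)) \<in> Lq q" using m eq assms unfolding Lq_def by auto
  show "mean_power q (\<lambda>x. f (x + t)) = mean_power q f" unfolding mean_power_def eq ..
qed

lemma trig_bounded: assumes "T \<in> trig_polys n" obtains K where "K \<ge> 0" "\<And>x. cmod (T x) \<le> K"
proof -
  obtain c where T: "T = (\<lambda>x. \<Sum>\<nu>\<in>{- int n..int n}. c \<nu> * cis (of_int \<nu> * x))"
    using assms unfolding trig_polys_eq_tspan tspan_def by auto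
  have "cmod (T x) \<le> (\<Sum>\<nu>\<in>{- int n..int n}. cmod (c \<nu>))" for x
    unfolding T by (rule order_trans[OF norm_sum]) (simp add: norm_mult)
  then show ?thesis using that[of "\<Sum>\<nu>\<in>{- int n..int n}. cmod (c \<nu>)"] by (simp add: sum_nonneg)
qed

lemma trig_continuous: assumes "T \<in> trig_polys n" shows "continuous_on UNIV T"
proof -
  obtain c where T: "T = (\<lambda>x. \<Sum>\<nu>\<in>{- int n..int n}. c \<nu> * cis (of_int \<nu> * x))"
    using assms unfolding trig_polys_eq_tspan tspan_def by auto
  show ?thesis unfolding T cis_conv_exp by (intro continuous_intros)
qed

lemma Iq_bounded:
  assumes "\<And>x. cmod (f x) \<le> K" "q > 0" shows "Iq q f \<le> ennreal (2 * pi * K powr q)"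
proof -
  have "Iq q f \<le> (\<integral>\<^sup>+x. ennreal (K powr q) * indicator {0..<2 * pi} x \<partial>lebesgue)"
    unfolding Iq_def using assms by (intro nn_integral_mono) (auto simp: indicator_def intro!: ennreal_leI powr_mono2)
  also have "\<dots> = ennreal (K powr q) * ennreal (2 * pi)"
    by (subst nn_integral_cmult_indicator) auto
  also have "\<dots> = ennreal (2 * pi * K powr q)" by (simp add: ennreal_mult'[symmetric] mult.commute)
  finally show ?thesis .
qed

lemma Lq_trig: assumes "T \<in> trig_polys n" "q > 0" shows "T \<in> Lq q"
proof -
  obtain K where K: "\<And>x. cmod (T x) \<le> K" by (rule trig_bounded[OF assms(1)]) blast
  have "Iq q T < \<infinity>" by (rule le_less_trans[OF Iq_bounded[OF K assms(2)]]) auto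
  moreover have "T \<in> borel_measurable lebesgue"
    using borel_measurable_continuous_onI[OF trig_continuous[OF assms(1)]] by (intro measurable_completion) simp
  moreover have "torus_fun T" using assms(1) torus_fun_tspan by (auto simp: trig_polys_eq_tspan)
  ultimately show ?thesis unfolding Lq_def by blast
qed

lemma mean_power_add_le_small:
  assumes "f \<in> Lq q" "g \<in> Lq q" "0 < q" "q \<le> 1"
  shows "mean_power q (\<lambda>x. f x + g x) \<le> mean_power q f + mean_power q g"
proof -
  have "cmod (f x + g x) powr q \<le> 1 * cmod (f x) powr q + 1 * cmod (g x) powr q" for x
  proof -
    have "cmod (f x + g x) powr q \<le> (cmod (f x) + cmod (g x)) powr q" using assms by (intro powr_mono2 norm_triangle_ineq) auto
    also have "\<dots> \<le> cmod (f x) powr q + cmod (g x) powr q" using assms by (intro powr_add_le) auto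
    finally show ?thesis by simp
  qed
  from Iq_mono_sum[OF assms(1,2) _ _ this] show ?thesis
    by (intro mean_power_le) (auto simp: mean_power_nonneg)
qed

text \<open>Convexity of the q-th power with the weights A/(A + B) and B/(A + B), where A and B are
  slightly enlarged norms of f and g.\<close>

lemma minkowski:
  assumes "f \<in> Lq q" "g \<in> Lq q" "q \<ge> 1"
  shows "mean_power q (\<lambda>x. f x + g x) powr (1 / q) \<le> mean_power q f powr (1 / q) + mean_power q g powr (1 / q)"
proof (rule field_le_epsilon)
  fix e :: real assume e: "e > 0"
  \<comment> \<open>The summand e/2 makes A and B positive, so that one may divide by them even for
    functions of norm zero.\<close>
  define A where "A = mean_power q f powr (1 / q) + e / 2"
  define B where "B = mean_power q g powr (1 / q) + e / 2"
  have A: "A > 0" and B: "B > 0" unfolding A_def B_def using e by (simp_all add: add_nonneg_pos)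
  have mA: "mean_power q f \<le> A powr q"
  proof -
    have "mean_power q f = (mean_power q f powr (1 / q)) powr q" using assms(3) mean_power_nonneg by (simp add: powr_powr)
    also have "\<dots> \<le> A powr q" unfolding A_def using e assms(3) by (intro powr_mono2) auto
    finally show ?thesis .
  qed
  have mB: "mean_power q g \<le> B powr q"
  proof -
    have "mean_power q g = (mean_power q g powr (1 / q)) powr q" using assms(3) mean_power_nonneg by (simp add: powr_powr)
    also have "\<dots> \<le> B powr q" unfolding B_def using e assms(3) by (intro powr_mono2) auto
    finally show ?thesis .
  qed
  define l where "l = A / (A + B)"
  have l: "0 < l" "l < 1" "1 - l = B / (A + B)" unfolding l_def using A B by (auto simp: field_simps)
  define a where "a = (A + B) powr q * (l / A powr q)"
  define b where "b = (A + B) powr q * ((1 - l) / B powr q)"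
  have ab: "a \<ge> 0" "b \<ge> 0" unfolding a_def b_def using l(1,2) by simp_all
  have "cmod (f x + g x) powr q \<le> a * cmod (f x) powr q + b * cmod (g x) powr q" for x
  proof -
    have "cmod (f x + g x) powr q \<le> ((A + B) * (l * (cmod (f x) / A) + (1 - l) * (cmod (g x) / B))) powr q"
    proof (intro powr_mono2)
      have "(A + B) * (l * (cmod (f x) / A) + (1 - l) * (cmod (g x) / B)) = cmod (f x) + cmod (g x)"
      proof -
        have "s * (A / s * u + B / s * v) = A * u + B * v" if "s \<noteq> 0" for s u v
          using that by (simp add: field_simps)
        then have "(A + B) * (l * (cmod (f x) / A) + (1 - l) * (cmod (g x) / B)) = A * (cmod (f x) / A) + B * (cmod (g x) / B)"
          unfolding l(3) unfolding l_def using A B by (metis add_pos_pos less_irrefl)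
        then show ?thesis using A B by simp
      qed
      then show "cmod (f x + g x) \<le> (A + B) * (l * (cmod (f x) / A) + (1 - l) * (cmod (g x) / B))"
        using norm_triangle_ineq by simp
    qed (use assms in auto)
    also have "\<dots> = (A + B) powr q * (l * (cmod (f x) / A) + (1 - l) * (cmod (g x) / B)) powr q" by (rule powr_mult)
    also have "\<dots> \<le> (A + B) powr q * (l * (cmod (f x) / A) powr q + (1 - l) * (cmod (g x) / B) powr q)"
      using A B l assms by (intro mult_left_mono powr_convex2) auto
    also have "\<dots> = a * cmod (f x) powr q + b * cmod (g x) powr q"
      unfolding a_def b_def using A B by (simp add: powr_divide distrib_left)
    finally show ?thesis .
  qed
  from Iq_mono_sum[OF assms(1,2) ab this]
  have "mean_power q (\<lambda>x. f x + g x) \<le> a * mean_power q f + b * mean_power q g"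
    using ab by (intro mean_power_le) (auto simp: mean_power_nonneg)
  also have "\<dots> \<le> a * A powr q + b * B powr q" using mA mB ab by (intro add_mono mult_left_mono) auto
  also have "\<dots> = (A + B) powr q"
  proof -
    have "a * A powr q = (A + B) powr q * l" "b * B powr q = (A + B) powr q * (1 - l)"
      unfolding a_def b_def using A B by simp_all
    then show ?thesis by (simp add: distrib_left[symmetric])
  qed
  finally have "mean_power q (\<lambda>x. f x + g x) powr (1 / q) \<le> ((A + B) powr q) powr (1 / q)"
    using assms mean_power_nonneg by (intro powr_mono2) auto
  also have "\<dots> = A + B" using A B assms(3) by (simp add: powr_powr)
  finally show "mean_power q (\<lambda>x. f x + g x) powr (1 / q) \<le> mean_power q f powr (1 / q) + mean_power q g powr (1 / q) + e"
    unfolding A_def B_def by simp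
qed

lemma gauge_small: assumes "0 < q" "q \<le> 1" shows "gauge (Lq q) (mean_power q) q"
  using assms by unfold_locales (auto simp: Lq_add Lq_scale Lq_shift Lq_trig mean_power_nonneg mean_power_add_le_small)

lemma gauge_large: assumes "q \<ge> 1" shows "gauge (Lq q) (\<lambda>f. mean_power q f powr (1 / q)) 1"
  using assms by unfold_locales (auto simp: Lq_add Lq_scale Lq_shift Lq_trig mean_power_nonneg minkowski powr_mult powr_powr)

section \<open>Continuous periodic functions with the supremum norm\<close>

definition Cper :: "(real \<Rightarrow> complex) set" where
  "Cper = {f. torus_fun f \<and> continuous_on UNIV f}"

definition sup_norm :: "(real \<Rightarrow> complex) \<Rightarrow> real" where
  "sup_norm f = enn2real (SUP x. ennreal (cmod (f x)))"

lemma Cper_bounded: assumes "f \<in> Cper" obtains K where "K \<ge> 0" "\<And>x. cmod (f x) \<le> K"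
proof -
  have "compact (f ` {0..2 * pi})" using assms unfolding Cper_def
    by (intro compact_continuous_image) (auto intro: continuous_on_subset)
  then obtain K where K: "\<And>y. y \<in> f ` {0..2 * pi} \<Longrightarrow> cmod y \<le> K" using compact_imp_bounded bounded_iff by metis
  have "cmod (f x) \<le> K" for x
  proof -
    define k where "k = \<lfloor>x / (2 * pi)\<rfloor>"
    have "of_int k \<le> x / (2 * pi)" "x / (2 * pi) \<le> of_int k + 1" unfolding k_def by linarith+
    then have "x - of_int k * (2 * pi) \<in> {0..2 * pi}" by (auto simp: field_simps)
    then have "cmod (f (x - of_int k * (2 * pi))) \<le> K" using K by blast
    moreover have "f ((x - of_int k * (2 * pi)) + of_int k * (2 * pi)) = f (x - of_int k * (2 * pi))"
      using assms unfolding Cper_def by (intro torus_fun_int) auto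
    ultimately show ?thesis by simp
  qed
  then show ?thesis using that[of K] by (meson norm_ge_zero order_trans)
qed

lemma sup_norm_ge: assumes "f \<in> Cper" shows "cmod (f x) \<le> sup_norm f"
proof -
  obtain K where K: "K \<ge> 0" "\<And>x. cmod (f x) \<le> K" using Cper_bounded[OF assms] by blast
  have "(SUP x. ennreal (cmod (f x))) \<le> ennreal K" using K by (intro SUP_least ennreal_leI) auto
  then have "(SUP x. ennreal (cmod (f x))) < top" by (rule le_less_trans) simp
  moreover have "ennreal (cmod (f x)) \<le> (SUP x. ennreal (cmod (f x)))" by (rule SUP_upper) simp
  ultimately have "ennreal (cmod (f x)) \<le> ennreal (sup_norm f)"
    unfolding sup_norm_def by simp
  moreover have "0 \<le> sup_norm f" unfolding sup_norm_def by simp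
  ultimately show ?thesis by (simp add: ennreal_le_iff)
qed

lemma sup_norm_le: assumes "\<And>x. cmod (f x) \<le> B" shows "sup_norm f \<le> B"
proof -
  have "0 \<le> B" using assms[of 0] norm_ge_zero order_trans by blast
  then show ?thesis unfolding sup_norm_def using assms by (intro enn2real_leI SUP_least ennreal_leI) auto
qed

lemma sup_norm_nonneg: "0 \<le> sup_norm f"
  unfolding sup_norm_def by simp

lemma Cper_add: "f \<in> Cper \<Longrightarrow> g \<in> Cper \<Longrightarrow> (\<lambda>x. f x + g x) \<in> Cper"
  unfolding Cper_def torus_fun_def by (auto intro: continuous_intros)

lemma Cper_scale: "f \<in> Cper \<Longrightarrow> (\<lambda>x. c * f x) \<in> Cper"
  unfolding Cper_def torus_fun_def by (auto intro: continuous_intros)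

lemma Cper_shift: assumes "f \<in> Cper" shows "(\<lambda>x. f (x + t)) \<in> Cper"
proof -
  have "f ((x + t) + 2 * pi) = f (x + t)" for x using assms unfolding Cper_def torus_fun_def by blast
  then have "torus_fun (\<lambda>x. f (x + t))" unfolding torus_fun_def by (simp add: algebra_simps)
  moreover have "continuous_on UNIV (\<lambda>x. f (x + t))"
    using assms unfolding Cper_def by (auto intro!: continuous_on_compose2[of UNIV f] continuous_intros)
  ultimately show ?thesis unfolding Cper_def by blast
qed

lemma gauge_sup: "gauge Cper sup_norm 1"
proof
  fix f g :: "real \<Rightarrow> complex" and c :: complex and t :: real
  assume f: "f \<in> Cper"
  show "(\<lambda>x. c * f x) \<in> Cper" by (rule Cper_scale[OF f])
  show "(\<lambda>x. f (x + t)) \<in> Cper" by (rule Cper_shift[OF f])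
  show "sup_norm (\<lambda>x. c * f x) = cmod c powr 1 * sup_norm f"
  proof (rule antisym)
    show "sup_norm (\<lambda>x. c * f x) \<le> cmod c powr 1 * sup_norm f"
      by (rule sup_norm_le) (simp add: norm_mult mult_left_mono sup_norm_ge[OF f])
    show "cmod c powr 1 * sup_norm f \<le> sup_norm (\<lambda>x. c * f x)"
    proof (cases "c = 0")
      case False
      have "sup_norm f \<le> sup_norm (\<lambda>x. c * f x) / cmod c"
      proof (rule sup_norm_le)
        fix x
        show "cmod (f x) \<le> sup_norm (\<lambda>x. c * f x) / cmod c"
          using sup_norm_ge[OF Cper_scale[OF f, of c], of x] False by (simp add: norm_mult field_simps)
      qed
      then show ?thesis using False by (simp add: field_simps)
    qed (simp add: sup_norm_nonneg)
  qed
  show "sup_norm (\<lambda>x. f (x + t)) = sup_norm f"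
  proof (rule antisym)
    show "sup_norm (\<lambda>x. f (x + t)) \<le> sup_norm f" by (rule sup_norm_le) (rule sup_norm_ge[OF f])
    show "sup_norm f \<le> sup_norm (\<lambda>x. f (x + t))"
    proof (rule sup_norm_le)
      fix x show "cmod (f x) \<le> sup_norm (\<lambda>x. f (x + t))" using sup_norm_ge[OF Cper_shift[OF f, of t], of "x - t"] by simp
    qed
  qed
  assume g: "g \<in> Cper"
  show "(\<lambda>x. f x + g x) \<in> Cper" by (rule Cper_add[OF f g])
  show "sup_norm (\<lambda>x. f x + g x) \<le> sup_norm f + sup_norm g"
    by (rule sup_norm_le) (meson add_mono norm_triangle_ineq order_trans sup_norm_ge f g)
next
  fix T n assume "T \<in> trig_polys n"
  then show "T \<in> Cper"
    unfolding Cper_def using trig_continuous[of T n] torus_fun_tspan by (auto simp: trig_polys_eq_tspan)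
qed (auto simp: sup_norm_nonneg)

section \<open>The Jackson theorem for small exponents\<close>

text \<open>Averaging over two lattice positions exchanges integrals over the Borel plane, so a
  Lebesgue measurable function is first replaced by a Borel one at distance zero.\<close>

lemma Lq_borel_representative:
  assumes "f \<in> Lq q" "q > 0"
  obtains g where "g \<in> Lq q" "g \<in> borel_measurable borel" "mean_power q (\<lambda>x. f x - g x) = 0"
proof -
  have fm: "f \<in> borel_measurable lebesgue" and per: "torus_fun f" and fin: "Iq q f < \<infinity>" using assms unfolding Lq_def by auto
  have "(\<lambda>x. Re (f x)) \<in> borel_measurable lebesgue" "(\<lambda>x. Im (f x)) \<in> borel_measurable lebesgue"
    using fm by (auto intro!: borel_measurable_Re borel_measurable_Im simp: borel_measurable_complex_iff[of f])
  then obtain u v where u: "u \<in> borel_measurable lborel" "AE x in lborel. Re (f x) = u x"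
    and v: "v \<in> borel_measurable lborel" "AE x in lborel. Im (f x) = v x"
    using completion_ex_borel_measurable_real by metis
  define h where "h x = Complex (u x) (v x)" for x
  have hm [measurable]: "h \<in> borel_measurable borel"
    unfolding borel_measurable_complex_iff h_def using u(1) v(1) by simp
  have ae: "AE x in lborel. f x = h x" using u(2) v(2) unfolding h_def by eventually_elim (simp add: complex_eq_iff)
  \<comment> \<open>The Borel function \<open>h\<close> agrees with f almost everywhere but may fail
    to be periodic; its restriction to one period is extended periodically.\<close>
  define g where "g x = h (x - 2 * pi * of_int \<lfloor>x / (2 * pi)\<rfloor>)" for x
  have gm [measurable]: "g \<in> borel_measurable borel" unfolding g_def by measurable
  have gh: "g x = h x" if "x \<in> {0..<2 * pi}" for x
  proof -
    have "\<lfloor>x / (2 * pi)\<rfloor> = 0" using that by (simp add: floor_eq_iff field_simps)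
    then show ?thesis unfolding g_def by simp
  qed
  have gper: "torus_fun g"
  proof -
    have "\<lfloor>(x + 2 * pi) / (2 * pi)\<rfloor> = \<lfloor>x / (2 * pi)\<rfloor> + 1" for x by (simp add: add_divide_distrib)
    then show ?thesis unfolding torus_fun_def g_def by (simp add: algebra_simps)
  qed
  have "Iq q g = Iq q f"
    unfolding Iq_def nn_integral_completion
  proof (rule nn_integral_cong_AE)
    show "AE x in lborel. ennreal (cmod (g x) powr q) * indicator {0..<2 * pi} x = ennreal (cmod (f x) powr q) * indicator {0..<2 * pi} x"
      using ae by eventually_elim (auto simp: gh indicator_def)
  qed
  moreover have "g \<in> borel_measurable lebesgue" using gm by (intro measurable_completion) simp
  ultimately have gL: "g \<in> Lq q" using gper fin unfolding Lq_def by simp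
  have "Iq q (\<lambda>x. f x - g x) = (\<integral>\<^sup>+x. 0 \<partial>(lborel :: real measure))"
    unfolding Iq_def nn_integral_completion
  proof (rule nn_integral_cong_AE)
    show "AE x in lborel. ennreal (cmod (f x - g x) powr q) * indicator {0..<2 * pi} x = 0"
      using ae by eventually_elim (auto simp: gh indicator_def)
  qed
  then have "mean_power q (\<lambda>x. f x - g x) = 0" unfolding mean_power_def by simp
  then show ?thesis using that gL gm by blast
qed

section \<open>Averaging over the position of a sampling lattice\<close>

lemma nn_integral_shift_borel:
  fixes g :: "real \<Rightarrow> ennreal" assumes "g \<in> borel_measurable borel"
  shows "(\<integral>\<^sup>+x\<in>{a..<b}. g (x + t) \<partial>lborel) = (\<integral>\<^sup>+x\<in>{a + t..<b + t}. g x \<partial>lborel)"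
proof -
  have "g \<in> borel_measurable lebesgue" using assms by (intro measurable_completion) simp
  from nn_integral_shift_lebesgue[OF this, where a = a and b = b and t = t]
  show ?thesis unfolding nn_integral_completion .
qed

lemma lattice_integral:
  fixes g :: "real \<Rightarrow> ennreal" assumes [measurable]: "g \<in> borel_measurable borel" and "t \<ge> 0"
  shows "(\<integral>\<^sup>+x\<in>{0..<real n * t}. g x \<partial>lborel) = (\<integral>\<^sup>+a\<in>{0..<t}. (\<Sum>y<n. g (a + real y * t)) \<partial>lborel)"
proof (induction n)
  case 0
  then show ?case by simp
next
  case (Suc n)
  have "(\<integral>\<^sup>+x\<in>{0..<real (Suc n) * t}. g x \<partial>lborel)
    = (\<integral>\<^sup>+x. g x * indicator {0..<real n * t} x + g x * indicator {0 + real n * t..<t + real n * t} x \<partial>lborel)"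
  proof (rule nn_integral_cong)
    fix x
    have gen: "g x * indicator {0..<t + c} x = g x * indicator {0..<c} x + g x * indicator {0 + c..<t + c} x" if "0 \<le> c" for c
      using assms(2) that by (auto simp: indicator_def)
    have eq: "real (Suc n) * t = t + real n * t" by (simp add: distrib_right)
    show "g x * indicator {0..<real (Suc n) * t} x = g x * indicator {0..<real n * t} x + g x * indicator {0 + real n * t..<t + real n * t} x"
      unfolding eq by (rule gen) (use assms(2) in simp)
  qed
  also have "\<dots> = (\<integral>\<^sup>+x\<in>{0..<real n * t}. g x \<partial>lborel) + (\<integral>\<^sup>+x\<in>{0 + real n * t..<t + real n * t}. g x \<partial>lborel)"
    by (rule nn_integral_add) measurable
  also have "(\<integral>\<^sup>+x\<in>{0 + real n * t..<t + real n * t}. g x \<partial>lborel) = (\<integral>\<^sup>+a\<in>{0..<t}. g (a + real n * t) \<partial>lborel)"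
    by (rule nn_integral_shift_borel[symmetric]) measurable
  also have "(\<integral>\<^sup>+x\<in>{0..<real n * t}. g x \<partial>lborel) = (\<integral>\<^sup>+a\<in>{0..<t}. (\<Sum>y<n. g (a + real y * t)) \<partial>lborel)" by (rule Suc)
  also have "\<dots> + (\<integral>\<^sup>+a\<in>{0..<t}. g (a + real n * t) \<partial>lborel)
    = (\<integral>\<^sup>+a. (\<Sum>y<n. g (a + real y * t)) * indicator {0..<t} a + g (a + real n * t) * indicator {0..<t} a \<partial>lborel)"
    by (rule nn_integral_add[symmetric]) measurable
  finally show ?case by (simp add: distrib_right)
qed

text \<open>The substitution a = b + h turns the inner integral into one over |h| \<le> \<tau>.
  After exchanging the order, for fixed h the lattice sum through b integrates over b to an integral
  over the full period, which is at most \<Omega>; the factor 2\<tau> is the length of the range of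
  h.\<close>

lemma average_over_lattices:
  fixes u v :: "real \<Rightarrow> complex"
  assumes [measurable]: "u \<in> borel_measurable borel" "v \<in> borel_measurable borel"
    and tau: "\<tau> > 0" "real N * \<tau> = 2 * pi"
    and bound: "\<And>h. \<bar>h\<bar> \<le> \<tau> \<Longrightarrow> (\<integral>\<^sup>+x\<in>{0..<2 * pi}. ennreal (cmod (u (x + h) - v x) powr q) \<partial>lborel) \<le> \<Omega>"
  shows "(\<integral>\<^sup>+b\<in>{0..<\<tau>}. (\<integral>\<^sup>+a\<in>{0..<\<tau>}. (\<Sum>y<N. ennreal (cmod (u (a + real y * \<tau>) - v (b + real y * \<tau>)) powr q)) \<partial>lborel) \<partial>lborel) \<le> ennreal (2 * \<tau>) * \<Omega>"
proof -
  define G where "G a b = (\<Sum>y<N. ennreal (cmod (u (a + real y * \<tau>) - v (b + real y * \<tau>)) powr q))" for a b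
  have [measurable]: "(\<lambda>x. G (f x) (g x)) \<in> borel_measurable M" if [measurable]: "f \<in> borel_measurable M" "g \<in> borel_measurable M" for f g and M :: "'b measure"
    unfolding G_def by measurable
  have [measurable]: "{0..<\<tau>} \<in> sets borel" "{- \<tau>..\<tau>} \<in> sets borel" by simp_all
  define K where "K b h = G (b + h) b * indicator {- \<tau>..\<tau>} h * indicator {0..<\<tau>} b" for b h
  have inner: "(\<integral>\<^sup>+a\<in>{0..<\<tau>}. G a b \<partial>lborel) * indicator {0..<\<tau>} b \<le> (\<integral>\<^sup>+h. K b h \<partial>lborel)" for b
  proof (cases "b \<in> {0..<\<tau>}")
    case True
    have "(\<integral>\<^sup>+a\<in>{0..<\<tau>}. G a b \<partial>lborel) = (\<integral>\<^sup>+h. G (b + 1 * h) b * indicator {0..<\<tau>} (b + 1 * h) \<partial>lborel)"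
    proof -
      have "(\<lambda>a. G a b * indicator {0..<\<tau>} a) \<in> borel_measurable borel" by measurable
      from nn_integral_real_affine[OF this, of 1 b] show ?thesis by simp
    qed
    also have "\<dots> \<le> (\<integral>\<^sup>+h. K b h \<partial>lborel)"
      using True unfolding K_def by (intro nn_integral_mono) (auto simp: indicator_def)
    finally show ?thesis using True by simp
  qed simp
  have outer: "(\<integral>\<^sup>+b. K b h \<partial>lborel) \<le> \<Omega> * indicator {- \<tau>..\<tau>} h" for h
  proof (cases "h \<in> {- \<tau>..\<tau>}")
    case True
    have "(\<integral>\<^sup>+b. K b h \<partial>lborel) = (\<integral>\<^sup>+b\<in>{0..<\<tau>}. (\<Sum>y<N. ennreal (cmod (u (b + real y * \<tau> + h) - v (b + real y * \<tau>)) powr q)) \<partial>lborel)"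
      using True unfolding K_def G_def by (intro nn_integral_cong) (simp add: algebra_simps)
    also have "\<dots> = (\<integral>\<^sup>+x\<in>{0..<real N * \<tau>}. ennreal (cmod (u (x + h) - v x) powr q) \<partial>lborel)"
      using tau by (intro lattice_integral[symmetric]) auto
    also have "\<dots> \<le> \<Omega>" unfolding tau(2) using True by (intro bound) auto
    finally show ?thesis using True by simp
  qed (simp add: K_def)
  have "(\<integral>\<^sup>+b\<in>{0..<\<tau>}. (\<integral>\<^sup>+a\<in>{0..<\<tau>}. G a b \<partial>lborel) \<partial>lborel) \<le> (\<integral>\<^sup>+b. (\<integral>\<^sup>+h. K b h \<partial>lborel) \<partial>lborel)"
    by (rule nn_integral_mono) (rule inner)
  also have "\<dots> = (\<integral>\<^sup>+h. (\<integral>\<^sup>+b. K b h \<partial>lborel) \<partial>lborel)"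
    by (rule lborel_pair.Fubini'[symmetric]) (unfold K_def, measurable)
  also have "\<dots> \<le> (\<integral>\<^sup>+h. \<Omega> * indicator {- \<tau>..\<tau>} h \<partial>lborel)"
    by (rule nn_integral_mono) (rule outer)
  also have "\<dots> = ennreal (2 * \<tau>) * \<Omega>"
    using tau by (subst nn_integral_cmult_indicator) (simp_all add: mult.commute)
  finally show ?thesis unfolding G_def .
qed

lemma ex_le_average:
  fixes F :: "real \<Rightarrow> ennreal"
  assumes "\<tau> > 0" "S \<ge> 0" "\<epsilon> > 0" "(\<integral>\<^sup>+a\<in>{0..<\<tau>}. F a \<partial>lborel) \<le> ennreal (\<tau> * S)"
  shows "\<exists>a\<in>{0..<\<tau>}. F a \<le> ennreal (S + \<epsilon>)"
proof (rule ccontr)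
  assume "\<not> ?thesis"
  then have mono: "ennreal (S + \<epsilon>) * indicator {0..<\<tau>} a \<le> F a * indicator {0..<\<tau>} a" for a
    by (auto simp: indicator_def not_le less_imp_le simp del: ennreal_plus)
  have "(\<integral>\<^sup>+a. ennreal (S + \<epsilon>) * indicator {0..<\<tau>} a \<partial>lborel) \<le> ennreal (\<tau> * S)"
    by (rule order_trans[OF nn_integral_mono assms(4)]) (rule mono)
  also have "(\<integral>\<^sup>+a. ennreal (S + \<epsilon>) * indicator {0..<\<tau>} a \<partial>lborel) = ennreal ((S + \<epsilon>) * \<tau>)"
    using assms by (subst nn_integral_cmult_indicator) (auto simp: ennreal_mult' simp del: ennreal_plus)
  finally have "(S + \<epsilon>) * \<tau> \<le> \<tau> * S" using assms by (subst (asm) ennreal_le_iff) auto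
  then have "\<epsilon> * \<tau> \<le> 0" by (simp add: algebra_simps)
  then show False using assms by (simp add: mult_le_0_iff)
qed

section \<open>Discrete convolution on a lattice and its iterated remainder\<close>

definition avg_op :: "(int \<Rightarrow> complex) \<Rightarrow> nat \<Rightarrow> real \<Rightarrow> (real \<Rightarrow> complex) \<Rightarrow> real \<Rightarrow> complex" where
  "avg_op \<kappa> R \<tau> u x = (\<Sum>l\<in>{- int R..int R}. \<kappa> l * u (x + of_int l * \<tau>))"

definition rest_op :: "(int \<Rightarrow> complex) \<Rightarrow> nat \<Rightarrow> real \<Rightarrow> (real \<Rightarrow> complex) \<Rightarrow> real \<Rightarrow> complex" where
  "rest_op \<kappa> R \<tau> u x = u x - avg_op \<kappa> R \<tau> u x"

text \<open>Because the weights add up to 1, the remainder involves only first differences of u; K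
  iterations therefore produce K-th differences in \<open>Q_rest_op\<close>.\<close>

lemma rest_op_eq:
  assumes "(\<Sum>l\<in>{- int R..int R}. \<kappa> l) = 1"
  shows "rest_op \<kappa> R \<tau> u = (\<lambda>x. \<Sum>l\<in>{- int R..int R}. \<kappa> l * fdiff 1 (of_int l * \<tau>) u x)"
proof
  fix x
  have "(\<Sum>l\<in>{- int R..int R}. \<kappa> l * fdiff 1 (of_int l * \<tau>) u x) = (\<Sum>l\<in>{- int R..int R}. \<kappa> l) * u x - avg_op \<kappa> R \<tau> u x"
    unfolding fdiff_1 avg_op_def right_diff_distrib sum_subtractf sum_distrib_right by simp
  then show "rest_op \<kappa> R \<tau> u x = (\<Sum>l\<in>{- int R..int R}. \<kappa> l * fdiff 1 (of_int l * \<tau>) u x)"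
    unfolding rest_op_def assms by simp
qed

lemma rest_op_fdiff: "fdiff k d (rest_op \<kappa> R \<tau> u) = rest_op \<kappa> R \<tau> (fdiff k d u)"
  unfolding rest_op_def avg_op_def fdiff_diff fdiff_lincomb fdiff_shift ..

lemma rest_op_funpow_fdiff: "fdiff k d ((rest_op \<kappa> R \<tau> ^^ K) u) = (rest_op \<kappa> R \<tau> ^^ K) (fdiff k d u)"
  by (induction K) (simp_all add: rest_op_fdiff)

lemma torus_fun_rest_op: assumes "torus_fun u" shows "torus_fun ((rest_op \<kappa> R \<tau> ^^ K) u)"
proof (induction K)
  case (Suc K)
  define w where "w = (rest_op \<kappa> R \<tau> ^^ K) u"
  have "w (x + 2 * pi + t) = w (x + t)" for x t
  proof -
    have "w ((x + t) + 2 * pi) = w (x + t)" using Suc unfolding w_def torus_fun_def by blast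
    then show ?thesis by (simp add: algebra_simps)
  qed
  moreover have "w (x + 2 * pi) = w x" for x using Suc unfolding w_def torus_fun_def by blast
  ultimately have "torus_fun (rest_op \<kappa> R \<tau> w)" unfolding torus_fun_def rest_op_def avg_op_def by simp
  then show ?case unfolding w_def by simp
qed (use assms in simp)

context gauge
begin

lemma X_rest_op: assumes "u \<in> X" shows "(rest_op \<kappa> R \<tau> ^^ K) u \<in> X"
proof (induction K)
  case (Suc K)
  have "rest_op \<kappa> R \<tau> w \<in> X" if "w \<in> X" for w
    unfolding rest_op_def avg_op_def by (rule X_diff[OF that X_shift_comb[OF that]])
  from this[OF Suc] show ?case by simp
qed (use assms in simp)

text \<open>Each factor of the remainder is bounded by C times one difference with step \<tau>, a
  step l\<tau> costing |l|. That difference commutes with the remaining factors, so the differences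
  accumulate.\<close>

lemma Q_rest_op:
  assumes "u \<in> X" "(\<Sum>l\<in>{- int R..int R}. \<kappa> l) = 1" "(\<Sum>l\<in>{- int R..int R}. cmod (\<kappa> l) powr \<theta> * \<bar>of_int l\<bar>) \<le> C"
  shows "Q ((rest_op \<kappa> R \<tau> ^^ K) u) \<le> C ^ K * Q (fdiff K \<tau> u)"
  using assms(1)
proof (induction K arbitrary: u)
  case 0
  then show ?case by (simp add: fdiff_0)
next
  case (Suc K)
  have C0: "C \<ge> 0" using assms(3) by (rule order_trans[rotated]) (auto intro!: sum_nonneg)
  define w where "w = (rest_op \<kappa> R \<tau> ^^ K) u"
  have w: "w \<in> X" unfolding w_def by (rule X_rest_op[OF Suc.prems])
  have each: "Q (fdiff 1 (of_int l * \<tau>) w) \<le> \<bar>of_int l\<bar> * Q (fdiff 1 \<tau> w)" for l :: int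
  proof -
    have "real (nat \<bar>l\<bar>) * \<tau> = of_int l * \<tau> \<or> real (nat \<bar>l\<bar>) * \<tau> = - (of_int l * \<tau>)" by (cases "l \<ge> 0") auto
    then have "Q (fdiff 1 (of_int l * \<tau>) w) = Q (fdiff 1 (real (nat \<bar>l\<bar>) * \<tau>) w)"
      using Q_fdiff_neg[OF w, of 1 "of_int l * \<tau>"] by auto
    also have "\<dots> \<le> real (nat \<bar>l\<bar>) * Q (fdiff 1 \<tau> w)" by (rule Q_fdiff_multiple_1[OF w])
    finally show ?thesis by simp
  qed
  have "Q (rest_op \<kappa> R \<tau> w) \<le> (\<Sum>l\<in>{- int R..int R}. cmod (\<kappa> l) powr \<theta> * Q (fdiff 1 (of_int l * \<tau>) w))"
    unfolding rest_op_eq[OF assms(2)] by (rule Q_lincomb) (rule X_fdiff[OF w])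
  also have "\<dots> \<le> (\<Sum>l\<in>{- int R..int R}. (cmod (\<kappa> l) powr \<theta> * \<bar>of_int l\<bar>) * Q (fdiff 1 \<tau> w))"
    unfolding mult.assoc by (intro sum_mono mult_left_mono each) auto
  also have "\<dots> \<le> C * Q (fdiff 1 \<tau> w)"
    unfolding sum_distrib_right[symmetric] by (intro mult_right_mono assms(3) Q_nonneg)
  also have "fdiff 1 \<tau> w = (rest_op \<kappa> R \<tau> ^^ K) (fdiff 1 \<tau> u)" unfolding w_def by (rule rest_op_funpow_fdiff)
  also have "C * Q ((rest_op \<kappa> R \<tau> ^^ K) (fdiff 1 \<tau> u)) \<le> C * (C ^ K * Q (fdiff K \<tau> (fdiff 1 \<tau> u)))"
    by (intro mult_left_mono C0 Suc.IH X_fdiff Suc.prems)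
  finally show ?case unfolding w_def by (simp only: fdiff_Suc' power_Suc mult.assoc funpow.simps o_apply)
qed

end

text \<open>The polynomial is the sum of u(node) W(x - node) / N over the lattice. When x is itself
  a lattice point, x - node is again a multiple of the spacing, and periodicity allows recentring
  the summation window at x, which gives the discrete convolution.\<close>

lemma lattice_poly:
  assumes "torus_fun u" "N = 2 * R + 1" "W \<in> trig_polys n"
  shows "\<exists>T\<in>trig_polys n. \<forall>j::int. T (a + of_int j * (2 * pi / real N)) =
    avg_op (\<lambda>l. W (- (of_int l * (2 * pi / real N))) / of_nat N) R (2 * pi / real N) u (a + of_int j * (2 * pi / real N))"
proof -
  define \<tau> where "\<tau> = 2 * pi / real N"
  have N0: "N > 0" using assms by simp
  have Nt: "real N * \<tau> = 2 * pi" unfolding \<tau>_def using N0 by simp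
  let ?I = "{- int R..int R}"
  have I: "?I = {- int R..< - int R + int N}" using assms(2) by auto
  define T where "T x = (\<Sum>l\<in>?I. (u (a + of_int l * \<tau>) / of_nat N) * W (x + (- (a + of_int l * \<tau>))))" for x
  have "T \<in> tspan (- int n) (int n)"
    unfolding T_def by (rule tspan_sum, rule tspan_scale, rule tspan_shift) (use assms(3) in \<open>simp add: trig_polys_eq_tspan\<close>)
  moreover have "T (a + of_int j * \<tau>) = avg_op (\<lambda>l. W (- (of_int l * \<tau>)) / of_nat N) R \<tau> u (a + of_int j * \<tau>)" for j :: int
  proof -
    define g where "g l = u (a + of_int l * \<tau>) / of_nat N * W (of_int (j - l) * \<tau>)" for l :: int
    have per: "g (l + int N) = g l" for l
    proof -
      have "u ((a + of_int l * \<tau>) + of_int 1 * (2 * pi)) = u (a + of_int l * \<tau>)" by (rule torus_fun_int[OF assms(1)])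
      moreover have "W (of_int (j - l) * \<tau> + of_int (-1) * (2 * pi)) = W (of_int (j - l) * \<tau>)"
        using assms(3) by (intro torus_fun_int torus_fun_tspan) (simp add: trig_polys_eq_tspan)
      moreover have "a + of_int (l + int N) * \<tau> = (a + of_int l * \<tau>) + of_int 1 * (2 * pi)"
        "of_int (j - (l + int N)) * \<tau> = of_int (j - l) * \<tau> + of_int (-1) * (2 * pi)"
        unfolding Nt[symmetric] by (simp_all add: algebra_simps)
      ultimately show ?thesis unfolding g_def by (simp only:)
    qed
    have "T (a + of_int j * \<tau>) = sum g ?I"
      unfolding T_def g_def by (intro sum.cong refl arg_cong2[where f = "(*)"] arg_cong[where f = W]) (simp_all add: algebra_simps)
    also have "\<dots> = sum g {- int R + j..< - int R + j + int N}"
      unfolding I by (rule sum_periodic_int) (use per N0 in auto)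
    also have "\<dots> = (\<Sum>l\<in>?I. g (l + j))"
      unfolding I by (rule sum.reindex_bij_witness[of _ "\<lambda>l. l + j" "\<lambda>l. l - j"]) auto
    also have "\<dots> = avg_op (\<lambda>l. W (- (of_int l * \<tau>)) / of_nat N) R \<tau> u (a + of_int j * \<tau>)"
      unfolding avg_op_def g_def by (intro sum.cong refl) (simp add: algebra_simps)
    finally show ?thesis .
  qed
  ultimately show ?thesis unfolding \<tau>_def trig_polys_eq_tspan by blast
qed

text \<open>With A the discrete convolution, 1 - (1 - A)^K is a sum of values of A, each of which is
  on the lattice the trace of a polynomial of degree n by \<open>lattice_poly\<close>; the induction
  adds one such polynomial per step.\<close>

lemma lattice_rest:
  assumes "torus_fun f" "N = 2 * R + 1" "W \<in> trig_polys n"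
  defines "\<kappa> \<equiv> \<lambda>l. W (- (of_int l * (2 * pi / real N))) / of_nat N"
  shows "\<exists>T\<in>trig_polys n. \<forall>j::int. f (a + of_int j * (2 * pi / real N)) - T (a + of_int j * (2 * pi / real N)) =
    (rest_op \<kappa> R (2 * pi / real N) ^^ K) f (a + of_int j * (2 * pi / real N))"
proof (induction K)
  case 0
  show ?case by (intro bexI[of _ "\<lambda>x. 0"]) (simp_all add: trig_polys_eq_tspan tspan_zero)
next
  case (Suc K)
  define w where "w = (rest_op \<kappa> R (2 * pi / real N) ^^ K) f"
  obtain T where T: "T \<in> trig_polys n" "\<And>j::int. f (a + of_int j * (2 * pi / real N)) - T (a + of_int j * (2 * pi / real N)) = w (a + of_int j * (2 * pi / real N))"
    using Suc unfolding w_def by blast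
  have "torus_fun w" unfolding w_def by (rule torus_fun_rest_op[OF assms(1)])
  from lattice_poly[OF this assms(2,3), of a]
  obtain S where S: "S \<in> trig_polys n" "\<And>j::int. S (a + of_int j * (2 * pi / real N)) = avg_op \<kappa> R (2 * pi / real N) w (a + of_int j * (2 * pi / real N))"
    unfolding \<kappa>_def by blast
  have "(\<lambda>x. T x + S x) \<in> trig_polys n" using T(1) S(1) unfolding trig_polys_eq_tspan by (rule tspan_add)
  moreover have "f (a + of_int j * (2 * pi / real N)) - (T (a + of_int j * (2 * pi / real N)) + S (a + of_int j * (2 * pi / real N)))
    = (rest_op \<kappa> R (2 * pi / real N) ^^ Suc K) f (a + of_int j * (2 * pi / real N))" for j :: int
  proof -
    define x where "x = a + of_int j * (2 * pi / real N)"
    have "f x - (T x + S x) = (f x - T x) - S x" by simp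
    also have "\<dots> = rest_op \<kappa> R (2 * pi / real N) w x" unfolding x_def T(2) S(2) rest_op_def ..
    finally show ?thesis unfolding x_def w_def by simp
  qed
  ultimately show ?case by (intro bexI[of _ "\<lambda>x. T x + S x"] allI)
qed

lemma sum_lattice_shift:
  fixes g :: "real \<Rightarrow> 'a::comm_monoid_add"
  assumes "\<And>x. g (x + 2 * pi) = g x" "N > 0" "\<tau> = 2 * pi / real N"
  shows "(\<Sum>y<N. g (a + real y * \<tau> + of_int j * \<tau>)) = (\<Sum>y<N. g (a + real y * \<tau>))"
proof -
  define h where "h l = g (a + of_int l * \<tau>)" for l :: int
  have per: "h (l + int N) = h l" for l
  proof -
    have "a + of_int (l + int N) * \<tau> = (a + of_int l * \<tau>) + 2 * pi" using assms(2,3) by (simp add: field_simps)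
    then show ?thesis unfolding h_def by (simp only: assms(1))
  qed
  have "(\<Sum>y<N. g (a + real y * \<tau> + of_int j * \<tau>)) = sum h {j..<j + int N}"
    by (rule sum.reindex_bij_witness[of _ "\<lambda>l. nat (l - j)" "\<lambda>y. int y + j"]) (auto simp: h_def algebra_simps)
  also have "\<dots> = sum h {0..<0 + int N}" by (rule sum_periodic_int) (use per assms in auto)
  also have "\<dots> = (\<Sum>y<N. g (a + real y * \<tau>))"
    by (rule sum.reindex_bij_witness[of _ int nat]) (auto simp: h_def)
  finally show ?thesis .
qed

definition lattice_sum :: "real \<Rightarrow> nat \<Rightarrow> real \<Rightarrow> (real \<Rightarrow> complex) \<Rightarrow> real \<Rightarrow> real" where
  "lattice_sum q N \<tau> u a = (\<Sum>y<N. cmod (u (a + real y * \<tau>)) powr q)"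

lemma lattice_sum_nonneg: "0 \<le> lattice_sum q N \<tau> u a"
  unfolding lattice_sum_def by (intro sum_nonneg) auto

lemma Iq_lattice:
  assumes [measurable]: "u \<in> borel_measurable borel" and "\<tau> > 0" "real N * \<tau> = 2 * pi"
  shows "(\<integral>\<^sup>+a\<in>{0..<\<tau>}. ennreal (lattice_sum q N \<tau> u a) \<partial>lborel) = Iq q u"
proof -
  have "Iq q u = (\<integral>\<^sup>+x\<in>{0..<real N * \<tau>}. ennreal (cmod (u x) powr q) \<partial>lborel)"
    unfolding Iq_def nn_integral_completion assms(3) ..
  also have "\<dots> = (\<integral>\<^sup>+a\<in>{0..<\<tau>}. (\<Sum>y<N. ennreal (cmod (u (a + real y * \<tau>)) powr q)) \<partial>lborel)"
    by (rule lattice_integral) (use assms(2) in \<open>measurable, simp\<close>)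
  finally show ?thesis unfolding lattice_sum_def by (simp add: sum_ennreal)
qed

lemma lattice_sum_mono_comb:
  assumes "\<And>y. cmod (w (a + real y * \<tau>)) powr q \<le> A * cmod (u (b + real y * \<tau>)) powr q + B * cmod (v (c + real y * \<tau>)) powr q"
  shows "lattice_sum q N \<tau> w a \<le> A * lattice_sum q N \<tau> u b + B * lattice_sum q N \<tau> v c"
  unfolding lattice_sum_def sum_distrib_left sum.distrib[symmetric] by (intro sum_mono assms)

lemma powr_sum_le:
  fixes z :: "'i \<Rightarrow> complex"
  assumes "0 < q" "q \<le> 1" shows "cmod (\<Sum>i\<in>I. z i) powr q \<le> (\<Sum>i\<in>I. cmod (z i) powr q)"
proof (induction I rule: infinite_finite_induct)
  case (insert i I)
  have "cmod (z i + (\<Sum>i\<in>I. z i)) powr q \<le> (cmod (z i) + cmod (\<Sum>i\<in>I. z i)) powr q"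
    using assms by (intro powr_mono2 norm_triangle_ineq) auto
  also have "\<dots> \<le> cmod (z i) powr q + cmod (\<Sum>i\<in>I. z i) powr q" using assms by (intro powr_add_le) auto
  also have "\<dots> \<le> cmod (z i) powr q + (\<Sum>i\<in>I. cmod (z i) powr q)" using insert.IH by simp
  finally show ?case using insert.hyps by simp
qed simp_all

text \<open>The lattice of the sum refines the kernel nodes by the integer factor m, so a shift by a
  kernel node permutes it modulo 2\<pi> and leaves \<open>lattice_sum\<close> unchanged. What
  remains is the coefficient sum of \<open>weak_bernstein_coeffs\<close>.\<close>

lemma bernstein_lattice:
  assumes "0 < q" "q \<le> 1" "real M * q \<ge> 4"
  shows "\<exists>C>0. \<forall>n m h V a N. m \<ge> 1 \<longrightarrow> N = m * nodes M n \<longrightarrow> \<bar>h\<bar> \<le> 2 * pi / real (nodes M n) \<longrightarrow> V \<in> trig_polys n \<longrightarrow>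
    lattice_sum q N (2 * pi / real N) (\<lambda>x. V (x + h) - V x) a \<le> C * (real n * \<bar>h\<bar>) powr (q / 2) * lattice_sum q N (2 * pi / real N) V a"
proof -
  obtain C where C: "C > 0" and b: "\<And>n h. \<bar>h\<bar> \<le> 2 * pi / real (nodes M n) \<Longrightarrow>
    (\<Sum>j\<in>{- half M n..half M n}. cmod ((ker M n (of_int j * (2 * pi / real (nodes M n)) + h) - ker M n (of_int j * (2 * pi / real (nodes M n)))) / of_nat (nodes M n)) powr q)
      \<le> C * (real n * \<bar>h\<bar>) powr (q / 2)"
    using weak_bernstein_coeffs[OF assms] by blast
  have "lattice_sum q N (2 * pi / real N) (\<lambda>x. V (x + h) - V x) a \<le> C * (real n * \<bar>h\<bar>) powr (q / 2) * lattice_sum q N (2 * pi / real N) V a"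
    if m: "m \<ge> 1" and N: "N = m * nodes M n" and h: "\<bar>h\<bar> \<le> 2 * pi / real (nodes M n)" and V: "V \<in> trig_polys n" for n m h V a N
  proof -
    define \<tau>0 where "\<tau>0 = 2 * pi / real (nodes M n)"
    define \<tau> where "\<tau> = 2 * pi / real N"
    have np: "real (nodes M n) > 0" by (rule nodes_pos)
    then have N0: "N > 0" unfolding N using m by simp
    have t0: "\<tau>0 = real m * \<tau>" unfolding \<tau>0_def \<tau>_def N using m np by simp
    define J where "J = {- half M n..half M n}"
    define b' where "b' j = (ker M n (of_int j * \<tau>0 + h) - ker M n (of_int j * \<tau>0)) / of_nat (nodes M n)" for j
    have rep: "V (x + h) - V x = (\<Sum>j\<in>J. b' j * V (x - of_int j * \<tau>0))" for x
    proof -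
      have "V (x + h') = (\<Sum>j\<in>J. ker M n (of_int j * \<tau>0 + h') / of_nat (nodes M n) * V (x - of_int j * \<tau>0))" for h'
        unfolding \<tau>0_def half_interval J_def by (rule ker_reproduce[OF V nodes_gt])
      from this[of h] this[of 0] show ?thesis
        unfolding b'_def by (simp add: sum_subtractf[symmetric] algebra_simps diff_divide_distrib)
    qed
    have per: "cmod (V (x + 2 * pi)) powr q = cmod (V x) powr q" for x
      using torus_fun_tspan V unfolding trig_polys_eq_tspan torus_fun_def by metis
    have shift: "lattice_sum q N \<tau> V (a - of_int j * \<tau>0) = lattice_sum q N \<tau> V a" for j
    proof -
      have "(\<Sum>y<N. cmod (V (a + real y * \<tau> + of_int (- j * int m) * \<tau>)) powr q) = (\<Sum>y<N. cmod (V (a + real y * \<tau>)) powr q)"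
        by (rule sum_lattice_shift[of "\<lambda>x. cmod (V x) powr q", OF per N0 \<tau>_def])
      then show ?thesis unfolding lattice_sum_def t0 by (simp add: algebra_simps)
    qed
    have "lattice_sum q N \<tau> (\<lambda>x. V (x + h) - V x) a \<le> (\<Sum>y<N. \<Sum>j\<in>J. cmod (b' j) powr q * cmod (V (a - of_int j * \<tau>0 + real y * \<tau>)) powr q)"
      unfolding lattice_sum_def rep
    proof (rule sum_mono)
      fix y
      have "cmod (\<Sum>j\<in>J. b' j * V (a + real y * \<tau> - of_int j * \<tau>0)) powr q \<le> (\<Sum>j\<in>J. cmod (b' j * V (a + real y * \<tau> - of_int j * \<tau>0)) powr q)"
        by (rule powr_sum_le[OF assms(1,2)])
      also have "\<dots> = (\<Sum>j\<in>J. cmod (b' j) powr q * cmod (V (a - of_int j * \<tau>0 + real y * \<tau>)) powr q)"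
        by (intro sum.cong refl) (simp add: norm_mult powr_mult algebra_simps)
      finally show "cmod (\<Sum>j\<in>J. b' j * V (a + real y * \<tau> - of_int j * \<tau>0)) powr q \<le> (\<Sum>j\<in>J. cmod (b' j) powr q * cmod (V (a - of_int j * \<tau>0 + real y * \<tau>)) powr q)" .
    qed
    also have "\<dots> = (\<Sum>j\<in>J. cmod (b' j) powr q * lattice_sum q N \<tau> V (a - of_int j * \<tau>0))"
      unfolding lattice_sum_def sum_distrib_left by (rule sum.swap)
    also have "\<dots> = (\<Sum>j\<in>J. cmod (b' j) powr q) * lattice_sum q N \<tau> V a"
      unfolding shift by (simp add: sum_distrib_right)
    also have "\<dots> \<le> C * (real n * \<bar>h\<bar>) powr (q / 2) * lattice_sum q N \<tau> V a"
      using b[OF h] unfolding b'_def J_def \<tau>0_def by (intro mult_right_mono lattice_sum_nonneg)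
    finally show ?thesis unfolding \<tau>_def .
  qed
  then show ?thesis using C by blast
qed

lemma nn_integral_lincomb_le:
  fixes F G H :: "real \<Rightarrow> ennreal"
  assumes "A \<in> sets borel" "F \<in> borel_measurable borel" "G \<in> borel_measurable borel" "H \<in> borel_measurable borel"
  shows "(\<integral>\<^sup>+b\<in>A. (F b + c * G b + d * H b) \<partial>lborel) \<le> (\<integral>\<^sup>+b\<in>A. F b \<partial>lborel) + c * (\<integral>\<^sup>+b\<in>A. G b \<partial>lborel) + d * (\<integral>\<^sup>+b\<in>A. H b \<partial>lborel)"
proof -
  note [measurable] = assms
  have "(\<integral>\<^sup>+b\<in>A. (F b + c * G b + d * H b) \<partial>lborel) = (\<integral>\<^sup>+b. (F b * indicator A b + c * (G b * indicator A b)) + d * (H b * indicator A b) \<partial>lborel)"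
    by (intro nn_integral_cong) (simp add: distrib_right mult.assoc)
  also have "\<dots> = (\<integral>\<^sup>+b. F b * indicator A b + c * (G b * indicator A b) \<partial>lborel) + (\<integral>\<^sup>+b. d * (H b * indicator A b) \<partial>lborel)"
    by (rule nn_integral_add) measurable
  also have "(\<integral>\<^sup>+b. F b * indicator A b + c * (G b * indicator A b) \<partial>lborel) = (\<integral>\<^sup>+b\<in>A. F b \<partial>lborel) + (\<integral>\<^sup>+b. c * (G b * indicator A b) \<partial>lborel)"
    by (rule nn_integral_add) measurable
  finally show ?thesis by (simp add: nn_integral_cmult)
qed

text \<open>
  For a lattice position \<open>b\<close> let \<open>T\<close> agree with \<open>f - e\<close>, \<open>e = (1 - A)\<^sup>K f\<close>, on the lattice through \<open>b\<close>, and
  put \<open>v = f - U\<close>, \<open>V = T - U\<close>. Then \<open>(f - T)(a) = v(a) - v(b) + e(b) - (V(a) - V(b))\<close>, and the last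
  bracket is small by the discrete Bernstein inequality. Averaging over \<open>a\<close> and \<open>b\<close> selects a good \<open>b\<close>.
\<close>

lemma sampling_step:
  assumes q: "0 < q" "q \<le> 1" and M: "real M * q \<ge> 4"
  shows "\<exists>C>0. \<forall>m. odd m \<longrightarrow> (\<exists>D>0. \<forall>n f U K \<omega> \<epsilon> \<tau>. f \<in> Lq q \<longrightarrow> f \<in> borel_measurable borel \<longrightarrow> U \<in> trig_polys n \<longrightarrow> \<epsilon> > 0 \<longrightarrow>
     \<tau> = 2 * pi / real (m * nodes M n) \<longrightarrow> (\<forall>h. \<bar>h\<bar> \<le> \<tau> \<longrightarrow> mean_power q (\<lambda>x. (f (x + h) - U (x + h)) - (f x - U x)) \<le> \<omega>) \<longrightarrow>
     (\<exists>T\<in>trig_polys n. mean_power q (\<lambda>x. f x - T x) \<le> 2 * \<omega> + (1 + C * (real n * \<tau>) powr (q / 2)) * (D ^ K * mean_power q (fdiff K \<tau> f))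
        + C * (real n * \<tau>) powr (q / 2) * mean_power q (\<lambda>x. f x - U x) + \<epsilon>))"
proof -
  interpret gauge "Lq q" "mean_power q" q by (rule gauge_small[OF q])
  obtain C where C: "C > 0" and bl: "\<And>n m h V a N. m \<ge> 1 \<Longrightarrow> N = m * nodes M n \<Longrightarrow> \<bar>h\<bar> \<le> 2 * pi / real (nodes M n) \<Longrightarrow> V \<in> trig_polys n \<Longrightarrow>
    lattice_sum q N (2 * pi / real N) (\<lambda>x. V (x + h) - V x) a \<le> C * (real n * \<bar>h\<bar>) powr (q / 2) * lattice_sum q N (2 * pi / real N) V a"
    using bernstein_lattice[OF q M] by blast
  \<comment> \<open>The order of the quantifiers matters: C is fixed before m, so that a large m
    makes \<open>C * (real n * \<tau>) powr (q / 2)\<close> small, while D may grow with m.\<close>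
  have "\<exists>D>0. \<forall>n f U K \<omega> \<epsilon> \<tau>. f \<in> Lq q \<longrightarrow> f \<in> borel_measurable borel \<longrightarrow> U \<in> trig_polys n \<longrightarrow> \<epsilon> > 0 \<longrightarrow>
     \<tau> = 2 * pi / real (m * nodes M n) \<longrightarrow> (\<forall>h. \<bar>h\<bar> \<le> \<tau> \<longrightarrow> mean_power q (\<lambda>x. (f (x + h) - U (x + h)) - (f x - U x)) \<le> \<omega>) \<longrightarrow>
     (\<exists>T\<in>trig_polys n. mean_power q (\<lambda>x. f x - T x) \<le> 2 * \<omega> + (1 + C * (real n * \<tau>) powr (q / 2)) * (D ^ K * mean_power q (fdiff K \<tau> f))
        + C * (real n * \<tau>) powr (q / 2) * mean_power q (\<lambda>x. f x - U x) + \<epsilon>)"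
    if m: "odd m" for m
  proof -
    have m1: "m \<ge> 1" using m by (cases m) auto
    obtain D where D: "D > 0" and ac: "\<And>n R. nodes M n \<le> 2 * R + 1 \<Longrightarrow> 2 * R + 1 \<le> m * nodes M n \<Longrightarrow>
     (\<Sum>l\<in>{- int R..int R}. (cmod (ker M (n div (M + 1)) (- (of_int l * (2 * pi / real (2 * R + 1))))) / real (2 * R + 1)) powr q * \<bar>of_int l\<bar>) \<le> D"
      using averaging_coeffs[OF q M m1] by blast
    have "\<exists>T\<in>trig_polys n. mean_power q (\<lambda>x. f x - T x) \<le> 2 * \<omega> + (1 + C * (real n * \<tau>) powr (q / 2)) * (D ^ K * mean_power q (fdiff K \<tau> f))
        + C * (real n * \<tau>) powr (q / 2) * mean_power q (\<lambda>x. f x - U x) + \<epsilon>"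
      if f: "f \<in> Lq q" and fm: "f \<in> borel_measurable borel" and U: "U \<in> trig_polys n" and eps: "\<epsilon> > 0" and tau: "\<tau> = 2 * pi / real (m * nodes M n)"
        and om: "\<And>h. \<bar>h\<bar> \<le> \<tau> \<Longrightarrow> mean_power q (\<lambda>x. (f (x + h) - U (x + h)) - (f x - U x)) \<le> \<omega>" for n f U K \<omega> \<epsilon> \<tau>
    proof -
      define N where "N = m * nodes M n"
      have np: "nodes M n > 0" using nodes_pos[of M n] by simp
      have N0: "N > 0" unfolding N_def using m1 np by simp
      have Nn: "nodes M n \<le> N" unfolding N_def using m1 by simp
      \<comment> \<open>The remainder operator averages over the symmetric window from -R to R,
        which is one full period only for an odd number of nodes; hence the requirement that m be
        odd.\<close>
      have "odd N" unfolding N_def nodes_def using m by simp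
      then obtain R where R: "N = 2 * R + 1" by (elim oddE)
      have tN: "\<tau> = 2 * pi / real N" using tau unfolding N_def .
      have t0: "\<tau> > 0" unfolding tN using N0 by simp
      have Nt: "real N * \<tau> = 2 * pi" unfolding tN using N0 by simp
      have t_le: "\<tau> \<le> 2 * pi / real (nodes M n)" unfolding tN using Nn np by (intro divide_left_mono) auto
      define \<kappa> where "\<kappa> = (\<lambda>l. ker M (n div (M + 1)) (- (of_int l * (2 * pi / real N))) / of_nat N)"
      have I: "{- int R..int R} = {- int R..< - int R + int N}" using R by auto
      have ksum: "(\<Sum>l\<in>{- int R..int R}. \<kappa> l) = 1"
      proof -
        have "2 * (n div (M + 1)) + M * (n div (M + 1)) < (M + 2) * (n div (M + 1) + 1)" by simp
        also have "\<dots> \<le> nodes M n" by (rule div_le_nodes)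
        also have "\<dots> \<le> N" by (rule Nn)
        finally have big: "N > 2 * (n div (M + 1)) + M * (n div (M + 1))" .
        have "(\<Sum>l\<in>{- int R..int R}. \<kappa> l) = (\<Sum>l\<in>{- int R..int R}. ker M (n div (M + 1)) (of_int l * (2 * pi / real N)) / of_nat N)"
          by (rule sum.reindex_bij_witness[of _ uminus uminus]) (auto simp: \<kappa>_def)
        also have "\<dots> = 1"
          using ker_sum_one[OF big, where a = "- int R" and h = 0] unfolding I by simp
        finally show ?thesis .
      qed
      have kabs: "(\<Sum>l\<in>{- int R..int R}. cmod (\<kappa> l) powr q * \<bar>of_int l\<bar>) \<le> D"
        using ac[of n R] Nn unfolding \<kappa>_def norm_divide norm_of_nat R[symmetric] by (simp add: N_def)
      define e where "e = (rest_op \<kappa> R \<tau> ^^ K) f"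
      have eX: "e \<in> Lq q" unfolding e_def by (rule X_rest_op[OF f])
      have eQ: "mean_power q e \<le> D ^ K * mean_power q (fdiff K \<tau> f)"
        unfolding e_def by (rule Q_rest_op[OF f ksum kabs])
      have em [measurable]: "e \<in> borel_measurable borel"
      proof -
        have "(rest_op \<kappa> R \<tau> ^^ K) f \<in> borel_measurable borel" for K
        proof (induction K)
          case (Suc K)
          have "rest_op \<kappa> R \<tau> w \<in> borel_measurable borel" if [measurable]: "w \<in> borel_measurable borel" for w
            unfolding rest_op_def[abs_def] avg_op_def by measurable
          from this[OF Suc] show ?case by simp
        qed (use fm in simp)
        then show ?thesis unfolding e_def .
      qed
      have Um [measurable]: "U \<in> borel_measurable borel" by (rule borel_measurable_continuous_onI[OF trig_continuous[OF U]])
      note fm [measurable]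
      define v where "v x = f x - U x" for x
      have vm [measurable]: "v \<in> borel_measurable borel" unfolding v_def by measurable
      have vX: "v \<in> Lq q" unfolding v_def by (rule X_diff[OF f X_trig[OF U]])
      define \<gamma> where "\<gamma> = C * (real n * \<tau>) powr (q / 2)"
      have g0: "\<gamma> \<ge> 0" unfolding \<gamma>_def using C by simp
      define F where "F b = (\<integral>\<^sup>+a\<in>{0..<\<tau>}. (\<Sum>y<N. ennreal (cmod (v (a + real y * \<tau>) - v (b + real y * \<tau>)) powr q)) \<partial>lborel)" for b
      have Fm [measurable]: "F \<in> borel_measurable borel"
        unfolding F_def by measurable
      have om0: "\<omega> \<ge> 0" by (rule order_trans[OF mean_power_nonneg om[of 0]]) (use t0 in simp)
      have Fint: "(\<integral>\<^sup>+b\<in>{0..<\<tau>}. F b \<partial>lborel) \<le> ennreal (2 * \<tau>) * ennreal (2 * pi * \<omega>)"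
        unfolding F_def
      proof (rule average_over_lattices[OF vm vm t0 Nt])
        fix h assume h: "\<bar>h\<bar> \<le> \<tau>"
        have vh: "(\<lambda>x. v (x + h) - v x) \<in> Lq q" by (rule X_diff[OF X_shift[OF vX] vX])
        have "(\<integral>\<^sup>+x\<in>{0..<2 * pi}. ennreal (cmod (v (x + h) - v x) powr q) \<partial>lborel) = Iq q (\<lambda>x. v (x + h) - v x)"
          unfolding Iq_def nn_integral_completion ..
        also have "\<dots> = ennreal (2 * pi * mean_power q (\<lambda>x. v (x + h) - v x))" by (rule Iq_eq[OF vh])
        also have "\<dots> \<le> ennreal (2 * pi * \<omega>)" using om[OF h] unfolding v_def by (intro ennreal_leI) simp
        finally show "(\<integral>\<^sup>+x\<in>{0..<2 * pi}. ennreal (cmod (v (x + h) - v x) powr q) \<partial>lborel) \<le> ennreal (2 * pi * \<omega>)" .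
      qed
      define Ge where "Ge = lattice_sum q N \<tau> e"
      define Gv where "Gv = lattice_sum q N \<tau> v"
      have [measurable]: "Ge \<in> borel_measurable borel" "Gv \<in> borel_measurable borel"
        unfolding Ge_def Gv_def lattice_sum_def[abs_def] by measurable
      define S where "S = 2 * pi * (2 * \<omega> + (1 + \<gamma>) * mean_power q e + \<gamma> * mean_power q v)"
      have S0: "S \<ge> 0" unfolding S_def using om0 g0 mean_power_nonneg by simp
      \<comment> \<open>A majorant of \<open>Iq q\<close> of the error f - T in terms of b alone: T
        depends on b, but this expression does not mention T. It is measurable in b and its mean
        over one lattice cell is at most S, so a good b can be selected before T is
        constructed.\<close>
      define RHS where "RHS b = F b + ennreal (\<tau> * (1 + \<gamma>)) * ennreal (Ge b) + ennreal (\<tau> * \<gamma>) * ennreal (Gv b)" for b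
      have "(\<integral>\<^sup>+b\<in>{0..<\<tau>}. RHS b \<partial>lborel) \<le> ennreal (\<tau> * S)"
      proof -
        have "(\<integral>\<^sup>+b\<in>{0..<\<tau>}. RHS b \<partial>lborel) \<le> (\<integral>\<^sup>+b\<in>{0..<\<tau>}. F b \<partial>lborel) + ennreal (\<tau> * (1 + \<gamma>)) * (\<integral>\<^sup>+b\<in>{0..<\<tau>}. ennreal (Ge b) \<partial>lborel) + ennreal (\<tau> * \<gamma>) * (\<integral>\<^sup>+b\<in>{0..<\<tau>}. ennreal (Gv b) \<partial>lborel)"
          unfolding RHS_def by (rule nn_integral_lincomb_le) measurable
        also have "\<dots> \<le> ennreal (2 * \<tau>) * ennreal (2 * pi * \<omega>) + ennreal (\<tau> * (1 + \<gamma>)) * ennreal (2 * pi * mean_power q e) + ennreal (\<tau> * \<gamma>) * ennreal (2 * pi * mean_power q v)"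
          unfolding Ge_def Gv_def Iq_lattice[OF em t0 Nt] Iq_lattice[OF vm t0 Nt] Iq_eq[OF eX] Iq_eq[OF vX]
          using Fint by (intro add_mono order_refl)
        also have "\<dots> = ennreal (2 * \<tau> * (2 * pi * \<omega>) + \<tau> * (1 + \<gamma>) * (2 * pi * mean_power q e) + \<tau> * \<gamma> * (2 * pi * mean_power q v))"
          using t0 g0 om0 mean_power_nonneg by (simp add: ennreal_mult'[symmetric] ennreal_plus[symmetric] del: ennreal_plus)
        also have "2 * \<tau> * (2 * pi * \<omega>) + \<tau> * (1 + \<gamma>) * (2 * pi * mean_power q e) + \<tau> * \<gamma> * (2 * pi * mean_power q v) = \<tau> * S"
          unfolding S_def by (simp add: algebra_simps)
        finally show ?thesis .
      qed
      moreover have "2 * pi * \<epsilon> > 0" using eps by simp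
      ultimately obtain b where b: "b \<in> {0..<\<tau>}" "RHS b \<le> ennreal (S + 2 * pi * \<epsilon>)"
        using ex_le_average[OF t0 S0] by blast
      have tf: "torus_fun f" using f unfolding Lq_def by blast
      obtain T where T: "T \<in> trig_polys n" and Tj: "\<And>j::int. f (b + of_int j * \<tau>) - T (b + of_int j * \<tau>) = e (b + of_int j * \<tau>)"
        using lattice_rest[OF tf R ker_div_trig, where a = b and K = K] unfolding tN e_def \<kappa>_def by blast
      define V where "V x = T x - U x" for x
      have VT: "V \<in> trig_polys n" unfolding V_def by (rule trig_polys_diff[OF T U])
      have Vb: "V (b + real y * \<tau>) = v (b + real y * \<tau>) - e (b + real y * \<tau>)" for y
        using Tj[of "int y"] unfolding V_def v_def by (simp add: algebra_simps)
      have GV: "lattice_sum q N \<tau> V b \<le> Gv b + Ge b"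
      proof -
        have "lattice_sum q N \<tau> V b \<le> 1 * lattice_sum q N \<tau> v b + 1 * lattice_sum q N \<tau> e b"
        proof (rule lattice_sum_mono_comb)
          fix y
          have "cmod (V (b + real y * \<tau>)) powr q \<le> (cmod (v (b + real y * \<tau>)) + cmod (e (b + real y * \<tau>))) powr q"
            unfolding Vb using q by (intro powr_mono2 norm_triangle_ineq4) auto
          also have "\<dots> \<le> cmod (v (b + real y * \<tau>)) powr q + cmod (e (b + real y * \<tau>)) powr q" using q by (intro powr_add_le) auto
          finally show "cmod (V (b + real y * \<tau>)) powr q \<le> 1 * cmod (v (b + real y * \<tau>)) powr q + 1 * cmod (e (b + real y * \<tau>)) powr q" by simp
        qed
        then show ?thesis unfolding Gv_def Ge_def by simp
      qed
      have point: "lattice_sum q N \<tau> (\<lambda>x. f x - T x) a \<le> (\<Sum>y<N. cmod (v (a + real y * \<tau>) - v (b + real y * \<tau>)) powr q) + ((1 + \<gamma>) * Ge b + \<gamma> * Gv b)"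
        if a: "a \<in> {0..<\<tau>}" for a
      proof -
        define h where "h = a - b"
        have h: "\<bar>h\<bar> \<le> \<tau>" unfolding h_def using a b(1) by auto
        have "lattice_sum q N \<tau> (\<lambda>x. V (x + h) - V x) b \<le> C * (real n * \<bar>h\<bar>) powr (q / 2) * lattice_sum q N \<tau> V b"
          unfolding tN using h t_le by (intro bl[OF m1 N_def _ VT]) auto
        also have "\<dots> \<le> \<gamma> * (Gv b + Ge b)"
          unfolding \<gamma>_def using h q C GV lattice_sum_nonneg by (intro mult_mono mult_left_mono powr_mono2) auto
        finally have Vd: "lattice_sum q N \<tau> (\<lambda>x. V (x + h) - V x) b \<le> \<gamma> * (Gv b + Ge b)" .
        have "lattice_sum q N \<tau> (\<lambda>x. f x - T x) a \<le> (\<Sum>y<N. cmod (v (a + real y * \<tau>) - v (b + real y * \<tau>)) powr q + (cmod (e (b + real y * \<tau>)) powr q + cmod (V (b + real y * \<tau> + h) - V (b + real y * \<tau>)) powr q))"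
          unfolding lattice_sum_def
        proof (rule sum_mono)
          fix y
          define X where "X = v (a + real y * \<tau>) - v (b + real y * \<tau>)"
          define Y where "Y = e (b + real y * \<tau>)"
          define Z where "Z = V (b + real y * \<tau> + h) - V (b + real y * \<tau>)"
          have ha: "b + real y * \<tau> + h = a + real y * \<tau>" unfolding h_def by simp
          have "f (a + real y * \<tau>) - T (a + real y * \<tau>) = v (a + real y * \<tau>) - V (a + real y * \<tau>)" unfolding v_def V_def by simp
          also have "\<dots> = X + (Y - Z)" unfolding X_def Y_def Z_def ha Vb by simp
          finally have "cmod (f (a + real y * \<tau>) - T (a + real y * \<tau>)) \<le> cmod X + (cmod Y + cmod Z)"
            by (metis add_left_mono norm_triangle_ineq norm_triangle_ineq4 order_trans)
          then have "cmod (f (a + real y * \<tau>) - T (a + real y * \<tau>)) powr q \<le> (cmod X + (cmod Y + cmod Z)) powr q"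
            using q by (intro powr_mono2) auto
          also have "\<dots> \<le> cmod X powr q + (cmod Y + cmod Z) powr q" using q by (intro powr_add_le) auto
          also have "\<dots> \<le> cmod X powr q + (cmod Y powr q + cmod Z powr q)" using q by (intro add_left_mono powr_add_le) auto
          finally show "cmod (f (a + real y * \<tau>) - T (a + real y * \<tau>)) powr q \<le> cmod (v (a + real y * \<tau>) - v (b + real y * \<tau>)) powr q + (cmod (e (b + real y * \<tau>)) powr q + cmod (V (b + real y * \<tau> + h) - V (b + real y * \<tau>)) powr q)"
            unfolding X_def Y_def Z_def .
        qed
        also have "\<dots> = (\<Sum>y<N. cmod (v (a + real y * \<tau>) - v (b + real y * \<tau>)) powr q) + (Ge b + lattice_sum q N \<tau> (\<lambda>x. V (x + h) - V x) b)"
          unfolding Ge_def lattice_sum_def by (simp add: sum.distrib)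
        also have "\<dots> \<le> (\<Sum>y<N. cmod (v (a + real y * \<tau>) - v (b + real y * \<tau>)) powr q) + ((1 + \<gamma>) * Ge b + \<gamma> * Gv b)"
          using Vd by (simp add: algebra_simps)
        finally show ?thesis .
      qed
      have Tm [measurable]: "T \<in> borel_measurable borel" by (rule borel_measurable_continuous_onI[OF trig_continuous[OF T]])
      have cg: "0 \<le> (1 + \<gamma>) * Ge b + \<gamma> * Gv b" using g0 lattice_sum_nonneg unfolding Ge_def Gv_def by simp
      have "Iq q (\<lambda>x. f x - T x) = (\<integral>\<^sup>+a\<in>{0..<\<tau>}. ennreal (lattice_sum q N \<tau> (\<lambda>x. f x - T x) a) \<partial>lborel)"
        by (rule Iq_lattice[OF _ t0 Nt, symmetric]) measurable
      also have "\<dots> \<le> (\<integral>\<^sup>+a. (\<Sum>y<N. ennreal (cmod (v (a + real y * \<tau>) - v (b + real y * \<tau>)) powr q)) * indicator {0..<\<tau>} a + ennreal ((1 + \<gamma>) * Ge b + \<gamma> * Gv b) * indicator {0..<\<tau>} a \<partial>lborel)"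
      proof (rule nn_integral_mono)
        fix a
        show "ennreal (lattice_sum q N \<tau> (\<lambda>x. f x - T x) a) * indicator {0..<\<tau>} a \<le> (\<Sum>y<N. ennreal (cmod (v (a + real y * \<tau>) - v (b + real y * \<tau>)) powr q)) * indicator {0..<\<tau>} a + ennreal ((1 + \<gamma>) * Ge b + \<gamma> * Gv b) * indicator {0..<\<tau>} a"
        proof (cases "a \<in> {0..<\<tau>}")
          case True
          have "ennreal (lattice_sum q N \<tau> (\<lambda>x. f x - T x) a) \<le> ennreal ((\<Sum>y<N. cmod (v (a + real y * \<tau>) - v (b + real y * \<tau>)) powr q) + ((1 + \<gamma>) * Ge b + \<gamma> * Gv b))"
            by (rule ennreal_leI[OF point[OF True]])
          also have "\<dots> = (\<Sum>y<N. ennreal (cmod (v (a + real y * \<tau>) - v (b + real y * \<tau>)) powr q)) + ennreal ((1 + \<gamma>) * Ge b + \<gamma> * Gv b)"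
            using cg by (subst ennreal_plus) (auto simp: sum_ennreal intro: sum_nonneg)
          finally show ?thesis using True by simp
        qed simp
      qed
      also have "\<dots> = F b + (\<integral>\<^sup>+a. ennreal ((1 + \<gamma>) * Ge b + \<gamma> * Gv b) * indicator {0..<\<tau>} a \<partial>lborel)"
        unfolding F_def by (rule nn_integral_add) measurable
      also have "(\<integral>\<^sup>+a. ennreal ((1 + \<gamma>) * Ge b + \<gamma> * Gv b) * indicator {0..<\<tau>} a \<partial>lborel) = ennreal ((1 + \<gamma>) * Ge b + \<gamma> * Gv b) * ennreal \<tau>"
        using t0 by (subst nn_integral_cmult_indicator) auto
      also have "\<dots> = ennreal (\<tau> * (1 + \<gamma>)) * ennreal (Ge b) + ennreal (\<tau> * \<gamma>) * ennreal (Gv b)"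
      proof -
        have "ennreal ((1 + \<gamma>) * Ge b + \<gamma> * Gv b) * ennreal \<tau> = ennreal (\<tau> * (1 + \<gamma>) * Ge b + \<tau> * \<gamma> * Gv b)"
          using cg t0 by (simp add: ennreal_mult'[symmetric] algebra_simps del: ennreal_plus)
        also have "\<dots> = ennreal (\<tau> * (1 + \<gamma>) * Ge b) + ennreal (\<tau> * \<gamma> * Gv b)"
          using g0 t0 lattice_sum_nonneg unfolding Ge_def Gv_def by (intro ennreal_plus) auto
        finally show ?thesis using g0 t0 by (simp add: ennreal_mult')
      qed
      also have "F b + (ennreal (\<tau> * (1 + \<gamma>)) * ennreal (Ge b) + ennreal (\<tau> * \<gamma>) * ennreal (Gv b)) = RHS b"
        unfolding RHS_def by (simp add: add.assoc)
      also have "RHS b \<le> ennreal (S + 2 * pi * \<epsilon>)" by (rule b(2))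
      also have "S + 2 * pi * \<epsilon> = 2 * pi * (2 * \<omega> + (1 + \<gamma>) * mean_power q e + \<gamma> * mean_power q v + \<epsilon>)"
        unfolding S_def by (simp add: algebra_simps)
      finally have "mean_power q (\<lambda>x. f x - T x) \<le> 2 * \<omega> + (1 + \<gamma>) * mean_power q e + \<gamma> * mean_power q v + \<epsilon>"
        using om0 g0 eps mean_power_nonneg by (intro mean_power_le) auto
      also have "\<dots> \<le> 2 * \<omega> + (1 + \<gamma>) * (D ^ K * mean_power q (fdiff K \<tau> f)) + \<gamma> * mean_power q v + \<epsilon>"
        using eQ g0 by (simp add: mult_left_mono)
      finally show ?thesis using T unfolding \<gamma>_def v_def by blast
    qed
    then show ?thesis using D by blast
  qed
  then show ?thesis using C by blast
qed

context gauge
begin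

text \<open>On steps below 1/n the function f contributes w. For U Bernstein's inequality gives the
  factor (n|h|)^(K\<theta>), small when h is much shorter than 1/n, times a K-th difference of U,
  which is traded back for one of f plus a multiple of \<open>Q\<close> of the remainder.\<close>

lemma fdiff_remainder_bound:
  assumes "K \<ge> 1"
  shows "\<exists>C>0. \<forall>f U n w h. f \<in> X \<longrightarrow> n \<ge> 1 \<longrightarrow> U \<in> trig_polys n \<longrightarrow> (\<forall>d. 0 < d \<and> d < 1 / real n \<longrightarrow> Q (fdiff K d f) \<le> w) \<longrightarrow> \<bar>h\<bar> < 1 / real n \<longrightarrow>
    Q (fdiff K h (\<lambda>x. f x - U x)) \<le> w + (C * (real n * \<bar>h\<bar>) powr \<theta>) ^ K * (w + 2 ^ K * Q (\<lambda>x. f x - U x))"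
proof -
  obtain c C where c: "0 < c" "c < 1" and C: "0 < C" and b: "\<And>k r n T h d. n \<ge> 1 \<Longrightarrow> T \<in> trig_polys n \<Longrightarrow> 0 < h \<Longrightarrow> h \<le> 1 / real n \<Longrightarrow> 0 < d \<Longrightarrow> d \<le> 1 / real n \<Longrightarrow>
     Q (fdiff k d (fdiff r h T)) \<le> (C * (real n * d) powr \<theta>) ^ k * (C * (real n * h) powr \<theta>) ^ r * Q (fdiff (k + r) (c / real n) T)"
    using bernstein_mixed by blast
  have "Q (fdiff K h (\<lambda>x. f x - U x)) \<le> w + (C * (real n * \<bar>h\<bar>) powr \<theta>) ^ K * (w + 2 ^ K * Q (\<lambda>x. f x - U x))"
    if f: "f \<in> X" and n: "n \<ge> 1" and U: "U \<in> trig_polys n" and w: "\<And>d. 0 < d \<Longrightarrow> d < 1 / real n \<Longrightarrow> Q (fdiff K d f) \<le> w" and h: "\<bar>h\<bar> < 1 / real n" for f U n w h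
  proof -
    have UX: "U \<in> X" by (rule X_trig[OF U])
    have vX: "(\<lambda>x. f x - U x) \<in> X" by (rule X_diff[OF f UX])
    have n0: "real n > 0" using n by simp
    have cn: "0 < c / real n" "c / real n < 1 / real n" using c n0 by (auto simp: divide_strict_right_mono)
    have w0: "0 \<le> w" by (rule order_trans[OF Q_nonneg w[OF cn]])
    have C0: "0 \<le> (C * (real n * \<bar>h\<bar>) powr \<theta>) ^ K" using C by simp
    show ?thesis
    proof (cases "h = 0")
      case True
      have "fdiff K 0 (\<lambda>x. f x - U x) = (\<lambda>x. 0)" using assms by (rule fdiff_zero_step)
      then show ?thesis unfolding True using w0 C0 Q_nonneg Q_zero unfolding True
        by (auto intro!: add_nonneg_nonneg mult_nonneg_nonneg)
    next
      case False
      have "Q (fdiff K h (\<lambda>x. f x - U x)) = Q (fdiff K \<bar>h\<bar> (\<lambda>x. f x - U x))" by (rule Q_fdiff_abs[OF vX, symmetric])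
      also have "\<dots> \<le> Q (fdiff K \<bar>h\<bar> f) + Q (fdiff K \<bar>h\<bar> U)"
        unfolding fdiff_diff by (rule Q_diff[OF X_fdiff[OF f] X_fdiff[OF UX]])
      also have "\<dots> \<le> w + Q (fdiff K \<bar>h\<bar> U)" using w[of "\<bar>h\<bar>"] False h by simp
      also have "Q (fdiff K \<bar>h\<bar> U) \<le> (C * (real n * \<bar>h\<bar>) powr \<theta>) ^ K * Q (fdiff K (c / real n) U)"
        using b[OF n U, of "1 / real n" "\<bar>h\<bar>" K 0] n0 False h by (simp add: fdiff_0)
      also have "Q (fdiff K (c / real n) U) \<le> Q (fdiff K (c / real n) f) + 2 ^ K * Q (\<lambda>x. U x - f x)"
        by (rule Q_fdiff_triangle[OF UX f])
      also have "\<dots> \<le> w + 2 ^ K * Q (\<lambda>x. f x - U x)"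
        unfolding Q_minus_commute[OF UX f] using w[OF cn] by simp
      finally show ?thesis using C0 by (simp add: mult_left_mono)
    qed
  qed
  then show ?thesis using C by blast
qed

text \<open>Starting from U = 0, i steps leave 2^(-i) \<open>Q f\<close> plus at most twice the term
  added per step.\<close>

lemma jackson_of_contraction:
  assumes "C > 0" and f: "f \<in> X" and "w \<ge> 0" "\<epsilon> > 0"
    and step: "\<And>U \<epsilon>. U \<in> trig_polys n \<Longrightarrow> \<epsilon> > 0 \<Longrightarrow> \<exists>T\<in>trig_polys n. Q (\<lambda>x. f x - T x) \<le> Q (\<lambda>x. f x - U x) / 2 + C * w + \<epsilon>"
  shows "\<exists>T\<in>trig_polys n. Q (\<lambda>x. f x - T x) \<le> 2 * C * w + \<epsilon>"
proof -
  \<comment> \<open>Twice e comes from the iteration and once from the term 2^(-i)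
    \<open>Q f\<close>, together three quarters of \<epsilon>.\<close>
  define e where "e = \<epsilon> / 4"
  have e: "e > 0" unfolding e_def using assms by simp
  have it: "\<exists>T\<in>trig_polys n. Q (\<lambda>x. f x - T x) \<le> (1 / 2) ^ i * Q f + 2 * (C * w + e)" for i
  proof (induction i)
    case 0
    show ?case by (rule bexI[of _ "\<lambda>x. 0"]) (use assms e in \<open>auto simp: trig_polys_eq_tspan tspan_zero\<close>)
  next
    case (Suc i)
    then obtain U where U: "U \<in> trig_polys n" "Q (\<lambda>x. f x - U x) \<le> (1 / 2) ^ i * Q f + 2 * (C * w + e)" by blast
    from step[OF U(1) e] obtain T where T: "T \<in> trig_polys n" "Q (\<lambda>x. f x - T x) \<le> Q (\<lambda>x. f x - U x) / 2 + C * w + e" by blast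
    have "Q (\<lambda>x. f x - T x) \<le> ((1 / 2) ^ i * Q f + 2 * (C * w + e)) / 2 + C * w + e"
      by (rule order_trans[OF T(2)]) (intro add_right_mono divide_right_mono U(2), simp)
    also have "\<dots> = (1 / 2) ^ Suc i * Q f + 2 * (C * w + e)" by simp
    finally show ?case using T(1) by blast
  qed
  have "(\<lambda>i. (1 / 2) ^ i * Q f) \<longlonglongrightarrow> 0 * Q f" by (intro tendsto_intros LIMSEQ_realpow_zero) auto
  then have "(\<lambda>i. (1 / 2) ^ i * Q f) \<longlonglongrightarrow> 0" by simp
  from order_tendstoD(2)[OF this e] obtain i where "(1 / 2) ^ i * Q f < e" unfolding eventually_sequentially by blast
  moreover obtain T where T: "T \<in> trig_polys n" "Q (\<lambda>x. f x - T x) \<le> (1 / 2) ^ i * Q f + 2 * (C * w + e)" using it by blast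
  ultimately have "Q (\<lambda>x. f x - T x) \<le> 2 * C * w + \<epsilon>" using e unfolding e_def by (simp add: algebra_simps)
  then show ?thesis using T(1) by blast
qed

end

lemma small_step_parameter:
  fixes q C1 C2 C3 :: real
  assumes "q > 0" "K \<ge> 1"
  obtains m :: nat where "odd m" "C1 * (2 ^ K * (C2 * (1 / real m) powr q) ^ K) \<le> 1 / 16" "C3 * (1 / real m) powr (q / 2) \<le> 1 / 4"
proof -
  have t: "(\<lambda>m. (1 / real m) powr a) \<longlonglongrightarrow> 0" if "a > 0" for a :: real
  proof -
    have "(\<lambda>m. real m powr (- a)) \<longlonglongrightarrow> 0"
      using that by (intro tendsto_neg_powr filterlim_real_sequentially) simp
    moreover have "(1 / real m) powr a = real m powr (- a)" for m by (simp add: powr_minus powr_divide inverse_eq_divide)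
    ultimately show ?thesis by simp
  qed
  have "(\<lambda>m. C1 * (2 ^ K * (C2 * (1 / real m) powr q) ^ K)) \<longlonglongrightarrow> C1 * (2 ^ K * (C2 * 0) ^ K)"
    by (intro tendsto_intros t assms)
  then have "(\<lambda>m. C1 * (2 ^ K * (C2 * (1 / real m) powr q) ^ K)) \<longlonglongrightarrow> 0" using assms(2) by (simp add: power_0_left)
  from order_tendstoD(2)[OF this, of "1/16"] have 1: "\<forall>\<^sub>F m in sequentially. C1 * (2 ^ K * (C2 * (1 / real m) powr q) ^ K) < 1 / 16" by simp
  have "(\<lambda>m. C3 * (1 / real m) powr (q / 2)) \<longlonglongrightarrow> C3 * 0" using assms(1) by (intro tendsto_intros t) simp
  then have "(\<lambda>m. C3 * (1 / real m) powr (q / 2)) \<longlonglongrightarrow> 0" by simp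
  from order_tendstoD(2)[OF this, of "1/4"] have 2: "\<forall>\<^sub>F m in sequentially. C3 * (1 / real m) powr (q / 2) < 1 / 4" by simp
  from eventually_conj[OF 1 2] obtain n where n: "\<And>m. m \<ge> n \<Longrightarrow> C1 * (2 ^ K * (C2 * (1 / real m) powr q) ^ K) < 1 / 16 \<and> C3 * (1 / real m) powr (q / 2) < 1 / 4"
    unfolding eventually_sequentially by blast
  show ?thesis by (rule that[of "2 * n + 1"]) (use n[of "2 * n + 1"] in auto)
qed

text \<open>In \<open>sampling_step\<close> the terms with v = f - U must add up to half of V =
  \<open>mean_power q v\<close>. The oscillation of v on steps up to \<tau>, bounded by
  \<open>marchaud\<close> with 1/16 and then by \<open>fdiff_remainder_bound\<close>, contributes
  2(1/16 + 1/16)V = V/4; the discrete Bernstein term contributes V/4 by the choice of m. The rest is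
  a multiple of w.\<close>

lemma sampling_contraction:
  assumes q: "0 < q" "q \<le> 1" and K: "K \<ge> 1"
  shows "\<exists>C>0. \<forall>f n w U \<epsilon>. f \<in> Lq q \<longrightarrow> f \<in> borel_measurable borel \<longrightarrow> n \<ge> 1 \<longrightarrow> (\<forall>d. 0 < d \<and> d < 1 / real n \<longrightarrow> mean_power q (fdiff K d f) \<le> w) \<longrightarrow>
    U \<in> trig_polys n \<longrightarrow> \<epsilon> > 0 \<longrightarrow> (\<exists>T\<in>trig_polys n. mean_power q (\<lambda>x. f x - T x) \<le> mean_power q (\<lambda>x. f x - U x) / 2 + C * w + \<epsilon>)"
proof -
  interpret gauge "Lq q" "mean_power q" q by (rule gauge_small[OF q])
  obtain M :: nat where M: "real M * q \<ge> 4"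
  proof -
    obtain M :: nat where "real M \<ge> 4 / q" using real_arch_simple by blast
    then show ?thesis using that q by (simp add: field_simps)
  qed
  obtain C1 where C1: "C1 \<ge> 0" and mar: "\<And>v h. v \<in> Lq q \<Longrightarrow> mean_power q (fdiff 1 h v) \<le> (1 / 16) * mean_power q v + C1 * mean_power q (fdiff K h v)"
    using marchaud[OF K, of "1 / 16"] by (metis divide_pos_pos zero_less_numeral zero_less_one)
  obtain C2 where C2: "C2 > 0" and rem: "\<And>f U n w h. f \<in> Lq q \<Longrightarrow> n \<ge> 1 \<Longrightarrow> U \<in> trig_polys n \<Longrightarrow> (\<forall>d. 0 < d \<and> d < 1 / real n \<longrightarrow> mean_power q (fdiff K d f) \<le> w) \<Longrightarrow> \<bar>h\<bar> < 1 / real n \<Longrightarrow>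
    mean_power q (fdiff K h (\<lambda>x. f x - U x)) \<le> w + (C2 * (real n * \<bar>h\<bar>) powr q) ^ K * (w + 2 ^ K * mean_power q (\<lambda>x. f x - U x))"
    using fdiff_remainder_bound[OF K] by blast
  obtain C3 where C3: "C3 > 0" and samp: "\<And>m. odd m \<Longrightarrow> (\<exists>D>0. \<forall>n f U K \<omega> \<epsilon> \<tau>. f \<in> Lq q \<longrightarrow> f \<in> borel_measurable borel \<longrightarrow> U \<in> trig_polys n \<longrightarrow> \<epsilon> > 0 \<longrightarrow>
     \<tau> = 2 * pi / real (m * nodes M n) \<longrightarrow> (\<forall>h. \<bar>h\<bar> \<le> \<tau> \<longrightarrow> mean_power q (\<lambda>x. (f (x + h) - U (x + h)) - (f x - U x)) \<le> \<omega>) \<longrightarrow>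
     (\<exists>T\<in>trig_polys n. mean_power q (\<lambda>x. f x - T x) \<le> 2 * \<omega> + (1 + C3 * (real n * \<tau>) powr (q / 2)) * (D ^ K * mean_power q (fdiff K \<tau> f))
        + C3 * (real n * \<tau>) powr (q / 2) * mean_power q (\<lambda>x. f x - U x) + \<epsilon>))"
    using sampling_step[OF q M] by blast
  obtain m :: nat where m: "odd m" and m1: "C1 * (2 ^ K * (C2 * (1 / real m) powr q) ^ K) \<le> 1 / 16" and m2: "C3 * (1 / real m) powr (q / 2) \<le> 1 / 4"
    using small_step_parameter[OF q(1) K] by blast
  obtain D where D: "D > 0" and sD: "\<And>n f U K \<omega> \<epsilon> \<tau>. f \<in> Lq q \<Longrightarrow> f \<in> borel_measurable borel \<Longrightarrow> U \<in> trig_polys n \<Longrightarrow> \<epsilon> > 0 \<Longrightarrow>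
     \<tau> = 2 * pi / real (m * nodes M n) \<Longrightarrow> (\<forall>h. \<bar>h\<bar> \<le> \<tau> \<longrightarrow> mean_power q (\<lambda>x. (f (x + h) - U (x + h)) - (f x - U x)) \<le> \<omega>) \<Longrightarrow>
     (\<exists>T\<in>trig_polys n. mean_power q (\<lambda>x. f x - T x) \<le> 2 * \<omega> + (1 + C3 * (real n * \<tau>) powr (q / 2)) * (D ^ K * mean_power q (fdiff K \<tau> f))
        + C3 * (real n * \<tau>) powr (q / 2) * mean_power q (\<lambda>x. f x - U x) + \<epsilon>)"
    using samp[OF m] by blast
  define A where "A = (C2 * (1 / real m) powr q) ^ K"
  have A0: "A \<ge> 0" unfolding A_def using C2 by simp
  define C where "C = 2 * C1 * (1 + A) + 2 * D ^ K"
  have C: "C > 0" unfolding C_def using C1 A0 D by (intro add_nonneg_pos) auto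
  have "\<exists>T\<in>trig_polys n. mean_power q (\<lambda>x. f x - T x) \<le> mean_power q (\<lambda>x. f x - U x) / 2 + C * w + \<epsilon>"
    if f: "f \<in> Lq q" "f \<in> borel_measurable borel" and n: "n \<ge> 1" and w: "\<forall>d. 0 < d \<and> d < 1 / real n \<longrightarrow> mean_power q (fdiff K d f) \<le> w"
      and U: "U \<in> trig_polys n" and eps: "\<epsilon> > 0" for f n w U \<epsilon>
  proof -
    define v where "v = (\<lambda>x. f x - U x)"
    have v: "v \<in> Lq q" unfolding v_def by (rule X_diff[OF f(1) X_trig[OF U]])
    define \<tau> where "\<tau> = 2 * pi / real (m * nodes M n)"
    have n0: "real n > 0" using n by simp
    have m0: "real m > 0" using m by (cases m) auto
    \<comment> \<open>Since M is at least 4, there are at least 8n > 2\<pi>n kernel nodes; the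
      m-fold refinement then makes \<tau> shorter than 1/(nm).\<close>
    have nt: "real n * \<tau> < 1 / real m"
    proof -
      have "8 * n \<le> nodes M n"
      proof -
        have "8 * n \<le> 2 * (4 * (n + 1)) + 1" by simp
        also have "\<dots> \<le> 2 * ((M + 2) * (n + 1)) + 1"
        proof -
          have "4 \<le> M"
          proof -
            have "4 \<le> real M * 1" using M q(2) by (meson mult_left_mono of_nat_0_le_iff order_trans)
            then show ?thesis by simp
          qed
          then have "4 \<le> M + 2" by simp
          then have "4 * (n + 1) \<le> (M + 2) * (n + 1)" by (rule mult_le_mono1)
          then show ?thesis by simp
        qed
        finally show ?thesis unfolding nodes_def .
      qed
      then have "8 * real n \<le> real (nodes M n)" by (metis of_nat_le_iff of_nat_mult of_nat_numeral)
      then have "2 * pi * real n < real (nodes M n)" 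
        using mult_strict_right_mono[of "2 * pi" 8 "real n"] pi_less_4 n0 by linarith
      then have "2 * pi * real n / real (nodes M n) < 1" using nodes_pos[of M n] by simp
      then have "(2 * pi * real n / real (nodes M n)) / real m < 1 / real m" using m0 by (intro divide_strict_right_mono)
      then show ?thesis unfolding \<tau>_def by (simp add: mult.commute mult.left_commute)
    qed
    have t0: "\<tau> > 0" unfolding \<tau>_def using m0 nodes_pos[of M n] by simp
    have tn: "\<tau> < 1 / real n"
    proof -
      have "1 / real m \<le> 1" using m by (cases m) auto
      then have "real n * \<tau> < 1" using nt by linarith
      then show ?thesis using n0 by (simp add: field_simps)
    qed
    have w0: "w \<ge> 0" using w t0 tn Q_nonneg[of "fdiff K \<tau> f"] by (meson order_trans)
    define V where "V = mean_power q v"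
    have V0: "V \<ge> 0" unfolding V_def by (rule Q_nonneg)
    define \<omega> where "\<omega> = (1 / 16) * V + C1 * (w + A * (w + 2 ^ K * V))"
    have om: "\<forall>h. \<bar>h\<bar> \<le> \<tau> \<longrightarrow> mean_power q (\<lambda>x. (f (x + h) - U (x + h)) - (f x - U x)) \<le> \<omega>"
    proof (intro allI impI)
      fix h assume h: "\<bar>h\<bar> \<le> \<tau>"
      have "mean_power q (\<lambda>x. (f (x + h) - U (x + h)) - (f x - U x)) = mean_power q (\<lambda>x. v x - v (x + h))"
        unfolding v_def[symmetric] using Q_minus_commute[OF X_shift[OF v] v, of h] unfolding v_def by simp
      also have "\<dots> = mean_power q (fdiff 1 h v)" by (rule arg_cong[where f = "mean_power q"], rule ext) (rule fdiff_1[symmetric])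
      also have "\<dots> \<le> (1 / 16) * V + C1 * mean_power q (fdiff K h v)" unfolding V_def by (rule mar[OF v])
      also have "mean_power q (fdiff K h v) \<le> w + (C2 * (real n * \<bar>h\<bar>) powr q) ^ K * (w + 2 ^ K * V)"
        unfolding V_def v_def by (rule rem[OF f(1) n U w]) (use h tn in simp)
      also have "(C2 * (real n * \<bar>h\<bar>) powr q) ^ K \<le> A"
      proof -
        have "real n * \<bar>h\<bar> \<le> 1 / real m" using h nt n0 by (meson less_imp_le mult_left_mono order_trans)
        then show ?thesis unfolding A_def using C2 q n0 by (intro power_mono mult_left_mono powr_mono2) auto
      qed
      finally show "mean_power q (\<lambda>x. (f (x + h) - U (x + h)) - (f x - U x)) \<le> \<omega>"
        unfolding \<omega>_def using C1 w0 V0 by (simp add: mult_left_mono mult_right_mono)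
    qed
    define \<gamma> where "\<gamma> = C3 * (real n * \<tau>) powr (q / 2)"
    have g: "0 \<le> \<gamma>" "\<gamma> \<le> 1 / 4"
    proof -
      show "0 \<le> \<gamma>" unfolding \<gamma>_def using C3 by simp
      have "\<gamma> \<le> C3 * (1 / real m) powr (q / 2)"
        unfolding \<gamma>_def using C3 nt t0 q by (intro mult_left_mono powr_mono2) auto
      then show "\<gamma> \<le> 1 / 4" using m2 by linarith
    qed
    obtain T where T: "T \<in> trig_polys n" "mean_power q (\<lambda>x. f x - T x) \<le> 2 * \<omega> + (1 + \<gamma>) * (D ^ K * mean_power q (fdiff K \<tau> f)) + \<gamma> * V + \<epsilon>"
      using sD[OF f U eps \<tau>_def om, of K] unfolding \<gamma>_def V_def v_def by blast
    have "(1 + \<gamma>) * (D ^ K * mean_power q (fdiff K \<tau> f)) \<le> 2 * (D ^ K * w)"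
      using g D w t0 tn w0 by (intro mult_mono) (auto simp: mean_power_nonneg)
    moreover have "\<gamma> * V \<le> 1 / 4 * V" using g V0 by (intro mult_right_mono) auto
    moreover have "2 * \<omega> \<le> V / 4 + 2 * C1 * (1 + A) * w"
    proof -
      have "(C1 * (2 ^ K * A)) * V \<le> (1 / 16) * V" using m1 V0 unfolding A_def by (rule mult_right_mono)
      then show ?thesis unfolding \<omega>_def by (simp add: algebra_simps)
    qed
    ultimately have "mean_power q (\<lambda>x. f x - T x) \<le> V / 2 + C * w + \<epsilon>"
      using T(2) unfolding C_def by (simp add: algebra_simps)
    then show ?thesis using T(1) unfolding V_def v_def by blast
  qed
  then show ?thesis using C by blast
qed

text \<open>The contraction is available for Borel functions; the differences of a Borel
  representative at distance zero satisfy the same bounds.\<close>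

lemma jackson_small:
  assumes q: "0 < q" "q \<le> 1" and K: "K \<ge> 1"
  shows "gauge.jackson (Lq q) (mean_power q) K"
proof -
  interpret gauge "Lq q" "mean_power q" q by (rule gauge_small[OF q])
  obtain C where C: "C > 0" and con: "\<And>f n w U \<epsilon>. f \<in> Lq q \<Longrightarrow> f \<in> borel_measurable borel \<Longrightarrow> n \<ge> 1 \<Longrightarrow> (\<forall>d. 0 < d \<and> d < 1 / real n \<longrightarrow> mean_power q (fdiff K d f) \<le> w) \<Longrightarrow>
    U \<in> trig_polys n \<Longrightarrow> \<epsilon> > 0 \<Longrightarrow> (\<exists>T\<in>trig_polys n. mean_power q (\<lambda>x. f x - T x) \<le> mean_power q (\<lambda>x. f x - U x) / 2 + C * w + \<epsilon>)"
    using sampling_contraction[OF assms] by blast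
  have "\<exists>T\<in>trig_polys n. mean_power q (\<lambda>x. g x - T x) \<le> 2 * C * w + \<epsilon>"
    if g: "g \<in> Lq q" and n: "n \<ge> 1" and w: "\<forall>d. 0 < d \<and> d < 1 / real n \<longrightarrow> mean_power q (fdiff K d g) \<le> w" and eps: "\<epsilon> > 0" for g n w \<epsilon>
  proof -
    obtain f where f: "f \<in> Lq q" "f \<in> borel_measurable borel" and gf: "mean_power q (\<lambda>x. g x - f x) = 0"
      using Lq_borel_representative[OF g q(1)] by blast
    have w': "\<forall>d. 0 < d \<and> d < 1 / real n \<longrightarrow> mean_power q (fdiff K d f) \<le> w"
    proof (intro allI impI)
      fix d assume d: "0 < d \<and> d < 1 / real n"
      have "mean_power q (fdiff K d f) \<le> mean_power q (fdiff K d g) + 2 ^ K * mean_power q (\<lambda>x. f x - g x)" by (rule Q_fdiff_triangle[OF f(1) g])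
      then show "mean_power q (fdiff K d f) \<le> w" using w d unfolding Q_minus_commute[OF f(1) g] gf by fastforce
    qed
    have w0: "w \<ge> 0"
    proof -
      have "0 < 1 / (2 * real n) \<and> 1 / (2 * real n) < 1 / real n" using n by (simp add: field_simps)
      then show ?thesis using w Q_nonneg order_trans by blast
    qed
    obtain T where T: "T \<in> trig_polys n" "mean_power q (\<lambda>x. f x - T x) \<le> 2 * C * w + \<epsilon>"
      using jackson_of_contraction[OF C f(1) w0 eps con[OF f n w']] by blast
    have "mean_power q (\<lambda>x. g x - T x) \<le> mean_power q (\<lambda>x. g x - f x) + mean_power q (\<lambda>x. f x - T x)"
      by (rule Q_triangle[OF g f(1) X_trig[OF T(1)]])
    then have "mean_power q (\<lambda>x. g x - T x) \<le> 2 * C * w + \<epsilon>" using T(2) gf by linarith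
    then show ?thesis using T(1) by blast
  qed
  moreover have "2 * C > 0" using C by simp
  ultimately show ?thesis unfolding jackson_def by blast
qed

section \<open>Density of trigonometric polynomials\<close>

context gauge
begin

lemma Q_fdiff_1_add:
  assumes "f \<in> X" shows "Q (fdiff 1 (s + t) f) \<le> Q (fdiff 1 s f) + Q (fdiff 1 t f)"
proof -
  have "fdiff 1 (s + t) f = (\<lambda>x. fdiff 1 s f x + fdiff 1 t f (x + s))"
    by (rule ext) (simp only: fdiff_1, simp add: add.assoc)
  then show ?thesis
    using Q_add[OF X_fdiff[OF assms, of 1 s] X_shift[OF X_fdiff[OF assms, of 1 t], of s]] Q_shift[OF X_fdiff[OF assms, of 1 t], of s] by simp
qed

lemma Q_fdiff_1_lattice:
  fixes l :: int
  assumes "f \<in> X" "\<And>h. \<bar>h\<bar> \<le> \<tau> \<Longrightarrow> Q (fdiff 1 h f) \<le> W" "\<bar>h\<bar> \<le> \<tau>"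
  shows "Q (fdiff 1 (h + of_int l * \<tau>) f) \<le> (1 + \<bar>of_int l\<bar>) * W"
proof -
  have "\<bar>of_int l * \<tau>\<bar> = real (nat \<bar>l\<bar>) * \<tau>" using assms(3) by (simp add: abs_mult)
  then have "Q (fdiff 1 (of_int l * \<tau>) f) = Q (fdiff 1 (real (nat \<bar>l\<bar>) * \<tau>) f)"
    using Q_fdiff_abs[OF assms(1), of 1 "of_int l * \<tau>"] by simp
  also have "\<dots> \<le> real (nat \<bar>l\<bar>) * Q (fdiff 1 \<tau> f)" by (rule Q_fdiff_multiple_1[OF assms(1)])
  also have "\<dots> \<le> real (nat \<bar>l\<bar>) * W" using assms(3) by (intro mult_left_mono assms(2)) auto
  finally have "Q (fdiff 1 (of_int l * \<tau>) f) \<le> \<bar>of_int l\<bar> * W" by simp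
  then show ?thesis using Q_fdiff_1_add[OF assms(1), of h "of_int l * \<tau>"] assms(2)[OF assms(3)] by (simp add: algebra_simps)
qed

text \<open>A bounded Hoelder seminorm yields continuity of translation through
  \<open>marchaud\<close>: the r-th difference is small because of the weight, and the multiple of
  \<open>Q f\<close> is small by choice. Density of polynomials is then proved for such f directly,
  from the smallness of translations.\<close>

lemma fdiff_vanishes:
  assumes "f \<in> X" "hb r \<alpha> f B" "r \<ge> 1" "\<alpha> > 0" "\<epsilon> > 0"
  shows "\<exists>\<delta>>0. \<forall>h. \<bar>h\<bar> \<le> \<delta> \<longrightarrow> Q (fdiff 1 h f) \<le> \<epsilon>"
proof -
  \<comment> \<open>The summand 1, here and in \<open>t\<close>, keeps the denominators positive
    when \<open>Q f\<close> or C B vanishes.\<close>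
  define s where "s = 1 + Q f"
  define e where "e = \<epsilon> / (2 * s)"
  have Q1: "s > 0" unfolding s_def using Q_nonneg[of f] by linarith
  have e0: "e > 0" unfolding e_def using assms(5) Q1 by simp
  have eQ: "e * Q f \<le> \<epsilon> / 2"
  proof -
    have "e * Q f \<le> e * s" unfolding s_def using e0 by simp
    also have "\<dots> = \<epsilon> / 2" unfolding e_def using Q1 by simp
    finally show ?thesis .
  qed
  obtain C where C: "C \<ge> 0" and mar: "\<And>h. Q (fdiff 1 h f) \<le> e * Q f + C * Q (fdiff r h f)"
    using marchaud[OF assms(3) e0] assms(1) by blast
  have B0: "B \<ge> 0" by (rule hb_nonneg[OF assms(2)])
  have at: "\<alpha> * \<theta> > 0" using assms(4) theta_pos by simp
  define t where "t = 1 + C * B"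
  define \<delta> where "\<delta> = (\<epsilon> / (2 * t)) powr (1 / (\<alpha> * \<theta>))"
  have CB: "t > 0" unfolding t_def using C B0 by (simp add: add_pos_nonneg)
  have d0: "\<delta> > 0" unfolding \<delta>_def using assms(5) CB by simp
  have da: "\<delta> powr (\<alpha> * \<theta>) = \<epsilon> / (2 * t)" unfolding \<delta>_def powr_powr using assms(4,5) theta_pos CB by simp
  have "Q (fdiff 1 h f) \<le> \<epsilon>" if h: "\<bar>h\<bar> \<le> \<delta>" for h
  proof (cases "h = 0")
    case True
    have "fdiff 1 0 f = (\<lambda>x. 0)" by (rule fdiff_zero_step) simp
    then show ?thesis unfolding True using Q_zero assms(5) by simp
  next
    case False
    have "C * Q (fdiff r \<bar>h\<bar> f) \<le> C * (\<delta> powr (\<alpha> * \<theta>) * B)"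
    proof (rule mult_left_mono[OF _ C])
      have "Q (fdiff r \<bar>h\<bar> f) \<le> \<bar>h\<bar> powr (\<alpha> * \<theta>) * B" using assms(2) False unfolding hb_def by simp
      also have "\<dots> \<le> \<delta> powr (\<alpha> * \<theta>) * B" using h at B0 by (intro mult_right_mono powr_mono2) auto
      finally show "Q (fdiff r \<bar>h\<bar> f) \<le> \<delta> powr (\<alpha> * \<theta>) * B" .
    qed
    also have "\<dots> = \<delta> powr (\<alpha> * \<theta>) * (C * B)" by (simp only: mult.left_commute)
    also have "\<dots> \<le> \<delta> powr (\<alpha> * \<theta>) * t" unfolding t_def by (intro mult_left_mono) auto
    also have "\<dots> = \<epsilon> / 2" unfolding da using CB by simp
    finally show ?thesis using mar[of h] eQ unfolding Q_fdiff_abs[OF assms(1)] by linarith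
  qed
  then show ?thesis using d0 by blast
qed

end

text \<open>A quasi-interpolant of f from its samples on the lattice through a. Its degree is n(M +
  1) instead of n, which is harmless for density.\<close>

definition kernel_sampling :: "nat \<Rightarrow> nat \<Rightarrow> real \<Rightarrow> (real \<Rightarrow> complex) \<Rightarrow> real \<Rightarrow> complex" where
  "kernel_sampling M n a f x = (\<Sum>l\<in>{- half M n..half M n}.
     f (a + of_int l * (2 * pi / real (nodes M n))) / of_nat (nodes M n) * ker M n (x + (- (a + of_int l * (2 * pi / real (nodes M n))))))"

lemma ker_trig: "ker M n \<in> trig_polys (n * (M + 1))"
proof -
  have "n * (M + 1) div (M + 1) = n" by (rule nonzero_mult_div_cancel_right) simp
  then show ?thesis using ker_div_trig[of M "n * (M + 1)"] by (simp only:)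
qed

lemma kernel_sampling_trig: "kernel_sampling M n a f \<in> trig_polys (n * (M + 1))"
  unfolding kernel_sampling_def[abs_def] trig_polys_eq_tspan
  by (intro tspan_sum tspan_scale, rule tspan_shift) (use ker_trig[of M n] in \<open>simp only: trig_polys_eq_tspan\<close>)

text \<open>By \<open>ker_sum_one\<close> the weights at offset b - a add up to 1, so constants are
  reproduced and the error is a weighted sum of increments of f. Only lattice points through b are
  evaluated, because there the summation window can be recentred.\<close>

lemma kernel_sampling_error:
  fixes y :: int
  assumes "torus_fun f" and tau: "\<tau> = 2 * pi / real (nodes M n)"
  shows "f (b + of_int y * \<tau>) - kernel_sampling M n a f (b + of_int y * \<tau>) =
    (\<Sum>l\<in>{- half M n..half M n}. ker M n (of_int l * \<tau> + (b - a)) / of_nat (nodes M n) * (f (b + of_int y * \<tau>) - f (a + of_int y * \<tau> - of_int l * \<tau>)))"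
proof -
  define N where "N = nodes M n"
  have N0: "N > 0" unfolding N_def using nodes_pos[of M n] by simp
  have Nt: "real N * \<tau> = 2 * pi" unfolding tau N_def using nodes_pos[of M n] by simp
  let ?I = "{- half M n..half M n}"
  have I: "?I = {- half M n..< - half M n + int N}" unfolding N_def by (rule half_interval)
  have I': "{y - half M n..y + half M n} = {y - half M n..< (y - half M n) + int N}" unfolding N_def half_def nodes_def by auto
  define g where "g l = f (a + of_int l * \<tau>) / of_nat N * ker M n (b + of_int y * \<tau> + (- (a + of_int l * \<tau>)))" for l :: int
  have per: "g (l + int N) = g l" for l
  proof -
    have "f ((a + of_int l * \<tau>) + of_int 1 * (2 * pi)) = f (a + of_int l * \<tau>)" by (rule torus_fun_int[OF assms(1)])
    moreover have "ker M n (b + of_int y * \<tau> + (- (a + of_int l * \<tau>)) + of_int (-1) * (2 * pi)) = ker M n (b + of_int y * \<tau> + (- (a + of_int l * \<tau>)))"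
      by (intro torus_fun_int torus_fun_tspan) (use ker_trig[of M n] in \<open>simp only: trig_polys_eq_tspan\<close>)
    moreover have "a + of_int (l + int N) * \<tau> = (a + of_int l * \<tau>) + of_int 1 * (2 * pi)"
      "b + of_int y * \<tau> + (- (a + of_int (l + int N) * \<tau>)) = b + of_int y * \<tau> + (- (a + of_int l * \<tau>)) + of_int (-1) * (2 * pi)"
      unfolding Nt[symmetric] by (simp_all add: algebra_simps)
    ultimately show ?thesis unfolding g_def by (simp only:)
  qed
  have "kernel_sampling M n a f (b + of_int y * \<tau>) = sum g ?I" unfolding kernel_sampling_def g_def N_def tau ..
  also have "\<dots> = sum g {y - half M n..y + half M n}" unfolding I I' by (rule sum_periodic_int) (use per N0 in auto)
  also have "\<dots> = (\<Sum>l\<in>?I. g (y - l))" by (rule sum.reindex_bij_witness[of _ "\<lambda>l. y - l" "\<lambda>l. y - l"]) auto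
  also have "\<dots> = (\<Sum>l\<in>?I. ker M n (of_int l * \<tau> + (b - a)) / of_nat N * f (a + of_int y * \<tau> - of_int l * \<tau>))"
    unfolding g_def by (intro sum.cong refl) (simp add: algebra_simps)
  finally have T: "kernel_sampling M n a f (b + of_int y * \<tau>) = \<dots>" .
  have "N > 2 * n + M * n" unfolding N_def by (rule nodes_gt)
  from ker_sum_one[OF this, of "b - a" "- half M n"]
  have "(\<Sum>l\<in>?I. ker M n (of_int l * \<tau> + (b - a)) / of_nat N) = 1" unfolding I tau N_def .
  then have "f (b + of_int y * \<tau>) = (\<Sum>l\<in>?I. ker M n (of_int l * \<tau> + (b - a)) / of_nat N) * f (b + of_int y * \<tau>)" by simp
  then show ?thesis unfolding T N_def right_diff_distrib sum_subtractf sum_distrib_right by simp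
qed

lemma nodes_fine:
  assumes "\<delta> > 0" shows "\<exists>n. 2 * pi / real (nodes M n) \<le> \<delta>"
proof -
  obtain n :: nat where "real n \<ge> 2 * pi / \<delta>" using real_arch_simple by blast
  moreover have "real n \<le> real (nodes M n)" using nodes_gt[of n M] by simp
  ultimately have "2 * pi / \<delta> \<le> real (nodes M n)" by linarith
  then show ?thesis using assms nodes_pos[of M n] by (intro exI[of _ n]) (simp add: field_simps)
qed

lemma half_sum_inverse_square: "(\<Sum>l\<in>{- half M n..half M n}. 1 / (1 + \<bar>of_int l\<bar>)\<^sup>2) \<le> (4::real)"
  using sum_inverse_square_le[of 1 "(M + 2) * (n + 1)"] unfolding half_def by simp

text \<open>Increments over l lattice steps grow like 1 + |l|. With M = 3 the kernel decays
  cubically, which leaves inverse squares with sum at most 4.\<close>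

lemma dense_sup:
  assumes f: "f \<in> Cper" and van: "\<And>\<epsilon>. \<epsilon> > 0 \<Longrightarrow> \<exists>\<delta>>0. \<forall>h. \<bar>h\<bar> \<le> \<delta> \<longrightarrow> sup_norm (fdiff 1 h f) \<le> \<epsilon>" and eps: "\<epsilon> > 0"
  shows "\<exists>m. \<exists>P\<in>trig_polys m. sup_norm (\<lambda>x. f x - P x) < \<epsilon>"
proof -
  interpret gauge Cper sup_norm 1 by (rule gauge_sup)
  \<comment> \<open>The constant of \<open>ker_node\<close> for M = 3. With the following W the
    total error 4 c^3 W equals \<epsilon>/2.\<close>
  define c :: real where "c = real (4 * (2 * 3 + 5))"
  define W where "W = \<epsilon> / (8 * c ^ 3)"
  have c0: "c > 0" unfolding c_def by simp
  have W: "W > 0" unfolding W_def using eps c0 by simp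
  obtain \<delta> where d: "\<delta> > 0" "\<And>h. \<bar>h\<bar> \<le> \<delta> \<Longrightarrow> sup_norm (fdiff 1 h f) \<le> W" using van[OF W] by blast
  obtain n where n: "2 * pi / real (nodes 3 n) \<le> \<delta>" using nodes_fine[OF d(1)] by blast
  define \<tau> where "\<tau> = 2 * pi / real (nodes 3 n)"
  have t0: "\<tau> > 0" unfolding \<tau>_def using nodes_pos[of 3 n] by simp
  have Wt: "sup_norm (fdiff 1 h f) \<le> W" if "\<bar>h\<bar> \<le> \<tau>" for h using d(2)[of h] that n unfolding \<tau>_def by linarith
  have "cmod (f x - kernel_sampling 3 n 0 f x) \<le> c ^ 3 * 4 * W" for x
  proof -
    define y where "y = \<lfloor>x / \<tau>\<rfloor>"
    define b where "b = x - of_int y * \<tau>"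
    have x: "x = b + of_int y * \<tau>" unfolding b_def by simp
    have b: "\<bar>b\<bar> \<le> \<tau>"
    proof -
      have "of_int y \<le> x / \<tau>" "x / \<tau> < of_int y + 1" unfolding y_def by linarith+
      then have "of_int y * \<tau> \<le> x" "x < (of_int y + 1) * \<tau>" using t0 by (simp_all add: pos_le_divide_eq pos_divide_less_eq)
      then show ?thesis unfolding b_def by (simp add: algebra_simps)
    qed
    have tf: "torus_fun f" using f unfolding Cper_def by blast
    have "cmod (f x - kernel_sampling 3 n 0 f x) \<le> (\<Sum>l\<in>{- half 3 n..half 3 n}. cmod (ker 3 n (of_int l * \<tau> + (b - 0)) / of_nat (nodes 3 n) * (f (b + of_int y * \<tau>) - f (0 + of_int y * \<tau> - of_int l * \<tau>))))"
      unfolding x kernel_sampling_error[OF tf \<tau>_def] by (rule norm_sum)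
    also have "\<dots> \<le> (\<Sum>l\<in>{- half 3 n..half 3 n}. c ^ 3 * W * (1 / (1 + \<bar>of_int l\<bar>)\<^sup>2))"
    proof (rule sum_mono)
      fix l assume "l \<in> {- half 3 n..half 3 n}"
      then have l: "\<bar>l\<bar> \<le> half 3 n" by auto
      have k: "cmod (ker 3 n (of_int l * \<tau> + b)) / real (nodes 3 n) \<le> (c / (1 + \<bar>of_int l\<bar>)) ^ 3"
        unfolding \<tau>_def c_def by (rule ker_node[OF _ l]) (use b in \<open>simp add: \<tau>_def\<close>)
      have "f (b + of_int y * \<tau>) - f (of_int y * \<tau> - of_int l * \<tau>) = - fdiff 1 (b + of_int l * \<tau>) f (of_int y * \<tau> - of_int l * \<tau>)"
        unfolding fdiff_1 by (simp add: algebra_simps)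
      then have "cmod (f (b + of_int y * \<tau>) - f (of_int y * \<tau> - of_int l * \<tau>)) \<le> sup_norm (fdiff 1 (b + of_int l * \<tau>) f)"
        using sup_norm_ge[OF X_fdiff[OF f]] by simp
      also have "\<dots> \<le> (1 + \<bar>of_int l\<bar>) * W" by (rule Q_fdiff_1_lattice[OF f Wt b])
      finally have df: "cmod (f (b + of_int y * \<tau>) - f (of_int y * \<tau> - of_int l * \<tau>)) \<le> (1 + \<bar>of_int l\<bar>) * W" .
      have "cmod (ker 3 n (of_int l * \<tau> + (b - 0)) / of_nat (nodes 3 n) * (f (b + of_int y * \<tau>) - f (0 + of_int y * \<tau> - of_int l * \<tau>)))
        \<le> (c / (1 + \<bar>of_int l\<bar>)) ^ 3 * ((1 + \<bar>of_int l\<bar>) * W)"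
        unfolding norm_mult norm_divide norm_of_nat diff_0_right add_0 using c0 by (intro mult_mono k df) auto
      also have "\<dots> = c ^ 3 * W * (1 / (1 + \<bar>of_int l\<bar>)\<^sup>2)"
      proof -
        have "(c / J) ^ 3 * (J * W) = c ^ 3 * W * (1 / J\<^sup>2)" if "J > 0" for J :: real
          using that by (simp add: power_divide power2_eq_square power3_eq_cube)
        then show ?thesis by simp
      qed
      finally show "cmod (ker 3 n (of_int l * \<tau> + (b - 0)) / of_nat (nodes 3 n) * (f (b + of_int y * \<tau>) - f (0 + of_int y * \<tau> - of_int l * \<tau>))) \<le> c ^ 3 * W * (1 / (1 + \<bar>of_int l\<bar>)\<^sup>2)" .
    qed
    also have "\<dots> \<le> c ^ 3 * W * 4"
      unfolding sum_distrib_left[symmetric] using c0 W by (intro mult_left_mono half_sum_inverse_square) auto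
    finally show ?thesis by (simp add: mult.commute mult.left_commute)
  qed
  then have "sup_norm (\<lambda>x. f x - kernel_sampling 3 n 0 f x) \<le> c ^ 3 * 4 * W" by (rule sup_norm_le)
  also have "\<dots> < \<epsilon>" unfolding W_def using c0 eps by simp
  finally show ?thesis using kernel_sampling_trig by blast
qed

text \<open>Takes the role of Hoelder's inequality. With S the last sum, one term of S is at most S,
  so u_i \<le> S^(1/q) v_i; it remains to add over i.\<close>

lemma powr_sum_weighted_le:
  fixes u v :: "'i \<Rightarrow> real"
  assumes "finite I" "q > 0" "\<And>i. i \<in> I \<Longrightarrow> u i \<ge> 0" "\<And>i. i \<in> I \<Longrightarrow> v i > 0"
  shows "(\<Sum>i\<in>I. u i) powr q \<le> (\<Sum>i\<in>I. v i) powr q * (\<Sum>i\<in>I. (u i / v i) powr q)"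
proof -
  define S where "S = (\<Sum>i\<in>I. (u i / v i) powr q)"
  have S0: "S \<ge> 0" unfolding S_def by (intro sum_nonneg) auto
  have "u i \<le> S powr (1 / q) * v i" if i: "i \<in> I" for i
  proof -
    have "(u i / v i) powr q \<le> S" unfolding S_def using i assms(1) by (intro member_le_sum) auto
    then have "((u i / v i) powr q) powr (1 / q) \<le> S powr (1 / q)" using assms(2) by (intro powr_mono2) auto
    then have "u i / v i \<le> S powr (1 / q)" unfolding powr_powr using assms(2) assms(3,4)[OF i] by simp
    then show ?thesis using assms(4)[OF i] by (simp add: pos_divide_le_eq)
  qed
  then have "(\<Sum>i\<in>I. u i) \<le> S powr (1 / q) * (\<Sum>i\<in>I. v i)" unfolding sum_distrib_left by (rule sum_mono)
  then have "(\<Sum>i\<in>I. u i) powr q \<le> (S powr (1 / q) * (\<Sum>i\<in>I. v i)) powr q"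
    using assms by (intro powr_mono2 sum_nonneg) auto
  also have "\<dots> = (\<Sum>i\<in>I. v i) powr q * S"
    using S0 assms(2) by (simp add: powr_mult powr_powr mult.commute)
  finally show ?thesis unfolding S_def .
qed

lemma ennreal_weighted_sum:
  fixes \<beta> :: "'i \<Rightarrow> real" and g :: "'i \<Rightarrow> 'j \<Rightarrow> real"
  assumes "\<And>l. \<beta> l \<ge> 0" "\<And>l y. g l y \<ge> 0"
  shows "ennreal (\<Sum>l\<in>I. \<beta> l * (\<Sum>y\<in>Y. g l y)) = (\<Sum>l\<in>I. ennreal (\<beta> l) * (\<Sum>y\<in>Y. ennreal (g l y)))"
proof -
  have "ennreal (\<beta> l) * (\<Sum>y\<in>Y. ennreal (g l y)) = ennreal (\<beta> l * (\<Sum>y\<in>Y. g l y))" for l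
    using assms by (subst sum_ennreal) (auto simp: ennreal_mult sum_nonneg)
  moreover have "(\<Sum>l\<in>I. ennreal (\<beta> l * (\<Sum>y\<in>Y. g l y))) = ennreal (\<Sum>l\<in>I. \<beta> l * (\<Sum>y\<in>Y. g l y))"
    using assms by (intro sum_ennreal mult_nonneg_nonneg sum_nonneg)
  ultimately show ?thesis by simp
qed

text \<open>For an L_q function the samples on one prescribed lattice carry no information, so the
  position a is chosen by averaging. M = 5 distributes the decay: two powers become the weights in
  \<open>powr_sum_weighted_le\<close>, one is consumed by the growth 1 + |l| of the increments, and
  the last two give a bounded sum since q \<ge> 1.\<close>

lemma dense_Lq_borel:
  assumes q: "q \<ge> 1" and f: "f \<in> Lq q" and fm [measurable]: "f \<in> borel_measurable borel" 
    and van: "\<And>\<epsilon>. \<epsilon> > 0 \<Longrightarrow> \<exists>\<delta>>0. \<forall>h. \<bar>h\<bar> \<le> \<delta> \<longrightarrow> mean_power q (fdiff 1 h f) powr (1 / q) \<le> \<epsilon>" and eps: "\<epsilon> > 0"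
  shows "\<exists>m. \<exists>P\<in>trig_polys m. mean_power q (\<lambda>x. f x - P x) < \<epsilon>"
proof -
  interpret gauge "Lq q" "\<lambda>f. mean_power q f powr (1 / q)" 1 by (rule gauge_large[OF q])
  define c :: real where "c = real (4 * (2 * 5 + 5))"
  \<comment> \<open>Collects 4^q from the weights, the kernel constant, and 8 = 4 * 4\<pi> /
    (2\<pi>), where 4 bounds the sum over l and 4\<pi> comes from the average over positions. With
    the W below, the error is at most \<epsilon>/2 plus the \<epsilon>/4 lost in selecting
    a.\<close>
  define K where "K = 4 powr q * ((c ^ 5) powr q) * 8"
  have c0: "c > 0" unfolding c_def by simp
  have K0: "K > 0" unfolding K_def using c0 by simp
  define W where "W = (\<epsilon> / (2 * K)) powr (1 / q)"
  have W: "W > 0" unfolding W_def using eps K0 by simp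
  have KW: "K * W powr q = \<epsilon> / 2" unfolding W_def powr_powr using eps K0 q by simp
  obtain \<delta> where d: "\<delta> > 0" "\<And>h. \<bar>h\<bar> \<le> \<delta> \<Longrightarrow> mean_power q (fdiff 1 h f) powr (1 / q) \<le> W" using van[OF W] by blast
  obtain n where n: "2 * pi / real (nodes 5 n) \<le> \<delta>" using nodes_fine[OF d(1)] by blast
  define N where "N = nodes 5 n"
  define \<tau> where "\<tau> = 2 * pi / real N"
  have tau: "\<tau> = 2 * pi / real (nodes 5 n)" unfolding \<tau>_def N_def ..
  have N0: "real N > 0" unfolding N_def by (rule nodes_pos)
  have t0: "\<tau> > 0" unfolding \<tau>_def using N0 by simp
  have Nt: "real N * \<tau> = 2 * pi" unfolding \<tau>_def using N0 by simp
  have Wt: "mean_power q (fdiff 1 h f) powr (1 / q) \<le> W" if "\<bar>h\<bar> \<le> \<tau>" for h using d(2)[of h] that n unfolding tau by linarith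
  have tf: "torus_fun f" using f unfolding Lq_def by blast
  define I where "I = {- half 5 n..half 5 n}"
  have fin: "finite I" unfolding I_def by simp
  define J where "J l = 1 + \<bar>real_of_int l\<bar>" for l
  have J1: "J l \<ge> 1" for l unfolding J_def by simp
  define \<beta> where "\<beta> l = 4 powr q * ((c ^ 5) powr q * (1 / J l ^ 3) powr q)" for l
  have b0: "\<beta> l \<ge> 0" for l unfolding \<beta>_def by simp
  define F where "F l a = (\<integral>\<^sup>+b\<in>{0..<\<tau>}. (\<Sum>y<N. ennreal (cmod (f (b + real y * \<tau>) - f (a + real y * \<tau> - of_int l * \<tau>)) powr q)) \<partial>lborel)" for l a
  have Fm [measurable]: "F l \<in> borel_measurable borel" for l unfolding F_def by measurable
  have Fint: "(\<integral>\<^sup>+a\<in>{0..<\<tau>}. F l a \<partial>lborel) \<le> ennreal (2 * \<tau>) * ennreal (2 * pi * (J l powr q * W powr q))" for l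
    unfolding F_def
  proof (rule average_over_lattices[where v = "\<lambda>x. f (x - of_int l * \<tau>)", OF fm _ t0 Nt])
    show "(\<lambda>x. f (x - of_int l * \<tau>)) \<in> borel_measurable borel" by measurable
    fix h assume h: "\<bar>h\<bar> \<le> \<tau>"
    define g where "g x = fdiff 1 (h + of_int l * \<tau>) f (x + - (of_int l * \<tau>))" for x
    have gX: "g \<in> Lq q" unfolding g_def by (rule X_shift[OF X_fdiff[OF f]])
    have "mean_power q g powr (1 / q) = mean_power q (fdiff 1 (h + of_int l * \<tau>) f) powr (1 / q)"
      unfolding g_def by (rule Q_shift[OF X_fdiff[OF f]])
    also have "\<dots> \<le> J l * W" unfolding J_def by (rule Q_fdiff_1_lattice[OF f Wt h])
    finally have "(mean_power q g powr (1 / q)) powr q \<le> (J l * W) powr q" using q by (intro powr_mono2) auto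
    then have gb: "mean_power q g \<le> J l powr q * W powr q"
      unfolding powr_powr using q mean_power_nonneg[of q g] J1[of l] W by (simp add: powr_mult)
    have "cmod (f (x + h) - f (x - of_int l * \<tau>)) = cmod (g x)" for x
      unfolding g_def fdiff_1 by (subst norm_minus_commute) (simp add: algebra_simps)
    then have "(\<integral>\<^sup>+x\<in>{0..<2 * pi}. ennreal (cmod (f (x + h) - f (x - of_int l * \<tau>)) powr q) \<partial>lborel) = Iq q g"
      unfolding Iq_def nn_integral_completion by simp
    also have "\<dots> = ennreal (2 * pi * mean_power q g)" by (rule Iq_eq[OF gX])
    also have "\<dots> \<le> ennreal (2 * pi * (J l powr q * W powr q))" using gb by (intro ennreal_leI) simp
    finally show "(\<integral>\<^sup>+x\<in>{0..<2 * pi}. ennreal (cmod (f (x + h) - f (x - of_int l * \<tau>)) powr q) \<partial>lborel) \<le> ennreal (2 * pi * (J l powr q * W powr q))" .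
  qed
  define S where "S = (\<Sum>l\<in>I. \<beta> l * (4 * pi * (J l powr q * W powr q)))"
  have S0: "S \<ge> 0" unfolding S_def by (intro sum_nonneg mult_nonneg_nonneg b0) auto
  have S: "S \<le> 2 * pi * (K * W powr q)"
  proof -
    have "\<beta> l * J l powr q \<le> 4 powr q * (c ^ 5) powr q * (1 / (1 + \<bar>of_int l\<bar>)\<^sup>2)" for l
    proof -
      have "\<beta> l * J l powr q = 4 powr q * (c ^ 5) powr q * ((1 / J l ^ 3) powr q * J l powr q)" unfolding \<beta>_def by simp
      also have "(1 / J l ^ 3) powr q * J l powr q = (1 / (J l)\<^sup>2) powr q"
        using J1[of l] by (subst powr_mult[symmetric]) (auto simp: power2_eq_square power3_eq_cube)
      also have "\<dots> \<le> (1 / (J l)\<^sup>2) powr 1"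
        using J1[of l] q by (intro powr_mono') auto
      also have "\<dots> = 1 / (1 + \<bar>of_int l\<bar>)\<^sup>2" unfolding J_def by simp
      finally show ?thesis by (simp add: mult_left_mono)
    qed
    then have "(\<beta> l * J l powr q) * (4 * pi * W powr q) \<le> (4 powr q * (c ^ 5) powr q * (1 / (1 + \<bar>of_int l\<bar>)\<^sup>2)) * (4 * pi * W powr q)" for l
      by (rule mult_right_mono) simp
    then have "S \<le> (\<Sum>l\<in>I. (4 powr q * (c ^ 5) powr q * (1 / (1 + \<bar>of_int l\<bar>)\<^sup>2)) * (4 * pi * W powr q))"
      unfolding S_def by (intro sum_mono) (simp only: mult.assoc mult.left_commute mult.commute)
    also have "\<dots> = (4 powr q * (c ^ 5) powr q) * (\<Sum>l\<in>I. 1 / (1 + \<bar>of_int l\<bar>)\<^sup>2) * (4 * pi * W powr q)"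
      by (simp only: sum_distrib_left sum_distrib_right)
    also have "\<dots> \<le> (4 powr q * (c ^ 5) powr q) * 4 * (4 * pi * W powr q)"
      unfolding I_def by (intro mult_right_mono mult_left_mono half_sum_inverse_square) auto
    also have "\<dots> = 2 * pi * (K * W powr q)" unfolding K_def by simp
    finally show ?thesis .
  qed
  have avg: "(\<integral>\<^sup>+a\<in>{0..<\<tau>}. (\<Sum>l\<in>I. ennreal (\<beta> l) * F l a) \<partial>lborel) \<le> ennreal (\<tau> * S)"
  proof -
    have "(\<integral>\<^sup>+a\<in>{0..<\<tau>}. (\<Sum>l\<in>I. ennreal (\<beta> l) * F l a) \<partial>lborel) = (\<integral>\<^sup>+a. (\<Sum>l\<in>I. ennreal (\<beta> l) * (F l a * indicator {0..<\<tau>} a)) \<partial>lborel)"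
      by (intro nn_integral_cong) (simp add: sum_distrib_right mult.assoc)
    also have "\<dots> = (\<Sum>l\<in>I. ennreal (\<beta> l) * (\<integral>\<^sup>+a\<in>{0..<\<tau>}. F l a \<partial>lborel))"
      by (subst nn_integral_sum) (auto intro!: sum.cong nn_integral_cmult)
    also have "\<dots> \<le> (\<Sum>l\<in>I. ennreal (\<beta> l) * (ennreal (2 * \<tau>) * ennreal (2 * pi * (J l powr q * W powr q))))"
      by (intro sum_mono mult_left_mono Fint) simp
    also have "\<dots> = (\<Sum>l\<in>I. ennreal (\<tau> * (\<beta> l * (4 * pi * (J l powr q * W powr q)))))"
      using t0 b0 by (intro sum.cong refl) (simp add: ennreal_mult'[symmetric] ennreal_mult''[symmetric] algebra_simps)
    also have "\<dots> = ennreal (\<tau> * S)"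
      unfolding S_def sum_distrib_left using t0 b0 by (subst sum_ennreal) auto
    finally show ?thesis .
  qed
  have e4: "2 * pi * (\<epsilon> / 4) > 0" using eps by simp
  obtain a where a: "a \<in> {0..<\<tau>}" "(\<Sum>l\<in>I. ennreal (\<beta> l) * F l a) \<le> ennreal (S + 2 * pi * (\<epsilon> / 4))"
    using ex_le_average[OF t0 S0 e4 avg] by (elim bexE)
  define T where "T = kernel_sampling 5 n a f"
  have T: "T \<in> trig_polys (n * (5 + 1))" unfolding T_def by (rule kernel_sampling_trig)
  have Tm [measurable]: "T \<in> borel_measurable borel" by (rule borel_measurable_continuous_onI[OF trig_continuous[OF T]])
  have point: "cmod (f (b + real y * \<tau>) - T (b + real y * \<tau>)) powr q \<le> (\<Sum>l\<in>I. \<beta> l * cmod (f (b + real y * \<tau>) - f (a + real y * \<tau> - of_int l * \<tau>)) powr q)"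
    if b: "b \<in> {0..<\<tau>}" for b y
  proof -
    define z where "z l = cmod (f (b + real y * \<tau>) - f (a + real y * \<tau> - of_int l * \<tau>))" for l :: int
    have ba: "\<bar>b - a\<bar> \<le> \<tau>" using a(1) b by auto
    have "f (b + of_int (int y) * \<tau>) - T (b + of_int (int y) * \<tau>) =
      (\<Sum>l\<in>I. ker 5 n (of_int l * \<tau> + (b - a)) / of_nat (nodes 5 n) * (f (b + of_int (int y) * \<tau>) - f (a + of_int (int y) * \<tau> - of_int l * \<tau>)))"
      unfolding T_def I_def by (rule kernel_sampling_error[OF tf tau])
    then have "cmod (f (b + real y * \<tau>) - T (b + real y * \<tau>)) \<le> (\<Sum>l\<in>I. cmod (ker 5 n (of_int l * \<tau> + (b - a))) / real (nodes 5 n) * z l)"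
      unfolding z_def by (simp add: norm_sum[THEN order_trans] norm_mult norm_divide)
    also have "\<dots> \<le> (\<Sum>l\<in>I. (c / J l) ^ 5 * z l)"
    proof (intro sum_mono mult_right_mono)
      fix l assume "l \<in> I"
      then have l: "\<bar>l\<bar> \<le> half 5 n" unfolding I_def by auto
      show "cmod (ker 5 n (of_int l * \<tau> + (b - a))) / real (nodes 5 n) \<le> (c / J l) ^ 5"
        unfolding tau c_def J_def by (rule ker_node[OF _ l]) (use ba in \<open>simp add: tau\<close>)
    qed (simp add: z_def)
    finally have "cmod (f (b + real y * \<tau>) - T (b + real y * \<tau>)) powr q \<le> (\<Sum>l\<in>I. (c / J l) ^ 5 * z l) powr q"
      using q by (intro powr_mono2) auto
    also have "\<dots> \<le> (\<Sum>l\<in>I. 1 / (J l)\<^sup>2) powr q * (\<Sum>l\<in>I. ((c / J l) ^ 5 * z l / (1 / (J l)\<^sup>2)) powr q)"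
    proof (rule powr_sum_weighted_le[OF fin])
      show "0 \<le> (c / J l) ^ 5 * z l" "0 < 1 / (J l)\<^sup>2" for l using c0 J1[of l] unfolding z_def by auto
    qed (use q in simp)
    also have "\<dots> \<le> 4 powr q * (\<Sum>l\<in>I. ((c / J l) ^ 5 * z l / (1 / (J l)\<^sup>2)) powr q)"
      using half_sum_inverse_square[of 5 n] q unfolding J_def I_def by (intro mult_right_mono powr_mono2 sum_nonneg) auto
    also have "\<dots> = (\<Sum>l\<in>I. \<beta> l * z l powr q)"
      unfolding sum_distrib_left
    proof (intro sum.cong refl)
      fix l
      have "(c / J l) ^ 5 * z l / (1 / (J l)\<^sup>2) = c ^ 5 * (1 / J l ^ 3) * z l"
        using J1[of l] by (simp add: power_divide power2_eq_square power3_eq_cube eval_nat_numeral)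
      moreover have "(c ^ 5 * (1 / J l ^ 3) * z l) powr q = (c ^ 5) powr q * (1 / J l ^ 3) powr q * z l powr q"
        using c0 J1[of l] unfolding z_def by (simp add: powr_mult powr_divide)
      ultimately show "4 powr q * ((c / J l) ^ 5 * z l / (1 / (J l)\<^sup>2)) powr q = \<beta> l * z l powr q"
        unfolding \<beta>_def by (simp only: mult.assoc)
    qed
    finally show ?thesis unfolding z_def .
  qed
  have "Iq q (\<lambda>x. f x - T x) = (\<integral>\<^sup>+b\<in>{0..<\<tau>}. ennreal (lattice_sum q N \<tau> (\<lambda>x. f x - T x) b) \<partial>lborel)"
    by (rule Iq_lattice[OF _ t0 Nt, symmetric]) measurable
  also have "\<dots> \<le> (\<integral>\<^sup>+b. (\<Sum>l\<in>I. ennreal (\<beta> l) * ((\<Sum>y<N. ennreal (cmod (f (b + real y * \<tau>) - f (a + real y * \<tau> - of_int l * \<tau>)) powr q)) * indicator {0..<\<tau>} b)) \<partial>lborel)"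
  proof (rule nn_integral_mono)
    fix b
    show "ennreal (lattice_sum q N \<tau> (\<lambda>x. f x - T x) b) * indicator {0..<\<tau>} b \<le> (\<Sum>l\<in>I. ennreal (\<beta> l) * ((\<Sum>y<N. ennreal (cmod (f (b + real y * \<tau>) - f (a + real y * \<tau> - of_int l * \<tau>)) powr q)) * indicator {0..<\<tau>} b))"
    proof (cases "b \<in> {0..<\<tau>}")
      case True
      have "lattice_sum q N \<tau> (\<lambda>x. f x - T x) b \<le> (\<Sum>y<N. \<Sum>l\<in>I. \<beta> l * cmod (f (b + real y * \<tau>) - f (a + real y * \<tau> - of_int l * \<tau>)) powr q)"
        unfolding lattice_sum_def by (intro sum_mono point True)
      also have "\<dots> = (\<Sum>l\<in>I. \<beta> l * (\<Sum>y<N. cmod (f (b + real y * \<tau>) - f (a + real y * \<tau> - of_int l * \<tau>)) powr q))"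
        unfolding sum_distrib_left by (rule sum.swap)
      finally have "ennreal (lattice_sum q N \<tau> (\<lambda>x. f x - T x) b) \<le> ennreal \<dots>" by (rule ennreal_leI)
      also have "\<dots> = (\<Sum>l\<in>I. ennreal (\<beta> l) * (\<Sum>y<N. ennreal (cmod (f (b + real y * \<tau>) - f (a + real y * \<tau> - of_int l * \<tau>)) powr q)))"
        by (rule ennreal_weighted_sum[OF b0]) simp
      finally show ?thesis using True by simp
    qed simp
  qed
  also have "\<dots> = (\<Sum>l\<in>I. ennreal (\<beta> l) * F l a)"
    unfolding F_def by (subst nn_integral_sum) (measurable, auto intro!: sum.cong nn_integral_cmult)
  also have "\<dots> \<le> ennreal (S + 2 * pi * (\<epsilon> / 4))" by (rule a(2))
  also have "\<dots> \<le> ennreal (2 * pi * (K * W powr q + \<epsilon> / 4))" using S by (intro ennreal_leI) (simp add: distrib_left)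
  finally have "mean_power q (\<lambda>x. f x - T x) \<le> K * W powr q + \<epsilon> / 4"
    by (rule mean_power_le) (use KW eps in simp)
  then have "mean_power q (\<lambda>x. f x - T x) < \<epsilon>" using KW eps by linarith
  then show ?thesis using T by blast
qed

lemma dense_Lq:
  assumes q: "q \<ge> 1" and f: "f \<in> Lq q"
    and van: "\<And>\<epsilon>. \<epsilon> > 0 \<Longrightarrow> \<exists>\<delta>>0. \<forall>h. \<bar>h\<bar> \<le> \<delta> \<longrightarrow> mean_power q (fdiff 1 h f) powr (1 / q) \<le> \<epsilon>" and eps: "\<epsilon> > 0"
  shows "\<exists>m. \<exists>P\<in>trig_polys m. mean_power q (\<lambda>x. f x - P x) powr (1 / q) < \<epsilon>"
proof -
  interpret gauge "Lq q" "\<lambda>f. mean_power q f powr (1 / q)" 1 by (rule gauge_large[OF q])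
  have q0: "q > 0" using q by simp
  obtain g where g: "g \<in> Lq q" "g \<in> borel_measurable borel" and fg: "mean_power q (\<lambda>x. f x - g x) = 0"
    using Lq_borel_representative[OF f q0] by blast
  have "\<exists>\<delta>>0. \<forall>h. \<bar>h\<bar> \<le> \<delta> \<longrightarrow> mean_power q (fdiff 1 h g) powr (1 / q) \<le> \<epsilon>" if "\<epsilon> > 0" for \<epsilon>
  proof -
    have "mean_power q (fdiff 1 h g) powr (1 / q) \<le> mean_power q (fdiff 1 h f) powr (1 / q)" for h
      using Q_fdiff_triangle[OF g(1) f, of 1 h] fg unfolding Q_minus_commute[OF g(1) f] by simp
    then show ?thesis using van[OF that] order_trans by metis
  qed
  from dense_Lq_borel[OF q g this, of "\<epsilon> powr q"] eps
  obtain m P where P: "P \<in> trig_polys m" "mean_power q (\<lambda>x. g x - P x) < \<epsilon> powr q" by auto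
  have "mean_power q (\<lambda>x. f x - P x) powr (1 / q) \<le> mean_power q (\<lambda>x. f x - g x) powr (1 / q) + mean_power q (\<lambda>x. g x - P x) powr (1 / q)"
    by (rule Q_triangle[OF f g(1) X_trig[OF P(1)]])
  also have "\<dots> = mean_power q (\<lambda>x. g x - P x) powr (1 / q)" unfolding fg by simp
  also have "\<dots> < (\<epsilon> powr q) powr (1 / q)" using P(2) mean_power_nonneg q0 by (intro powr_less_mono2) auto
  also have "\<dots> = \<epsilon>" unfolding powr_powr using q0 eps by simp
  finally show ?thesis using P(1) by blast
qed

section \<open>The equivalence\<close>

context gauge
begin

lemma psib_mono: "psib k r \<alpha> f \<delta> B \<Longrightarrow> \<delta>' \<le> \<delta> \<Longrightarrow> psib k r \<alpha> f \<delta>' B"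
  unfolding psib_def by (meson order_trans less_le_trans)

lemma psib_raise:
  assumes "f \<in> X" "s \<le> k" "psib s r \<alpha> f \<delta> B" shows "psib k r \<alpha> f \<delta> (2 ^ (k - s) * B)"
  unfolding psib_def
proof (intro allI impI)
  fix h d assume hd: "0 < h \<and> h \<le> \<delta> \<and> 0 < d \<and> d < \<delta>"
  have "Q (fdiff k d (fdiff r h f)) \<le> 2 ^ (k - s) * Q (fdiff s d (fdiff r h f))" by (rule Q_fdiff_mono[OF X_fdiff[OF assms(1)] assms(2)])
  also have "\<dots> \<le> 2 ^ (k - s) * (h powr (\<alpha> * \<theta>) * B)" using assms(3) hd unfolding psib_def by (intro mult_left_mono) auto
  finally show "Q (fdiff k d (fdiff r h f)) \<le> h powr (\<alpha> * \<theta>) * (2 ^ (k - s) * B)" by (simp only: mult.left_commute)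
qed

text \<open>\<open>J\<close> and \<open>E2\<close> bound \<open>EE n\<close> by 2C times \<Psi> k at
  1/n, up to \<epsilon>. For arbitrary h take n = floor(1/h), so that h \<le> 1/n \<le> 2h: \<Psi> s
  is monotone, and \<Psi> k grows by at most the factor of \<open>psib_scale\<close> with l =
  2.\<close>

lemma forward_direction:
  fixes \<Psi> :: "nat \<Rightarrow> real \<Rightarrow> real" and EE :: "nat \<Rightarrow> real"
  assumes f: "f \<in> X"
    and P1: "\<And>k \<delta>. \<delta> > 0 \<Longrightarrow> psib k r \<alpha> f \<delta> (\<Psi> k \<delta>)" and P2: "\<And>k \<delta> B. \<delta> > 0 \<Longrightarrow> psib k r \<alpha> f \<delta> B \<Longrightarrow> \<Psi> k \<delta> \<le> B"
    and E2: "\<And>n T B. T \<in> trig_polys n \<Longrightarrow> Q (\<lambda>x. f x - T x) \<le> B \<Longrightarrow> hb r \<alpha> (\<lambda>x. f x - T x) B \<Longrightarrow> EE n \<le> 2 * B"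
    and C: "C > 0" and J: "\<And>n B \<epsilon>. n \<ge> 1 \<Longrightarrow> psib k r \<alpha> f (1 / real n) B \<Longrightarrow> \<epsilon> > 0 \<Longrightarrow>
       \<exists>T\<in>trig_polys n. Q (\<lambda>x. f x - T x) \<le> C * (B + \<epsilon>) \<and> hb r \<alpha> (\<lambda>x. f x - T x) (C * (B + \<epsilon>))"
    and L: "L > 0" "\<And>n. n \<ge> 1 \<Longrightarrow> \<Psi> s (1 / real n) \<le> L * EE n"
  shows "\<exists>M>0. \<forall>h. 0 < h \<and> h \<le> 1 \<longrightarrow> \<Psi> s h \<le> M * \<Psi> k h"
proof -
  define M0 where "M0 = L * (2 * C)"
  have M0: "M0 > 0" unfolding M0_def using L C by simp
  have main: "\<Psi> s (1 / real n) \<le> M0 * \<Psi> k (1 / real n)" if n: "n \<ge> 1" for n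
  proof (rule field_le_epsilon)
    fix e :: real assume e: "e > 0"
    have "e / M0 > 0" using e M0 by simp
    from J[OF n P1 this] n obtain T where T: "T \<in> trig_polys n" "Q (\<lambda>x. f x - T x) \<le> C * (\<Psi> k (1 / real n) + e / M0)" "hb r \<alpha> (\<lambda>x. f x - T x) (C * (\<Psi> k (1 / real n) + e / M0))"
      by auto
    have "\<Psi> s (1 / real n) \<le> L * EE n" by (rule L(2)[OF n])
    also have "\<dots> \<le> L * (2 * (C * (\<Psi> k (1 / real n) + e / M0)))" using L(1) by (intro mult_left_mono E2[OF T]) auto
    also have "\<dots> = M0 * \<Psi> k (1 / real n) + M0 * (e / M0)" unfolding M0_def by (simp only: distrib_left mult.assoc)
    finally show "\<Psi> s (1 / real n) \<le> M0 * \<Psi> k (1 / real n) + e" using M0 by simp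
  qed
  define D where "D = 2 powr (real k + real r - \<alpha> * \<theta>)"
  have D: "D > 0" unfolding D_def by simp
  have "\<Psi> s h \<le> (M0 * D) * \<Psi> k h" if h: "0 < h" "h \<le> 1" for h
  proof -
    define n where "n = nat \<lfloor>1 / h\<rfloor>"
    have "1 / h \<ge> 1" using h by simp
    then have "\<lfloor>1 / h\<rfloor> \<ge> 1" by (simp only: one_le_floor)
    then have fl: "real n = of_int \<lfloor>1 / h\<rfloor>" "n \<ge> 1" unfolding n_def by linarith+
    have "real n \<le> 1 / h" "1 / h < real n + 1" unfolding fl(1) by linarith+
    then have n1: "h \<le> 1 / real n" and n2: "1 / real n \<le> real 2 * h"
    proof -
      assume a: "real n \<le> 1 / h" "1 / h < real n + 1"
      have n0: "real n > 0" using fl(2) by simp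
      have "real n * h \<le> 1" using a(1) h(1) by (simp add: pos_le_divide_eq)
      then show "h \<le> 1 / real n" using n0 by (simp add: pos_le_divide_eq mult.commute)
      have "1 / h \<le> 2 * real n" using a(2) fl(2) by linarith
      then have "1 \<le> 2 * real n * h" using h(1) by (simp add: pos_divide_le_eq)
      then show "1 / real n \<le> real 2 * h" using n0 by (simp add: pos_divide_le_eq mult.commute mult.left_commute)
    qed
    have n0: "1 / real n > 0" using fl(2) by simp
    have "\<Psi> s h \<le> \<Psi> s (1 / real n)" by (rule P2[OF h(1) psib_mono[OF P1[OF n0] n1]])
    also have "\<dots> \<le> M0 * \<Psi> k (1 / real n)" by (rule main[OF fl(2)])
    also have "\<Psi> k (1 / real n) \<le> real 2 powr (real k + real r - \<alpha> * \<theta>) * \<Psi> k h"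
      by (rule P2[OF n0 psib_mono[OF psib_scale[OF f P1[OF h(1)]] n2]]) simp
    finally show ?thesis using M0 unfolding D_def by (simp add: mult_left_mono mult.assoc)
  qed
  moreover have "M0 * D > 0" using M0 D by simp
  ultimately show ?thesis by blast
qed

text \<open>A loop from 1/n back to 1/n: \<open>scale\<close> passes to the finer scale 1/m with m =
  2^j n, \<open>M\<close> replaces s by k there, \<open>psib_upper\<close> returns to 1/n with the
  gain P^(-\<gamma>) for P = 2^j, and \<open>psib_raise\<close> replaces k by s. The starting
  quantity reappears with coefficient H P^(\<beta>-\<gamma>), which is at most 1/2 for large
  j.\<close>

lemma absorption:
  fixes \<Psi> :: "nat \<Rightarrow> real \<Rightarrow> real" and EE :: "nat \<Rightarrow> real"
  assumes f: "f \<in> X" and a: "\<alpha> > 0" "\<alpha> \<le> real r" and sk: "s \<le> k"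
    and P1: "\<And>k \<delta>. \<delta> > 0 \<Longrightarrow> psib k r \<alpha> f \<delta> (\<Psi> k \<delta>)" and P2: "\<And>k \<delta> B. \<delta> > 0 \<Longrightarrow> psib k r \<alpha> f \<delta> B \<Longrightarrow> \<Psi> k \<delta> \<le> B"
    and E1: "\<And>n \<epsilon>. n \<ge> 1 \<Longrightarrow> \<epsilon> > 0 \<Longrightarrow> \<exists>T\<in>trig_polys n. hb r \<alpha> (\<lambda>x. f x - T x) (EE n + \<epsilon>)"
    and M: "M > 0" "\<And>h. 0 < h \<Longrightarrow> h \<le> 1 \<Longrightarrow> \<Psi> s h \<le> M * \<Psi> k h"
    and A: "A > 0" "\<beta> < (real k + real r - \<alpha>) * \<theta>"
    and scale: "\<And>n j. n \<ge> 1 \<Longrightarrow> \<Psi> s (1 / real n) \<le> A * (2 ^ j) powr \<beta> * \<Psi> s (1 / real (2 ^ j * n))"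
  shows "\<exists>L>0. \<forall>n\<ge>1. \<Psi> s (1 / real n) \<le> L * EE n"
proof -
  define \<gamma> where "\<gamma> = (real k + real r - \<alpha>) * \<theta>"
  obtain C where C: "C > 0" and up: "\<And>f n m T E B. f \<in> X \<Longrightarrow> 1 \<le> n \<Longrightarrow> n \<le> m \<Longrightarrow> T \<in> trig_polys n \<Longrightarrow> hb r \<alpha> (\<lambda>x. f x - T x) E \<Longrightarrow> psib k r \<alpha> f (1 / real n) B \<Longrightarrow>
     psib k r \<alpha> f (1 / real m) (2 ^ k * E + C * (real n / real m) powr \<gamma> * (B + 2 ^ k * E))"
    using psib_upper[OF a, of k] unfolding \<gamma>_def by blast
  define H where "H = A * M * C * 2 ^ (k - s)"
  have H: "H > 0" unfolding H_def using A M C by simp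
  obtain j :: nat where j: "H * (2 ^ j) powr (\<beta> - \<gamma>) \<le> 1 / 2"
  proof -
    have "2 powr (\<beta> - \<gamma>) < (1::real)" using powr_less_mono[of "\<beta> - \<gamma>" 0 "2::real"] A(2) unfolding \<gamma>_def by simp
    then have "(\<lambda>j. H * (2 powr (\<beta> - \<gamma>)) ^ j) \<longlonglongrightarrow> H * 0" by (intro tendsto_intros LIMSEQ_realpow_zero) auto
    then have "(\<lambda>j. H * (2 powr (\<beta> - \<gamma>)) ^ j) \<longlonglongrightarrow> 0" by simp
    from order_tendstoD(2)[OF this, of "1/2"] obtain j where "H * (2 powr (\<beta> - \<gamma>)) ^ j < 1/2" unfolding eventually_sequentially by auto
    moreover have "(2 powr (\<beta> - \<gamma>)) ^ j = (2 ^ j) powr (\<beta> - \<gamma>)" by (induction j) (simp_all add: powr_mult)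
    ultimately show ?thesis using that[of j] by simp
  qed
  define P where "P = (2::real) ^ j"
  have P: "P > 0" "P \<ge> 1" unfolding P_def by simp_all
  define L where "L = 2 * (A * P powr \<beta> * (M * (2 ^ k + C * P powr (- \<gamma>) * 2 ^ k)))"
  have L: "L > 0" unfolding L_def using A M C P by (intro mult_pos_pos add_pos_nonneg) auto
  have "\<Psi> s (1 / real n) \<le> L * EE n" if n: "n \<ge> 1" for n
  proof (rule field_le_epsilon)
    fix e :: real assume e: "e > 0"
    have "e / L > 0" using e L by simp
    from E1[OF n this] obtain T where T: "T \<in> trig_polys n" "hb r \<alpha> (\<lambda>x. f x - T x) (EE n + e / L)" by blast
    define E where "E = EE n + e / L"
    define x where "x = \<Psi> s (1 / real n)"
    have n0: "1 / real n > 0" using n by simp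
    define m where "m = 2 ^ j * n"
    have m1: "m \<ge> 1" "n \<le> m" unfolding m_def using n by (auto simp: Suc_le_eq)
    have m0: "0 < 1 / real m" "1 / real m \<le> 1" using m1 by auto
    have nm: "(real n / real m) powr \<gamma> = P powr (- \<gamma>)"
    proof -
      have "real n / real m = 1 / P" unfolding m_def P_def using n by simp
      then show ?thesis using inverse_powr[OF P(1)] by simp
    qed
    have k1: "\<Psi> k (1 / real n) \<le> 2 ^ (k - s) * x" unfolding x_def by (rule P2[OF n0 psib_raise[OF f sk P1[OF n0]]])
    have "\<Psi> k (1 / real m) \<le> 2 ^ k * E + C * P powr (- \<gamma>) * (\<Psi> k (1 / real n) + 2 ^ k * E)"
      using P2[OF m0(1) up[OF f n m1(2) T P1[OF n0]]] unfolding nm E_def .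
    also have "\<dots> \<le> 2 ^ k * E + C * P powr (- \<gamma>) * (2 ^ (k - s) * x + 2 ^ k * E)"
      using k1 C by (intro add_left_mono mult_left_mono) auto
    finally have k2: "\<Psi> k (1 / real m) \<le> 2 ^ k * E + C * P powr (- \<gamma>) * (2 ^ (k - s) * x + 2 ^ k * E)" .
    have "x \<le> A * P powr \<beta> * \<Psi> s (1 / real m)" unfolding x_def P_def m_def by (rule scale[OF n])
    also have "\<dots> \<le> A * P powr \<beta> * (M * \<Psi> k (1 / real m))" using A(1) M(2)[OF m0] by (intro mult_left_mono) auto
    also have "\<dots> \<le> A * P powr \<beta> * (M * (2 ^ k * E + C * P powr (- \<gamma>) * (2 ^ (k - s) * x + 2 ^ k * E)))"
      using A(1) M(1) k2 by (intro mult_left_mono) auto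
    also have "\<dots> = L / 2 * E + H * (P powr \<beta> * P powr (- \<gamma>)) * x"
      unfolding L_def H_def by (simp add: algebra_simps)
    also have "P powr \<beta> * P powr (- \<gamma>) = P powr (\<beta> - \<gamma>)" by (simp add: powr_add[symmetric])
    \<comment> \<open>Absorption is legitimate since x is a real number, thus finite: half of it
      moves to the left-hand side.\<close>
    also have "H * P powr (\<beta> - \<gamma>) * x \<le> 1 / 2 * x"
      using j psib_nonneg[OF P1[OF n0] n0] unfolding P_def x_def by (intro mult_right_mono) auto
    finally have "x \<le> L * E" by simp
    also have "\<dots> = L * EE n + e" unfolding E_def using L by (simp add: distrib_left)
    finally show "\<Psi> s (1 / real n) \<le> L * EE n + e" unfolding x_def .
  qed
  then show ?thesis using L by blast
qed

text \<open>For \<theta> = 1 the exponent s + r - \<alpha> of \<open>psib_scale\<close> lies below k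
  + r - \<alpha> as soon as s < k, so no detour through the one-step modulus is made.\<close>

lemma equivalence_one:
  fixes \<Psi> :: "nat \<Rightarrow> real \<Rightarrow> real" and EE :: "nat \<Rightarrow> real"
  assumes f: "f \<in> X" and a: "\<alpha> > 0" "\<alpha> \<le> real r" and sk: "s < k" and th: "\<theta> = 1"
    and P1: "\<And>k \<delta>. \<delta> > 0 \<Longrightarrow> psib k r \<alpha> f \<delta> (\<Psi> k \<delta>)" and P2: "\<And>k \<delta> B. \<delta> > 0 \<Longrightarrow> psib k r \<alpha> f \<delta> B \<Longrightarrow> \<Psi> k \<delta> \<le> B"
    and E1: "\<And>n \<epsilon>. n \<ge> 1 \<Longrightarrow> \<epsilon> > 0 \<Longrightarrow> \<exists>T\<in>trig_polys n. hb r \<alpha> (\<lambda>x. f x - T x) (EE n + \<epsilon>)"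
    and E2: "\<And>n T B. T \<in> trig_polys n \<Longrightarrow> Q (\<lambda>x. f x - T x) \<le> B \<Longrightarrow> hb r \<alpha> (\<lambda>x. f x - T x) B \<Longrightarrow> EE n \<le> 2 * B"
    and dense: "\<And>\<epsilon>. \<epsilon> > 0 \<Longrightarrow> \<exists>m. \<exists>P\<in>trig_polys m. Q (\<lambda>x. f x - P x) < \<epsilon>"
  shows "(\<exists>L>0. \<forall>n\<ge>1. \<Psi> s (1 / real n) \<le> L * EE n) \<longleftrightarrow> (\<exists>M>0. \<forall>h. 0 < h \<and> h \<le> 1 \<longrightarrow> \<Psi> s h \<le> M * \<Psi> k h)"
proof
  have k1: "k \<ge> 1" using sk by simp
  obtain C where C: "C > 0" and J: "\<And>n B \<epsilon>. n \<ge> 1 \<Longrightarrow> psib k r \<alpha> f (1 / real n) B \<Longrightarrow> \<epsilon> > 0 \<Longrightarrow>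
       \<exists>T\<in>trig_polys n. Q (\<lambda>x. f x - T x) \<le> C * (B + \<epsilon>) \<and> hb r \<alpha> (\<lambda>x. f x - T x) (C * (B + \<epsilon>))"
    using jackson_dense[OF th k1 a f dense] by blast
  assume "\<exists>L>0. \<forall>n\<ge>1. \<Psi> s (1 / real n) \<le> L * EE n"
  then obtain L where L: "L > 0" "\<And>n. n \<ge> 1 \<Longrightarrow> \<Psi> s (1 / real n) \<le> L * EE n" by blast
  show "\<exists>M>0. \<forall>h. 0 < h \<and> h \<le> 1 \<longrightarrow> \<Psi> s h \<le> M * \<Psi> k h" by (rule forward_direction[where \<Psi> = \<Psi> and EE = EE and s = s and L = L and C = C, OF f P1 P2 E2 C J L])
next
  assume "\<exists>M>0. \<forall>h. 0 < h \<and> h \<le> 1 \<longrightarrow> \<Psi> s h \<le> M * \<Psi> k h"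
  then obtain M where M: "M > 0" "\<And>h. 0 < h \<Longrightarrow> h \<le> 1 \<Longrightarrow> \<Psi> s h \<le> M * \<Psi> k h" by blast
  have beta: "real s + real r - \<alpha> < (real k + real r - \<alpha>) * \<theta>" using sk th by simp
  have scale: "\<Psi> s (1 / real n) \<le> 1 * (2 ^ j) powr (real s + real r - \<alpha>) * \<Psi> s (1 / real (2 ^ j * n))" if n: "n \<ge> 1" for n j
  proof -
    have m0: "1 / real (2 ^ j * n) > 0" using n by simp
    have "psib s r \<alpha> f (real (2 ^ j) * (1 / real (2 ^ j * n))) (real (2 ^ j) powr (real s + real r - \<alpha> * \<theta>) * \<Psi> s (1 / real (2 ^ j * n)))"
      by (rule psib_scale[OF f P1[OF m0]]) simp
    moreover have "real (2 ^ j) * (1 / real (2 ^ j * n)) = 1 / real n" using n by simp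
    ultimately show ?thesis using P2[of "1 / real n" s] n unfolding th by simp
  qed
  have "s \<le> k" using sk by simp
  then show "\<exists>L>0. \<forall>n\<ge>1. \<Psi> s (1 / real n) \<le> L * EE n"
    by (rule absorption[where \<Psi> = \<Psi> and EE = EE and k = k and M = M and A = 1 and \<beta> = "real s + real r - \<alpha>", OF f a _ P1 P2 E1 M zero_less_one beta scale])
qed

text \<open>The scaling inequality for \<Psi> s is itself obtained with the help of
  \<open>M\<close>: \<open>modulus_scaling\<close> bounds the one-step modulus at all dyadic scales
  by \<Psi> s at the fine scale, the second part of \<open>jackson_holder\<close> turns this into a
  bound for \<Psi> k at 1/n, and \<open>M\<close> leads back to \<Psi> s at 1/n.\<close>

lemma equivalence_small:
  fixes \<Psi> :: "nat \<Rightarrow> real \<Rightarrow> real" and EE :: "nat \<Rightarrow> real"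
  assumes f: "f \<in> X" and a: "\<alpha> > 0" "\<alpha> \<le> real r" and s: "s \<ge> 1" and sk: "real k > real s + 1 / \<theta> - 1"
    and P1: "\<And>k \<delta>. \<delta> > 0 \<Longrightarrow> psib k r \<alpha> f \<delta> (\<Psi> k \<delta>)" and P2: "\<And>k \<delta> B. \<delta> > 0 \<Longrightarrow> psib k r \<alpha> f \<delta> B \<Longrightarrow> \<Psi> k \<delta> \<le> B"
    and E1: "\<And>n \<epsilon>. n \<ge> 1 \<Longrightarrow> \<epsilon> > 0 \<Longrightarrow> \<exists>T\<in>trig_polys n. hb r \<alpha> (\<lambda>x. f x - T x) (EE n + \<epsilon>)"
    and E2: "\<And>n T B. T \<in> trig_polys n \<Longrightarrow> Q (\<lambda>x. f x - T x) \<le> B \<Longrightarrow> hb r \<alpha> (\<lambda>x. f x - T x) B \<Longrightarrow> EE n \<le> 2 * B"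
    and jk: "jackson (k + r)" and om: "is_modulus (k + r) f om" "\<alpha> = real r \<longrightarrow> dini r om"
  shows "(\<exists>L>0. \<forall>n\<ge>1. \<Psi> s (1 / real n) \<le> L * EE n) \<longleftrightarrow> (\<exists>M>0. \<forall>h. 0 < h \<and> h \<le> 1 \<longrightarrow> \<Psi> s h \<le> M * \<Psi> k h)"
proof
  obtain C where C: "C > 0" and J: "\<And>n B \<epsilon>. n \<ge> 1 \<Longrightarrow> psib k r \<alpha> f (1 / real n) B \<Longrightarrow> \<epsilon> > 0 \<Longrightarrow>
       \<exists>T\<in>trig_polys n. Q (\<lambda>x. f x - T x) \<le> C * (B + \<epsilon>) \<and> hb r \<alpha> (\<lambda>x. f x - T x) (C * (B + \<epsilon>))"
    using jackson_holder(1)[OF a jk f om] by blast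
  assume "\<exists>L>0. \<forall>n\<ge>1. \<Psi> s (1 / real n) \<le> L * EE n"
  then obtain L where L: "L > 0" "\<And>n. n \<ge> 1 \<Longrightarrow> \<Psi> s (1 / real n) \<le> L * EE n" by blast
  show "\<exists>M>0. \<forall>h. 0 < h \<and> h \<le> 1 \<longrightarrow> \<Psi> s h \<le> M * \<Psi> k h" by (rule forward_direction[where \<Psi> = \<Psi> and EE = EE and s = s and L = L and C = C, OF f P1 P2 E2 C J L])
next
  assume "\<exists>M>0. \<forall>h. 0 < h \<and> h \<le> 1 \<longrightarrow> \<Psi> s h \<le> M * \<Psi> k h"
  then obtain M where M: "M > 0" "\<And>h. 0 < h \<Longrightarrow> h \<le> 1 \<Longrightarrow> \<Psi> s h \<le> M * \<Psi> k h" by blast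
  have "1 / \<theta> \<ge> 1" using theta_pos theta_le by simp
  then have sk': "s \<le> k" using sk by linarith
  obtain C where C: "C > 0" and hold: "\<And>n B. n \<ge> 1 \<Longrightarrow> (\<forall>i. om (1 / real (2 ^ i * n)) \<le> real (2 ^ i * n) powr (- (\<alpha> * \<theta>)) * B) \<Longrightarrow> psib k r \<alpha> f (1 / real n) (C * B)"
    using jackson_holder(2)[OF a jk f om] by blast
  define \<beta> where "\<beta> = real (s + r - 1) * \<theta> + 1 - \<alpha> * \<theta>"
  define D where "D = 2 ^ (k - s) * real (s + r)"
  have D: "D > 0" unfolding D_def using s by simp
  have beta: "\<beta> < (real k + real r - \<alpha>) * \<theta>"
  proof -
    have "(real s + 1 / \<theta> - 1) * \<theta> < real k * \<theta>" using sk theta_pos by (rule mult_strict_right_mono)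
    then have "real s * \<theta> + 1 - \<theta> < real k * \<theta>" using theta_pos by (simp add: algebra_simps)
    moreover have "real (s + r - 1) = real s + real r - 1" using s by simp
    ultimately show ?thesis unfolding \<beta>_def by (simp add: algebra_simps)
  qed
  have A: "M * C * D > 0" using M(1) C D by simp
  have scale: "\<Psi> s (1 / real n) \<le> M * C * D * (2 ^ j) powr \<beta> * \<Psi> s (1 / real (2 ^ j * n))" if n: "n \<ge> 1" for n j
  proof -
    have m0: "1 / real (2 ^ j * n) > 0" using n by simp
    have n0: "0 < 1 / real n" "1 / real n \<le> 1" using n by auto
    have "\<forall>i. om (1 / real (2 ^ i * n)) \<le> real (2 ^ i * n) powr (- (\<alpha> * \<theta>)) * (D * (2 ^ j) powr \<beta> * \<Psi> s (1 / real (2 ^ j * n)))"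
      unfolding D_def \<beta>_def by (intro allI modulus_scaling[OF f s sk' a(1) om(1) a(2) n P1[OF m0]])
    from P2[OF n0(1) hold[OF n this]]
    have "\<Psi> k (1 / real n) \<le> C * (D * (2 ^ j) powr \<beta> * \<Psi> s (1 / real (2 ^ j * n)))" .
    then have "M * \<Psi> k (1 / real n) \<le> M * (C * (D * (2 ^ j) powr \<beta> * \<Psi> s (1 / real (2 ^ j * n))))" using M(1) by simp
    then show ?thesis using M(2)[OF n0] by (simp only: mult.assoc)
  qed
  show "\<exists>L>0. \<forall>n\<ge>1. \<Psi> s (1 / real n) \<le> L * EE n"
    by (rule absorption[where \<Psi> = \<Psi> and EE = EE and k = k and M = M and A = "M * C * D" and \<beta> = \<beta>, OF f a sk' P1 P2 E1 M A beta scale])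
qed

end

section \<open>From extended norms to their real powers\<close>

lemma powr_le_powr_iff:
  fixes a b e :: real assumes "a \<ge> 0" "b \<ge> 0" "e > 0" shows "a powr e \<le> b powr e \<longleftrightarrow> a \<le> b"
  using powr_mono2[of e a b] powr_less_mono2[of e b a] assms by (auto simp: not_le[symmetric])

lemma powr_root_cancel:
  fixes a e :: real assumes "a \<ge> 0" "e > 0" shows "(a powr e) powr (1 / e) = a" "(a powr (1 / e)) powr e = a"
  using assms by (simp_all add: powr_powr)

lemma ennreal_ratio_iff:
  fixes a b L \<theta> :: real assumes "a \<ge> 0" "b \<ge> 0" "L > 0" "\<theta> > 0"
  shows "ennreal (a powr (1 / \<theta>)) \<le> ennreal L * ennreal (b powr (1 / \<theta>)) \<longleftrightarrow> a \<le> L powr \<theta> * b"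
proof -
  have "ennreal L * ennreal (b powr (1 / \<theta>)) = ennreal (L * b powr (1 / \<theta>))" using assms by (simp add: ennreal_mult)
  also have "L * b powr (1 / \<theta>) = (L powr \<theta> * b) powr (1 / \<theta>)"
    using assms by (simp add: powr_mult powr_root_cancel)
  finally show ?thesis using assms by (simp add: powr_le_powr_iff)
qed

lemma ennreal_ratio_ex:
  fixes a b :: "'i \<Rightarrow> real"
  assumes "\<theta> > 0" "\<And>i. i \<in> S \<Longrightarrow> a i \<ge> 0" "\<And>i. i \<in> S \<Longrightarrow> b i \<ge> 0"
  shows "(\<exists>L>0. \<forall>i\<in>S. ennreal (a i powr (1 / \<theta>)) \<le> ennreal L * ennreal (b i powr (1 / \<theta>))) \<longleftrightarrow> (\<exists>L>0. \<forall>i\<in>S. a i \<le> L * b i)"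
proof
  assume "\<exists>L>0. \<forall>i\<in>S. ennreal (a i powr (1 / \<theta>)) \<le> ennreal L * ennreal (b i powr (1 / \<theta>))"
  then obtain L where "L > 0" "\<forall>i\<in>S. ennreal (a i powr (1 / \<theta>)) \<le> ennreal L * ennreal (b i powr (1 / \<theta>))" by blast
  then have "L powr \<theta> > 0" "\<forall>i\<in>S. a i \<le> L powr \<theta> * b i" using assms by (auto simp: ennreal_ratio_iff)
  then show "\<exists>L>0. \<forall>i\<in>S. a i \<le> L * b i" by blast
next
  assume "\<exists>L>0. \<forall>i\<in>S. a i \<le> L * b i"
  then obtain L where L: "L > 0" "\<forall>i\<in>S. a i \<le> L * b i" by blast
  have "L powr (1 / \<theta>) > 0" using L by simp
  moreover have "\<forall>i\<in>S. ennreal (a i powr (1 / \<theta>)) \<le> ennreal (L powr (1 / \<theta>)) * ennreal (b i powr (1 / \<theta>))"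
    using L assms by (simp add: ennreal_ratio_iff powr_root_cancel)
  ultimately show "\<exists>L>0. \<forall>i\<in>S. ennreal (a i powr (1 / \<theta>)) \<le> ennreal L * ennreal (b i powr (1 / \<theta>))" by blast
qed

lemma ennreal_power_rep:
  assumes "x < \<infinity>" "\<theta> > 0" shows "x = ennreal ((enn2real x powr \<theta>) powr (1 / \<theta>))"
  using assms by (simp add: powr_root_cancel less_top)

lemma enn2real_powr_le:
  assumes "x \<le> ennreal (B powr (1 / \<theta>))" "B \<ge> 0" "\<theta> > 0" shows "enn2real x powr \<theta> \<le> B"
proof -
  have "enn2real x \<le> B powr (1 / \<theta>)" using assms by (intro enn2real_leI) auto
  then have "enn2real x powr \<theta> \<le> (B powr (1 / \<theta>)) powr \<theta>" using assms by (intro powr_mono2) auto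
  then show ?thesis using assms by (simp add: powr_root_cancel)
qed

lemma epowr_ennreal: "a \<ge> 0 \<Longrightarrow> epowr (ennreal a) e = ennreal (a powr e)"
  unfolding epowr_def by simp

lemma epowr_le_imp:
  assumes "epowr x (1 / \<theta>) \<le> ennreal c" "c \<ge> 0" "\<theta> > 0" shows "x \<le> ennreal (c powr \<theta>)"
proof -
  have fin: "x \<noteq> \<infinity>" using assms(1) unfolding epowr_def by (auto simp: top_unique)
  then have "enn2real x powr (1 / \<theta>) \<le> c" using assms unfolding epowr_def by simp
  then have "(enn2real x powr (1 / \<theta>)) powr \<theta> \<le> c powr \<theta>" using assms by (intro powr_mono2) auto
  then have "enn2real x \<le> c powr \<theta>" using assms by (simp add: powr_root_cancel)
  then have "ennreal (enn2real x) \<le> ennreal (c powr \<theta>)" by (rule ennreal_leI)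
  moreover have "ennreal (enn2real x) = x" using fin by (simp add: less_top)
  ultimately show ?thesis by (simp only:)
qed

text \<open>On (0, 1/N) the function G lies above the step function with value c_i on the i-th
  dyadic interval, whose length is 1/(2^(i+1) N).\<close>

lemma dyadic_integral_ge:
  fixes G :: "real \<Rightarrow> ennreal" and c :: "nat \<Rightarrow> real"
  assumes "N > 0" "\<And>i. c i \<ge> 0" "\<And>i t. 1 / (2 ^ Suc i * N) \<le> t \<Longrightarrow> t < 1 / (2 ^ i * N) \<Longrightarrow> ennreal (c i) \<le> G t"
  shows "ennreal (\<Sum>i<I. c i * (1 / (2 ^ Suc i * N))) \<le> (\<integral>\<^sup>+t\<in>{0<..<1 / N}. G t \<partial>lborel)"
proof -
  define A where "A i = {1 / (2 ^ Suc i * N)..<1 / (2 ^ i * N)}" for i :: nat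
  have le: "1 / (2 ^ Suc i * N) \<le> 1 / (2 ^ i * N)" for i :: nat
    using assms(1) by (intro divide_left_mono) auto
  have le0: "1 / (2 ^ i * N) \<le> 1 / N" for i :: nat
    using assms(1) by (intro divide_left_mono) auto
  \<comment> \<open>The indicator on the right starts at the left end of the intervals summed so
    far. For t in the next interval the induction hypothesis therefore says that the earlier sum
    vanishes, which replaces a disjointness argument.\<close>
  have pt: "(\<Sum>i<I. ennreal (c i) * indicator (A i) t) \<le> G t * indicator {1 / (2 ^ I * N)..<1 / N} t" for I t
  proof (induction I)
    case (Suc I)
    show ?case
    proof (cases "t \<in> A I")
      case True
      then have "(\<Sum>i<I. ennreal (c i) * indicator (A i) t) \<le> 0" using Suc unfolding A_def by simp
      moreover have "t \<in> {1 / (2 ^ Suc I * N)..<1 / N}" using True le0[of I] unfolding A_def by auto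
      moreover have "ennreal (c I) \<le> G t" using assms(3) True unfolding A_def by auto
      ultimately show ?thesis using True by simp
    next
      case False
      then have "(\<Sum>i<Suc I. ennreal (c i) * indicator (A i) t) = (\<Sum>i<I. ennreal (c i) * indicator (A i) t)" by simp
      also have "\<dots> \<le> G t * indicator {1 / (2 ^ I * N)..<1 / N} t" by (rule Suc)
      also have "\<dots> \<le> G t * indicator {1 / (2 ^ Suc I * N)..<1 / N} t"
        using le[of I] by (intro mult_left_mono) (auto simp: indicator_def simp del: power_Suc)
      finally show ?thesis .
    qed
  qed simp
  have "ennreal (\<Sum>i<I. c i * (1 / (2 ^ Suc i * N))) = (\<Sum>i<I. ennreal (c i) * ennreal (1 / (2 ^ i * N) - 1 / (2 ^ Suc i * N)))"
  proof -
    have eq: "1 / (2 ^ i * N) - 1 / (2 ^ Suc i * N) = 1 / (2 ^ Suc i * N)" for i :: nat using assms(1) by (simp add: field_simps)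
    have "ennreal (\<Sum>i<I. c i * (1 / (2 ^ Suc i * N))) = (\<Sum>i<I. ennreal (c i * (1 / (2 ^ Suc i * N))))"
      using assms(1,2) by (intro sum_ennreal[symmetric] mult_nonneg_nonneg) auto
    also have "\<dots> = (\<Sum>i<I. ennreal (c i) * ennreal (1 / (2 ^ Suc i * N)))"
      using assms(1,2) by (intro sum.cong refl ennreal_mult) auto
    finally show ?thesis unfolding eq .
  qed
  also have "\<dots> = (\<Sum>i<I. \<integral>\<^sup>+t. ennreal (c i) * indicator (A i) t \<partial>lborel)"
    unfolding A_def using le by (intro sum.cong refl) (subst nn_integral_cmult_indicator, auto simp del: power_Suc)
  also have "\<dots> = (\<integral>\<^sup>+t. (\<Sum>i<I. ennreal (c i) * indicator (A i) t) \<partial>lborel)"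
    unfolding A_def by (rule nn_integral_sum[symmetric]) measurable
  also have "\<dots> \<le> (\<integral>\<^sup>+t\<in>{0<..<1 / N}. G t \<partial>lborel)"
  proof (rule nn_integral_mono)
    fix t
    have gen: "indicator {e..<M} t \<le> (indicator {0<..<M} t :: ennreal)" if "0 < e" for e M :: real
      using that by (auto simp: indicator_def)
    have "indicator {1 / (2 ^ I * N)..<1 / N} t \<le> (indicator {0<..<1 / N} t :: ennreal)" by (rule gen) (use assms(1) in simp)
    then show "(\<Sum>i<I. ennreal (c i) * indicator (A i) t) \<le> G t * indicator {0<..<1 / N} t"
      using pt[where I = I and t = t] by (meson mult_left_mono order_trans zero_le)
  qed
  finally show ?thesis .
qed

text \<open>The ranges p < 1, 1 \<le> p < \<infinity> and p = \<infinity> differ only in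
  \<open>Q\<close>. Expressing the extended norm through \<open>Q\<close> lets them share
  \<open>equivalence_admissible\<close>.\<close>

locale lp_gauge = gauge "Lspace p" Q "p_one p" for p Q +
  assumes Lnorm_eq: "\<And>g. g \<in> Lspace p \<Longrightarrow> Lnorm p g = ennreal (Q g powr (1 / p_one p))"
begin

lemma weighted_Lnorm_le_iff:
  assumes "g \<in> Lspace p" "B \<ge> 0" "h > 0"
  shows "ennreal (h powr (- \<alpha>)) * Lnorm p g \<le> ennreal (B powr (1 / p_one p)) \<longleftrightarrow> Q g \<le> h powr (\<alpha> * p_one p) * B"
proof -
  have "ennreal (h powr (- \<alpha>)) * Lnorm p g = ennreal ((h powr (- (\<alpha> * p_one p)) * Q g) powr (1 / p_one p))"
    unfolding Lnorm_eq[OF assms(1)] using theta_pos Q_nonneg[of g] assms(3)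
    by (simp add: ennreal_mult'[symmetric] powr_mult powr_powr)
  then have "ennreal (h powr (- \<alpha>)) * Lnorm p g \<le> ennreal (B powr (1 / p_one p)) \<longleftrightarrow> h powr (- (\<alpha> * p_one p)) * Q g \<le> B"
    using theta_pos Q_nonneg[of g] assms(2,3) by (simp add: powr_le_powr_iff)
  also have "\<dots> \<longleftrightarrow> Q g \<le> h powr (\<alpha> * p_one p) * B"
    using assms(3) by (simp add: powr_minus field_simps)
  finally show ?thesis .
qed

lemma psi_le_iff:
  assumes "f \<in> Lspace p" "B \<ge> 0"
  shows "psi k r \<alpha> f \<delta> p \<le> ennreal (B powr (1 / p_one p)) \<longleftrightarrow> psib k r \<alpha> f \<delta> B"
proof -
  have "psi k r \<alpha> f \<delta> p \<le> ennreal (B powr (1 / p_one p)) \<longleftrightarrow>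
    (\<forall>h\<in>{0<..\<delta>}. \<forall>d\<in>{0<..<\<delta>}. ennreal (h powr (- \<alpha>)) * Lnorm p (fdiff k d (fdiff r h f)) \<le> ennreal (B powr (1 / p_one p)))"
  proof (cases "\<delta> > 0")
    case True
    then have "{0<..<\<delta>} \<noteq> {}" by simp
    then show ?thesis unfolding psi_def modulus_def SUP_mult_left_ennreal SUP_le_iff by simp
  next
    case False
    then show ?thesis unfolding psi_def SUP_le_iff by simp
  qed
  also have "\<dots> \<longleftrightarrow> (\<forall>h\<in>{0<..\<delta>}. \<forall>d\<in>{0<..<\<delta>}. Q (fdiff k d (fdiff r h f)) \<le> h powr (\<alpha> * p_one p) * B)"
    by (intro ball_cong refl weighted_Lnorm_le_iff X_fdiff assms) auto
  also have "\<dots> \<longleftrightarrow> psib k r \<alpha> f \<delta> B" unfolding psib_def by auto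
  finally show ?thesis .
qed

lemma Hseminorm_le_iff:
  assumes "g \<in> Lspace p" "B \<ge> 0"
  shows "Hseminorm p r \<alpha> g \<le> ennreal (B powr (1 / p_one p)) \<longleftrightarrow> hb r \<alpha> g B"
proof -
  have "Hseminorm p r \<alpha> g \<le> ennreal (B powr (1 / p_one p)) \<longleftrightarrow> (\<forall>h\<in>{0<..}. Q (fdiff r h g) \<le> h powr (\<alpha> * p_one p) * B)"
    unfolding Hseminorm_def SUP_le_iff by (intro ball_cong refl weighted_Lnorm_le_iff X_fdiff assms) auto
  then show ?thesis unfolding hb_def by auto
qed

lemma Lnorm_le_iff:
  assumes "g \<in> Lspace p" "B \<ge> 0" shows "Lnorm p g \<le> ennreal (B powr (1 / p_one p)) \<longleftrightarrow> Q g \<le> B"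
  using weighted_Lnorm_le_iff[OF assms, of 1] by simp

lemma modulus_is_modulus:
  assumes "f \<in> Lspace p"
  shows "modulus K p f \<delta> < \<infinity>" "is_modulus K f (\<lambda>\<delta>. enn2real (modulus K p f \<delta>) powr p_one p)"
proof -
  have iff: "modulus K p f \<delta> \<le> ennreal (W powr (1 / p_one p)) \<longleftrightarrow> (\<forall>d\<in>{0<..<\<delta>}. Q (fdiff K d f) \<le> W)" if "W \<ge> 0" for \<delta> W
    unfolding modulus_def SUP_le_iff by (intro ball_cong refl Lnorm_le_iff X_fdiff assms that)
  have "modulus K p f \<delta> \<le> ennreal ((2 ^ K * Q f) powr (1 / p_one p))" for \<delta>
    using Q_fdiff[OF assms] Q_nonneg[of f] by (subst iff) auto
  then show fin: "modulus K p f \<delta> < \<infinity>" for \<delta> by (rule le_less_trans) simp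
  show "is_modulus K f (\<lambda>\<delta>. enn2real (modulus K p f \<delta>) powr p_one p)"
    unfolding is_modulus_def
  proof (intro allI impI conjI)
    fix \<delta> d :: real assume "0 < \<delta>" "0 < d \<and> d < \<delta>"
    then show "Q (fdiff K d f) \<le> enn2real (modulus K p f \<delta>) powr p_one p"
      using iff[of "enn2real (modulus K p f \<delta>) powr p_one p" \<delta>] ennreal_power_rep[OF fin theta_pos, of \<delta>] by auto
  next
    fix \<delta> W :: real assume d: "0 < \<delta>" and W: "\<forall>d. 0 < d \<and> d < \<delta> \<longrightarrow> Q (fdiff K d f) \<le> W"
    have "0 < \<delta> / 2 \<and> \<delta> / 2 < \<delta>" using d by simp
    then have W0: "W \<ge> 0" using W Q_nonneg order_trans by blast
    have "modulus K p f \<delta> \<le> ennreal (W powr (1 / p_one p))" using W by (subst iff[OF W0]) auto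
    then show "enn2real (modulus K p f \<delta>) powr p_one p \<le> W" by (rule enn2real_powr_le[OF _ W0 theta_pos])
  qed
qed

text \<open>On a dyadic interval the integrand is at least the value with the modulus taken at the
  left end and the power of t at the right end. Summation gives the dyadic sums up to a shift of the
  index, and the leading terms lost by the shift are bounded by monotonicity of the modulus.\<close>

lemma modulus_int_cond_imp_dini:
  assumes f: "f \<in> Lspace p" and cond: "modulus_int_cond p r (real r) f k"
  shows "dini r (\<lambda>\<delta>. enn2real (modulus (k + r) p f \<delta>) powr p_one p)"
proof -
  define om where "om \<delta> = enn2real (modulus (r + k) p f \<delta>) powr p_one p" for \<delta>
  define a where "a = real r * p_one p"
  have a0: "a \<ge> 0" unfolding a_def using theta_pos by simp
  have ism: "is_modulus (r + k) f om" unfolding om_def by (rule modulus_is_modulus(2)[OF f])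
  have om0: "om t \<ge> 0" for t unfolding om_def by simp
  have rep: "modulus (r + k) p f t = ennreal (om t powr (1 / p_one p))" for t
    unfolding om_def by (rule ennreal_power_rep[OF modulus_is_modulus(1)[OF f] theta_pos])
  have quot: "modulus (r + k) p f t / ennreal (t powr real r) = ennreal ((t powr (- a) * om t) powr (1 / p_one p))" if "t > 0" for t
  proof -
    have "modulus (r + k) p f t / ennreal (t powr real r) = ennreal (om t powr (1 / p_one p) / t powr real r)"
      unfolding rep using that by (subst divide_ennreal) auto
    also have "om t powr (1 / p_one p) / t powr real r = (t powr (- a) * om t) powr (1 / p_one p)"
    proof -
      have "(t powr (- a)) powr (1 / p_one p) = t powr (- real r)" unfolding a_def using theta_pos by (simp add: powr_powr)
      then show ?thesis using om0[of t] by (simp add: powr_mult powr_minus divide_inverse mult.commute)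
    qed
    finally show ?thesis .
  qed
  obtain C where C: "C > 0" and cd: "\<And>\<delta>. 0 < \<delta> \<Longrightarrow> \<delta> < 1 \<Longrightarrow>
       epowr (\<integral>\<^sup>+t\<in>{0<..<\<delta>}. epowr (modulus (r + k) p f t / ennreal (t powr real r)) (p_one p) / ennreal t \<partial>lborel) (1 / p_one p)
       \<le> ennreal C * (modulus (r + k) p f \<delta> / ennreal (\<delta> powr real r))"
    using cond unfolding modulus_int_cond_def by blast
  define G where "G t = epowr (modulus (r + k) p f t / ennreal (t powr real r)) (p_one p) / ennreal t" for t
  have G: "G t = ennreal (t powr (- a) * om t / t)" if "t > 0" for t
    unfolding G_def quot[OF that] using that om0[of t] theta_pos
    by (simp add: epowr_ennreal powr_root_cancel divide_ennreal)
  have int: "(\<integral>\<^sup>+t\<in>{0<..<1 / N}. G t \<partial>lborel) \<le> ennreal (C powr p_one p * (N powr a * om (1 / N)))" if "N > 1" for N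
  proof -
    have d: "0 < 1 / N" "1 / N < 1" using that by auto
    have "epowr (\<integral>\<^sup>+t\<in>{0<..<1 / N}. G t \<partial>lborel) (1 / p_one p) \<le> ennreal C * ennreal (((1 / N) powr (- a) * om (1 / N)) powr (1 / p_one p))"
      unfolding G_def using cd[OF d] unfolding quot[OF d(1)] .
    also have "(1 / N) powr (- a) = N powr a" using inverse_powr[of N "- a"] that by simp
    also have "ennreal C * ennreal ((N powr a * om (1 / N)) powr (1 / p_one p)) = ennreal (C * (N powr a * om (1 / N)) powr (1 / p_one p))"
      using C by (simp add: ennreal_mult)
    finally have "(\<integral>\<^sup>+t\<in>{0<..<1 / N}. G t \<partial>lborel) \<le> ennreal ((C * (N powr a * om (1 / N)) powr (1 / p_one p)) powr p_one p)"
      by (rule epowr_le_imp) (use C theta_pos in auto)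
    then show ?thesis using C om0[of "1 / N"] theta_pos by (simp add: powr_mult powr_root_cancel)
  qed
  \<comment> \<open>The summands 1 and \<open>2 powr a\<close> account for the terms with index 0
    and 1, the last one for the tail from index 2 on.\<close>
  define D where "D = 1 + 2 powr a + 2 * 2 powr a * (C powr p_one p * 2 powr a)"
  have "(\<Sum>i<I. real (2 ^ i * n) powr a * om (1 / real (2 ^ i * n))) \<le> D * (real n powr a * om (1 / real n))" if n: "n \<ge> 1" for n I
  proof -
    define x where "x i = real (2 ^ i * n) powr a * om (1 / real (2 ^ i * n))" for i
    have x0: "x i \<ge> 0" for i unfolding x_def using om0 by simp
    \<comment> \<open>The integral condition only covers \<open>\<delta> < 1\<close>, which excludes \<open>\<delta> = 1/n\<close> for \<open>n = 1\<close>.\<close>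
    define N where "N = 2 * real n"
    have N: "N > 1" unfolding N_def using n by simp
    have x1: "N powr a * om (1 / N) \<le> 2 powr a * x 0"
    proof -
      have "om (1 / N) \<le> om (1 / real n)" by (rule is_modulus_mono[OF ism]) (use n in \<open>simp_all add: N_def field_simps\<close>)
      then have "N powr a * om (1 / N) \<le> (2 powr a * real n powr a) * om (1 / real n)"
        unfolding N_def powr_mult by (rule mult_left_mono) simp
      then show ?thesis unfolding x_def by (simp add: mult.assoc)
    qed
    define c where "c i = (2 ^ i * N) powr a * (2 ^ i * N) * om (1 / (2 ^ Suc i * N))" for i :: nat
    have c0: "c i \<ge> 0" for i unfolding c_def using om0 N by simp
    have cG: "ennreal (c i) \<le> G t" if t: "1 / (2 ^ Suc i * N) \<le> t" "t < 1 / (2 ^ i * N)" for i :: nat and t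
    proof -
      have d0: "0 < 1 / (2 ^ Suc i * N)" using N by simp
      have t0: "t > 0" using d0 t(1) by linarith
      have u: "2 ^ i * N > 0" using N by simp
      have ut: "2 ^ i * N \<le> 1 / t" using t(2) t0 u by (simp add: field_simps)
      have "(2 ^ i * N) powr a \<le> (1 / t) powr a" using ut u a0 by (intro powr_mono2) auto
      also have "\<dots> = t powr (- a)" by (rule inverse_powr[OF t0])
      finally have "(2 ^ i * N) powr a * (2 ^ i * N) * om (1 / (2 ^ Suc i * N)) \<le> t powr (- a) * (1 / t) * om t"
        using ut u om0 t0 by (intro mult_mono is_modulus_mono[OF ism d0 t(1)]) auto
      then have "c i \<le> t powr (- a) * om t / t" unfolding c_def by simp
      then show ?thesis unfolding G[OF t0] by (rule ennreal_leI)
    qed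
    have cx: "c i * (1 / (2 ^ Suc i * N)) = 1 / (2 * 2 powr a) * x (i + 2)" for i
    proof -
      have e: "real (2 ^ (i + 2) * n) = 2 * (2 ^ i * N)" "2 ^ Suc i * N = 2 * (2 ^ i * N)" unfolding N_def by simp_all
      have u: "2 ^ i * N > 0" using N by simp
      have gen: "u powr a * u * y * (1 / (2 * u)) = 1 / (2 * 2 powr a) * ((2 * u) powr a * y)" if "u > 0" for u y :: real
        using that by (simp add: powr_mult)
      show ?thesis unfolding x_def c_def e by (rule gen[OF u])
    qed
    have "ennreal (\<Sum>i<I. c i * (1 / (2 ^ Suc i * N))) \<le> ennreal (C powr p_one p * (N powr a * om (1 / N)))"
      by (rule order_trans[OF dyadic_integral_ge[OF _ c0 cG] int[OF N]]) (use N in simp)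
    then have "(\<Sum>i<I. c i * (1 / (2 ^ Suc i * N))) \<le> C powr p_one p * (N powr a * om (1 / N))"
      using om0 by (subst (asm) ennreal_le_iff) auto
    also have "\<dots> \<le> C powr p_one p * (2 powr a * x 0)" by (intro mult_left_mono x1) simp
    finally have "1 / (2 * 2 powr a) * (\<Sum>i<I. x (i + 2)) \<le> C powr p_one p * (2 powr a * x 0)"
      unfolding cx sum_distrib_left .
    then have tail: "(\<Sum>i<I. x (i + 2)) \<le> 2 * 2 powr a * (C powr p_one p * (2 powr a * x 0))"
      by (simp add: field_simps)
    have "x 1 = N powr a * om (1 / N)" unfolding x_def N_def by simp
    then have x1': "x 1 \<le> 2 powr a * x 0" using x1 by simp
    have "(\<Sum>i<I. x i) \<le> (\<Sum>i<I + 2. x i)" by (intro sum_mono2) (auto simp: x0)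
    also have "\<dots> = x 0 + x 1 + (\<Sum>i<I. x (i + 2))" by (induction I) (simp_all add: numeral_2_eq_2)
    also have "\<dots> \<le> x 0 + 2 powr a * x 0 + 2 * 2 powr a * (C powr p_one p * (2 powr a * x 0))" using tail x1' by linarith
    also have "\<dots> = D * x 0" unfolding D_def by (simp add: algebra_simps)
    finally show ?thesis unfolding x_def by simp
  qed
  moreover have "D > 0" unfolding D_def by (intro add_pos_nonneg) auto
  ultimately show ?thesis unfolding dini_def a_def om_def add.commute[of k r] by blast
qed

lemma Hspace_imp_hb:
  assumes "f \<in> Hspace p r \<alpha>" obtains B where "hb r \<alpha> f B"
proof -
  have f: "f \<in> Lspace p" and fin: "Hnorm p r \<alpha> f < \<infinity>" using assms unfolding Hspace_def by auto
  have Sfin: "Hseminorm p r \<alpha> f < \<infinity>" using fin unfolding Hnorm_def by (simp add: less_top)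
  have "hb r \<alpha> f (enn2real (Hseminorm p r \<alpha> f) powr p_one p)"
    using Hseminorm_le_iff[OF f, of "enn2real (Hseminorm p r \<alpha> f) powr p_one p" r \<alpha>] ennreal_power_rep[OF Sfin theta_pos] by simp
  then show ?thesis by (rule that)
qed

lemma Hspace_fdiff_vanishes:
  assumes "f \<in> Hspace p r \<alpha>" "r \<ge> 1" "\<alpha> > 0" "\<epsilon> > 0"
  shows "\<exists>\<delta>>0. \<forall>h. \<bar>h\<bar> \<le> \<delta> \<longrightarrow> Q (fdiff 1 h f) \<le> \<epsilon>"
proof -
  obtain B where "hb r \<alpha> f B" using Hspace_imp_hb[OF assms(1)] .
  moreover have "f \<in> Lspace p" using assms(1) unfolding Hspace_def by blast
  ultimately show ?thesis using fdiff_vanishes assms(2-4) by blast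
qed

text \<open>Everything is transferred to the \<theta>-th powers of \<open>psi\<close> and
  \<open>best_approx\<close>, which are real because f lies in the Hoelder class. A constant L turns
  into L^\<theta>, so the existence of constants is unaffected. \<open>small\<close> and
  \<open>large\<close> are the inputs specific to the range of p.\<close>

lemma equivalence_admissible:
  assumes r: "r \<ge> 1" and s: "s \<ge> 1" and a: "0 < \<alpha>" "\<alpha> \<le> real r" and fH: "f \<in> Hspace p r \<alpha>" and k: "k \<in> admissible p r s \<alpha> f"
    and small: "p < 1 \<Longrightarrow> jackson (k + r)"
    and large: "\<not> p < 1 \<Longrightarrow> p_one p = 1 \<and> (\<forall>\<epsilon>>0. \<exists>m. \<exists>P\<in>trig_polys m. Q (\<lambda>x. f x - P x) < \<epsilon>)"
  shows "(\<exists>L::real. L > 0 \<and> (\<forall>n::nat. n \<ge> 1 \<longrightarrow> psi s r \<alpha> f (1 / real n) p \<le> ennreal L * best_approx n p r \<alpha> f)) \<longleftrightarrow>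
    (\<exists>M::real. M > 0 \<and> (\<forall>h::real. 0 < h \<and> h \<le> 1 \<longrightarrow> psi s r \<alpha> f h p \<le> ennreal M * psi k r \<alpha> f h p))"
proof -
  define \<theta> where "\<theta> = p_one p"
  have th: "\<theta> > 0" "\<theta> \<le> 1" unfolding \<theta>_def by (rule theta_pos theta_le)+
  have f: "f \<in> Lspace p" using fH unfolding Hspace_def by blast
  have Hfin: "Hnorm p r \<alpha> f < \<infinity>" using fH unfolding Hspace_def by blast
  obtain B where hbf: "hb r \<alpha> f B" using Hspace_imp_hb[OF fH] .
  have B0: "B \<ge> 0" by (rule hb_nonneg[OF hbf])
  have psib_fin: "psib i r \<alpha> f \<delta> (2 ^ i * B)" for i \<delta>
    unfolding psib_def
  proof (intro allI impI)
    fix h d assume hd: "0 < h \<and> h \<le> \<delta> \<and> 0 < d \<and> d < \<delta>"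
    have "Q (fdiff i d (fdiff r h f)) \<le> 2 ^ i * Q (fdiff r h f)" by (rule Q_fdiff[OF X_fdiff[OF f]])
    also have "\<dots> \<le> 2 ^ i * (h powr (\<alpha> * p_one p) * B)" using hbf hd unfolding hb_def by simp
    finally show "Q (fdiff i d (fdiff r h f)) \<le> h powr (\<alpha> * p_one p) * (2 ^ i * B)" by (simp only: mult.left_commute)
  qed
  define \<Psi> where "\<Psi> i \<delta> = enn2real (psi i r \<alpha> f \<delta> p) powr \<theta>" for i \<delta>
  have psi_fin: "psi i r \<alpha> f \<delta> p < \<infinity>" for i \<delta>
  proof -
    have "psi i r \<alpha> f \<delta> p \<le> ennreal ((2 ^ i * B) powr (1 / p_one p))"
      using psib_fin B0 by (subst psi_le_iff[OF f]) auto
    then show ?thesis by (rule le_less_trans) simp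
  qed
  have psi_rep: "psi i r \<alpha> f \<delta> p = ennreal (\<Psi> i \<delta> powr (1 / \<theta>))" for i \<delta>
    unfolding \<Psi>_def by (rule ennreal_power_rep[OF psi_fin th(1)])
  have Psi0: "\<Psi> i \<delta> \<ge> 0" for i \<delta> unfolding \<Psi>_def by simp
  have P1: "psib i r \<alpha> f \<delta> (\<Psi> i \<delta>)" if "\<delta> > 0" for i \<delta>
    using psi_le_iff[OF f Psi0, of i r \<alpha> \<delta> i \<delta>] psi_rep[of i \<delta>] unfolding \<theta>_def by simp
  have P2: "\<Psi> i \<delta> \<le> W" if "\<delta> > 0" "psib i r \<alpha> f \<delta> W" for i \<delta> W
  proof -
    have W0: "W \<ge> 0" by (rule psib_nonneg[OF that(2,1)])
    have "psi i r \<alpha> f \<delta> p \<le> ennreal (W powr (1 / \<theta>))" unfolding \<theta>_def psi_le_iff[OF f W0] by (rule that(2))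
    then show ?thesis unfolding \<Psi>_def by (rule enn2real_powr_le[OF _ W0 th(1)])
  qed
  define EE where "EE n = enn2real (best_approx n p r \<alpha> f) powr \<theta>" for n
  have zero: "(\<lambda>x. 0) \<in> trig_polys n" for n by (simp add: trig_polys_eq_tspan tspan_zero)
  have best_fin: "best_approx n p r \<alpha> f < \<infinity>" for n
  proof -
    have "best_approx n p r \<alpha> f \<le> Hnorm p r \<alpha> (\<lambda>x. f x - 0)" unfolding best_approx_def by (rule INF_lower[OF zero])
    then show ?thesis using Hfin by (simp add: le_less_trans)
  qed
  have best_rep: "best_approx n p r \<alpha> f = ennreal (EE n powr (1 / \<theta>))" for n
    unfolding EE_def by (rule ennreal_power_rep[OF best_fin th(1)])
  have EE0: "EE n \<ge> 0" for n unfolding EE_def by simp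
  have E1: "\<exists>T\<in>trig_polys n. hb r \<alpha> (\<lambda>x. f x - T x) (EE n + \<epsilon>)" if "n \<ge> 1" "\<epsilon> > 0" for n \<epsilon>
  proof -
    \<comment> \<open>The strict gap \<epsilon> allows a polynomial to be chosen even if the infimum
      is not attained.\<close>
    have "best_approx n p r \<alpha> f < ennreal ((EE n + \<epsilon>) powr (1 / \<theta>))"
      unfolding best_rep using that EE0[of n] th(1) by (intro ennreal_lessI powr_less_mono2) auto
    then obtain T where T: "T \<in> trig_polys n" "Hnorm p r \<alpha> (\<lambda>x. f x - T x) < ennreal ((EE n + \<epsilon>) powr (1 / \<theta>))"
      unfolding best_approx_def INF_less_iff by blast
    have "Hseminorm p r \<alpha> (\<lambda>x. f x - T x) \<le> Hnorm p r \<alpha> (\<lambda>x. f x - T x)" unfolding Hnorm_def by (simp add: add_increasing)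
    then have "Hseminorm p r \<alpha> (\<lambda>x. f x - T x) \<le> ennreal ((EE n + \<epsilon>) powr (1 / p_one p))" using T(2) unfolding \<theta>_def by simp
    moreover have "EE n + \<epsilon> \<ge> 0" using EE0[of n] that by simp
    ultimately have "hb r \<alpha> (\<lambda>x. f x - T x) (EE n + \<epsilon>)"
      using Hseminorm_le_iff[OF X_diff[OF f X_trig[OF T(1)]]] by blast
    then show ?thesis using T(1) by blast
  qed
  have E2: "EE n \<le> 2 * W" if T: "T \<in> trig_polys n" and QW: "Q (\<lambda>x. f x - T x) \<le> W" and hW: "hb r \<alpha> (\<lambda>x. f x - T x) W" for n T W
  proof -
    have W0: "W \<ge> 0" by (rule hb_nonneg[OF hW])
    have gX: "(\<lambda>x. f x - T x) \<in> Lspace p" by (rule X_diff[OF f X_trig[OF T]])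
    have "best_approx n p r \<alpha> f \<le> Hnorm p r \<alpha> (\<lambda>x. f x - T x)" unfolding best_approx_def by (rule INF_lower[OF T])
    also have "\<dots> \<le> ennreal (W powr (1 / p_one p)) + ennreal (W powr (1 / p_one p))"
      unfolding Hnorm_def using QW hW Lnorm_le_iff[OF gX W0] Hseminorm_le_iff[OF gX W0] by (intro add_mono) auto
    \<comment> \<open>The norm adds two terms of size W^(1/\<theta>), which equals (2^\<theta>
      W)^(1/\<theta>); then 2^\<theta> \<le> 2 gives the factor in \<open>E2\<close>.\<close>
    also have "\<dots> = ennreal ((2 powr \<theta> * W) powr (1 / \<theta>))"
      using th W0 unfolding \<theta>_def[symmetric] by (simp add: powr_mult powr_root_cancel ennreal_plus[symmetric] del: ennreal_plus)
    finally have "EE n \<le> 2 powr \<theta> * W" unfolding EE_def by (rule enn2real_powr_le) (use W0 th in auto)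
    also have "\<dots> \<le> 2 powr 1 * W" using th W0 by (intro mult_right_mono powr_mono) auto
    finally show ?thesis by simp
  qed
  have sk: "real k > real s + 1 / p_one p - 1" using k unfolding admissible_def by blast
  have main: "(\<exists>L>0. \<forall>n\<ge>1. \<Psi> s (1 / real n) \<le> L * EE n) \<longleftrightarrow> (\<exists>M>0. \<forall>h. 0 < h \<and> h \<le> 1 \<longrightarrow> \<Psi> s h \<le> M * \<Psi> k h)"
  proof (cases "p < 1")
    case True
    define om where "om \<delta> = enn2real (modulus (k + r) p f \<delta>) powr p_one p" for \<delta>
    have om: "is_modulus (k + r) f om" unfolding om_def by (rule modulus_is_modulus(2)[OF f])
    have dini: "\<alpha> = real r \<longrightarrow> dini r om"
    proof
      assume "\<alpha> = real r"
      then have "modulus_int_cond p r (real r) f k" using k True unfolding admissible_def by simp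
      then show "dini r om" unfolding om_def by (rule modulus_int_cond_imp_dini[OF f])
    qed
    show ?thesis by (rule equivalence_small[where \<Psi> = \<Psi> and EE = EE, OF f a s sk P1 P2 E1 E2 small[OF True] om dini])
  next
    case False
    then have one: "p_one p = 1" and dense: "\<And>\<epsilon>. \<epsilon> > 0 \<Longrightarrow> \<exists>m. \<exists>P\<in>trig_polys m. Q (\<lambda>x. f x - P x) < \<epsilon>" using large by auto
    have "s < k" using sk one by simp
    then show ?thesis by (rule equivalence_one[where \<Psi> = \<Psi> and EE = EE, OF f a _ one P1 P2 E1 E2 dense])
  qed
  have left: "(\<exists>L>0. \<forall>n\<in>{1..}. ennreal (\<Psi> s (1 / real n) powr (1 / \<theta>)) \<le> ennreal L * ennreal (EE n powr (1 / \<theta>))) \<longleftrightarrow>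
    (\<exists>L>0. \<forall>n\<in>{1..}. \<Psi> s (1 / real n) \<le> L * EE n)"
    by (rule ennreal_ratio_ex[OF th(1) Psi0 EE0])
  have right: "(\<exists>M>0. \<forall>h\<in>{0<..1}. ennreal (\<Psi> s h powr (1 / \<theta>)) \<le> ennreal M * ennreal (\<Psi> k h powr (1 / \<theta>))) \<longleftrightarrow>
    (\<exists>M>0. \<forall>h\<in>{0<..1}. \<Psi> s h \<le> M * \<Psi> k h)"
    by (rule ennreal_ratio_ex[OF th(1) Psi0 Psi0])
  show ?thesis
    using left right main unfolding psi_rep best_rep by (simp add: Ball_def)
qed

end

section \<open>The three ranges of p and the theorem\<close>

lemma Lspace_finite:
  assumes "0 < p" "p < \<infinity>"
  shows "Lspace p = Lq (enn2real p)" "g \<in> Lspace p \<Longrightarrow> Lnorm p g = ennreal (mean_power (enn2real p) g powr (1 / enn2real p))"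
proof -
  define q where "q = enn2real p"
  have q: "q > 0" unfolding q_def using assms by (simp add: enn2real_positive_iff)
  have L: "Lnorm p g = epowr (ennreal (1 / (2 * pi)) * Iq q g) (1 / q)" for g
    using assms(2) unfolding Lnorm_def Iq_def q_def by auto
  have fin: "Lnorm p g < \<infinity> \<longleftrightarrow> Iq q g < \<infinity>" for g
    unfolding L epowr_def by (auto simp: ennreal_mult_less_top less_top ennreal_mult_eq_top_iff)
  show eq: "Lspace p = Lq (enn2real p)"
    using assms(2) fin unfolding Lspace_def Lq_def q_def by auto
  show "Lnorm p g = ennreal (mean_power (enn2real p) g powr (1 / enn2real p))" if "g \<in> Lspace p"
  proof -
    have "g \<in> Lq q" using that eq unfolding q_def by simp
    then have "ennreal (1 / (2 * pi)) * Iq q g = ennreal (mean_power q g)"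
      by (simp add: Iq_eq ennreal_mult'[symmetric])
    then show ?thesis using L[of g] mean_power_nonneg[of q g] unfolding q_def by (simp add: epowr_ennreal)
  qed
qed

theorem theorem3p6:
  fixes p :: ennreal and r s :: nat and \<alpha> :: real and f :: "real \<Rightarrow> complex"
  assumes "0 < p" and "r \<ge> 1" and "s \<ge> 1" and "0 < \<alpha>" and "\<alpha> \<le> real r"
    and "f \<in> Hspace p r \<alpha>"
    and "admissible p r s \<alpha> f \<noteq> {}"
  shows "(\<exists>L::real. L > 0 \<and>
            (\<forall>n::nat. n \<ge> 1 \<longrightarrow> psi s r \<alpha> f (1 / real n) p \<le> ennreal L * best_approx n p r \<alpha> f))
     \<longleftrightarrow> (\<exists>k\<in>admissible p r s \<alpha> f. \<exists>M::real. M > 0 \<and>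
            (\<forall>h::real. 0 < h \<and> h \<le> 1 \<longrightarrow> psi s r \<alpha> f h p \<le> ennreal M * psi k r \<alpha> f h p))"
proof -
  define q where "q = enn2real p"
  \<comment> \<open>The equivalence is proved for each admissible k separately. Its left side does
    not mention k, so nonemptiness of the set of admissible k yields the existential form.\<close>
  have "(\<exists>L::real. L > 0 \<and> (\<forall>n::nat. n \<ge> 1 \<longrightarrow> psi s r \<alpha> f (1 / real n) p \<le> ennreal L * best_approx n p r \<alpha> f)) \<longleftrightarrow>
    (\<exists>M::real. M > 0 \<and> (\<forall>h::real. 0 < h \<and> h \<le> 1 \<longrightarrow> psi s r \<alpha> f h p \<le> ennreal M * psi k r \<alpha> f h p))"
    if k: "k \<in> admissible p r s \<alpha> f" for k
  proof -
    consider "p < 1" | "1 \<le> p" "p < \<infinity>" | "p = \<infinity>" by (metis infinity_ennreal_def not_le top.not_eq_extremum)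
    then show ?thesis
    proof cases
      case 1
      then have pf: "p < \<infinity>" by (rule less_trans) simp
      have q: "0 < q" "q \<le> 1"
        unfolding q_def using assms(1) 1 pf by (auto simp: enn2real_positive_iff intro!: enn2real_leI)
      have pq: "p_one p = q" unfolding p_one_def q_def using 1 by (simp add: min_absorb1 less_imp_le)
      have L: "Lspace p = Lq q" unfolding q_def by (rule Lspace_finite(1)[OF assms(1) pf])
      have g: "gauge (Lspace p) (mean_power q) (p_one p)" unfolding L pq by (rule gauge_small[OF q])
      interpret lp_gauge p "mean_power q"
        by (intro lp_gauge.intro lp_gauge_axioms.intro g) (simp add: Lspace_finite(2)[OF assms(1) pf] pq q_def)
      have k1: "k + r \<ge> 1" using assms(2) by simp
      have jk: "jackson (k + r)" using jackson_small[OF q k1] unfolding L .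
      show ?thesis
        by (rule equivalence_admissible[OF assms(2-6) k jk]) (use 1 in simp)
    next
      case 2
      have q: "q \<ge> 1"
        using enn2real_mono[of 1 p] 2 unfolding q_def by simp
      have pq: "p_one p = 1" unfolding p_one_def using 2 by (simp add: min_absorb2)
      have L: "Lspace p = Lq q" unfolding q_def by (rule Lspace_finite(1)[OF assms(1) 2(2)])
      have g: "gauge (Lspace p) (\<lambda>f. mean_power q f powr (1 / q)) (p_one p)" unfolding L pq by (rule gauge_large[OF q])
      interpret lp_gauge p "\<lambda>f. mean_power q f powr (1 / q)"
        by (intro lp_gauge.intro lp_gauge_axioms.intro g) (simp add: Lspace_finite(2)[OF assms(1) 2(2)] pq q_def)
      have fL: "f \<in> Lq q" using assms(6) unfolding Hspace_def L by blast
      have "\<exists>m. \<exists>P\<in>trig_polys m. mean_power q (\<lambda>x. f x - P x) powr (1 / q) < \<epsilon>" if "\<epsilon> > 0" for \<epsilon>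
        by (rule dense_Lq[OF q fL Hspace_fdiff_vanishes[OF assms(6,2,4)] that])
      then show ?thesis
        by (intro equivalence_admissible[OF assms(2-6) k]) (use 2 pq in auto)
    next
      case 3
      have pq: "p_one p = 1" unfolding p_one_def 3 by simp
      have L: "Lspace p = Cper" unfolding Lspace_def Cper_def 3 by simp
      have g: "gauge (Lspace p) sup_norm (p_one p)" unfolding L pq by (rule gauge_sup)
      have ax: "lp_gauge_axioms p sup_norm"
      proof
        fix g assume "g \<in> Lspace p"
        then have "g \<in> Cper" unfolding L .
        then obtain K where K: "\<And>x. cmod (g x) \<le> K" using Cper_bounded by blast
        have "(SUP x. ennreal (cmod (g x))) \<le> ennreal K" by (intro SUP_least ennreal_leI K)
        then have "(SUP x. ennreal (cmod (g x))) < top" by (rule le_less_trans) simp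
        then show "Lnorm p g = ennreal (sup_norm g powr (1 / p_one p))"
          unfolding Lnorm_def sup_norm_def pq using 3 by simp
      qed
      interpret lp_gauge p sup_norm by (rule lp_gauge.intro[OF g ax])
      have fC: "f \<in> Cper" using assms(6) unfolding Hspace_def L by blast
      have "\<exists>m. \<exists>P\<in>trig_polys m. sup_norm (\<lambda>x. f x - P x) < \<epsilon>" if "\<epsilon> > 0" for \<epsilon>
        by (rule dense_sup[OF fC Hspace_fdiff_vanishes[OF assms(6,2,4)] that])
      then show ?thesis
        by (intro equivalence_admissible[OF assms(2-6) k]) (use 3 pq in auto)
    qed
  qed
  then show ?thesis using assms(7) by blast
qed

end
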